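(* Let $$\mathcal A:=\mathcal L^T_{m_1}\oplus\dots\oplus\mathcal L^T_{m_{\underline s}}\oplus\bigoplus_{i=1}^{t}\Big(\mathcal D_{k_{i1}}(\lambda_i)\oplus\dots\oplus\mathcal D_{k_{is_i}}(\lambda_i)\Big)\oplus\mathcal L_{n_{\overline s}}\oplus\mathcal L_{n_{\overline s-1}}\oplus\dots\oplus\mathcal L_{n_1},$$ in which $m_1\le\cdots\le m_{\underline s}$, $k_{i1}\le\cdots\le k_{is_i}$ $(i=1,\dots,t)$, $n_1\le\cdots\le n_{\overline s}$, and $\lambda_1,\dots,\lambda_t\in\mathbb C\cup\{\infty\}$ are distinct (summands of any of the types may be absent). Let $\mathcal A=([A_{ij}],[A'_{ij}])$ be partitioned into blocks $A_{ij}$ and $A'_{ij}$ such that the pairs of diagonal blocks $(A_{11},A'_{11}),(A_{22},A'_{22}),\dots$ are the direct summands $$\mathcal L^T_{m_1},\dots,\mathcal L^T_{m_{\underline s}},\ \mathcal D_{k_{11}}(\lambda_1),\dots,\mathcal D_{k_{1s_1}}(\lambda_1),\ \dots,\ \mathcal D_{k_{t1}}(\lambda_t),\dots,\mathcal D_{k_{ts_t}}(\lambda_t),\ \mathcal L_{n_{\overline s}},\dots,\mathcal L_{n_1}$$ of $\mathcal A$. Then each immediate successor of $\langle\mathcal A\rangle$ is the orbit of some matrix pair that is obtained from $\mathcal A$ by an arbitrarily small perturbation of only one pair $(A_{ij},A'_{ij})$ with $i<j$ of its upper diagonal blocks.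
   Context: All matrices are complex, and both matrices in each matrix pair have the same size; sizes with zero rows or zero columns are allowed. Two pairs $(A,B)$ and $(A',B')$ are equivalent if $(A',B')=(SAR,SBR)$ for some nonsingular $S,R$. The orbit $\langle\mathcal A\rangle$ is the set of all pairs equivalent to $\mathcal A$. One writes $\langle\mathcal A\rangle\le\langle\mathcal B\rangle$ if $\langle\mathcal A\rangle$ is contained in the closure of $\langle\mathcal B\rangle$, and $\langle\mathcal A\rangle<\langle\mathcal B\rangle$ if in addition the orbits are different. $\langle\mathcal B\rangle$ is an immediate successor of $\langle\mathcal A\rangle$ if $\langle\mathcal A\rangle<\langle\mathcal B\rangle$ and there is no $\langle\mathcal C\rangle$ with $\langle\mathcal A\rangle<\langle\mathcal C\rangle<\langle\mathcal B\rangle$. Direct sums of pairs are taken componentwise. "Obtained by an arbitrarily small perturbation of only one pair of blocks" means: for every $\delta>0$, the orbit contains a pair that differs from $\mathcal A$ only in the blocks $A_{ij}$ and $A'_{ij}$ (at one position $(i,j)$) and whose distance from $\mathcal A$ is less than $\delta$. For $n\ge1$, $L_n$ and $R_n$ are the $(n-1)\times n$ matrices $L_n=[I_{n-1}\;0]$ and $R_n=[0\;I_{n-1}]$; $L_1=R_1$ is the $0\times1$ matrix. $J_n(\lambda)$ is the $n\times n$ upper triangular Jordan block with eigenvalue $\lambda$. $\mathcal L_n:=(L_n,R_n)$, $\mathcal L_n^T:=(L_n^T,R_n^T)$, $\mathcal D_n(\lambda):=(I_n,J_n(\lambda))$ for $\lambda\in\mathbb C$, and $\mathcal D_n(\infty):=(J_n(0),I_n)$,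 where $n\ge1$. *)

theory Defs
  imports "HOL-Analysis.Abstract_Metric_Spaces" "HOL-Analysis.L2_Norm"
    "Jordan_Normal_Form.Jordan_Normal_Form"
begin

type_synonym mat_pair = "complex mat \<times> complex mat"

definition mat_pairs :: "nat \<Rightarrow> nat \<Rightarrow> mat_pair set" where
  "mat_pairs m n = carrier_mat m n \<times> carrier_mat m n"

definition is_mat_pair :: "mat_pair \<Rightarrow> bool" where
  "is_mat_pair P \<longleftrightarrow> (\<exists>m n. P \<in> mat_pairs m n)"

definition pair_rows :: "mat_pair \<Rightarrow> nat" where
  "pair_rows P = dim_row (fst P)"

definition pair_cols :: "mat_pair \<Rightarrow> nat" where
  "pair_cols P = dim_col (fst P)"

definition orbit :: "mat_pair \<Rightarrow> mat_pair set" where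
  "orbit P = {(S * fst P * R, S * snd P * R) | S R.
     S \<in> carrier_mat (pair_rows P) (pair_rows P) \<and> invertible_mat S \<and>
     R \<in> carrier_mat (pair_cols P) (pair_cols P) \<and> invertible_mat R}"

text \<open>The Frobenius distance on pairs of size \<open>m \<times> n\<close>. The size is a parameter because
  the type of matrices contains matrices of all sizes.\<close>

definition mat_pair_dist :: "nat \<Rightarrow> nat \<Rightarrow> mat_pair \<Rightarrow> mat_pair \<Rightarrow> real" where
  "mat_pair_dist m n P Q = sqrt (\<Sum>i<m. \<Sum>j<n.
     (cmod (fst P $$ (i,j) - fst Q $$ (i,j)))\<^sup>2 + (cmod (snd P $$ (i,j) - snd Q $$ (i,j)))\<^sup>2)"

lemma Metric_space_mat_pairs: "Metric_space (mat_pairs m n) (mat_pair_dist m n)"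
proof
  define I where "I = {..<m} \<times> {..<n} \<times> (UNIV :: bool set)"
  define e :: "mat_pair \<Rightarrow> nat \<times> nat \<times> bool \<Rightarrow> complex"
    where "e P = (\<lambda>(i, j, b). if b then fst P $$ (i,j) else snd P $$ (i,j))" for P
  have fin: "finite I"
    by (simp add: I_def)
  have d: "mat_pair_dist m n P Q = L2_set (\<lambda>x. cmod (e P x - e Q x)) I" for P Q
    by (simp add: mat_pair_dist_def L2_set_def I_def e_def sum.cartesian_product'
        UNIV_bool add.commute)
  fix P Q R :: mat_pair
  show "0 \<le> mat_pair_dist m n P Q"
    by (simp add: d L2_set_nonneg)
  show "mat_pair_dist m n P Q = mat_pair_dist m n Q P"
    by (simp add: d norm_minus_commute)
  show "mat_pair_dist m n P Q = 0 \<longleftrightarrow> P = Q" if "P \<in> mat_pairs m n" "Q \<in> mat_pairs m n"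
  proof -
    have "mat_pair_dist m n P Q = 0 \<longleftrightarrow> (\<forall>x\<in>I. e P x = e Q x)"
      using fin by (simp add: d L2_set_eq_0_iff)
    also have "\<dots> \<longleftrightarrow> P = Q"
      using that by (auto simp: I_def e_def mat_pairs_def Ball_def all_bool_eq prod_eq_iff intro!: eq_matI)
    finally show ?thesis .
  qed
  show "mat_pair_dist m n P R \<le> mat_pair_dist m n P Q + mat_pair_dist m n Q R"
  proof -
    have "L2_set (\<lambda>x. cmod (e P x - e R x)) I
        \<le> L2_set (\<lambda>x. cmod (e P x - e Q x) + cmod (e Q x - e R x)) I"
      by (rule L2_set_mono) (simp_all add: dist_norm[symmetric] dist_triangle)
    also have "\<dots> \<le> L2_set (\<lambda>x. cmod (e P x - e Q x)) I + L2_set (\<lambda>x. cmod (e Q x - e R x)) I"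
      by (rule L2_set_triangle_ineq)
    finally show ?thesis
      by (simp add: d)
  qed
qed

definition mat_pair_topology :: "nat \<Rightarrow> nat \<Rightarrow> mat_pair topology" where
  "mat_pair_topology m n = Metric_space.mtopology (mat_pairs m n) (mat_pair_dist m n)"

text \<open>Orbits consist of pairs of a single size, so closures are taken within the space of all
  pairs of some fixed size \<open>m \<times> n\<close>.\<close>

definition orbit_le :: "mat_pair set \<Rightarrow> mat_pair set \<Rightarrow> bool" where
  "orbit_le X Y \<longleftrightarrow> (\<exists>m n. X \<subseteq> mat_pair_topology m n closure_of Y)"

definition orbit_less :: "mat_pair set \<Rightarrow> mat_pair set \<Rightarrow> bool" where
  "orbit_less X Y \<longleftrightarrow> orbit_le X Y \<and> X \<noteq> Y"

definition immediate_successor :: "mat_pair set \<Rightarrow> mat_pair set \<Rightarrow> bool" where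
  "immediate_successor Y X \<longleftrightarrow> orbit_less X Y \<and>
     \<not> (\<exists>C. is_mat_pair C \<and> orbit_less X (orbit C) \<and> orbit_less (orbit C) Y)"

definition L_mat :: "nat \<Rightarrow> complex mat" where
  "L_mat n = mat (n - 1) n (\<lambda>(i, j). if j = i then 1 else 0)"

definition R_mat :: "nat \<Rightarrow> complex mat" where
  "R_mat n = mat (n - 1) n (\<lambda>(i, j). if j = Suc i then 1 else 0)"

definition L_pair :: "nat \<Rightarrow> mat_pair" where
  "L_pair n = (L_mat n, R_mat n)"

definition LT_pair :: "nat \<Rightarrow> mat_pair" where
  "LT_pair n = (transpose_mat (L_mat n), transpose_mat (R_mat n))"

datatype ext_complex = Finite complex | Infinity

fun D_pair :: "ext_complex \<Rightarrow> nat \<Rightarrow> mat_pair" where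
  "D_pair (Finite \<mu>) n = (1\<^sub>m n, jordan_block n \<mu>)"
| "D_pair Infinity n = (jordan_block n 0, 1\<^sub>m n)"

definition direct_sum :: "mat_pair list \<Rightarrow> mat_pair" where
  "direct_sum Ps = (diag_block_mat (map fst Ps), diag_block_mat (map snd Ps))"

text \<open>The eigenvalue data \<open>es\<close> list the eigenvalues together with the sizes
  \<open>k\<^sub>i\<^sub>1, k\<^sub>i\<^sub>2, \<dots>\<close> of their Jordan blocks; \<open>ns\<close> is given in increasing order.\<close>

definition kronecker_summands ::
    "nat list \<Rightarrow> (ext_complex \<times> nat list) list \<Rightarrow> nat list \<Rightarrow> mat_pair list" where
  "kronecker_summands ms es ns =
     map LT_pair ms @ concat (map (\<lambda>(\<mu>, ks). map (D_pair \<mu>) ks) es) @ map L_pair (rev ns)"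

text \<open>Row and column indices (from 0) of the \<open>i\<close>-th block strip in the partition of
  \<open>direct_sum Ps\<close> conforming to its summands; a strip may be empty.\<close>

definition block_rows :: "mat_pair list \<Rightarrow> nat \<Rightarrow> nat set" where
  "block_rows Ps i =
     {sum_list (map pair_rows (take i Ps)) ..< sum_list (map pair_rows (take (Suc i) Ps))}"

definition block_cols :: "mat_pair list \<Rightarrow> nat \<Rightarrow> nat set" where
  "block_cols Ps j =
     {sum_list (map pair_cols (take j Ps)) ..< sum_list (map pair_cols (take (Suc j) Ps))}"

definition differs_only_in_block :: "mat_pair list \<Rightarrow> nat \<Rightarrow> nat \<Rightarrow> mat_pair \<Rightarrow> bool" where
  "differs_only_in_block Ps i j Q \<longleftrightarrow>
     (let P = direct_sum Ps; m = pair_rows P; n = pair_cols P in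
      Q \<in> mat_pairs m n \<and>
      (\<forall>a<m. \<forall>b<n. \<not> (a \<in> block_rows Ps i \<and> b \<in> block_cols Ps j) \<longrightarrow>
         fst Q $$ (a,b) = fst P $$ (a,b) \<and> snd Q $$ (a,b) = snd P $$ (a,b)))"

definition small_block_perturbation :: "mat_pair list \<Rightarrow> nat \<Rightarrow> nat \<Rightarrow> mat_pair set \<Rightarrow> bool" where
  "small_block_perturbation Ps i j Y \<longleftrightarrow>
     (let P = direct_sum Ps in
      \<forall>\<delta>>0. \<exists>Q\<in>Y. differs_only_in_block Ps i j Q \<and>
        mat_pair_dist (pair_rows P) (pair_cols P) P Q < \<delta>)"

end

(* Orbit closures are governed by the dimensions of the spaces of chains x_0, ..., x_(k-1) with
   (B - mu A) x_i = A x_(i-1) and x_(-1) = 0 (and the analogue for mu infinite), and of the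
   polynomial solutions of bounded degree of (B - x A) f(x) = 0, for the pair and for its
   transpose.  These dimensions can only grow in a limit, so <A> <= <B> forces them to be at
   least as large for A as for B.

   Conversely let A and B be in Kronecker form with the dimensions of A at least those of B and
   A not equivalent to B.  Then two summands of A can be replaced by the summands of a
   nontrivial extension of one by the other so that the dimensions still dominate those of B:
   two singular summands of the same kind become closer in size, two Jordan blocks of one
   eigenvalue become further apart in size, a singular block grows at the expense of a Jordan
   block, or L^T_m and L_n merge into regular blocks.  The extension is a perturbation in one
   off-diagonal block, and it can be made arbitrarily small by scaling its rows and columns;
   in the order of the summands of the theorem it lies above the diagonal.  Iterating, A lies in
   the closure of <B>.  If <B> is an immediate successor of <A>, the first step already
   reaches <B>. *)
theory Submission
  imports Defs
begin

text \<open>Kronecker's form is needed for the given pair and again to read off the summands of an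
  extension of L_n by L^T_m. Its proof works with bases of quotients written relative to subspaces,
  so that the induction can both restrict and factor out. The dimensions are additive over summands
  and piecewise linear in the length or degree bound; their second differences are multiplicities of
  summands. Hence they determine the pair up to equivalence, and a maximal bounded interval on which
  one of them is larger for A than for B forces A to contain two summands that can be changed. The
  delicate case is that A has more singular summands than B. If no Jordan block can be absorbed, the
  largest L^T_m and L_n of A are merged, and m + n - 1 regular dimensions have to be distributed
  over the eigenvalues as B requires: a pencil of companion type realises any distribution, and
  counting rows and columns shows that m + n - 1 is enough. The iteration stops because the number
  of L summands, the Jordan total, the sum of squares of the singular sizes, and the square of the
  Jordan total minus the sum of squares of the Jordan sizes decrease lexicographically.\<close>

section \<open>Linear algebra relative to a subspace\<close>

lemma underdetermined_system:
  fixes a :: "'i => 'j => 'a::field"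
  assumes "finite J" "finite I" "card J < card I"
  shows "\<exists>c. (\<exists>i\<in>I. c i \<noteq> 0) \<and> (\<forall>j\<in>J. (\<Sum>i\<in>I. c i * a i j) = 0)"
  using assms
proof (induction J arbitrary: I a rule: finite_induct)
  case empty
  then obtain i where "i \<in> I" by fastforce
  then show ?case by (intro exI[of _ "\<lambda>_. 1"]) auto
next
  case (insert j J)
  show ?case
  proof (cases "\<forall>i\<in>I. a i j = 0")
    case True
    have "card J < card I" using insert by simp
    from insert.IH[OF insert.prems(1) this, of a] show ?thesis using True by auto
  next
    case False
    then obtain i0 where i0: "i0 \<in> I" "a i0 j \<noteq> 0" by blast
    \<comment> \<open>Pivot elimination: the unknown \<open>i0\<close> is spent on equation
      \<open>j\<close>, and \<open>b\<close> is the system that remains for the other unknowns, with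
      one equation and one unknown fewer.\<close>
    define b where "b i l = a i l - a i j / a i0 j * a i0 l" for i l
    have "card J < card (I - {i0})" using insert i0 by simp
    from insert.IH[OF _ this, of b] insert.prems obtain c where
      c: "\<exists>i\<in>I - {i0}. c i \<noteq> 0" "\<forall>l\<in>J. (\<Sum>i\<in>I - {i0}. c i * b i l) = 0" by auto
    define s where "s = - (\<Sum>i\<in>I - {i0}. c i * a i j) / a i0 j"
    have eq: "(\<Sum>i\<in>I. (c(i0 := s)) i * a i l) = (\<Sum>i\<in>I - {i0}. c i * b i l)" for l
    proof -
      have "(\<Sum>i\<in>I. (c(i0 := s)) i * a i l) = s * a i0 l + (\<Sum>i\<in>I - {i0}. c i * a i l)"
        using insert.prems(1) i0 by (subst sum.remove[of _ i0]) auto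
      also have "s * a i0 l = - (\<Sum>i\<in>I - {i0}. c i * (a i j / a i0 j * a i0 l))"
        by (simp add: s_def sum_distrib_left sum_distrib_right sum_divide_distrib mult_ac)
      finally show ?thesis by (simp add: b_def right_diff_distrib sum_subtractf)
    qed
    have "b i j = 0" for i using i0 by (simp add: b_def)
    then show ?thesis using c eq by (intro exI[of _ "c(i0 := s)"]) auto
  qed
qed

locale complex_vector_space = vector_space scale
  for scale :: "complex => 'b::ab_group_add => 'b" (infixr "\<star>" 75)
begin

text \<open>\<open>indep_mod\<close>, \<open>add_span\<close> and \<open>basis_mod\<close> describe
  families in a quotient by \<open>U\<close> without forming it. The induction for the Kronecker
  form passes to subspaces and to quotients alike, and in this encoding everything stays in one
  fixed type.\<close>

definition indep_mod :: "'b set => 'i set => ('i => 'b) => bool" where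
  "indep_mod U I u \<longleftrightarrow> (\<forall>c. (\<Sum>i\<in>I. c i \<star> u i) \<in> U \<longrightarrow> (\<forall>i\<in>I. c i = 0))"

definition add_span :: "'b set => 'i set => ('i => 'b) => 'b set" where
  "add_span U I u = {x. \<exists>c. x - (\<Sum>i\<in>I. c i \<star> u i) \<in> U}"

definition basis_mod :: "'b set => 'i set => ('i => 'b) => 'b set => bool" where
  "basis_mod U I u V \<longleftrightarrow> finite I \<and> (\<forall>i\<in>I. u i \<in> V) \<and> V \<subseteq> add_span U I u \<and> indep_mod U I u"

lemma add_spanI: "x - (\<Sum>i\<in>I. c i \<star> u i) \<in> U ==> x \<in> add_span U I u"
  by (auto simp: add_span_def)

lemma subspace_add_span: "subspace U ==> subspace (add_span U I u)"
proof (rule subspaceI)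
  assume U: "subspace U"
  show "0 \<in> add_span U I u"
    by (rule add_spanI[of _ "\<lambda>_. 0"]) (simp add: U subspace_0)
  fix x y assume "x \<in> add_span U I u" "y \<in> add_span U I u"
  then obtain c d where c: "x - (\<Sum>i\<in>I. c i \<star> u i) \<in> U" "y - (\<Sum>i\<in>I. d i \<star> u i) \<in> U"
    by (auto simp: add_span_def)
  have "x + y - (\<Sum>i\<in>I. (c i + d i) \<star> u i) = (x - (\<Sum>i\<in>I. c i \<star> u i)) + (y - (\<Sum>i\<in>I. d i \<star> u i))"
    by (simp add: scale_left_distrib sum.distrib)
  then have "x + y - (\<Sum>i\<in>I. (c i + d i) \<star> u i) \<in> U"
    using subspace_add[OF U c] by (simp only:)
  then show "x + y \<in> add_span U I u"
    by (rule add_spanI)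
next
  fix k x assume U: "subspace U" and "x \<in> add_span U I u"
  then obtain c where c: "x - (\<Sum>i\<in>I. c i \<star> u i) \<in> U" by (auto simp: add_span_def)
  have "k \<star> x - (\<Sum>i\<in>I. (k * c i) \<star> u i) = k \<star> (x - (\<Sum>i\<in>I. c i \<star> u i))"
    by (simp add: scale_right_diff_distrib scale_sum_right)
  then show "k \<star> x \<in> add_span U I u"
    using subspace_scale[OF U c] by (intro add_spanI[of _ "\<lambda>i. k * c i"]) simp
qed

lemma add_span_superset: "U \<subseteq> add_span U I u" if "subspace U"
  by (auto intro!: add_spanI[where c="\<lambda>_. 0"])

lemma add_span_base: "finite I ==> i \<in> I ==> subspace U ==> u i \<in> add_span U I u"
  by (rule add_spanI[where c="\<lambda>j. if j = i then 1 else 0"])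
     (simp add: if_distrib[where f="\<lambda>c. c \<star> _"] sum.delta subspace_0 cong: if_cong)

lemma add_span_least:
  assumes "subspace V" "U \<subseteq> V" "\<forall>i\<in>I. u i \<in> V"
  shows "add_span U I u \<subseteq> V"
proof
  fix x assume "x \<in> add_span U I u"
  then obtain c where c: "x - (\<Sum>i\<in>I. c i \<star> u i) \<in> U" by (auto simp: add_span_def)
  have "(\<Sum>i\<in>I. c i \<star> u i) \<in> V" using assms by (intro subspace_sum subspace_scale) auto
  from subspace_add[OF assms(1) _ this] c assms(2) show "x \<in> V" by force
qed

text \<open>Steinitz: if there were more \<open>u\<close> than \<open>t\<close>, the coefficient
  matrix \<open>a\<close> would have a nontrivial left null vector, which is a nontrivial relation
  among the \<open>u\<close> modulo \<open>U\<close>.\<close>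

lemma indep_mod_card_le:
  assumes U: "subspace U" and fin: "finite I" "finite J"
    and u: "\<forall>i\<in>I. u i \<in> add_span U J t" and ind: "indep_mod U I u"
  shows "card I \<le> card J"
proof (rule ccontr)
  assume "\<not> card I \<le> card J"
  from u obtain a where a: "\<And>i. i \<in> I ==> u i - (\<Sum>j\<in>J. a i j \<star> t j) \<in> U"
    unfolding add_span_def by (simp add: bchoice_iff) metis
  from underdetermined_system[OF fin(2,1), of a] \<open>\<not> _\<close> obtain c where
    c: "\<exists>i\<in>I. c i \<noteq> 0" "\<forall>j\<in>J. (\<Sum>i\<in>I. c i * a i j) = 0" by auto
  have "(\<Sum>i\<in>I. c i \<star> (u i - (\<Sum>j\<in>J. a i j \<star> t j))) \<in> U"
    using a by (intro subspace_sum subspace_scale U) auto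
  also have "(\<Sum>i\<in>I. c i \<star> (u i - (\<Sum>j\<in>J. a i j \<star> t j)))
      = (\<Sum>i\<in>I. c i \<star> u i) - (\<Sum>j\<in>J. (\<Sum>i\<in>I. c i * a i j) \<star> t j)"
    by (simp add: scale_right_diff_distrib sum_subtractf scale_sum_right scale_sum_left)
       (rule sum.swap)
  also have "(\<Sum>j\<in>J. (\<Sum>i\<in>I. c i * a i j) \<star> t j) = 0"
    using c(2) by (intro sum.neutral) simp
  finally show False using ind c(1) by (auto simp: indep_mod_def)
qed

lemma basis_mod_card:
  assumes "subspace U" "basis_mod U I u V" "basis_mod U J t V"
  shows "card I = card J"
  using assms indep_mod_card_le[of U I J u t] indep_mod_card_le[of U J I t u]
  by (force simp: basis_mod_def intro: antisym)

lemma indep_mod_insert: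
  assumes U: "subspace U" and "finite I" "i \<notin> I" "indep_mod U I u" "u i \<notin> add_span U I u"
  shows "indep_mod U (insert i I) u"
  unfolding indep_mod_def
proof (intro allI impI)
  fix c assume *: "(\<Sum>j\<in>insert i I. c j \<star> u j) \<in> U"
  have "c i = 0"
  proof (rule ccontr)
    assume "c i \<noteq> 0"
    have "u i - (\<Sum>j\<in>I. (- c j / c i) \<star> u j) = (1 / c i) \<star> (\<Sum>j\<in>insert i I. c j \<star> u j)"
      using \<open>c i \<noteq> 0\<close> assms(2,3)
      by (simp add: scale_right_distrib scale_sum_right sum_negf scale_minus_left)
    moreover have "(1 / c i) \<star> (\<Sum>j\<in>insert i I. c j \<star> u j) \<in> U"
      by (rule subspace_scale[OF U *])
    ultimately have "u i - (\<Sum>j\<in>I. (- c j / c i) \<star> u j) \<in> U" by (simp only:)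
    then have "u i \<in> add_span U I u" by (rule add_spanI)
    with assms show False by simp
  qed
  then have "(\<Sum>j\<in>I. c j \<star> u j) \<in> U" using * assms(2,3) by simp
  with assms(4) \<open>c i = 0\<close> show "\<forall>j\<in>insert i I. c j = 0" by (auto simp: indep_mod_def)
qed

lemma sum_scale_reindex:
  assumes "bij_betw f J I"
  shows "(\<Sum>i\<in>I. c i \<star> u i) = (\<Sum>j\<in>J. c (f j) \<star> u (f j))"
  using sum.reindex_bij_betw[OF assms, of "\<lambda>i. c i \<star> u i"] by simp

lemma basis_mod_reindex:
  assumes f: "bij_betw f J I" and "basis_mod U I u V" and "\<And>j. j \<in> J ==> t j = u (f j)"
  shows "basis_mod U J t V"
proof -
  have s: "(\<Sum>i\<in>I. c i \<star> u i) = (\<Sum>j\<in>J. c (f j) \<star> t j)" for c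
    using assms(3) by (simp add: sum_scale_reindex[OF f])
  have "V \<subseteq> add_span U J t"
  proof
    fix x assume "x \<in> V"
    then obtain c where "x - (\<Sum>i\<in>I. c i \<star> u i) \<in> U"
      using assms(2) by (auto simp: basis_mod_def add_span_def)
    then show "x \<in> add_span U J t" unfolding s by (rule add_spanI)
  qed
  moreover have "indep_mod U J t"
    unfolding indep_mod_def
  proof (intro allI impI ballI)
    fix c j assume *: "(\<Sum>i\<in>J. c i \<star> t i) \<in> U" "j \<in> J"
    define d where "d i = c (inv_into J f i)" for i
    have dc: "d (f j) = c j" if "j \<in> J" for j
      using that f by (simp add: d_def bij_betw_def)
    have "(\<Sum>i\<in>I. d i \<star> u i) = (\<Sum>j\<in>J. c j \<star> t j)"
      unfolding s by (intro sum.cong) (simp_all add: dc)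
    then have "\<forall>i\<in>I. d i = 0" using assms(2) *(1) by (simp add: basis_mod_def indep_mod_def)
    then have "d (f j) = 0" using bij_betwE[OF f] *(2) by blast
    then show "c j = 0" using dc[OF *(2)] by simp
  qed
  moreover have "\<forall>j\<in>J. t j \<in> V" using assms(2,3) bij_betwE[OF f] by (simp add: basis_mod_def)
  moreover have "finite J" using assms(2) bij_betw_finite[OF f] by (simp add: basis_mod_def)
  ultimately show ?thesis by (simp add: basis_mod_def)
qed

lemma basis_mod_cong:
  "basis_mod U I u V ==> (\<And>i. i \<in> I ==> u i = t i) ==> basis_mod U I t V"
  using basis_mod_reindex[of "\<lambda>i. i" I I U u V t] by (simp add: bij_betw_def)

lemma basis_mod_trans:
  assumes sub: "subspace U" "subspace V" "U \<subseteq> V" "V \<subseteq> W" and disj: "I \<inter> J = {}"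
    and b: "basis_mod U I u V" "basis_mod V J u W"
  shows "basis_mod U (I \<union> J) u W"
proof -
  have fin: "finite I" "finite J" using b by (auto simp: basis_mod_def)
  have s: "(\<Sum>i\<in>I \<union> J. c i \<star> u i) = (\<Sum>i\<in>I. c i \<star> u i) + (\<Sum>i\<in>J. c i \<star> u i)" for c
    by (rule sum.union_disjoint[OF fin disj])
  have uV: "(\<Sum>i\<in>I. c i \<star> u i) \<in> V" for c
    using b sub by (auto simp: basis_mod_def intro!: subspace_sum subspace_scale)
  have "W \<subseteq> add_span U (I \<union> J) u"
  proof
    fix x assume "x \<in> W"
    then obtain c where c: "x - (\<Sum>i\<in>J. c i \<star> u i) \<in> V"
      using b by (auto simp: basis_mod_def add_span_def)
    then obtain d where d: "x - (\<Sum>i\<in>J. c i \<star> u i) - (\<Sum>i\<in>I. d i \<star> u i) \<in> U"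
      using b by (auto simp: basis_mod_def add_span_def)
    have "(\<Sum>i\<in>I. (if i \<in> I then d i else c i) \<star> u i) = (\<Sum>i\<in>I. d i \<star> u i)"
         "(\<Sum>i\<in>J. (if i \<in> I then d i else c i) \<star> u i) = (\<Sum>i\<in>J. c i \<star> u i)"
      using disj by (auto intro!: sum.cong)
    then show "x \<in> add_span U (I \<union> J) u"
      using d by (intro add_spanI[where c="\<lambda>i. if i \<in> I then d i else c i"]) (simp add: s algebra_simps)
  qed
  moreover have "indep_mod U (I \<union> J) u"
    unfolding indep_mod_def
  proof (intro allI impI)
    fix c assume *: "(\<Sum>i\<in>I \<union> J. c i \<star> u i) \<in> U"
    have "(\<Sum>i\<in>J. c i \<star> u i) = (\<Sum>i\<in>I \<union> J. c i \<star> u i) - (\<Sum>i\<in>I. c i \<star> u i)"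
      by (simp add: s)
    then have "(\<Sum>i\<in>J. c i \<star> u i) \<in> V" using * uV sub subspace_diff by auto
    then have J: "\<forall>i\<in>J. c i = 0" using b by (auto simp: basis_mod_def indep_mod_def)
    then have "(\<Sum>i\<in>I. c i \<star> u i) \<in> U" using * by (simp add: s)
    with J show "\<forall>i\<in>I \<union> J. c i = 0" using b by (auto simp: basis_mod_def indep_mod_def)
  qed
  moreover have "\<forall>i\<in>I \<union> J. u i \<in> W" using b sub(4) unfolding basis_mod_def by blast
  ultimately show ?thesis using fin by (simp add: basis_mod_def)
qed


lemma indep_mod_bound:
  assumes "subspace U" "subspace V" "basis_mod U I u V" "finite J" "\<forall>j\<in>J. t j \<in> V" "indep_mod U J t"
  shows "card J \<le> card I"
  using assms by (intro indep_mod_card_le[of U J I t u]) (auto simp: basis_mod_def)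

text \<open>The bound \<open>N\<close> replaces finite dimensionality: an independent family in
  \<open>T\<close> of greatest length is a basis. The set \<open>T\<close> of representatives lets
  the basis vectors be taken from a prescribed part of \<open>V\<close>, for instance from the
  kernel of a map.\<close>

lemma basis_mod_exists:
  fixes N :: nat
  assumes U: "subspace U" and "U \<subseteq> V"
    and bnd: "\<And>d (u :: nat => 'b). \<forall>i<d. u i \<in> V ==> indep_mod U {..<d} u ==> d \<le> N"
    and T: "T \<subseteq> V" "\<forall>x\<in>V. \<exists>t\<in>T. x - t \<in> U"
  obtains d u where "basis_mod U {..<d::nat} u V" "\<forall>i<d. u i \<in> T"
proof -
  define P where "P d \<longleftrightarrow> (\<exists>u. (\<forall>i<d. u i \<in> T) \<and> indep_mod U {..<d} u)" for d :: nat
  have P0: "P 0" by (simp add: P_def indep_mod_def)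
  have "\<forall>y. P y \<longrightarrow> y < Suc N"
  proof (intro allI impI)
    fix y assume "P y"
    then obtain u where "\<forall>i<y. u i \<in> T" "indep_mod U {..<y} u" unfolding P_def by metis
    moreover from this(1) T(1) have "\<forall>i<y. u i \<in> V" by blast
    ultimately have "y \<le> N" by (intro bnd)
    then show "y < Suc N" by simp
  qed
  from ex_has_greatest_nat[of P 0 id "Suc N"] P0 this obtain d where
    d: "P d" "\<forall>y. P y \<longrightarrow> y \<le> d" unfolding id_def by blast
  from d(1) obtain u where u: "\<forall>i<d. u i \<in> T" "indep_mod U {..<d} u" by (auto simp: P_def)
  have "V \<subseteq> add_span U {..<d} u"
  proof
    fix x assume "x \<in> V"
    then obtain t where t: "t \<in> T" "x - t \<in> U" using T by blast
    have "t \<in> add_span U {..<d} u"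
    proof (rule ccontr)
      assume *: "t \<notin> add_span U {..<d} u"
      define v where "v = u(d := t)"
      have vu: "(\<Sum>i<d. c i \<star> v i) = (\<Sum>i<d. c i \<star> u i)" for c
        by (intro sum.cong) (auto simp: v_def)
      have "indep_mod U (insert d {..<d}) v"
        using * u U by (intro indep_mod_insert) (auto simp: indep_mod_def add_span_def vu, auto simp: v_def)
      then have "indep_mod U {..<Suc d} v" by (simp add: lessThan_Suc)
      moreover have "\<forall>i<Suc d. v i \<in> T" using u(1) t(1) by (simp add: v_def less_Suc_eq)
      ultimately have "P (Suc d)" unfolding P_def by metis
      with d(2) show False by (metis Suc_n_not_le_n)
    qed
    moreover have "x - t \<in> add_span U {..<d} u" using add_span_superset[OF U] t by blast
    ultimately have "t + (x - t) \<in> add_span U {..<d} u"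
      by (rule subspace_add[OF subspace_add_span[OF U]])
    then show "x \<in> add_span U {..<d} u" by simp
  qed
  moreover have "\<forall>i\<in>{..<d}. u i \<in> V" using u T(1) by auto
  ultimately have "basis_mod U {..<d} u V" using u(2) by (simp add: basis_mod_def)
  then show ?thesis using u(1) by (rule that)
qed

text \<open>Dimension is monotone for the subquotient \<open>V'/U'\<close> of \<open>V/U\<close>,
  and strictly so when something is lost; this strictness drives the induction for the Kronecker
  form.\<close>

lemma basis_mod_between:
  fixes d :: nat
  assumes b: "basis_mod U {..<d} u V"
    and sub: "subspace U" "subspace U'" "subspace V'" "subspace V" "U \<subseteq> U'" "U' \<subseteq> V'" "V' \<subseteq> V"
  obtains e t where "basis_mod U' {..<e::nat} t V'" "e \<le> d" "U' \<noteq> U \<or> V' \<noteq> V ==> e < d"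
proof -
  have bnd: "card J \<le> d" if "finite J" "\<forall>j\<in>J. t j \<in> V" "indep_mod U J t" for J :: "nat set" and t
    using indep_mod_bound[OF sub(1,4) b that] by simp
  have down: "indep_mod U J t" if "indep_mod U' J t" for J :: "nat set" and t
    using that sub(5) by (auto simp: indep_mod_def)
  have bd: "k \<le> d" if "\<forall>i<k. t i \<in> V'" "indep_mod U' {..<k} t" for k t
  proof -
    have "\<forall>i\<in>{..<k}. t i \<in> V" using that sub by auto
    from bnd[OF _ this down[OF that(2)]] show ?thesis by simp
  qed
  have self: "\<forall>x\<in>V'. \<exists>t\<in>V'. x - t \<in> U'" using subspace_0[OF sub(2)] by (metis diff_self)
  obtain e t where t: "basis_mod U' {..<e::nat} t V'"
    by (rule basis_mod_exists[OF sub(2,6) _ order_refl self]) (rule bd, assumption, assumption, blast)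
  have ti: "indep_mod U {..<e} t" "indep_mod U' {..<e} t" "\<forall>i<e. t i \<in> V'"
    using t down by (auto simp: basis_mod_def)
  have "e \<le> d" using bd ti by blast
  moreover have "e < d" if "x \<in> V" "x \<notin> add_span U {..<e} t" for x
  proof -
    define v where "v = t(e := x)"
    have vu: "(\<Sum>i<e. c i \<star> v i) = (\<Sum>i<e. c i \<star> t i)" for c
      by (intro sum.cong) (auto simp: v_def)
    have "indep_mod U (insert e {..<e}) v"
      using that(2) ti sub by (intro indep_mod_insert) (auto simp: indep_mod_def add_span_def vu, auto simp: v_def)
    moreover have "\<forall>j\<in>insert e {..<e}. v j \<in> V" using that(1) ti(3) sub(7) by (auto simp: v_def)
    ultimately have "card (insert e {..<e}) \<le> d" by (intro bnd) auto
    then show ?thesis by simp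
  qed
  moreover have "\<exists>x. x \<in> V \<and> x \<notin> add_span U {..<e} t" if "U' \<noteq> U"
  proof -
    obtain x where x: "x \<in> U'" "x \<notin> U" using \<open>U' \<noteq> U\<close> sub(5) by blast
    have "x \<notin> add_span U {..<e} t"
    proof
      assume "x \<in> add_span U {..<e} t"
      then obtain c where c: "x - (\<Sum>i<e. c i \<star> t i) \<in> U" by (auto simp: add_span_def)
      then have "x - (\<Sum>i<e. c i \<star> t i) \<in> U'" using sub(5) by blast
      then have "x - (x - (\<Sum>i<e. c i \<star> t i)) \<in> U'" by (rule subspace_diff[OF sub(2) x(1)])
      then have "(\<Sum>i<e. c i \<star> t i) \<in> U'" by simp
      then have "\<forall>i\<in>{..<e}. c i = 0" using ti(2) unfolding indep_mod_def by blast
      then have "(\<Sum>i<e. c i \<star> t i) = 0" by (intro sum.neutral) simp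
      with c x show False by simp
    qed
    then show ?thesis using x sub by blast
  qed
  moreover have "\<exists>x. x \<in> V \<and> x \<notin> add_span U {..<e} t" if "V' \<noteq> V"
  proof -
    have "add_span U {..<e} t \<subseteq> V'" using ti sub by (intro add_span_least) auto
    then show ?thesis using that sub by blast
  qed
  ultimately show ?thesis using that t by metis
qed

definition lin_map :: "('b => 'b) => bool" where
  "lin_map f \<longleftrightarrow> (\<forall>x y. f (x + y) = f x + f y) \<and> (\<forall>c x. f (c \<star> x) = c \<star> f x)"

lemma lin_map_add: "lin_map f ==> f (x + y) = f x + f y"
  and lin_map_scale: "lin_map f ==> f (c \<star> x) = c \<star> f x"
  by (auto simp: lin_map_def)

lemma lin_map_0: "lin_map f ==> f 0 = 0"
  using lin_map_scale[of f 0 0] by simp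

lemma lin_map_diff: "lin_map f ==> f (x - y) = f x - f y"
  using lin_map_add[of f "x - y" y] by (simp add: algebra_simps)

lemma lin_map_sum: "lin_map f ==> f (\<Sum>i\<in>I. c i \<star> u i) = (\<Sum>i\<in>I. c i \<star> f (u i))"
proof (cases "finite I")
  case True
  assume "lin_map f"
  from True show ?thesis
    by induction (use \<open>lin_map f\<close> in \<open>auto simp: lin_map_0 lin_map_add lin_map_scale\<close>)
qed (simp add: lin_map_0)

lemma subspace_preimage: "lin_map f ==> subspace V ==> subspace W ==> subspace {v \<in> V. f v \<in> W}"
  by (auto simp: subspace_def lin_map_add lin_map_scale lin_map_0)

lemma subspace_image_sum:
  assumes "lin_map f" "subspace V" "subspace W"
  shows "subspace {x. \<exists>v\<in>V. x - f v \<in> W}"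
proof (rule subspaceI)
  show "0 \<in> {x. \<exists>v\<in>V. x - f v \<in> W}"
    using assms by (auto intro!: bexI[of _ 0] simp: lin_map_0 subspace_0)
  fix x y assume "x \<in> {x. \<exists>v\<in>V. x - f v \<in> W}" "y \<in> {x. \<exists>v\<in>V. x - f v \<in> W}"
  then obtain u v where u: "u \<in> V" "x - f u \<in> W" and v: "v \<in> V" "y - f v \<in> W" by auto
  have "x + y - f (u + v) = (x - f u) + (y - f v)" by (simp add: lin_map_add[OF assms(1)])
  then have "x + y - f (u + v) \<in> W" using subspace_add[OF assms(3) u(2) v(2)] by (simp only:)
  moreover have "u + v \<in> V" using subspace_add[OF assms(2) u(1) v(1)] .
  ultimately show "x + y \<in> {x. \<exists>v\<in>V. x - f v \<in> W}" by blast
next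
  fix c x assume "x \<in> {x. \<exists>v\<in>V. x - f v \<in> W}"
  then obtain u where u: "u \<in> V" "x - f u \<in> W" by auto
  have "c \<star> x - f (c \<star> u) = c \<star> (x - f u)"
    by (simp add: lin_map_scale[OF assms(1)] scale_right_diff_distrib)
  then have "c \<star> x - f (c \<star> u) \<in> W" using subspace_scale[OF assms(3) u(2), of c] by (simp only:)
  moreover have "c \<star> u \<in> V" using subspace_scale[OF assms(2) u(1)] .
  ultimately show "c \<star> x \<in> {x. \<exists>v\<in>V. x - f v \<in> W}" by blast
qed

end

context complex_vector_space begin

lemma indep_mod_mono: "indep_mod U' I u ==> U \<subseteq> U' ==> indep_mod U I u"
  by (auto simp: indep_mod_def)

lemma basis_mod_add_span:
  "subspace U ==> finite I ==> indep_mod U I u ==> basis_mod U I u (add_span U I u)"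
  by (simp add: basis_mod_def add_span_base)

text \<open>By \<open>h1\<close> and \<open>h2\<close> the unmarked rows span \<open>X V'\<close>
  modulo \<open>W0\<close>, so the marked rows \<open>w (e i)\<close> represent \<open>W'\<close>
  modulo \<open>X V' + W0\<close>. As \<open>X\<close> maps \<open>V\<close> onto \<open>W'\<close>
  modulo \<open>W0\<close>, each marked row has a preimage \<open>u i\<close>, and these, completed
  by vectors killed by \<open>X\<close>, form a basis of \<open>V\<close> modulo \<open>V'\<close>.
  Because \<open>V'\<close> is the full preimage of \<open>W'\<close> under \<open>Y\<close>, the
  vectors \<open>Y (u i)\<close> stay independent modulo \<open>W'\<close>. Thus every marked chain
  grows by one vector, and new chains begin at \<open>E1\<close> and \<open>E2\<close>.\<close>

lemma chain_extension:
  fixes X Y :: "'b => 'b" and e :: "nat => 'r" and N dV dW :: nat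
  assumes X: "lin_map X" and Y: "lin_map Y"
    and sub: "subspace V0" "subspace V" "subspace W0" "subspace W" "W0 \<subseteq> W" "V0 \<subseteq> V'"
    and map: "\<And>v. v \<in> V ==> X v \<in> W" "\<And>v. v \<in> V ==> Y v \<in> W"
    and V': "V' = {v\<in>V. Y v \<in> W'}" and W': "W' = {x. \<exists>v\<in>V. x - X v \<in> W0}"
    and bV: "basis_mod V0 {..<dV} a V" and bW: "basis_mod W0 {..<dW} b W"
    and bR: "basis_mod W0 R w W'"
    and e: "inj_on e E0" "e ` E0 \<subseteq> R" "finite E0" "E0 \<subseteq> {..<N}"
    and h1: "\<And>v. v \<in> V' ==> \<exists>c. X v - (\<Sum>r\<in>R - e ` E0. c r \<star> w r) \<in> W0"
    and h2: "\<And>r. r \<in> R - e ` E0 ==> \<exists>v\<in>V'. w r - X v \<in> W0"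
  obtains E1 E2 u y where "finite E1" "finite E2" "E1 \<inter> E2 = {}" "E1 \<union> E2 \<subseteq> {N..}"
    "\<And>i. i \<in> E0 ==> X (u i) - w (e i) \<in> W0" "\<And>i. i \<in> E1 ==> X (u i) \<in> W0"
    "basis_mod V' (E0 \<union> E1) u V" "basis_mod W' (E0 \<union> E1 \<union> E2) y W"
    "\<And>i. i \<in> E0 \<union> E1 ==> y i = Y (u i)"
proof -
  have sW': "subspace W'" unfolding W' by (rule subspace_image_sum[OF X sub(2,3)])
  have sV': "subspace V'" unfolding V' by (rule subspace_preimage[OF Y sub(2) sW'])
  have XW': "X v \<in> W'" if "v \<in> V" for v using that subspace_0[OF sub(3)] by (auto simp: W' intro!: bexI[of _ v])
  have "W' \<subseteq> W"
  proof
    fix x assume "x \<in> W'"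
    then obtain v where v: "v \<in> V" "x - X v \<in> W0" by (auto simp: W')
    then have "(x - X v) + X v \<in> W" using map(1) sub(4,5) by (intro subspace_add) auto
    then show "x \<in> W" by simp
  qed
  have W0W': "W0 \<subseteq> W'"
    using subspace_0[OF sub(2)] by (auto simp: W' lin_map_0[OF X] intro!: bexI[of _ 0])
  have fR: "finite R" and wR: "\<And>r. r \<in> R ==> w r \<in> W'" using bR by (auto simp: basis_mod_def)
  have "\<forall>i\<in>E0. \<exists>v. v \<in> V \<and> w (e i) - X v \<in> W0"
    using wR e(2) unfolding W' by blast
  from bchoice[OF this] obtain u0 where u0: "\<And>i. i \<in> E0 ==> u0 i \<in> V"
    "\<And>i. i \<in> E0 ==> w (e i) - X (u0 i) \<in> W0" by blast
  have ind0: "indep_mod V' E0 u0"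
    unfolding indep_mod_def
  proof (intro allI impI)
    fix c assume "(\<Sum>i\<in>E0. c i \<star> u0 i) \<in> V'"
    from h1[OF this] obtain d where
      "X (\<Sum>i\<in>E0. c i \<star> u0 i) - (\<Sum>r\<in>R - e ` E0. d r \<star> w r) \<in> W0" by blast
    moreover have "(\<Sum>i\<in>E0. c i \<star> (w (e i) - X (u0 i))) \<in> W0"
      using u0 by (intro subspace_sum subspace_scale sub(3)) auto
    ultimately have "(X (\<Sum>i\<in>E0. c i \<star> u0 i) - (\<Sum>r\<in>R - e ` E0. d r \<star> w r))
        + (\<Sum>i\<in>E0. c i \<star> (w (e i) - X (u0 i))) \<in> W0"
      by (rule subspace_add[OF sub(3)])
    then have *: "(\<Sum>i\<in>E0. c i \<star> w (e i)) - (\<Sum>r\<in>R - e ` E0. d r \<star> w r) \<in> W0"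
      by (simp add: lin_map_sum[OF X] scale_right_diff_distrib sum_subtractf)
    \<comment> \<open>The relation is rewritten on the whole basis \<open>w\<close>; its
      coefficients at the marked rows are the \<open>c i\<close>.\<close>
    define k where "k r = (if r \<in> e ` E0 then c (inv_into E0 e r) else - d r)" for r
    have "(\<Sum>r\<in>R. k r \<star> w r) = (\<Sum>r\<in>R - e ` E0. k r \<star> w r) + (\<Sum>r\<in>e ` E0. k r \<star> w r)"
      by (rule sum.subset_diff[OF e(2) fR])
    also have "(\<Sum>r\<in>e ` E0. k r \<star> w r) = (\<Sum>i\<in>E0. c i \<star> w (e i))"
      by (simp add: sum.reindex[OF e(1)] k_def e(1))
    also have "(\<Sum>r\<in>R - e ` E0. k r \<star> w r) = - (\<Sum>r\<in>R - e ` E0. d r \<star> w r)"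
      by (simp add: k_def sum_negf scale_minus_left)
    finally have "(\<Sum>r\<in>R. k r \<star> w r) \<in> W0" using * by simp
    then have k0: "\<And>r. r \<in> R ==> k r = 0" using bR by (simp add: basis_mod_def indep_mod_def)
    show "\<forall>i\<in>E0. c i = 0"
    proof
      fix i assume "i \<in> E0"
      then have "k (e i) = c i" "e i \<in> R" using e by (auto simp: k_def)
      then show "c i = 0" using k0 by metis
    qed
  qed
  define V1 where "V1 = add_span V' E0 u0"
  have sV1: "subspace V1" unfolding V1_def by (rule subspace_add_span[OF sV'])
  have V'V: "V' \<subseteq> V" by (auto simp: V')
  have V1: "V' \<subseteq> V1" "V1 \<subseteq> V" unfolding V1_def
    using add_span_superset[OF sV', of E0 u0] add_span_least[OF sub(2) V'V, of E0 u0] u0(1) by blast+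
  have b0: "basis_mod V' E0 u0 V1" unfolding V1_def by (rule basis_mod_add_span[OF sV' e(3) ind0])
  define K where "K = {x\<in>V. X x \<in> W0}"
  have hit: "\<forall>r\<in>R. \<exists>v. v \<in> V1 \<and> w r - X v \<in> W0"
  proof
    fix r assume r: "r \<in> R"
    show "\<exists>v. v \<in> V1 \<and> w r - X v \<in> W0"
    proof (cases "r \<in> e ` E0")
      case True
      then obtain i where "i \<in> E0" "r = e i" by blast
      moreover from this b0 have "u0 i \<in> V1" by (simp add: basis_mod_def)
      ultimately show ?thesis using u0(2)[of i] by metis
    next
      case False
      then show ?thesis using h2[of r] r V1(1) by blast
    qed
  qed
  from bchoice[OF hit] obtain p where p: "\<And>r. r \<in> R ==> p r \<in> V1"
    "\<And>r. r \<in> R ==> w r - X (p r) \<in> W0" by blast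
  \<comment> \<open>Every vector of \<open>V\<close> is congruent modulo \<open>V1\<close> to one
    that \<open>X\<close> sends into \<open>W0\<close>, so the completing basis vectors can be taken
    in \<open>K\<close>.\<close>
  have KT: "\<forall>x\<in>V. \<exists>t\<in>K. x - t \<in> V1"
  proof
    fix x assume x: "x \<in> V"
    have "W' \<subseteq> add_span W0 R w" using bR by (simp add: basis_mod_def)
    then obtain c where c: "X x - (\<Sum>r\<in>R. c r \<star> w r) \<in> W0"
      using XW'[OF x] by (auto simp: add_span_def)
    define s where "s = (\<Sum>r\<in>R. c r \<star> p r)"
    have s: "s \<in> V1" unfolding s_def using p by (intro subspace_sum subspace_scale sV1) auto
    have "(\<Sum>r\<in>R. c r \<star> (w r - X (p r))) \<in> W0"
      using p by (intro subspace_sum subspace_scale sub(3)) auto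
    from subspace_add[OF sub(3) c this] have "X (x - s) \<in> W0"
      by (simp add: s_def lin_map_diff[OF X] lin_map_sum[OF X] scale_right_diff_distrib sum_subtractf)
    moreover have "x - s \<in> V" using x s V1 subspace_diff[OF sub(2)] by blast
    ultimately have "x - s \<in> K" by (simp add: K_def)
    then show "\<exists>t\<in>K. x - t \<in> V1" using s by (intro bexI[of _ "x - s"]) auto
  qed
  have bd: "k \<le> dV" if "\<forall>i<k. t i \<in> V" "indep_mod V1 {..<k} t" for k t
  proof -
    have "indep_mod V0 {..<k} t" using indep_mod_mono[OF that(2)] sub(6) V1(1) by blast
    from indep_mod_bound[OF sub(1,2) bV _ _ this] that(1) show ?thesis by simp
  qed
  have "K \<subseteq> V" by (auto simp: K_def)
  obtain d1 u1 where u1: "basis_mod V1 {..<d1::nat} u1 V" "\<forall>i<d1. u1 i \<in> K"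
    by (rule basis_mod_exists[OF sV1 V1(2) _ \<open>K \<subseteq> V\<close> KT]) (rule bd, assumption, assumption, blast)
  define E1 where "E1 = {N..<N + d1}"
  define u where "u i = (if i \<in> E0 then u0 i else u1 (i - N))" for i
  have disj: "E0 \<inter> E1 = {}" using e(4) by (auto simp: E1_def)
  have "bij_betw (\<lambda>i. i - N) E1 {..<d1}"
    by (rule bij_betw_byWitness[where f'="\<lambda>i. i + N"]) (auto simp: E1_def)
  then have b1: "basis_mod V1 E1 u V"
    by (rule basis_mod_reindex[OF _ u1(1)]) (use disj in \<open>auto simp: u_def\<close>)
  have "basis_mod V' E0 u V1" by (rule basis_mod_cong[OF b0]) (simp add: u_def)
  then have b2: "basis_mod V' (E0 \<union> E1) u V"
    by (rule basis_mod_trans[OF sV' sV1 V1 disj _ b1])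
  define E where "E = E0 \<union> E1"
  have E: "finite E" using e(3) by (simp add: E_def E1_def)
  have indY: "indep_mod W' E (\<lambda>i. Y (u i))"
    unfolding indep_mod_def
  proof (intro allI impI)
    fix c assume "(\<Sum>i\<in>E. c i \<star> Y (u i)) \<in> W'"
    then have "Y (\<Sum>i\<in>E. c i \<star> u i) \<in> W'" by (simp add: lin_map_sum[OF Y])
    moreover have "(\<Sum>i\<in>E. c i \<star> u i) \<in> V"
      using b2 by (intro subspace_sum subspace_scale sub(2)) (auto simp: basis_mod_def E_def)
    ultimately have "(\<Sum>i\<in>E. c i \<star> u i) \<in> V'" by (simp add: V')
    then show "\<forall>i\<in>E. c i = 0" using b2 by (simp add: basis_mod_def indep_mod_def E_def)
  qed
  define W2 where "W2 = add_span W' E (\<lambda>i. Y (u i))"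
  have sW2: "subspace W2" unfolding W2_def by (rule subspace_add_span[OF sW'])
  have "\<forall>i\<in>E. Y (u i) \<in> W" using b2 map(2) by (auto simp: basis_mod_def E_def)
  then have W2: "W' \<subseteq> W2" "W2 \<subseteq> W" unfolding W2_def
    by (intro add_span_superset add_span_least sW' sub(4) \<open>W' \<subseteq> W\<close>; assumption)+
  have b3: "basis_mod W' E (\<lambda>i. Y (u i)) W2"
    unfolding W2_def by (rule basis_mod_add_span[OF sW' E indY])
  obtain d2 y2 where y2: "basis_mod W2 {..<d2::nat} y2 W"
    by (rule basis_mod_between[OF bW sub(3) sW2 sub(4) sub(4) _ W2(2) order_refl])
      (use W0W' W2 in blast)+
  define E2 where "E2 = {N + d1..<N + d1 + d2}"
  define y where "y i = (if i \<in> E then Y (u i) else y2 (i - (N + d1)))" for i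
  have disj2: "E \<inter> E2 = {}" using e(4) by (auto simp: E_def E1_def E2_def)
  have "bij_betw (\<lambda>i. i - (N + d1)) E2 {..<d2}"
    by (rule bij_betw_byWitness[where f'="\<lambda>i. i + (N + d1)"]) (auto simp: E2_def)
  then have b4: "basis_mod W2 E2 y W"
    by (rule basis_mod_reindex[OF _ y2]) (use disj2 in \<open>auto simp: y_def\<close>)
  have "basis_mod W' E y W2" by (rule basis_mod_cong[OF b3]) (simp add: y_def)
  then have b5: "basis_mod W' (E \<union> E2) y W"
    by (rule basis_mod_trans[OF sW' sW2 W2 disj2 _ b4])
  show ?thesis
  proof (rule that)
    show "finite E1" "finite E2" "E1 \<inter> E2 = {}" "E1 \<union> E2 \<subseteq> {N..}"
      by (auto simp: E1_def E2_def)
    show "X (u i) - w (e i) \<in> W0" if "i \<in> E0" for i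
      using subspace_neg[OF sub(3) u0(2)[OF that]] that by (simp add: u_def)
    show "X (u i) \<in> W0" if "i \<in> E1" for i
    proof -
      have "i \<notin> E0" "i - N < d1" using that disj by (auto simp: E1_def)
      then show ?thesis using u1(2) by (simp add: u_def K_def)
    qed
    show "basis_mod V' (E0 \<union> E1) u V" by (rule b2)
    show "basis_mod W' (E0 \<union> E1 \<union> E2) y W" using b5 by (simp add: E_def)
    show "y i = Y (u i)" if "i \<in> E0 \<union> E1" for i using that by (simp add: y_def E_def)
  qed
qed
end

section \<open>Kronecker blocks as chains, and the reduction step at one eigenvalue\<close>

datatype kblock = LB nat | LTB nat | DB ext_complex nat

fun brows :: "kblock => nat" where
  "brows (LB n) = n - 1" | "brows (LTB n) = n" | "brows (DB \<mu> n) = n"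

fun bcols :: "kblock => nat" where
  "bcols (LB n) = n" | "bcols (LTB n) = n - 1" | "bcols (DB \<mu> n) = n"

fun bvalid :: "kblock => bool" where
  "bvalid (LB n) = (1 \<le> n)" | "bvalid (LTB n) = (1 \<le> n)" | "bvalid (DB \<mu> n) = (1 \<le> n)"

abbreviation col_index :: "nat set => (nat => kblock) => (nat \<times> nat) set" where
  "col_index I typ \<equiv> Sigma I (\<lambda>i. {..<bcols (typ i)})"

abbreviation row_index :: "nat set => (nat => kblock) => (nat \<times> nat) set" where
  "row_index I typ \<equiv> Sigma I (\<lambda>i. {..<brows (typ i)})"

context complex_vector_space begin

text \<open>The eigenvalue \<open>\<mu>\<close> of the pencil \<open>(A, B)\<close> becomes the eigenvalue \<open>0\<close> of the
  pencil \<open>(Y, X)\<close> with \<open>X = eigX \<mu> A B\<close> and \<open>Y = eigY \<mu> A B\<close>.\<close>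

fun eigX :: "ext_complex => ('b => 'b) => ('b => 'b) => 'b => 'b" where
  "eigX (Finite \<mu>) A B x = B x - \<mu> \<star> A x" | "eigX Infinity A B x = A x"

fun eigY :: "ext_complex => ('b => 'b) => ('b => 'b) => 'b => 'b" where
  "eigY (Finite \<mu>) A B x = A x" | "eigY Infinity A B x = B x"

text \<open>The action of the pencil on the columns \<open>v\<close> and rows \<open>w\<close> of
  one summand, read modulo \<open>U\<close>. Neighbours that are out of range count as 0: at both
  ends for \<open>LB\<close>, at the start for a Jordan chain.\<close>

fun chain :: "'b set => ('b => 'b) => ('b => 'b) => kblock => (nat => 'b) => (nat => 'b) => bool" where
  "chain U A B (LB n) v w \<longleftrightarrow> (\<forall>q<n. A (v q) - (if Suc q < n then w q else 0) \<in> U \<and>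
      B (v q) - (if q = 0 then 0 else w (q - 1)) \<in> U)"
| "chain U A B (LTB n) v w \<longleftrightarrow> (\<forall>q. Suc q < n \<longrightarrow> A (v q) - w q \<in> U \<and> B (v q) - w (Suc q) \<in> U)"
| "chain U A B (DB \<mu> n) v w \<longleftrightarrow> (\<forall>q<n. eigX \<mu> A B (v q) - (if q = 0 then 0 else w (q - 1)) \<in> U \<and>
      eigY \<mu> A B (v q) - w q \<in> U)"

definition kronecker_basis where
  "kronecker_basis V0 V W0 W A B I typ v w \<longleftrightarrow> finite I \<and> (\<forall>i\<in>I. bvalid (typ i)) \<and>
     basis_mod V0 (col_index I typ) (\<lambda>(i, q). v i q) V \<and>
     basis_mod W0 (row_index I typ) (\<lambda>(i, p). w i p) W \<and>
     (\<forall>i\<in>I. chain W0 A B (typ i) (v i) (w i))"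

definition pencil_on where
  "pencil_on V0 V W0 W A B \<longleftrightarrow> lin_map A \<and> lin_map B \<and>
     subspace V0 \<and> subspace V \<and> subspace W0 \<and> subspace W \<and> V0 \<subseteq> V \<and> W0 \<subseteq> W \<and>
     A ` V \<subseteq> W \<and> B ` V \<subseteq> W \<and> A ` V0 \<subseteq> W0 \<and> B ` V0 \<subseteq> W0"

lemma lin_map_eigX: "lin_map A ==> lin_map B ==> lin_map (eigX \<mu> A B)"
  and lin_map_eigY: "lin_map A ==> lin_map B ==> lin_map (eigY \<mu> A B)"
  by (cases \<mu>; simp add: lin_map_def algebra_simps scale_right_distrib scale_left_commute
      scale_right_diff_distrib)+

lemma eigX_mem: "subspace W ==> A x \<in> W ==> B x \<in> W ==> eigX \<mu> A B x \<in> W"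
  and eigY_mem: "A x \<in> W ==> B x \<in> W ==> eigY \<mu> A B x \<in> W"
  by (cases \<mu>; simp add: subspace_diff subspace_scale)+

lemma AB_mem:
  assumes "subspace W" "eigX \<mu> A B x \<in> W" "eigY \<mu> A B x \<in> W"
  shows "A x \<in> W" "B x \<in> W"
proof (atomize(full), cases \<mu>)
  case (Finite c)
  then have "(B x - c \<star> A x) + c \<star> A x \<in> W"
    using assms by (intro subspace_add subspace_scale) auto
  with assms Finite show "A x \<in> W \<and> B x \<in> W" by simp
qed (use assms in auto)

lemma mem_cong: "subspace S ==> W0 \<subseteq> S ==> y - z \<in> W0 ==> z \<in> S ==> y \<in> S"
  using subspace_add[of S "y - z" z] by auto

lemma add_span_image:
  assumes X: "lin_map X" and S: "subspace S" and V0: "\<And>x. x \<in> V0 ==> X x \<in> S"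
    and u: "\<And>i. i \<in> I ==> X (u i) \<in> S" and x: "x \<in> add_span V0 I u"
  shows "X x \<in> S"
proof -
  obtain c where c: "x - (\<Sum>i\<in>I. c i \<star> u i) \<in> V0" using x by (auto simp: add_span_def)
  have "X (x - (\<Sum>i\<in>I. c i \<star> u i)) + (\<Sum>i\<in>I. c i \<star> X (u i)) \<in> S"
    using V0[OF c] u by (intro subspace_add subspace_sum subspace_scale S) auto
  then show ?thesis by (simp add: lin_map_diff[OF X] lin_map_sum[OF X])
qed

text \<open>\<open>A\<close> never reaches the last row of an \<open>LTB\<close> chain or of a
  Jordan chain at \<open>Infinity\<close>, so only the other rows have to lie in
  \<open>S\<close>.\<close>

lemma chain_A_mem:
  assumes S: "subspace S" "U \<subseteq> S" and ch: "chain U A B b v w" and q: "q < bcols b"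
    and w: "\<And>p. p < brows b ==> (\<forall>n. b = LTB n \<or> b = DB Infinity n \<longrightarrow> Suc p < n) ==> w p \<in> S"
  shows "A (v q) \<in> S"
proof -
  have "\<exists>x\<in>S. A (v q) - x \<in> U"
  proof (cases b)
    case (LB n)
    then show ?thesis using ch q w[of q] subspace_0[OF S(1)]
      by (intro bexI[of _ "if Suc q < n then w q else 0"]) auto
  next
    case (LTB n)
    then show ?thesis using ch q w[of q] by (intro bexI[of _ "w q"]) auto
  next
    case (DB \<mu> n)
    then show ?thesis using ch q w[of q] w[of "q - 1"] subspace_0[OF S(1)]
      by (intro bexI[of _ "case \<mu> of Infinity => if q = 0 then 0 else w (q - 1) | _ => w q"])
         (cases \<mu>; auto)+
  qed
  then show ?thesis using mem_cong[OF S] by blast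
qed

text \<open>Bookkeeping for longer chains: every chain in \<open>Z\<close> receives one vector at
  its end, and a chain of \<open>Z\<close> outside \<open>I\<close> begins with it.\<close>

lemma basis_mod_append:
  assumes sub: "subspace V0" "subspace V1" "V0 \<subseteq> V1" "V1 \<subseteq> V"
    and b: "basis_mod V0 (Sigma I (\<lambda>i. {..<d i})) (\<lambda>(i, q). v i q) V1" and u: "basis_mod V1 Z u V"
    and n: "\<And>i. n i = (if i \<in> I then d i else 0)" and I': "I \<subseteq> I'" "Z \<subseteq> I'"
    and d': "\<And>i. i \<in> I' ==> d' i = (if i \<in> Z then Suc (n i) else n i)"
  shows "basis_mod V0 (Sigma I' (\<lambda>i. {..<d' i})) (\<lambda>(i, q). if i \<in> Z \<and> q = n i then u i else v i q) V"
proof -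
  have eq: "Sigma I' (\<lambda>i. {..<d' i}) = Sigma I (\<lambda>i. {..<d i}) \<union> (\<lambda>i. (i, n i)) ` Z"
    using d' n I' by (auto split: if_splits simp: less_Suc_eq)
  have bij: "bij_betw fst ((\<lambda>i. (i, n i)) ` Z) Z"
    by (rule bij_betw_byWitness[where f'="\<lambda>i. (i, n i)"]) auto
  show ?thesis unfolding eq
  proof (rule basis_mod_trans[OF sub])
    show "Sigma I (\<lambda>i. {..<d i}) \<inter> (\<lambda>i. (i, n i)) ` Z = {}" using n by auto
  qed (rule basis_mod_cong[OF b] basis_mod_reindex[OF bij u]; use n in auto)+
qed

text \<open>Cutting down to the image of \<open>eigX\<close> shortens the Jordan chains at \<mu> by
  one; \<open>kronecker_step\<close> undoes this.\<close>

lemma pencil_on_restrict: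
  assumes P: "pencil_on V0 V W0 W A B"
    and W1: "W1 = {x. \<exists>v\<in>V. x - eigX \<mu> A B v \<in> W0}" and V1: "V1 = {v\<in>V. eigY \<mu> A B v \<in> W1}"
  shows "pencil_on V0 V1 W0 W1 A B" "V1 \<subseteq> V" "W1 \<subseteq> W"
proof -
  note P' = P[unfolded pencil_on_def]
  have sub: "subspace V0" "subspace V" "subspace W0" "subspace W" "W0 \<subseteq> W" using P' by auto
  have lX: "lin_map (eigX \<mu> A B)" and lY: "lin_map (eigY \<mu> A B)"
    using P' by (auto intro: lin_map_eigX lin_map_eigY)
  have map: "eigX \<mu> A B x \<in> W" "eigY \<mu> A B x \<in> W" if "x \<in> V" for x
    using that P' by (auto intro!: eigX_mem eigY_mem)
  have map0: "eigY \<mu> A B x \<in> W0" if "x \<in> V0" for x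
    using that P' by (auto intro!: eigY_mem)
  have sW1: "subspace W1" unfolding W1 by (rule subspace_image_sum[OF lX sub(2,3)])
  have sV1: "subspace V1" unfolding V1 by (rule subspace_preimage[OF lY sub(2) sW1])
  have W0W1: "W0 \<subseteq> W1"
    using subspace_0[OF sub(2)] by (auto simp: W1 lin_map_0[OF lX] intro!: bexI[of _ 0])
  have V0V1: "V0 \<subseteq> V1" using P' map0 W0W1 by (auto simp: V1)
  have XW1: "eigX \<mu> A B v \<in> W1" if "v \<in> V" for v
    using that subspace_0[OF sub(3)] by (auto simp: W1 intro!: bexI[of _ v])
  show "W1 \<subseteq> W"
  proof
    fix x assume "x \<in> W1"
    then obtain v where "v \<in> V" "x - eigX \<mu> A B v \<in> W0" by (auto simp: W1)
    then show "x \<in> W" using map sub mem_cong by blast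
  qed
  show "V1 \<subseteq> V" by (auto simp: V1)
  have "A v \<in> W1 \<and> B v \<in> W1" if "v \<in> V1" for v
    using AB_mem[OF sW1 XW1, of v] that by (auto simp: V1)
  then show "pencil_on V0 V1 W0 W1 A B"
    unfolding pencil_on_def using P' sW1 sV1 W0W1 V0V1 by auto
qed

text \<open>The chains to be lengthened are those whose last row is missed by \<open>X V1\<close>:
  the Jordan chains at \<mu>, and for \<open>\<mu> = Infinity\<close> also the \<open>LTB\<close>
  chains. For finite \<mu> the hypothesis \<open>fin\<close> admits only finite Jordan chains,
  because the vectors of singular chains are adapted to \<open>A\<close> and \<open>B\<close> and
  not to \<open>B - \<mu> A\<close>.\<close>

lemma kronecker_step:
  fixes \<mu> :: ext_complex and dV dW :: nat
  defines "X \<equiv> eigX \<mu>" and "Y \<equiv> eigY \<mu>"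
  assumes P: "pencil_on V0 V W0 W A B"
    and W1: "W1 = {x. \<exists>v\<in>V. x - X A B v \<in> W0}" and V1: "V1 = {v\<in>V. Y A B v \<in> W1}"
    and bV: "basis_mod V0 {..<dV} a V" and bW: "basis_mod W0 {..<dW} b W"
    and K: "kronecker_basis V0 V1 W0 W1 A B I typ v w"
    and fin: "\<And>c i. \<mu> = Finite c ==> i \<in> I ==> \<exists>d n. typ i = DB (Finite d) n"
  shows "\<exists>I typ v w. kronecker_basis V0 V W0 W A B I typ v w"
proof -
  note P' = P[unfolded pencil_on_def]
  have sub: "subspace V0" "subspace V" "subspace W0" "subspace W" "W0 \<subseteq> W" using P' by auto
  have lX: "lin_map (X A B)" and lY: "lin_map (Y A B)"
    using P' by (auto simp: X_def Y_def intro: lin_map_eigX lin_map_eigY)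
  have map: "X A B x \<in> W" "Y A B x \<in> W" if "x \<in> V" for x
    using that P' by (auto simp: X_def Y_def intro!: eigX_mem eigY_mem)
  have map0: "X A B x \<in> W0" "Y A B x \<in> W0" if "x \<in> V0" for x
    using that P' by (auto simp: X_def Y_def intro!: eigX_mem eigY_mem)
  have W1': "W1 = {x. \<exists>v\<in>V. x - eigX \<mu> A B v \<in> W0}" and V1': "V1 = {v\<in>V. eigY \<mu> A B v \<in> W1}"
    unfolding W1 V1 X_def Y_def by (rule refl)+
  note restrict = pencil_on_restrict[OF P W1' V1']
  have sW1: "subspace W1" and sV1: "subspace V1" and W0W1: "W0 \<subseteq> W1" and V0V1: "V0 \<subseteq> V1"
    using restrict(1) by (auto simp: pencil_on_def)
  note K' = K[unfolded kronecker_basis_def]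
  define C R where "C = col_index I typ" and "R = row_index I typ"
  have fI: "finite I" and bC: "basis_mod V0 C (\<lambda>(i, q). v i q) V1"
    and bR: "basis_mod W0 R (\<lambda>(i, q). w i q) W1"
    and ch: "\<And>i. i \<in> I ==> chain W0 A B (typ i) (v i) (w i)"
    and val: "\<And>i. i \<in> I ==> bvalid (typ i)"
    using K' by (auto simp: C_def R_def)
  have fR: "finite R" using bR by (auto simp: basis_mod_def)
  have vV1: "v i q \<in> V1" if "i \<in> I" "q < bcols (typ i)" for i q
    using bC that by (auto simp: basis_mod_def C_def)
  define E0 where "E0 = {i\<in>I. (\<exists>n. typ i = DB \<mu> n) \<or> \<mu> = Infinity \<and> (\<exists>n. typ i = LTB n)}"
  define e where "e i = (i, brows (typ i) - 1)" for i
  obtain N where N: "I \<subseteq> {..<N}" using finite_nat_iff_bounded fI by auto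
  have E0: "finite E0" "E0 \<subseteq> I" "E0 \<subseteq> {..<N}" using fI N by (auto simp: E0_def)
  have rpos: "0 < brows (typ i)" if "i \<in> E0" for i
    using that val[of i] by (auto simp: E0_def)
  have e: "inj_on e E0" "e ` E0 \<subseteq> R" using E0(2) rpos by (auto simp: e_def inj_on_def R_def)
  define S where "S = add_span W0 (R - e ` E0) (\<lambda>(i, q). w i q)"
  have sS: "subspace S" and S0: "W0 \<subseteq> S"
    unfolding S_def by (rule subspace_add_span[OF sub(3)], rule add_span_superset[OF sub(3)])
  have wS: "w i p \<in> S" if "i \<in> I" "p < brows (typ i)" "i \<in> E0 ==> p + 1 < brows (typ i)" for i p
  proof -
    have "(i, p) \<in> R - e ` E0" using that by (auto simp: R_def e_def)
    from add_span_base[OF _ this sub(3), of "\<lambda>(i, q). w i q"] fR show ?thesis by (simp add: S_def)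
  qed
  have zS: "0 \<in> S" using subspace_0[OF sS] .
  have XS: "X A B (v i q) \<in> S" if iq: "i \<in> I" "q < bcols (typ i)" for i q
  proof (cases "\<mu>")
    case (Finite c)
    then obtain d n where d: "typ i = DB (Finite d) n" using fin iq by blast
    have q: "q < n" using iq d by simp
    have ch1: "B (v i q) - d \<star> A (v i q) - (if q = 0 then 0 else w i (q - 1)) \<in> W0" "A (v i q) - w i q \<in> W0"
      using ch[OF iq(1)] q by (auto simp: d)
    have w1: "(if q = 0 then 0 else w i (q - 1)) \<in> S"
      using wS[OF iq(1), of "q - 1"] q zS by (auto simp: d)
    have "B (v i q) - d \<star> A (v i q) \<in> S" by (rule mem_cong[OF sS S0 ch1(1) w1])
    \<comment> \<open>Write \<open>B - c A\<close> as \<open>(B - d A) + (d - c) A\<close>. For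
      \<open>d \<noteq> c\<close> the chain is unmarked, so all its rows lie in
      \<open>S\<close>.\<close>
    moreover have "(d - c) \<star> A (v i q) \<in> S"
    proof (cases "d = c")
      case False
      then have "i \<notin> E0" using d Finite by (auto simp: E0_def)
      then have "w i q \<in> S" using wS[OF iq(1), of q] q by (auto simp: d)
      from mem_cong[OF sS S0 ch1(2) this] show ?thesis using subspace_scale[OF sS] by blast
    qed (simp add: zS)
    ultimately have "B (v i q) - d \<star> A (v i q) + (d - c) \<star> A (v i q) \<in> S"
      by (rule subspace_add[OF sS])
    then show ?thesis by (simp add: X_def Finite scale_left_diff_distrib)
  next
    case Infinity
    have XA: "X A B = A" by (rule ext) (simp add: X_def Infinity)
    show ?thesis unfolding XA
      by (rule chain_A_mem[OF sS S0 ch[OF iq(1)] iq(2)]) (rule wS[OF iq(1)], use Infinity in \<open>auto simp: E0_def\<close>)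
  qed
  have h1: "\<exists>c. X A B x - (\<Sum>r\<in>R - e ` E0. c r \<star> (case r of (i, q) => w i q)) \<in> W0" if "x \<in> V1" for x
  proof -
    have "x \<in> add_span V0 C (\<lambda>(i, q). v i q)" using that bC by (auto simp: basis_mod_def)
    then have "X A B x \<in> S"
      by (rule add_span_image[OF lX sS, rotated 2]) (use map0 S0 XS in \<open>auto simp: C_def\<close>)
    then show ?thesis by (auto simp: S_def add_span_def)
  qed
  define T where "T = {x. \<exists>v\<in>V1. x - X A B v \<in> W0}"
  have sT: "subspace T" unfolding T_def by (rule subspace_image_sum[OF lX sV1 sub(3)])
  have XT: "x \<in> T" if "X A B v - x \<in> W0" "v \<in> V1" for x v
    using subspace_neg[OF sub(3) that(1)] that(2) by (auto simp: T_def)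
  have wT: "w i p \<in> T" if ip: "i \<in> I" "p < brows (typ i)" "i \<in> E0 ==> Suc p < brows (typ i)" for i p
  proof (cases "\<mu>")
    case (Finite c)
    then obtain d n where d: "typ i = DB (Finite d) n" using fin ip by blast
    have ch1: "B (v i q) - d \<star> A (v i q) - (if q = 0 then 0 else w i (q - 1)) \<in> W0" "A (v i q) - w i q \<in> W0"
      if "q < n" for q using ch[OF ip(1)] that by (auto simp: d)
    have vv: "v i q \<in> V1" if "q < n" for q using vV1[OF ip(1)] that d by simp
    show ?thesis
    proof (cases "d = c")
      case True
      then have "i \<in> E0" using ip d Finite by (auto simp: E0_def)
      then have "Suc p < n" using ip d by simp
      then show ?thesis using XT[of "v i (Suc p)" "w i p"] ch1(1)[of "Suc p"] vv[of "Suc p"] True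
        by (simp add: X_def Finite)
    next
      case False
      have "p < n" using ip d by simp
      \<comment> \<open>For \<open>d \<noteq> c\<close> the map \<open>B - c A\<close> is triangular
        on the chain with \<open>d - c\<close> on the diagonal, so the rows are reached one after
        another.\<close>
      then show ?thesis
      proof (induction p)
        case 0
        have "X A B (v i 0) - (d - c) \<star> w i 0 \<in> W0"
        proof -
          have "B (v i 0) - d \<star> A (v i 0) + (d - c) \<star> (A (v i 0) - w i 0) \<in> W0"
            using ch1[OF 0] by (intro subspace_add subspace_scale sub(3)) auto
          then show ?thesis by (simp add: X_def Finite algebra_simps)
        qed
        from XT[OF this vv[OF 0]] have "(1 / (d - c)) \<star> (d - c) \<star> w i 0 \<in> T"
          by (rule subspace_scale[OF sT])
        then show ?case using False by simp
      next
        case (Suc p)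
        then have IH: "w i p \<in> T" by simp
        have "X A B (v i (Suc p)) - ((d - c) \<star> w i (Suc p) + w i p) \<in> W0"
        proof -
          have "(B (v i (Suc p)) - d \<star> A (v i (Suc p)) - w i p) + (d - c) \<star> (A (v i (Suc p)) - w i (Suc p)) \<in> W0"
            using ch1[OF Suc.prems] by (intro subspace_add subspace_scale sub(3)) auto
          then show ?thesis by (simp add: X_def Finite algebra_simps)
        qed
        from XT[OF this vv[OF Suc.prems]]
        have "(d - c) \<star> w i (Suc p) + w i p - w i p \<in> T" using IH by (rule subspace_diff[OF sT])
        then have "(1 / (d - c)) \<star> ((d - c) \<star> w i (Suc p) + w i p - w i p) \<in> T"
          by (rule subspace_scale[OF sT])
        then show ?case using False by simp
      qed
    qed
  next
    case Infinity
    have XA: "X A B = A" by (rule ext) (simp add: X_def Infinity)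
    note XT' = XT[unfolded XA]
    show ?thesis
    proof (cases "typ i")
      case (LB n)
      then show ?thesis using ch[OF ip(1)] vV1[OF ip(1), of p] ip
        by (intro XT'[of "v i p"]) (auto split: if_splits)
    next
      case (LTB n)
      then have "i \<in> E0" using ip Infinity by (auto simp: E0_def)
      then show ?thesis using ch[OF ip(1)] vV1[OF ip(1), of p] ip LTB
        by (intro XT'[of "v i p"]) auto
    next
      case (DB l n)
      show ?thesis
      proof (cases l)
        case (Finite d)
        then show ?thesis using ch[OF ip(1)] vV1[OF ip(1), of p] ip DB
          by (intro XT'[of "v i p"]) auto
      next
        case l: Infinity
        then have "i \<in> E0" using ip Infinity DB by (auto simp: E0_def)
        then have "Suc p < n" using ip DB by simp
        then have "A (v i (Suc p)) - w i p \<in> W0" using ch[OF ip(1)] by (auto simp: DB l)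
        then show ?thesis using vV1[OF ip(1), of "Suc p"] \<open>Suc p < n\<close> DB
          by (intro XT'[of "v i (Suc p)"]) auto
      qed
    qed
  qed
  have h2: "\<exists>v\<in>V1. (case r of (i, q) => w i q) - X A B v \<in> W0" if r: "r \<in> R - e ` E0" for r
  proof -
    obtain i p where ip: "r = (i, p)" "i \<in> I" "p < brows (typ i)" using r by (auto simp: R_def)
    moreover have "Suc p < brows (typ i)" if "i \<in> E0"
      using r that ip by (auto simp: e_def image_iff)
    ultimately have "w i p \<in> T" by (intro wT)
    then show ?thesis using ip by (auto simp: T_def)
  qed
  obtain E1 E2 u y where E: "finite E1" "finite E2" "E1 \<inter> E2 = {}" "E1 \<union> E2 \<subseteq> {N..}"
    and u0: "\<And>i. i \<in> E0 ==> X A B (u i) - (case e i of (i, q) => w i q) \<in> W0"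
    and u1: "\<And>i. i \<in> E1 ==> X A B (u i) \<in> W0"
    and bu: "basis_mod V1 (E0 \<union> E1) u V" and by': "basis_mod W1 (E0 \<union> E1 \<union> E2) y W"
    and yu: "\<And>i. i \<in> E0 \<union> E1 ==> y i = Y A B (u i)"
    using chain_extension[OF lX lY sub V0V1 map V1 W1 bV bW bR e(1,2) E0(1,3) h1 h2] by blast
  \<comment> \<open>Marked chains gain one column and one row, \<open>E1\<close> starts Jordan
    chains of length 1 at \<mu>, and each vector of \<open>E2\<close> is a row without columns,
    which is \<open>LTB 1\<close>.\<close>
  define typ' where "typ' i = (if i \<in> E0 then (case typ i of LTB n => LTB (Suc n) | DB l n => DB l (Suc n) | LB n => LB n)
    else if i \<in> E1 then DB \<mu> 1 else if i \<in> E2 then LTB 1 else typ i)" for i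
  define nc nr where "nc i = (if i \<in> I then bcols (typ i) else 0)" and "nr i = (if i \<in> I then brows (typ i) else 0)" for i
  define v' where "v' i q = (if i \<in> E0 \<union> E1 \<and> q = nc i then u i else v i q)" for i q
  define w' where "w' i p = (if i \<in> E0 \<union> E1 \<union> E2 \<and> p = nr i then y i else w i p)" for i p
  define I' where "I' = I \<union> E1 \<union> E2"
  have dj: "I \<inter> E1 = {}" "I \<inter> E2 = {}" "E0 \<inter> E1 = {}" "E0 \<inter> E2 = {}"
    using N E E0 by force+
  have t0: "bcols (typ' i) = Suc (bcols (typ i)) \<and> brows (typ' i) = Suc (brows (typ i))" if "i \<in> E0" for i
    using that val[of i] by (auto simp: typ'_def E0_def)
  have t1: "bcols (typ' i) = 1 \<and> brows (typ' i) = 1" if "i \<in> E1" for i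
    using that dj by (auto simp: typ'_def)
  have t2: "bcols (typ' i) = 0 \<and> brows (typ' i) = 1" if "i \<in> E2" for i
    using that dj E(3) by (auto simp: typ'_def)
  have t3: "typ' i = typ i" if "i \<in> I" "i \<notin> E0" for i
    using that dj by (auto simp: typ'_def)
  have bC': "basis_mod V0 (col_index I' typ') (\<lambda>(i, q). v' i q) V"
    unfolding v'_def
    by (rule basis_mod_append[OF sub(1) sV1 V0V1 restrict(2) bC[unfolded C_def] bu nc_def])
       (use E0(2) E(3) dj t0 t1 t2 t3 in \<open>auto simp: I'_def nc_def\<close>)
  have bR': "basis_mod W0 (row_index I' typ') (\<lambda>(i, q). w' i q) W"
    unfolding w'_def
    by (rule basis_mod_append[OF sub(3) sW1 W0W1 restrict(3) bR[unfolded R_def] by' nr_def])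
       (use E0(2) E(3) dj t0 t1 t2 t3 in \<open>auto simp: I'_def nr_def\<close>)
  have val': "bvalid (typ' i)" if "i \<in> I'" for i
    using that val[of i] E0(2) by (auto simp: I'_def typ'_def split: kblock.splits)
  have ch': "chain W0 A B (typ' i) (v' i) (w' i)" if iI': "i \<in> I'" for i
  proof -
    consider "i \<in> E0" | "i \<in> I" "i \<notin> E0" | "i \<in> E1" | "i \<in> E2" using E0(2) iI' by (auto simp: I'_def)
    then show ?thesis
    proof cases
      case 1
      have iI: "i \<in> I" using 1 E0 by auto
      have y: "y i = Y A B (u i)" using yu 1 by auto
      have u: "X A B (u i) - w i (brows (typ i) - 1) \<in> W0" using u0[OF 1] by (simp add: e_def)
      from 1 consider n where "typ i = DB \<mu> n" | n where "\<mu> = Infinity" "typ i = LTB n"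
        by (auto simp: E0_def)
      then show ?thesis
      proof cases
        case (1 n)
        have "n \<ge> 1" using val[OF iI] 1 by simp
        then show ?thesis using ch[OF iI] u y iI \<open>i \<in> E0\<close> subspace_0[OF sub(3)]
          by (auto simp: 1 typ'_def v'_def w'_def nc_def nr_def less_Suc_eq X_def Y_def)
      next
        case (2 n)
        have "n \<ge> 1" using val[OF iI] 2 by simp
        then show ?thesis using ch[OF iI] u y iI \<open>i \<in> E0\<close> subspace_0[OF sub(3)] 2(1)
          by (auto simp: 2(2) typ'_def v'_def w'_def nc_def nr_def less_Suc_eq X_def Y_def)
      qed
    next
      case 2
      have "i \<notin> E1" "i \<notin> E2" using 2 dj by auto
      then have "v' i = v i" "w' i = w i" using 2 by (auto simp: v'_def w'_def fun_eq_iff)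
      then show ?thesis using ch[OF 2(1)] t3[OF 2] by simp
    next
      case 3
      then show ?thesis using u1[OF 3] yu[of i] dj subspace_0[OF sub(3)]
        by (auto simp: typ'_def v'_def w'_def nc_def nr_def X_def Y_def)
    next
      case 4
      then show ?thesis using dj E(3) by (auto simp: typ'_def)
    qed
  qed
  have "finite I'" using fI E by (simp add: I'_def)
  then show ?thesis using bC' bR' val' ch' unfolding kronecker_basis_def by blast
qed

end

section \<open>Kernel reduction, eigenvalues, and the existence of a Kronecker basis\<close>

context complex_vector_space begin

lemma chain_LB_A: "chain U A B (LB n) v w ==> Suc q < n ==> A (v q) - w q \<in> U"
  by (auto dest: spec[of _ q])

lemma chain_LB_last: "chain U A B (LB n) v w ==> 1 \<le> n ==> A (v (n - 1)) \<in> U"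
  by (auto dest: spec[of _ "n - 1"])

lemma indep_modD: "indep_mod U I u ==> (\<Sum>i\<in>I. c i \<star> u i) \<in> U ==> i \<in> I ==> c i = 0"
  unfolding indep_mod_def by metis

lemma basis_mod_notin:
  assumes "subspace U" "basis_mod U I u V" "i \<in> I"
  shows "u i \<notin> U"
proof
  assume "u i \<in> U"
  have "(\<Sum>j\<in>I. (if j = i then 1 else 0) \<star> u j) = u i"
    using assms by (subst sum.remove[of I i]) (auto simp: basis_mod_def intro!: sum.neutral)
  with \<open>u i \<in> U\<close> have "(\<Sum>j\<in>I. (if j = i then 1 else 0) \<star> u j) \<in> U" by simp
  from indep_modD[OF _ this assms(3)] assms(2) show False by (simp add: basis_mod_def)
qed

lemma indep_mod_notin_span:
  assumes "subspace U" "finite I" "indep_mod U I u" "i \<in> I"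
  shows "u i \<notin> add_span U (I - {i}) u"
proof
  assume "u i \<in> add_span U (I - {i}) u"
  then obtain c where c: "u i - (\<Sum>j\<in>I - {i}. c j \<star> u j) \<in> U" by (auto simp: add_span_def)
  have "(\<Sum>j\<in>I. (if j = i then 1 else - c j) \<star> u j) = u i - (\<Sum>j\<in>I - {i}. c j \<star> u j)"
    using assms by (subst sum.remove[of I i]) (auto simp: sum_negf[symmetric] intro!: sum.cong)
  with c have "(\<Sum>j\<in>I. (if j = i then 1 else - c j) \<star> u j) \<in> U" by simp
  from indep_modD[OF assms(3) this assms(4)] show False by simp
qed

lemma indep_mod_image:
  assumes "indep_mod U C u" "finite C" "f ` L \<subseteq> C" "inj_on f L"
  shows "indep_mod U L (\<lambda>i. u (f i))"
  unfolding indep_mod_def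
proof (intro allI impI)
  fix c assume *: "(\<Sum>i\<in>L. c i \<star> u (f i)) \<in> U"
  define d where "d j = (if j \<in> f ` L then c (inv_into L f j) else 0)" for j
  have "(\<Sum>j\<in>C. d j \<star> u j) = (\<Sum>j\<in>f ` L. d j \<star> u j)"
    using assms(2,3) by (intro sum.mono_neutral_right) (auto simp: d_def)
  also have "\<dots> = (\<Sum>i\<in>L. c i \<star> u (f i))"
    using assms(4) by (simp add: sum.reindex d_def)
  finally have "(\<Sum>j\<in>C. d j \<star> u j) \<in> U" using * by simp
  then have d0: "\<forall>j\<in>C. d j = 0" using assms(1) by (simp add: indep_mod_def)
  show "\<forall>i\<in>L. c i = 0"
  proof
    fix i assume "i \<in> L"
    then have "d (f i) = c i" "f i \<in> C" using assms(3,4) by (auto simp: d_def)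
    then show "c i = 0" using d0 by metis
  qed
qed

lemma basis_mod_perturb:
  assumes U: "subspace U" and V: "subspace V" "U \<subseteq> V" and b: "basis_mod U I u V"
    and t: "\<And>i. i \<in> I ==> t i - u i \<in> U"
  shows "basis_mod U I t V"
proof -
  have diff: "(\<Sum>i\<in>I. c i \<star> t i) - (\<Sum>i\<in>I. c i \<star> u i) \<in> U" for c
  proof -
    have "(\<Sum>i\<in>I. c i \<star> (t i - u i)) \<in> U" using t by (intro subspace_sum subspace_scale U) auto
    then show ?thesis by (simp add: scale_right_diff_distrib sum_subtractf)
  qed
  have "t i \<in> V" if "i \<in> I" for i
    using mem_cong[OF V t[OF that]] that b by (simp add: basis_mod_def)
  moreover have "V \<subseteq> add_span U I t"
  proof
    fix x assume "x \<in> V"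
    then obtain c where "x - (\<Sum>i\<in>I. c i \<star> u i) \<in> U" using b by (auto simp: basis_mod_def add_span_def)
    from subspace_diff[OF U this diff[of c]] have "x - (\<Sum>i\<in>I. c i \<star> t i) \<in> U" by simp
    then show "x \<in> add_span U I t" by (rule add_spanI)
  qed
  moreover have "indep_mod U I t"
    unfolding indep_mod_def
  proof (intro allI impI)
    fix c assume "(\<Sum>i\<in>I. c i \<star> t i) \<in> U"
    from subspace_diff[OF U this diff[of c]] have "(\<Sum>i\<in>I. c i \<star> u i) \<in> U" by simp
    then show "\<forall>i\<in>I. c i = 0" using b by (simp add: basis_mod_def indep_mod_def)
  qed
  ultimately show ?thesis using b by (simp add: basis_mod_def)
qed

text \<open>An \<open>LB\<close> chain ends, and a Jordan chain at \<open>Infinity\<close> begins,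
  with a vector killed by \<open>A\<close>.\<close>

lemma kronecker_injective_types:
  assumes P: "pencil_on V0 V W0 W A B" and K: "kronecker_basis V0 V W0 W A B I typ v w"
    and inj: "\<And>x. x \<in> V ==> A x \<in> W0 ==> x \<in> V0" and i: "i \<in> I"
  shows "typ i \<noteq> LB n" "typ i \<noteq> DB Infinity n"
proof -
  have V0: "subspace V0" using P by (simp add: pencil_on_def)
  have b: "basis_mod V0 (col_index I typ) (\<lambda>(i, q). v i q) V" and ch: "chain W0 A B (typ i) (v i) (w i)"
    and val: "bvalid (typ i)" using K i by (auto simp: kronecker_basis_def)
  have no: False if "q < bcols (typ i)" "A (v i q) \<in> W0" for q
  proof -
    have "(i, q) \<in> col_index I typ" using that i by simp
    from basis_mod_notin[OF V0 b this] have "v i q \<notin> V0" by simp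
    moreover have "v i q \<in> V" using b that i by (auto simp: basis_mod_def)
    ultimately show False using inj that by blast
  qed
  show "typ i \<noteq> LB n"
  proof
    assume n: "typ i = LB n"
    then have "A (v i (n - 1)) \<in> W0" using ch val by (intro chain_LB_last) auto
    then show False using no[of "n - 1"] val n by simp
  qed
  show "typ i \<noteq> DB Infinity n"
  proof
    assume n: "typ i = DB Infinity n"
    then have "A (v i 0) - 0 \<in> W0" using ch val by auto
    then show False using no[of 0] val n by simp
  qed
qed

text \<open>Apply \<open>chain_A_mem\<close> with \<open>S\<close> spanned by all rows but the last
  one of the chain \<open>i\<close>: the image of \<open>A\<close> lies in \<open>S\<close> and
  misses that row.\<close>

lemma kronecker_surjective_types:
  assumes P: "pencil_on V0 V W0 W A B" and K: "kronecker_basis V0 V W0 W A B I typ v w"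
    and surj: "\<And>x. x \<in> W ==> \<exists>v\<in>V. x - A v \<in> W0" and i: "i \<in> I"
  shows "typ i \<noteq> LTB n" "typ i \<noteq> DB Infinity n"
proof -
  have sub: "subspace V0" "subspace W0" and lA: "lin_map A" and A0: "A ` V0 \<subseteq> W0"
    using P by (auto simp: pencil_on_def)
  have bV: "basis_mod V0 (col_index I typ) (\<lambda>(i, q). v i q) V"
    and bW: "basis_mod W0 (row_index I typ) (\<lambda>(i, q). w i q) W"
    and ch: "\<And>j. j \<in> I ==> chain W0 A B (typ j) (v j) (w j)"
    and val: "\<And>j. j \<in> I ==> bvalid (typ j)" using K by (auto simp: kronecker_basis_def)
  have "False" if T: "typ i = LTB n \<or> typ i = DB Infinity n"
  proof -
    define r where "r = (i, n - 1)"
    have r: "r \<in> row_index I typ" using T i val[OF i] by (auto simp: r_def)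
    define S where "S = add_span W0 (row_index I typ - {r}) (\<lambda>(i, q). w i q)"
    have fR: "finite (row_index I typ)" using bW by (simp add: basis_mod_def)
    have sS: "subspace S" and S0: "W0 \<subseteq> S"
      unfolding S_def by (rule subspace_add_span[OF sub(2)], rule add_span_superset[OF sub(2)])
    have wS: "w j p \<in> S" if "j \<in> I" "p < brows (typ j)" "(j, p) \<noteq> r" for j p
    proof -
      have "(j, p) \<in> row_index I typ - {r}" using that by auto
      from add_span_base[OF _ this sub(2), of "\<lambda>(i, q). w i q"] fR show ?thesis by (simp add: S_def)
    qed
    have zS: "0 \<in> S" using subspace_0[OF sS] .
    have AS: "A (v j q) \<in> S" if jq: "j \<in> I" "q < bcols (typ j)" for j q
      by (rule chain_A_mem[OF sS S0 ch[OF jq(1)] jq(2)]) (rule wS[OF jq(1)], use T in \<open>auto simp: r_def\<close>)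
    have "w i (n - 1) \<in> W" using bW r by (auto simp: basis_mod_def r_def)
    from surj[OF this] obtain x where x: "x \<in> V" "w i (n - 1) - A x \<in> W0" by blast
    have "x \<in> add_span V0 (col_index I typ) (\<lambda>(i, q). v i q)" using x bV by (auto simp: basis_mod_def)
    then have "A x \<in> S"
      by (rule add_span_image[OF lA sS, rotated 2]) (use A0 S0 AS in auto)
    from mem_cong[OF sS S0 x(2) this] have "(case r of (i, q) => w i q) \<in> S" by (simp add: r_def)
    moreover have "(case r of (i, q) => w i q) \<notin> S"
      unfolding S_def using bW by (intro indep_mod_notin_span[OF sub(2) fR _ r]) (simp add: basis_mod_def)
    ultimately show False by blast
  qed
  then show "typ i \<noteq> LTB n" "typ i \<noteq> DB Infinity n" by blast+
qed

text \<open>Here \<open>A\<close> is onto, and its kernel \<open>K\<close> has been factored out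
  together with \<open>B K\<close>. The quotient has only \<open>LB\<close> and finite Jordan
  chains. Their relations hold modulo \<open>B K + W0\<close> and are repaired by subtracting
  vectors of \<open>K\<close>, which \<open>A\<close> does not notice. The last
  \<open>A\<close>-image of an \<open>LB\<close> chain lies in \<open>B K + W0\<close>, so up to
  \<open>W0\<close> it is \<open>B\<close> of a kernel vector, which prolongs the chain by one.
  Kernel vectors killed by \<open>B\<close> too are new summands \<open>LB 1\<close>.\<close>

lemma kronecker_step_noninjective:
  assumes P: "pencil_on V0 V W0 W A B"
    and K: "K = {v\<in>V. A v \<in> W0}" and W1: "W1 = {x. \<exists>k\<in>K. x - B k \<in> W0}"
    and bV: "basis_mod V0 {..<dV::nat} a V"
    and surj: "\<And>x. x \<in> W ==> \<exists>v\<in>V. x - A v \<in> W0"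
    and P1: "pencil_on K V W1 W A B"
    and KB: "kronecker_basis K V W1 W A B I typ v w"
  shows "\<exists>I typ v w. kronecker_basis V0 V W0 W A B I typ v w"
proof -
  note P' = P[unfolded pencil_on_def]
  have sub: "subspace V0" "subspace V" "subspace W0" "subspace W" "W0 \<subseteq> W" "V0 \<subseteq> V" using P' by auto
  have lA: "lin_map A" and lB: "lin_map B" using P' by auto
  have AV: "A x \<in> W" "B x \<in> W" if "x \<in> V" for x using that P' by auto
  have sub1: "subspace K" "subspace W1" "K \<subseteq> V" "W1 \<subseteq> W" using P1 by (auto simp: pencil_on_def)
  have KV: "A x \<in> W1" "B x \<in> W1" if "x \<in> K" for x using that P1 by (auto simp: pencil_on_def)
  have W0W1: "W0 \<subseteq> W1"
    using subspace_0[OF sub1(1)] by (auto simp: W1 lin_map_0[OF lB] intro!: bexI[of _ 0])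
  have AK: "A x \<in> W0" if "x \<in> K" for x using that by (simp add: K)
  define C where "C = col_index I typ"
  note KB' = KB[unfolded kronecker_basis_def]
  have fI: "finite I" and bC: "basis_mod K C (\<lambda>(i, q). v i q) V"
    and bR: "basis_mod W1 (row_index I typ) (\<lambda>(i, q). w i q) W"
    and ch: "\<And>i. i \<in> I ==> chain W1 A B (typ i) (v i) (w i)"
    and val: "\<And>i. i \<in> I ==> bvalid (typ i)"
    using KB' by (auto simp: C_def)
  have fC: "finite C" using bC by (simp add: basis_mod_def)
  have surj1: "\<exists>v\<in>V. x - A v \<in> W1" if "x \<in> W" for x using surj[OF that] W0W1 by blast
  have ty: "(\<exists>n. typ i = LB n) \<or> (\<exists>c n. typ i = DB (Finite c) n)" if "i \<in> I" for i
  proof (cases "typ i")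
    case (DB l n)
    then show ?thesis using kronecker_surjective_types(2)[OF P1 KB surj1 that, of n] by (cases l) auto
  qed (use kronecker_surjective_types(1)[OF P1 KB surj1 that] in auto)
  \<comment> \<open>\<open>T i\<close> sends each vector of the chain \<open>i\<close> to the
    preceding row. On \<open>K\<close> it agrees with \<open>B\<close> modulo \<open>W0\<close>,
    which is what makes the correction by \<kappa> work.\<close>
  define T where "T i x = (case typ i of DB l n => eigX l A B x | _ => B x)" for i x
  have lT: "lin_map (T i)" for i
    using lB lin_map_eigX[OF lA lB] by (cases "typ i") (auto simp: T_def[abs_def])
  have AVw: "A (v i p) - w i p \<in> W1" if "i \<in> I" "p < brows (typ i)" for i p
    using ty[OF that(1)] ch[OF that(1)] that(2)
    by (elim disjE exE) (simp_all only: chain_LB_A less_diff_conv brows.simps Suc_eq_plus1, simp_all)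
  have err: "T i (v i q) - (if q = 0 then 0 else A (v i (q - 1))) \<in> W1" if iq: "(i, q) \<in> C" for i q
  proof -
    have iq': "i \<in> I" "q < bcols (typ i)" using iq by (auto simp: C_def)
    have 1: "T i (v i q) - (if q = 0 then 0 else w i (q - 1)) \<in> W1"
      using ty[OF iq'(1)] ch[OF iq'(1)] iq'(2) by (elim disjE exE; simp add: T_def)
    show ?thesis
    proof (cases "q = 0")
      case False
      have "A (v i (q - 1)) - w i (q - 1) \<in> W1"
        using ty[OF iq'(1)] iq'(2) False by (intro AVw iq') auto
      from subspace_diff[OF sub1(2) 1 this] False show ?thesis by simp
    qed (use 1 in simp)
  qed
  have "\<forall>j\<in>C. \<exists>k. k \<in> K \<and> (case j of (i, q) => T i (v i q) - (if q = 0 then 0 else A (v i (q - 1)))) - B k \<in> W0"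
  proof
    fix j assume j: "j \<in> C"
    obtain i q where iq: "j = (i, q)" by (cases j)
    from err[of i q] j obtain k where
      "k \<in> K" "T i (v i q) - (if q = 0 then 0 else A (v i (q - 1))) - B k \<in> W0"
      unfolding iq W1 by blast
    then show "\<exists>k. k \<in> K \<and> (case j of (i, q) => T i (v i q) - (if q = 0 then 0 else A (v i (q - 1)))) - B k \<in> W0"
      unfolding iq prod.case by blast
  qed
  from bchoice[OF this] obtain \<kappa> where \<kappa>: "\<And>i q. (i, q) \<in> C ==> \<kappa> (i, q) \<in> K"
    "\<And>i q. (i, q) \<in> C ==> T i (v i q) - (if q = 0 then 0 else A (v i (q - 1))) - B (\<kappa> (i, q)) \<in> W0"
    by fastforce
  define v1 where "v1 i q = v i q - \<kappa> (i, q)" for i q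
  have Tk: "B k - T i k \<in> W0" if "k \<in> K" "i \<in> I" for i k
    using ty[OF that(2)] subspace_scale[OF sub(3) AK[OF that(1)]] subspace_0[OF sub(3)]
    by (auto simp: T_def)
  have v1A: "A (v i q) - A (v1 i q) \<in> W0" if "(i, q) \<in> C" for i q
    using AK[OF \<kappa>(1)[OF that]] by (simp add: v1_def lin_map_diff[OF lA])
  \<comment> \<open>The rows are redefined as images under \<open>A\<close>. Since \<open>A\<close>
    induces an isomorphism of \<open>V/K\<close> onto \<open>W/W0\<close>, they form a basis of
    \<open>W\<close> modulo \<open>W0\<close> indexed by all column positions
    \<open>C\<close>.\<close>
  define w1 where "w1 i q = A (v1 i q)" for i q
  have rel: "T i (v1 i q) - (if q = 0 then 0 else w1 i (q - 1)) \<in> W0" if iq: "(i, q) \<in> C" for i q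
  proof -
    have i: "i \<in> I" using iq by (simp add: C_def)
    have "(if q = 0 then 0 else A (v i (q - 1))) - (if q = 0 then 0 else w1 i (q - 1)) \<in> W0"
      using v1A[of i "q - 1"] iq subspace_0[OF sub(3)] by (auto simp: w1_def C_def)
    with \<kappa>(2)[OF iq] Tk[OF \<kappa>(1)[OF iq] i]
    have "(T i (v i q) - (if q = 0 then 0 else A (v i (q - 1))) - B (\<kappa> (i, q)))
        + (B (\<kappa> (i, q)) - T i (\<kappa> (i, q)))
        + ((if q = 0 then 0 else A (v i (q - 1))) - (if q = 0 then 0 else w1 i (q - 1))) \<in> W0"
      by (intro subspace_add sub(3))
    then show ?thesis by (simp add: v1_def lin_map_diff[OF lT] algebra_simps split: if_splits)
  qed
  have bC1: "basis_mod K C (\<lambda>(i, q). v1 i q) V"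
    by (rule basis_mod_perturb[OF sub1(1) sub(2) sub1(3) bC])
       (use \<kappa>(1) subspace_neg[OF sub1(1)] in \<open>auto simp: v1_def\<close>)
  have v1V: "v1 i q \<in> V" if "(i, q) \<in> C" for i q
    using bC1 that by (auto simp: basis_mod_def)
  have bR1: "basis_mod W1 (row_index I typ) (\<lambda>(i, q). w1 i q) W"
  proof (rule basis_mod_perturb[OF sub1(2) sub(4) sub1(4) bR])
    fix j assume j: "j \<in> row_index I typ"
    obtain i p where ip: "j = (i, p)" "i \<in> I" "p < brows (typ i)" using j by auto
    then have "(i, p) \<in> C" using ty[OF ip(2)] by (auto simp: C_def)
    from subspace_diff[OF sub1(2) AVw[OF ip(2,3)] W0W1[THEN subsetD, OF v1A[OF this]]]
    show "(case j of (i, q) => w1 i q) - (case j of (i, p) => w i p) \<in> W1"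
      by (simp add: ip w1_def)
  qed
  have lin_sum: "A (\<Sum>j\<in>C. c j \<star> (case j of (i, q) => v1 i q)) = (\<Sum>j\<in>C. c j \<star> (case j of (i, q) => w1 i q))" for c
    by (simp add: lin_map_sum[OF lA] w1_def split_def)
  have sum_V: "(\<Sum>j\<in>C. c j \<star> (case j of (i, q) => v1 i q)) \<in> V" for c
    using v1V by (intro subspace_sum subspace_scale sub(2)) auto
  have span_W: "\<exists>c. x - (\<Sum>j\<in>C. c j \<star> (case j of (i, q) => w1 i q)) \<in> W0" if x: "x \<in> W" for x
  proof -
    obtain y where y: "y \<in> V" "x - A y \<in> W0" using surj[OF x] by blast
    obtain c where "y - (\<Sum>j\<in>C. c j \<star> (case j of (i, q) => v1 i q)) \<in> K"
      using bC1 y by (auto simp: basis_mod_def add_span_def)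
    from AK[OF this] have "A y - (\<Sum>j\<in>C. c j \<star> (case j of (i, q) => w1 i q)) \<in> W0"
      unfolding lin_map_diff[OF lA] lin_sum .
    from subspace_add[OF sub(3) y(2) this] show ?thesis by auto
  qed
  have bW: "basis_mod W0 C (\<lambda>(i, q). w1 i q) W"
    unfolding basis_mod_def
  proof (intro conjI fC ballI subsetI)
    fix j assume "j \<in> C"
    then show "(case j of (i, q) => w1 i q) \<in> W" using AV v1V by (cases j) (auto simp: w1_def)
  next
    fix x assume "x \<in> W"
    from span_W[OF this] show "x \<in> add_span W0 C (\<lambda>(i, q). w1 i q)" by (simp add: add_span_def)
  next
    show "indep_mod W0 C (\<lambda>(i, q). w1 i q)"
      unfolding indep_mod_def
    proof (intro allI impI)
      fix c assume "(\<Sum>j\<in>C. c j \<star> (case j of (i, q) => w1 i q)) \<in> W0"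
      then have "(\<Sum>j\<in>C. c j \<star> (case j of (i, q) => v1 i q)) \<in> K"
        using sum_V[of c] by (simp add: K lin_sum)
      then show "\<forall>j\<in>C. c j = 0" using bC1 by (simp add: basis_mod_def indep_mod_def)
    qed
  qed
  define L where "L = {i\<in>I. \<exists>n. typ i = LB n}"
  define f where "f i = (i, bcols (typ i) - 1)" for i
  have fL: "finite L" "inj_on f L" "f ` L \<subseteq> C" using fI val
    by (force simp: L_def f_def inj_on_def C_def)+
  \<comment> \<open>The surplus of the columns over the rows is the last position of each
    \<open>LB\<close> chain.\<close>
  have CR: "C = row_index I typ \<union> f ` L" "row_index I typ \<inter> f ` L = {}"
  proof -
    show "row_index I typ \<inter> f ` L = {}" by (auto simp: L_def f_def)
    show "C = row_index I typ \<union> f ` L"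
    proof (rule Set.set_eqI, simp only: split_paired_all)
      fix i q
      have img: "(i, q) \<in> f ` L \<longleftrightarrow> i \<in> L \<and> q = bcols (typ i) - 1" by (auto simp: f_def)
      show "(i, q) \<in> C \<longleftrightarrow> (i, q) \<in> row_index I typ \<union> f ` L"
        using ty[of i] val[of i] unfolding Un_iff img by (auto simp: C_def L_def)
    qed
  qed
  define z where "z i = (case f i of (i, q) => w1 i q)" for i
  have z1: "z i \<in> W1" if iL: "i \<in> L" for i
  proof -
    obtain n where n: "i \<in> I" "typ i = LB n" using iL by (auto simp: L_def)
    then have n1: "n \<ge> 1" using val[of i] by simp
    then have 1: "A (v i (n - 1)) \<in> W1" using ch[OF n(1)] n(2) by (intro chain_LB_last) auto
    have "(i, n - 1) \<in> C" using n n1 by (simp add: C_def)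
    from subspace_diff[OF sub1(2) 1 W0W1[THEN subsetD, OF v1A[OF this]]] show ?thesis
      by (simp add: z_def f_def n w1_def)
  qed
  have "\<forall>i\<in>L. \<exists>k. k \<in> K \<and> z i - B k \<in> W0" using z1 by (auto simp: W1)
  from bchoice[OF this] obtain kk where kk: "\<And>i. i \<in> L ==> kk i \<in> K" "\<And>i. i \<in> L ==> z i - B (kk i) \<in> W0"
    by blast
  define K0 where "K0 = {k\<in>K. B k \<in> W0}"
  have sK0: "subspace K0" unfolding K0_def by (rule subspace_preimage[OF lB sub1(1) sub(3)])
  have K0: "V0 \<subseteq> K0" "K0 \<subseteq> K" using P' by (auto simp: K0_def K)
  have Bkk: "(\<Sum>i\<in>L. c i \<star> z i) - B (\<Sum>i\<in>L. c i \<star> kk i) \<in> W0" for c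
  proof -
    have "(\<Sum>i\<in>L. c i \<star> (z i - B (kk i))) \<in> W0" using kk by (intro subspace_sum subspace_scale sub(3)) auto
    then show ?thesis by (simp add: lin_map_sum[OF lB] scale_right_diff_distrib sum_subtractf)
  qed
  have kkK: "(\<Sum>i\<in>L. c i \<star> kk i) \<in> K" for c
    using kk by (intro subspace_sum subspace_scale sub1(1)) auto
  have indz: "indep_mod W0 L z"
    using indep_mod_image[of W0 C "\<lambda>(i, q). w1 i q", OF _ fC fL(3,2)] bW
    by (simp add: basis_mod_def z_def[abs_def])
  \<comment> \<open>Expand \<open>B k\<close> in the basis \<open>w1\<close>: modulo
    \<open>W1\<close> the coefficients at the old rows vanish, so only the end rows
    \<open>z i\<close> survive, and these are \<open>B (kk i)\<close> up to
    \<open>W0\<close>.\<close>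
  have bL: "basis_mod K0 L kk K"
    unfolding basis_mod_def
  proof (intro conjI fL(1) ballI subsetI)
    show "kk i \<in> K" if "i \<in> L" for i using kk that by blast
    show "indep_mod K0 L kk"
      unfolding indep_mod_def
    proof (intro allI impI)
      fix c assume "(\<Sum>i\<in>L. c i \<star> kk i) \<in> K0"
      then have "B (\<Sum>i\<in>L. c i \<star> kk i) \<in> W0" by (simp add: K0_def)
      from subspace_add[OF sub(3) Bkk[of c] this] have "(\<Sum>i\<in>L. c i \<star> z i) \<in> W0" by simp
      then show "\<forall>i\<in>L. c i = 0" using indz by (simp add: indep_mod_def)
    qed
    fix k assume k: "k \<in> K"
    have "B k \<in> W" using k sub1(3) AV by blast
    from span_W[OF this] obtain c where
      c: "B k - (\<Sum>j\<in>C. c j \<star> (case j of (i, q) => w1 i q)) \<in> W0" by blast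
    have split: "(\<Sum>j\<in>C. c j \<star> (case j of (i, q) => w1 i q))
        = (\<Sum>j\<in>row_index I typ. c j \<star> (case j of (i, q) => w1 i q)) + (\<Sum>i\<in>L. c (f i) \<star> z i)"
      using fC fL(2) unfolding CR(1)
      by (subst sum.union_disjoint) (auto simp: CR(2) sum.reindex z_def simp del: mem_Sigma_iff)
    have "(\<Sum>i\<in>L. c (f i) \<star> z i) \<in> W1" using z1 by (intro subspace_sum subspace_scale sub1(2)) auto
    with subspace_diff[OF sub1(2) KV(2)[OF k] W0W1[THEN subsetD, OF c]]
    have "(B k - (B k - (\<Sum>j\<in>C. c j \<star> (case j of (i, q) => w1 i q)))) - (\<Sum>i\<in>L. c (f i) \<star> z i) \<in> W1"
      by (rule subspace_diff[OF sub1(2)])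
    then have "(\<Sum>j\<in>row_index I typ. c j \<star> (case j of (i, q) => w1 i q)) \<in> W1" by (simp add: split)
    then have "\<forall>j\<in>row_index I typ. c j = 0" using bR1 by (simp add: basis_mod_def indep_mod_def)
    then have "(\<Sum>j\<in>row_index I typ. c j \<star> (case j of (i, q) => w1 i q)) = 0"
      by (intro sum.neutral) auto
    with c have "B k - (\<Sum>i\<in>L. c (f i) \<star> z i) \<in> W0" by (simp add: split)
    from subspace_add[OF sub(3) this Bkk[of "\<lambda>i. c (f i)"]] have "B (k - (\<Sum>i\<in>L. c (f i) \<star> kk i)) \<in> W0"
      by (simp add: lin_map_diff[OF lB])
    then have "k - (\<Sum>i\<in>L. c (f i) \<star> kk i) \<in> K0"
      using subspace_diff[OF sub1(1) k kkK] by (simp add: K0_def)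
    then show "k \<in> add_span K0 L kk" by (rule add_spanI)
  qed
  obtain d t where t: "basis_mod V0 {..<d::nat} t K0"
    by (rule basis_mod_between[OF bV sub(1) sub(1) sK0 sub(2) order_refl K0(1)])
      (use K0 sub1 in blast)+
  obtain N where N: "I \<subseteq> {..<N}" using finite_nat_iff_bounded fI by auto
  define E where "E = {N..<N + d}"
  have IE: "I \<inter> E = {}" using N by (auto simp: E_def)
  have LI: "x \<in> I" "x \<notin> E" if "x \<in> L" for x using that IE by (auto simp: L_def)
  have IE': "x \<notin> E" if "x \<in> I" for x using that IE by auto
  define I' where "I' = I \<union> E"
  define typ' where "typ' i = (if i \<in> E then LB 1 else case typ i of LB n => LB (Suc n) | b => b)" for i
  define v' where "v' i q = (if i \<in> E then t (i - N) else if i \<in> L \<and> q = bcols (typ i) then kk i else v1 i q)" for i q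
  define g where "g i = (i, bcols (typ i))" for i
  have Ceq: "col_index I' typ' = ((\<lambda>i. (i, 0)) ` E \<union> g ` L) \<union> C"
  proof (rule Set.set_eqI, simp only: split_paired_all)
    fix i q
    have img: "(i, q) \<in> g ` L \<longleftrightarrow> i \<in> L \<and> q = bcols (typ i)" by (auto simp: g_def)
    have img': "(i, q) \<in> (\<lambda>i. (i, 0)) ` E \<longleftrightarrow> i \<in> E \<and> q = 0" by auto
    show "(i, q) \<in> col_index I' typ' \<longleftrightarrow> (i, q) \<in> ((\<lambda>i. (i, 0)) ` E \<union> g ` L) \<union> C"
      using ty[of i] IE unfolding Un_iff img img' by (auto simp: I'_def typ'_def C_def L_def)
  qed
  have Req: "row_index I' typ' = C"
  proof (rule Set.set_eqI, simp only: split_paired_all)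
    fix i q
    show "(i, q) \<in> row_index I' typ' \<longleftrightarrow> (i, q) \<in> C"
      using ty[of i] IE by (auto simp: I'_def typ'_def C_def)
  qed
  have b1: "basis_mod V0 ((\<lambda>i. (i, 0)) ` E) (\<lambda>(i, q). v' i q) K0"
  proof (rule basis_mod_reindex[OF _ t])
    show "bij_betw (\<lambda>(i, q). i - N) ((\<lambda>i. (i, 0::nat)) ` E) {..<d}"
      by (rule bij_betw_byWitness[where f'="\<lambda>i. (i + N, 0)"]) (auto simp: E_def)
  qed (auto simp: v'_def)
  have b2: "basis_mod K0 (g ` L) (\<lambda>(i, q). v' i q) K"
  proof (rule basis_mod_reindex[OF _ bL])
    show "bij_betw fst (g ` L) L"
      by (rule bij_betw_byWitness[where f'=g]) (auto simp: g_def)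
  qed (use LI IE' in \<open>auto simp: v'_def g_def\<close>)
  have b3: "basis_mod K C (\<lambda>(i, q). v' i q) V"
    by (rule basis_mod_cong[OF bC1]) (use IE' in \<open>auto simp: v'_def C_def\<close>)
  have b12: "basis_mod V0 ((\<lambda>i. (i, 0)) ` E \<union> g ` L) (\<lambda>(i, q). v' i q) K"
    by (rule basis_mod_trans[OF sub(1) sK0 K0 _ b1 b2]) (use LI IE' in \<open>auto simp: g_def\<close>)
  have bV': "basis_mod V0 (col_index I' typ') (\<lambda>(i, q). v' i q) V"
    unfolding Ceq
    by (rule basis_mod_trans[OF sub(1) sub1(1) _ sub1(3) _ b12 b3])
       (use K0 LI IE' in \<open>auto simp: g_def C_def\<close>)
  have val': "bvalid (typ' i)" if "i \<in> I'" for i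
    using that val[of i] by (auto simp: I'_def typ'_def split: kblock.splits)
  have ch': "chain W0 A B (typ' i) (v' i) (w1 i)" if iI': "i \<in> I'" for i
  proof (cases "i \<in> E")
    case True
    then have "i - N < d" by (auto simp: E_def)
    then have "t (i - N) \<in> K0" using t by (auto simp: basis_mod_def)
    then show ?thesis using True AK by (auto simp: typ'_def v'_def K0_def)
  next
    case False
    then have i: "i \<in> I" using iI' by (simp add: I'_def)
    have rel': "T i (v1 i q) - (if q = 0 then 0 else w1 i (q - 1)) \<in> W0" if "q < bcols (typ i)" for q
      using rel[of i q] that i by (simp add: C_def)
    from ty[OF i] show ?thesis
    proof (elim disjE exE)
      fix n assume n: "typ i = LB n"
      then have iL: "i \<in> L" using i by (simp add: L_def)
      have n1: "n \<ge> 1" using val[OF i] n by simp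
      have Bk: "B (kk i) - w1 i (n - 1) \<in> W0"
        using subspace_neg[OF sub(3) kk(2)[OF iL]] by (simp add: z_def f_def n)
      show ?thesis using False iL n n1 Bk AK[OF kk(1)[OF iL]] rel' subspace_0[OF sub(3)]
        by (auto simp: typ'_def v'_def less_Suc_eq T_def w1_def)
    next
      fix c n assume n: "typ i = DB (Finite c) n"
      then have iL: "i \<notin> L" by (simp add: L_def)
      show ?thesis using False iL n rel' subspace_0[OF sub(3)]
        by (auto simp: typ'_def v'_def T_def w1_def)
    qed
  qed
  have "finite I'" using fI by (simp add: I'_def E_def)
  then show ?thesis using bV' bW val' ch' Req unfolding kronecker_basis_def by metis
qed

end

text \<open>A root of the characteristic polynomial of the transpose. The index \<open>k\<close>
  records a nonzero coordinate, which later names a vector outside an image.\<close>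

lemma left_eigenvector_exists:
  fixes t :: "nat => nat => complex"
  assumes "0 < d"
  shows "\<exists>c \<mu> k. k < d \<and> c k \<noteq> 0 \<and> (\<forall>j<d. (\<Sum>i<d. c i * t i j) = \<mu> * c j)"
proof -
  define M where "M = mat d d (\<lambda>(j, i). t i j)"
  have M: "M \<in> carrier_mat d d" by (simp add: M_def)
  have "degree (char_poly M) = d" using degree_monic_char_poly[OF M] by simp
  then have "\<not> constant (poly (char_poly M))" using assms by (simp add: constant_degree)
  then obtain \<mu> where "poly (char_poly M) \<mu> = 0" using fundamental_theorem_of_algebra by blast
  then have "eigenvalue M \<mu>" by (simp add: eigenvalue_root_char_poly[OF M])
  then obtain v where v: "v \<in> carrier_vec d" "v \<noteq> 0\<^sub>v d" "M *\<^sub>v v = \<mu> \<cdot>\<^sub>v v"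
    using M by (auto simp: eigenvalue_def eigenvector_def)
  have "\<exists>k<d. v $ k \<noteq> 0" using v(1,2) by (metis carrier_vecD eq_vecI index_zero_vec)
  then obtain k where k: "k < d" "v $ k \<noteq> 0" by blast
  have "(\<Sum>i<d. v $ i * t i j) = \<mu> * v $ j" if "j < d" for j
  proof -
    have "(M *\<^sub>v v) $ j = (\<Sum>i<d. v $ i * t i j)"
      using that v(1) by (simp add: M_def scalar_prod_def lessThan_atLeast0 mult.commute)
    also have "(M *\<^sub>v v) $ j = \<mu> * v $ j" using v that by simp
    finally show ?thesis by simp
  qed
  with k show ?thesis by (intro exI[of _ "\<lambda>i. v $ i"] exI[of _ \<mu>] exI[of _ k]) auto
qed

context complex_vector_space begin

text \<open>As \<open>A\<close> is bijective, \<open>t\<close> is the matrix of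
  \<open>A^-1 B\<close>. A left eigenvector \<open>c\<close> for \<mu> is a functional that
  annihilates the image of \<open>B - \<mu> A\<close>, while its value on \<open>A (u k)\<close> is
  \<open>c k \<noteq> 0\<close>.\<close>

lemma eigenvalue_not_surjective:
  assumes P: "pencil_on V0 V W0 W A B" and b: "basis_mod V0 {..<d::nat} u V" and d: "0 < d"
    and inj: "\<And>x. x \<in> V ==> A x \<in> W0 ==> x \<in> V0"
    and surj: "\<And>x. x \<in> W ==> \<exists>v\<in>V. x - A v \<in> W0"
  shows "\<exists>c. {x. \<exists>v\<in>V. x - (B v - c \<star> A v) \<in> W0} \<noteq> W"
proof -
  note P' = P[unfolded pencil_on_def]
  have sub: "subspace V0" "subspace V" "subspace W0" "subspace W" using P' by auto
  have lA: "lin_map A" and lB: "lin_map B" and A0: "A ` V0 \<subseteq> W0" and B0: "B ` V0 \<subseteq> W0" using P' by auto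
  have uV: "u j \<in> V" if "j < d" for j using b that by (simp add: basis_mod_def)
  have "\<forall>j\<in>{..<d}. \<exists>t. B (u j) - (\<Sum>i<d. t i \<star> A (u i)) \<in> W0"
  proof
    fix j assume "j \<in> {..<d}"
    then have "B (u j) \<in> W" using uV P' by auto
    from surj[OF this] obtain x where x: "x \<in> V" "B (u j) - A x \<in> W0" by blast
    obtain t where "x - (\<Sum>i<d. t i \<star> u i) \<in> V0" using x b by (auto simp: basis_mod_def add_span_def)
    then have "A (x - (\<Sum>i<d. t i \<star> u i)) \<in> W0" using A0 by blast
    from subspace_add[OF sub(3) x(2) this] have "B (u j) - (\<Sum>i<d. t i \<star> A (u i)) \<in> W0"
      by (simp add: lin_map_diff[OF lA] lin_map_sum[OF lA])
    then show "\<exists>t. B (u j) - (\<Sum>i<d. t i \<star> A (u i)) \<in> W0" by blast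
  qed
  from bchoice[OF this] obtain t where
    t: "\<And>j. j < d ==> B (u j) - (\<Sum>i<d. t j i \<star> A (u i)) \<in> W0" by auto
  from left_eigenvector_exists[OF d, of "\<lambda>i j. t j i"] obtain c \<mu> k where
    c: "k < d" "c k \<noteq> 0" "\<forall>j<d. (\<Sum>i<d. c i * t j i) = \<mu> * c j" by (elim exE conjE)
  have "A (u k) \<notin> {x. \<exists>v\<in>V. x - (B v - \<mu> \<star> A v) \<in> W0}"
  proof
    assume "A (u k) \<in> {x. \<exists>v\<in>V. x - (B v - \<mu> \<star> A v) \<in> W0}"
    then obtain v where v: "v \<in> V" "A (u k) - (B v - \<mu> \<star> A v) \<in> W0" by blast
    obtain y where y: "v - (\<Sum>j<d. y j \<star> u j) \<in> V0" using v b by (auto simp: basis_mod_def add_span_def)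
    then have y0: "A (v - (\<Sum>j<d. y j \<star> u j)) \<in> W0" "B (v - (\<Sum>j<d. y j \<star> u j)) \<in> W0" using A0 B0 by auto
    have "(\<Sum>j<d. y j \<star> (B (u j) - (\<Sum>i<d. t j i \<star> A (u i)))) \<in> W0"
      using t by (intro subspace_sum subspace_scale sub(3)) auto
    then have "(A (u k) - (B v - \<mu> \<star> A v)) + B (v - (\<Sum>j<d. y j \<star> u j))
       + (\<Sum>j<d. y j \<star> (B (u j) - (\<Sum>i<d. t j i \<star> A (u i)))) - \<mu> \<star> A (v - (\<Sum>j<d. y j \<star> u j)) \<in> W0"
      by (intro subspace_diff[OF sub(3) subspace_add[OF sub(3) subspace_add[OF sub(3) v(2) y0(2)]]
            subspace_scale[OF sub(3) y0(1)]])
    moreover have "(\<Sum>j<d. y j \<star> (\<Sum>i<d. t j i \<star> A (u i))) = (\<Sum>i<d. (\<Sum>j<d. y j * t j i) \<star> A (u i))"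
      by (simp add: scale_sum_right scale_sum_left) (rule sum.swap)
    ultimately have *: "A (u k) + (\<Sum>i<d. (\<mu> * y i - (\<Sum>j<d. y j * t j i)) \<star> A (u i)) \<in> W0"
      by (simp add: lin_map_diff[OF lA] lin_map_diff[OF lB] lin_map_sum[OF lA] lin_map_sum[OF lB]
        scale_right_diff_distrib sum_subtractf scale_left_diff_distrib scale_sum_right algebra_simps)
    \<comment> \<open>The coordinates of the combination that lies in \<open>W0\<close>. Injectivity
      of \<open>A\<close> makes them zero, and pairing them with \<open>c\<close> leaves
      \<open>c k = 0\<close>.\<close>
    define z where "z i = (if i = k then 1 else 0) + (\<mu> * y i - (\<Sum>j<d. y j * t j i))" for i
    have "(\<Sum>i<d. (if i = k then 1 else 0) \<star> A (u i)) = A (u k)"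
      using c(1) by (subst sum.remove[of _ k]) (auto intro!: sum.neutral)
    then have "(\<Sum>i<d. z i \<star> A (u i)) \<in> W0" using * by (simp add: z_def scale_left_distrib sum.distrib)
    then have "A (\<Sum>i<d. z i \<star> u i) \<in> W0" by (simp add: lin_map_sum[OF lA])
    then have "(\<Sum>i<d. z i \<star> u i) \<in> V0"
      using uV by (intro inj subspace_sum subspace_scale sub(2)) auto
    then have z0: "z i = 0" if "i < d" for i
      using b that by (auto simp: basis_mod_def indep_mod_def)
    have "0 = (\<Sum>i<d. c i * z i)" using z0 by simp
    also have "\<dots> = (\<Sum>i<d. c i * (if i = k then 1 else 0)) + \<mu> * (\<Sum>i<d. c i * y i)
        - (\<Sum>i<d. c i * (\<Sum>j<d. y j * t j i))"
      by (simp add: z_def algebra_simps sum.distrib sum_subtractf sum_distrib_left)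
    also have "(\<Sum>i<d. c i * (\<Sum>j<d. y j * t j i)) = (\<Sum>j<d. y j * (\<Sum>i<d. c i * t j i))"
      by (simp add: sum_distrib_left mult_ac) (rule sum.swap)
    also have "\<dots> = \<mu> * (\<Sum>i<d. c i * y i)"
      using c(3) by (simp add: sum_distrib_left mult_ac)
    also have "(\<Sum>i<d. c i * (if i = k then 1 else 0)) = c k" using c(1) by (simp add: if_distrib sum.delta cong: if_cong)
    finally show False using c(2) by simp
  qed
  moreover have "A (u k) \<in> W" using uV[OF c(1)] P' by auto
  ultimately show ?thesis by blast
qed

text \<open>Induction on the sum of the two dimensions. If \<open>A\<close> is not onto, restrict to
  its image, which is the step at \<open>Infinity\<close>; if it is onto with a kernel, factor the
  kernel out; if it is bijective, restrict to the image of \<open>B - c A\<close> for an eigenvalue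
  \<open>c\<close>. The last restriction keeps \<open>A\<close> bijective, so only finite Jordan
  chains occur there, as \<open>kronecker_step\<close> requires.\<close>

theorem kronecker_basis_exists:
  fixes dV dW :: nat
  assumes "pencil_on V0 V W0 W A B" "basis_mod V0 {..<dV} a V" "basis_mod W0 {..<dW} b W"
  shows "\<exists>I typ v w. kronecker_basis V0 V W0 W A B I typ v w"
  using assms
proof (induction "dV + dW" arbitrary: V0 V W0 W dV dW a b rule: less_induct)
  case less
  note P = less.prems(1)
  note P' = P[unfolded pencil_on_def]
  have sub: "subspace V0" "subspace V" "subspace W0" "subspace W" "V0 \<subseteq> V" "W0 \<subseteq> W" using P' by auto
  have lA: "lin_map A" and lB: "lin_map B" using P' by auto
  have IH: "\<exists>I typ v w. kronecker_basis V1 V2 W1 W2 A B I typ v w"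
    if P1: "pencil_on V1 V2 W1 W2 A B" and s: "V0 \<subseteq> V1" "V2 \<subseteq> V" "W0 \<subseteq> W1" "W2 \<subseteq> W"
      and ne: "V0 \<noteq> V1 \<or> V2 \<noteq> V \<or> W0 \<noteq> W1 \<or> W2 \<noteq> W" for V1 V2 W1 W2
  proof -
    have s1: "subspace V1" "subspace V2" "subspace W1" "subspace W2" "V1 \<subseteq> V2" "W1 \<subseteq> W2"
      using P1 by (auto simp: pencil_on_def)
    obtain e t where e: "basis_mod V1 {..<e::nat} t V2" "e \<le> dV" "V1 \<noteq> V0 \<or> V2 \<noteq> V ==> e < dV"
      using basis_mod_between[OF less.prems(2) sub(1) s1(1,2) sub(2) s(1) s1(5) s(2)] by metis
    obtain e' t' where e': "basis_mod W1 {..<e'::nat} t' W2" "e' \<le> dW" "W1 \<noteq> W0 \<or> W2 \<noteq> W ==> e' < dW"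
      using basis_mod_between[OF less.prems(3) sub(3) s1(3,4) sub(4) s(3) s1(6) s(4)] by metis
    have "e + e' < dV + dW" using e(2,3) e'(2,3) ne by (cases "V1 \<noteq> V0 \<or> V2 \<noteq> V") auto
    from less.hyps[OF this P1 e(1) e'(1)] show ?thesis .
  qed
  define W1 where "W1 = {x. \<exists>v\<in>V. x - A v \<in> W0}"
  define K where "K = {v\<in>V. A v \<in> W0}"
  show ?case
  proof (cases "W1 = W")
    case False
    define V1 where "V1 = {v\<in>V. B v \<in> W1}"
    have W1: "W1 = {x. \<exists>v\<in>V. x - eigX Infinity A B v \<in> W0}" by (simp add: W1_def)
    have V1: "V1 = {v\<in>V. eigY Infinity A B v \<in> W1}" by (simp add: V1_def)
    note R = pencil_on_restrict[OF P W1 V1]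
    obtain I ty v w where "kronecker_basis V0 V1 W0 W1 A B I ty v w"
      using IH[OF R(1) _ R(2) _ R(3)] False by blast
    from kronecker_step[OF P W1 V1 less.prems(2,3) this] show ?thesis by simp
  next
    case True
    have surj: "\<exists>v\<in>V. x - A v \<in> W0" if "x \<in> W" for x using that True by (auto simp: W1_def)
    show ?thesis
    proof (cases "K = V0")
      case False
      define W2 where "W2 = {x. \<exists>k\<in>K. x - B k \<in> W0}"
      have sK: "subspace K" unfolding K_def by (rule subspace_preimage[OF lA sub(2,3)])
      have sW2: "subspace W2" unfolding W2_def by (rule subspace_image_sum[OF lB sK sub(3)])
      have W0W2: "W0 \<subseteq> W2"
        using subspace_0[OF sK] by (auto simp: W2_def lin_map_0[OF lB] intro!: bexI[of _ 0])
      have V0K: "V0 \<subseteq> K" using P' by (auto simp: K_def)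
      have W2W: "W2 \<subseteq> W"
      proof
        fix x assume "x \<in> W2"
        then obtain k where "k \<in> K" "x - B k \<in> W0" by (auto simp: W2_def)
        moreover from this have "B k \<in> W" using P' by (auto simp: K_def)
        ultimately show "x \<in> W" using sub mem_cong by blast
      qed
      have "B k \<in> W2" if "k \<in> K" for k
        using that subspace_0[OF sub(3)] by (auto simp: W2_def intro!: bexI[of _ k])
      then have P1: "pencil_on K V W2 W A B"
        unfolding pencil_on_def using P' sK sW2 W2W W0W2 by (auto simp: K_def)
      obtain I ty v w where "kronecker_basis K V W2 W A B I ty v w"
        using IH[OF P1 V0K order_refl W0W2 order_refl] False by blast
      from kronecker_step_noninjective[OF P K_def W2_def less.prems(2) surj P1 this] show ?thesis .
    next
      case KV0: True
      have inj: "x \<in> V0" if "x \<in> V" "A x \<in> W0" for x using that KV0 by (auto simp: K_def)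
      show ?thesis
      proof (cases "dV = 0")
        case True
        then have V: "V = V0" using less.prems(2) sub(5) by (auto simp: basis_mod_def add_span_def)
        have "W = W0"
        proof
          show "W \<subseteq> W0"
          proof
            fix x assume "x \<in> W"
            then obtain v where v: "v \<in> V" "x - A v \<in> W0" using surj by blast
            then have "A v \<in> W0" using P' V by auto
            with v(2) show "x \<in> W0" using mem_cong[OF sub(3) order_refl] by blast
          qed
        qed (use sub in blast)
        with V have "kronecker_basis V0 V W0 W A B {} (\<lambda>_. LB 1) (\<lambda>_ _. 0) (\<lambda>_ _. 0)"
          by (auto simp: kronecker_basis_def basis_mod_def indep_mod_def add_span_def)
        then show ?thesis by blast
      next
        case False
        then obtain c where c: "{x. \<exists>v\<in>V. x - (B v - c \<star> A v) \<in> W0} \<noteq> W"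
          using eigenvalue_not_surjective[OF P less.prems(2) _ inj surj] by auto
        define W2 where "W2 = {x. \<exists>v\<in>V. x - eigX (Finite c) A B v \<in> W0}"
        define V2 where "V2 = {v\<in>V. eigY (Finite c) A B v \<in> W2}"
        have "W2 \<noteq> W" using c by (simp add: W2_def)
        note R = pencil_on_restrict[OF P W2_def V2_def]
        obtain I ty v w where KB: "kronecker_basis V0 V2 W0 W2 A B I ty v w"
          using IH[OF R(1) _ R(2) _ R(3)] \<open>W2 \<noteq> W\<close> by blast
        have inj2: "x \<in> V0" if "x \<in> V2" "A x \<in> W0" for x using that inj R(2) by blast
        have surj2: "\<exists>v\<in>V2. x - A v \<in> W0" if x: "x \<in> W2" for x
        proof -
          have "x \<in> W" using x R(3) by blast
          from surj[OF this] obtain v where v: "v \<in> V" "x - A v \<in> W0" by blast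
          have sW2: "subspace W2" and W0W2: "W0 \<subseteq> W2" using R(1) by (auto simp: pencil_on_def)
          have "x - (x - A v) \<in> W2" using subspace_diff[OF sW2 x] W0W2 v(2) by blast
          then have "v \<in> V2" using v by (simp add: V2_def)
          then show ?thesis using v by blast
        qed
        have "\<exists>d n. ty i = DB (Finite d) n" if "i \<in> I" for i
        proof (cases "ty i")
          case (DB l n)
          then show ?thesis
            using kronecker_injective_types(2)[OF R(1) KB inj2 that, of n] by (cases l) auto
        qed (use kronecker_injective_types(1)[OF R(1) KB inj2 that]
            kronecker_surjective_types(1)[OF R(1) KB surj2 that] in auto)
        with kronecker_step[OF P W2_def V2_def less.prems(2,3) KB] show ?thesis by blast
      qed
    qed
  qed
qed

end

section \<open>Explicit new chains for perturbed pairs of blocks\<close>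

context complex_vector_space begin

text \<open>Equality of spans, tested on subspaces: in this form it is transitive at once and
  transports membership in any subspace.\<close>

definition same_span :: "nat => (nat => 'b) => (nat => 'b) => bool" where
  "same_span n u t \<longleftrightarrow> (\<forall>S. subspace S \<longrightarrow> (\<forall>q<n. u q \<in> S) \<longleftrightarrow> (\<forall>q<n. t q \<in> S))"

lemma same_span_refl: "same_span n u u"
  by (simp add: same_span_def)

lemma same_span_trans: "same_span n u t ==> same_span n t s ==> same_span n u s"
  by (simp add: same_span_def)

lemma same_span_rev: "same_span n u (\<lambda>q. u (n - 1 - q))"
proof -
  have "(\<forall>q<n. u q \<in> S) \<longleftrightarrow> (\<forall>q<n. u (n - 1 - q) \<in> S)" for S
  proof
    assume *: "\<forall>q<n. u (n - 1 - q) \<in> S"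
    show "\<forall>q<n. u q \<in> S"
    proof (intro allI impI)
      fix q assume "q < n"
      then show "u q \<in> S" using *[rule_format, of "n - 1 - q"] by simp
    qed
  qed auto
  then show ?thesis by (simp add: same_span_def)
qed

text \<open>Changing the parameter of a chain: the matrix \<open>(j choose q) c\<^bsup>j - q\<^esup>\<close> expresses the powers
  of \<open>x + c\<close> through those of \<open>x\<close>.\<close>

definition shift :: "complex => nat => nat => complex" where
  "shift c j q = of_nat (j choose q) * c ^ (j - q)"

lemma shift_diag [simp]: "shift c q q = 1"
  by (simp add: shift_def)

lemma shift_less [simp]: "j < q ==> shift c j q = 0"
  by (simp add: shift_def)

lemma shift_Suc: "shift c (Suc j) (Suc q) = c * shift c j (Suc q) + shift c j q"
proof (cases "q < j")
  case True
  then have "j - q = Suc (j - Suc q)" by simp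
  then show ?thesis by (simp add: shift_def algebra_simps)
qed (cases "q = j"; simp add: shift_def)

lemma shift_Suc_0: "shift c (Suc j) 0 = c * shift c j 0"
  by (simp add: shift_def)

definition upper_shift :: "complex => nat => (nat => 'b) => nat => 'b" where
  "upper_shift c n u q = (\<Sum>j<n. shift c j q \<star> u j)"

text \<open>The matrix \<open>shift\<close> is unitriangular, so the old vectors are recovered from
  the largest index downwards.\<close>

lemma same_span_upper: "same_span n u (upper_shift c n u)"
  unfolding same_span_def
proof (intro allI impI iffI)
  fix S q assume S: "subspace S" and "\<forall>q<n. u q \<in> S" "q < n"
  then show "upper_shift c n u q \<in> S" unfolding upper_shift_def
    by (intro subspace_sum subspace_scale) auto
next
  fix S q assume S: "subspace S" and *: "\<forall>q<n. upper_shift c n u q \<in> S" and "q < n"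
  from \<open>q < n\<close> show "u q \<in> S"
  proof (induction "n - q" arbitrary: q rule: less_induct)
    case less
    have "upper_shift c n u q = (\<Sum>j\<in>{q} \<union> {q<..<n}. shift c j q \<star> u j)"
      unfolding upper_shift_def using less.prems by (intro sum.mono_neutral_right) auto
    also have "\<dots> = u q + (\<Sum>j\<in>{q<..<n}. shift c j q \<star> u j)" by (subst sum.union_disjoint) auto
    finally have "upper_shift c n u q = u q + (\<Sum>j\<in>{q<..<n}. shift c j q \<star> u j)" .
    moreover have "(\<Sum>j\<in>{q<..<n}. shift c j q \<star> u j) \<in> S"
      using less by (intro subspace_sum subspace_scale S) auto
    moreover have "upper_shift c n u q \<in> S" using * less.prems by blast
    ultimately have "u q + (\<Sum>j\<in>{q<..<n}. shift c j q \<star> u j) - (\<Sum>j\<in>{q<..<n}. shift c j q \<star> u j) \<in> S"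
      using subspace_diff[OF S] by metis
    then show ?case by simp
  qed
qed

text \<open>\<open>L_n\<close> has no eigenvalue: replacing \<open>B\<close> by
  \<open>B - c A\<close> gives the same block in another basis. Pascal's rule
  \<open>shift_Suc\<close> is exactly the relation needed for \<open>B\<close>.\<close>

lemma LB_shift:
  assumes A: "lin_map A" and B: "lin_map B" and ch: "chain {0} A B (LB n) v w"
  shows "chain {0} A (\<lambda>x. B x - c \<star> A x) (LB n) (upper_shift c n v) (upper_shift c (n - 1) w)"
proof (cases n)
  case (Suc n')
  have a: "A (v j) = (if j < n' then w j else 0)" "B (v j) = (if j = 0 then 0 else w (j - 1))" if "j \<le> n'" for j
    using ch that by (auto simp: Suc)
  have Av: "A (upper_shift c n v q) = upper_shift c n' w q" for q
  proof -
    have "A (upper_shift c n v q) = (\<Sum>j<Suc n'. shift c j q \<star> (if j < n' then w j else 0))"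
      unfolding upper_shift_def lin_map_sum[OF A] Suc using a by (intro sum.cong) auto
    then show ?thesis by (simp add: upper_shift_def)
  qed
  have Bv: "B (upper_shift c n v q) = (\<Sum>j<n'. shift c (Suc j) q \<star> w j)" for q
  proof -
    have "B (upper_shift c n v q) = (\<Sum>j<Suc n'. shift c j q \<star> (if j = 0 then 0 else w (j - 1)))"
      unfolding upper_shift_def lin_map_sum[OF B] Suc using a by (intro sum.cong) auto
    then show ?thesis by (subst (asm) sum.lessThan_Suc_shift) simp
  qed
  have last: "upper_shift c n' w n' = 0" unfolding upper_shift_def by (intro sum.neutral) auto
  have D: "B (upper_shift c n v q) - c \<star> A (upper_shift c n v q) = (if q = 0 then 0 else upper_shift c n' w (q - 1))" for q
  proof (cases q)
    case 0
    then show ?thesis unfolding Av Bv by (simp add: upper_shift_def shift_Suc_0 scale_sum_right)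
  next
    case (Suc r)
    then show ?thesis unfolding Av Bv
      by (simp add: upper_shift_def shift_Suc scale_sum_right scale_left_distrib sum.distrib)
  qed
  show ?thesis using Av D last by (auto simp: Suc less_Suc_eq)
qed simp

lemma LB_reverse:
  assumes "chain {0} A B (LB n) v w"
  shows "chain {0} B A (LB n) (\<lambda>q. v (n - 1 - q)) (\<lambda>q. w (n - 1 - 1 - q))"
proof -
  have a: "A (v i) = (if Suc i < n then w i else 0)" "B (v i) = (if i = 0 then 0 else w (i - 1))" if "i < n" for i
    using assms that by auto
  have "B (v (n - 1 - q)) = (if Suc q < n then w (n - 1 - 1 - q) else 0)"
    "A (v (n - 1 - q)) = (if q = 0 then 0 else w (n - 1 - 1 - (q - 1)))" if "q < n" for q
  proof -
    have "n - 1 - q < n" using that by simp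
    from a[OF this] show "B (v (n - 1 - q)) = (if Suc q < n then w (n - 1 - 1 - q) else 0)"
      "A (v (n - 1 - q)) = (if q = 0 then 0 else w (n - 1 - 1 - (q - 1)))"
      using that by (auto simp: diff_commute)
  qed
  then show ?thesis by auto
qed

lemma eig_Finite: "eigX (Finite c) A B = (\<lambda>x. B x - c \<star> A x)" "eigY (Finite c) A B = A"
  and eig_Infinity: "eigX Infinity A B = A" "eigY Infinity A B = B"
  by (auto simp: fun_eq_iff)

lemma eig_shift:
  "(\<lambda>x. B x + (- c) \<star> A x) = (\<lambda>x. B x - c \<star> A x)"
  "(\<lambda>x. B x - c \<star> A x + c \<star> A x) = B" "(\<lambda>x. B x - c \<star> A x - (- c) \<star> A x) = B"
  by (auto simp: fun_eq_iff)

text \<open>Rewrites an \<open>LB\<close> chain of \<open>(A, B)\<close> as one of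
  \<open>(eigX, eigY)\<close>, so that it can be joined to a Jordan chain at \<mu>. The position
  where \<open>Z\<close> is nonzero is chosen so that it becomes the last one: for finite \<mu> the
  shift keeps \<open>Z\<close> concentrated at 0, and the reversal takes 0 to the end.\<close>

lemma LB_twist:
  assumes A: "lin_map A" and B: "lin_map B" and ch: "chain {0} A B (LB n) v w"
    and Z: "lin_map Z" "\<And>q. q < n ==> Z (v q) = (if q = (if \<mu> = Infinity then n - 1 else 0) then z else 0)"
  obtains v' w' where "chain {0} (eigX \<mu> A B) (eigY \<mu> A B) (LB n) v' w'"
    "same_span n v v'" "same_span (n - 1) w w'"
    "\<And>q. q < n ==> Z (v' q) = (if q = n - 1 then z else 0)"
proof (cases \<mu>)
  case (Finite c)
  from LB_reverse[OF LB_shift[OF A B ch, of c]]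
  have ch': "chain {0} (eigX \<mu> A B) (eigY \<mu> A B) (LB n) (\<lambda>q. upper_shift c n v (n - 1 - q))
     (\<lambda>q. upper_shift c (n - 1) w (n - 1 - 1 - q))" unfolding Finite eig_Finite .
  have "Z (upper_shift c n v q) = (if q = 0 then z else 0)" if "q < n" for q
  proof -
    have "Z (upper_shift c n v q) = (\<Sum>j<n. if j = 0 then shift c 0 q \<star> z else 0)"
      unfolding upper_shift_def lin_map_sum[OF Z(1)] using Z(2) Finite by (intro sum.cong) auto
    also have "\<dots> = (if q = 0 then z else 0)" using that by (cases "q = 0") auto
    finally show ?thesis .
  qed
  then show ?thesis
    by (intro that[OF ch' same_span_trans[OF same_span_upper same_span_rev]
          same_span_trans[OF same_span_upper same_span_rev]]) auto
next
  case Infinity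
  then show ?thesis using ch Z by (intro that[of v w]) (auto simp: eig_Infinity same_span_refl)
qed

lemma LB_untwist:
  assumes A: "lin_map A" and B: "lin_map B"
    and ch: "chain {0} (eigX \<mu> A B) (eigY \<mu> A B) (LB n) v w"
  obtains v' w' where "chain {0} A B (LB n) v' w'" "same_span n v v'" "same_span (n - 1) w w'"
proof (cases \<mu>)
  case (Finite c)
  have X: "lin_map (\<lambda>x. B x - c \<star> A x)" using lin_map_eigX[OF A B, of "Finite c"] by (simp add: eig_Finite)
  have "chain {0} A (\<lambda>x. B x - c \<star> A x) (LB n) (\<lambda>q. v (n - 1 - q)) (\<lambda>q. w (n - 1 - 1 - q))"
    using LB_reverse[OF ch] unfolding Finite eig_Finite .
  from LB_shift[OF A X this, of "- c"]
  have "chain {0} A B (LB n) (upper_shift (- c) n (\<lambda>q. v (n - 1 - q))) (upper_shift (- c) (n - 1) (\<lambda>q. w (n - 1 - 1 - q)))"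
    unfolding eig_shift .
  then show ?thesis
    by (rule that) (rule same_span_trans[OF same_span_rev same_span_upper])+
next
  case Infinity
  then show ?thesis using ch by (intro that[of v w]) (auto simp: eig_Infinity same_span_refl)
qed

end

context complex_vector_space begin

text \<open>The perturbation \<open>Z\<close> is put into that matrix of the pair for which
  \<open>eigX\<close> changes by \<open>Z\<close> and \<open>eigY\<close> stays the same, see
  \<open>eig_add\<close>.\<close>

fun addA :: "ext_complex => ('b => 'b) => ('b => 'b) => 'b => 'b" where
  "addA (Finite \<mu>) A Z x = A x" | "addA Infinity A Z x = A x + Z x"

fun addB :: "ext_complex => ('b => 'b) => ('b => 'b) => 'b => 'b" where
  "addB (Finite \<mu>) B Z x = B x + Z x" | "addB Infinity B Z x = B x"

lemma eig_add: "eigX \<mu> (addA \<mu> A Z) (addB \<mu> B Z) x = eigX \<mu> A B x + Z x"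
  "eigY \<mu> (addA \<mu> A Z) (addB \<mu> B Z) x = eigY \<mu> A B x"
  by (cases \<mu>; simp)+

lemma lin_map_addA: "lin_map A ==> lin_map Z ==> lin_map (addA \<mu> A Z)"
  and lin_map_addB: "lin_map B ==> lin_map Z ==> lin_map (addB \<mu> B Z)"
  by (cases \<mu>; simp add: lin_map_def algebra_simps scale_right_distrib)+

text \<open>The common conclusion of the moves: new chains of types \<open>c1\<close> and
  \<open>c2\<close> that span the same columns and the same rows as the two old families. With equal
  numbers of vectors this makes them a frame.\<close>

definition rechain where
  "rechain A B b1 v w b2 v' w' c1 c2 \<longleftrightarrow> (\<exists>V1 W1 V2 W2.
     chain {0} A B c1 V1 W1 \<and> chain {0} A B c2 V2 W2 \<and>
     (\<forall>S. subspace S \<longrightarrow> ((\<forall>q<bcols b1. v q \<in> S) \<and> (\<forall>q<bcols b2. v' q \<in> S)) =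
         ((\<forall>q<bcols c1. V1 q \<in> S) \<and> (\<forall>q<bcols c2. V2 q \<in> S))) \<and>
     (\<forall>S. subspace S \<longrightarrow> ((\<forall>q<brows b1. w q \<in> S) \<and> (\<forall>q<brows b2. w' q \<in> S)) =
         ((\<forall>q<brows c1. W1 q \<in> S) \<and> (\<forall>q<brows c2. W2 q \<in> S))))"

lemma rechainI:
  assumes "chain {0} A B c1 V1 W1" "chain {0} A B c2 V2 W2"
    and "\<And>S q. subspace S ==> (\<And>q. q < bcols b1 ==> v q \<in> S) ==> (\<And>q. q < bcols b2 ==> v' q \<in> S) ==>
      (q < bcols c1 \<longrightarrow> V1 q \<in> S) \<and> (q < bcols c2 \<longrightarrow> V2 q \<in> S)"
    and "\<And>S q. subspace S ==> (\<And>q. q < bcols c1 ==> V1 q \<in> S) ==> (\<And>q. q < bcols c2 ==> V2 q \<in> S) ==>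
      (q < bcols b1 \<longrightarrow> v q \<in> S) \<and> (q < bcols b2 \<longrightarrow> v' q \<in> S)"
    and "\<And>S q. subspace S ==> (\<And>q. q < brows b1 ==> w q \<in> S) ==> (\<And>q. q < brows b2 ==> w' q \<in> S) ==>
      (q < brows c1 \<longrightarrow> W1 q \<in> S) \<and> (q < brows c2 \<longrightarrow> W2 q \<in> S)"
    and "\<And>S q. subspace S ==> (\<And>q. q < brows c1 ==> W1 q \<in> S) ==> (\<And>q. q < brows c2 ==> W2 q \<in> S) ==>
      (q < brows b1 \<longrightarrow> w q \<in> S) \<and> (q < brows b2 \<longrightarrow> w' q \<in> S)"
  shows "rechain A B b1 v w b2 v' w' c1 c2"
  unfolding rechain_def
  by (intro exI[of _ V1] exI[of _ W1] exI[of _ V2] exI[of _ W2] conjI assms(1,2) allI impI iffI)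
     (use assms(3-6) in blast)+

lemma chain_LB_D: "chain {0} A B (LB n) v w ==> q < n ==>
    A (v q) = (if Suc q < n then w q else 0) \<and> B (v q) = (if q = 0 then 0 else w (q - 1))"
  by auto

lemma chain_DB_D: "chain {0} A B (DB \<mu> n) v w ==> q < n ==>
    eigX \<mu> A B (v q) = (if q = 0 then 0 else w (q - 1)) \<and> eigY \<mu> A B (v q) = w q"
  by auto

lemma chain_LB_I: "(\<And>q. q < n ==> A (v q) = (if Suc q < n then w q else 0)) ==>
   (\<And>q. q < n ==> B (v q) = (if q = 0 then 0 else w (q - 1))) ==> chain {0} A B (LB n) v w"
  by simp

lemma chain_DB_I: "(\<And>q. q < n ==> eigX \<mu> A B (v q) = (if q = 0 then 0 else w (q - 1))) ==>
   (\<And>q. q < n ==> eigY \<mu> A B (v q) = w q) ==> chain {0} A B (DB \<mu> n) v w"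
  by simp

text \<open>The perturbed \<open>B\<close> sends \<open>v' 0\<close> to \<open>w 0\<close>, so
  \<open>v 0\<close> can be put in front of the short chain. The rest of the long chain is corrected
  to \<open>v (Suc q) - v' q\<close>, which begins with a vector killed by the perturbed
  \<open>B\<close>; \<open>j < k\<close> leaves room for the whole of \<open>v'\<close>.\<close>

lemma move_LB:
  assumes A: "lin_map A" and B: "lin_map B" and Z: "lin_map Z" and jk: "1 \<le> j" "j < k"
    and ch: "chain {0} A B (LB k) v w" "chain {0} A B (LB j) v' w'"
    and Zv: "\<And>q. q < k ==> Z (v q) = 0" "\<And>q. q < j ==> Z (v' q) = (if q = 0 then w 0 else 0)"
  shows "rechain A (\<lambda>x. B x + Z x) (LB k) v w (LB j) v' w' (LB (Suc j)) (LB (k - 1))"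
proof -
  define V1 where "V1 q = (if q = 0 then v 0 else v' (q - 1))" for q
  define W1 where "W1 q = (if q = 0 then w 0 else w' (q - 1))" for q
  define V2 where "V2 q = v (Suc q) - (if q < j then v' q else 0)" for q
  define W2 where "W2 q = w (Suc q) - (if Suc q < j then w' q else 0)" for q
  note D = chain_LB_D[OF ch(1)] chain_LB_D[OF ch(2)]
  show ?thesis
  proof (rule rechainI[of _ _ _ V1 W1 _ V2 W2])
    show "chain {0} A (\<lambda>x. B x + Z x) (LB (Suc j)) V1 W1"
    proof (rule chain_LB_I)
      fix q assume q: "q < Suc j"
      show "A (V1 q) = (if Suc q < Suc j then W1 q else 0)"
        using D(1)[of 0] D(2)[of "q - 1"] q jk by (cases q) (auto simp: V1_def W1_def)
      show "B (V1 q) + Z (V1 q) = (if q = 0 then 0 else W1 (q - 1))"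
        using D(1)[of 0] D(2)[of "q - 1"] Zv(1)[of 0] Zv(2)[of "q - 1"] q jk
        by (cases q) (auto simp: V1_def W1_def)
    qed
    show "chain {0} A (\<lambda>x. B x + Z x) (LB (k - 1)) V2 W2"
    proof (rule chain_LB_I)
      fix q assume q: "q < k - 1"
      show "A (V2 q) = (if Suc q < k - 1 then W2 q else 0)"
        using D(1)[of "Suc q"] D(2)[of q] q jk
        by (auto simp: V2_def W2_def lin_map_diff[OF A] lin_map_0[OF A])
      show "B (V2 q) + Z (V2 q) = (if q = 0 then 0 else W2 (q - 1))"
        using D(1)[of "Suc q"] D(2)[of q] Zv(1)[of "Suc q"] Zv(2)[of q] q jk
        by (auto simp: V2_def W2_def lin_map_diff[OF B] lin_map_0[OF B] lin_map_diff[OF Z] lin_map_0[OF Z])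
    qed
  next
    fix S q assume S: "subspace S" and v: "\<And>q. q < bcols (LB k) ==> v q \<in> S" "\<And>q. q < bcols (LB j) ==> v' q \<in> S"
    show "(q < bcols (LB (Suc j)) \<longrightarrow> V1 q \<in> S) \<and> (q < bcols (LB (k - 1)) \<longrightarrow> V2 q \<in> S)"
      using v(1)[of 0] v(1)[of "Suc q"] v(2)[of "q - 1"] v(2)[of q] jk subspace_0[OF S]
      by (auto simp: V1_def V2_def intro!: subspace_diff[OF S])
  next
    fix S q assume S: "subspace S" and v: "\<And>q. q < bcols (LB (Suc j)) ==> V1 q \<in> S"
      "\<And>q. q < bcols (LB (k - 1)) ==> V2 q \<in> S"
    have v': "v' q \<in> S" if "q < j" for q
      using v(1)[of "Suc q"] that by (auto simp: V1_def)
    have "v q \<in> S" if "q < k"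
    proof (cases q)
      case (Suc r)
      have "(if r < j then v' r else 0) \<in> S" using v' subspace_0[OF S] by auto
      from subspace_add[OF S v(2)[of r] this] show ?thesis using that Suc by (simp add: V2_def)
    qed (use v(1)[of 0] in \<open>auto simp: V1_def\<close>)
    then show "(q < bcols (LB k) \<longrightarrow> v q \<in> S) \<and> (q < bcols (LB j) \<longrightarrow> v' q \<in> S)" using v' by simp
  next
    fix S q assume S: "subspace S" and v: "\<And>q. q < brows (LB k) ==> w q \<in> S" "\<And>q. q < brows (LB j) ==> w' q \<in> S"
    show "(q < brows (LB (Suc j)) \<longrightarrow> W1 q \<in> S) \<and> (q < brows (LB (k - 1)) \<longrightarrow> W2 q \<in> S)"
      using v(1)[of 0] v(1)[of "Suc q"] v(2)[of "q - 1"] v(2)[of q] jk subspace_0[OF S]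
      by (auto simp: W1_def W2_def intro!: subspace_diff[OF S])
  next
    fix S q assume S: "subspace S" and v: "\<And>q. q < brows (LB (Suc j)) ==> W1 q \<in> S"
      "\<And>q. q < brows (LB (k - 1)) ==> W2 q \<in> S"
    have v': "w' q \<in> S" if "Suc q < j" for q
      using v(1)[of "Suc q"] that by (auto simp: W1_def)
    have "w q \<in> S" if "q < k - 1"
    proof (cases q)
      case (Suc r)
      have "(if Suc r < j then w' r else 0) \<in> S" using v' subspace_0[OF S] by auto
      from subspace_add[OF S v(2)[of r] this] show ?thesis using that Suc by (simp add: W2_def)
    qed (use v(1)[of 0] jk in \<open>auto simp: W1_def\<close>)
    then show "(q < brows (LB k) \<longrightarrow> w q \<in> S) \<and> (q < brows (LB j) \<longrightarrow> w' q \<in> S)" using v' by simp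
  qed
qed

text \<open>The same device for Jordan chains: \<open>v 0\<close> goes in front of
  \<open>v'\<close>, and the differences \<open>v (Suc q) - v' q\<close> form a Jordan chain because
  the two images \<open>w 0\<close> cancel at \<open>q = 0\<close>. The condition
  \<open>j \<le> k\<close> provides a \<open>v' q\<close> for each of them.\<close>

lemma move_DB:
  assumes A: "lin_map A" and B: "lin_map B" and Z: "lin_map Z" and jk: "1 \<le> j" "j \<le> k"
    and ch: "chain {0} A B (DB \<mu> j) v w" "chain {0} A B (DB \<mu> k) v' w'"
    and Zv: "\<And>q. q < j ==> Z (v q) = 0" "\<And>q. q < k ==> Z (v' q) = (if q = 0 then w 0 else 0)"
  shows "rechain (addA \<mu> A Z) (addB \<mu> B Z) (DB \<mu> j) v w (DB \<mu> k) v' w' (DB \<mu> (Suc k)) (DB \<mu> (j - 1))"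
proof -
  define V1 where "V1 q = (if q = 0 then v 0 else v' (q - 1))" for q
  define W1 where "W1 q = (if q = 0 then w 0 else w' (q - 1))" for q
  define V2 where "V2 q = v (Suc q) - v' q" for q
  define W2 where "W2 q = w (Suc q) - w' q" for q
  note D = chain_DB_D[OF ch(1)] chain_DB_D[OF ch(2)]
  have X: "lin_map (eigX \<mu> A B)" and Y: "lin_map (eigY \<mu> A B)"
    using A B by (auto intro: lin_map_eigX lin_map_eigY)
  show ?thesis
  proof (rule rechainI[of _ _ _ V1 W1 _ V2 W2])
    show "chain {0} (addA \<mu> A Z) (addB \<mu> B Z) (DB \<mu> (Suc k)) V1 W1"
    proof (rule chain_DB_I; unfold eig_add)
      fix q assume q: "q < Suc k"
      show "eigX \<mu> A B (V1 q) + Z (V1 q) = (if q = 0 then 0 else W1 (q - 1))"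
        using D(1)[of 0] D(2)[of "q - 1"] Zv(1)[of 0] Zv(2)[of "q - 1"] q jk
        by (cases q) (auto simp: V1_def W1_def)
      show "eigY \<mu> A B (V1 q) = W1 q"
        using D(1)[of 0] D(2)[of "q - 1"] q jk by (cases q) (auto simp: V1_def W1_def)
    qed
    show "chain {0} (addA \<mu> A Z) (addB \<mu> B Z) (DB \<mu> (j - 1)) V2 W2"
    proof (rule chain_DB_I; unfold eig_add)
      fix q assume q: "q < j - 1"
      show "eigX \<mu> A B (V2 q) + Z (V2 q) = (if q = 0 then 0 else W2 (q - 1))"
        using D(1)[of "Suc q"] D(2)[of q] Zv(1)[of "Suc q"] Zv(2)[of q] q jk
        by (auto simp: V2_def W2_def lin_map_diff[OF X] lin_map_diff[OF Z])
      show "eigY \<mu> A B (V2 q) = W2 q"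
        using D(1)[of "Suc q"] D(2)[of q] q jk by (auto simp: V2_def W2_def lin_map_diff[OF Y])
    qed
  next
    fix S q assume S: "subspace S" and v: "\<And>q. q < bcols (DB \<mu> j) ==> v q \<in> S" "\<And>q. q < bcols (DB \<mu> k) ==> v' q \<in> S"
    show "(q < bcols (DB \<mu> (Suc k)) \<longrightarrow> V1 q \<in> S) \<and> (q < bcols (DB \<mu> (j - 1)) \<longrightarrow> V2 q \<in> S)"
      using v(1)[of 0] v(1)[of "Suc q"] v(2)[of "q - 1"] v(2)[of q] jk
      by (auto simp: V1_def V2_def intro!: subspace_diff[OF S])
  next
    fix S q assume S: "subspace S" and v: "\<And>q. q < bcols (DB \<mu> (Suc k)) ==> V1 q \<in> S"
      "\<And>q. q < bcols (DB \<mu> (j - 1)) ==> V2 q \<in> S"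
    have v': "v' q \<in> S" if "q < k" for q
      using v(1)[of "Suc q"] that by (auto simp: V1_def)
    have "v q \<in> S" if "q < j"
    proof (cases q)
      case (Suc r)
      then show ?thesis using subspace_add[OF S v(2)[of r] v'[of r]] that jk by (simp add: V2_def)
    qed (use v(1)[of 0] in \<open>auto simp: V1_def\<close>)
    then show "(q < bcols (DB \<mu> j) \<longrightarrow> v q \<in> S) \<and> (q < bcols (DB \<mu> k) \<longrightarrow> v' q \<in> S)" using v' by simp
  next
    fix S q assume S: "subspace S" and v: "\<And>q. q < brows (DB \<mu> j) ==> w q \<in> S" "\<And>q. q < brows (DB \<mu> k) ==> w' q \<in> S"
    show "(q < brows (DB \<mu> (Suc k)) \<longrightarrow> W1 q \<in> S) \<and> (q < brows (DB \<mu> (j - 1)) \<longrightarrow> W2 q \<in> S)"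
      using v(1)[of 0] v(1)[of "Suc q"] v(2)[of "q - 1"] v(2)[of q] jk
      by (auto simp: W1_def W2_def intro!: subspace_diff[OF S])
  next
    fix S q assume S: "subspace S" and v: "\<And>q. q < brows (DB \<mu> (Suc k)) ==> W1 q \<in> S"
      "\<And>q. q < brows (DB \<mu> (j - 1)) ==> W2 q \<in> S"
    have v': "w' q \<in> S" if "q < k" for q
      using v(1)[of "Suc q"] that by (auto simp: W1_def)
    have "w q \<in> S" if "q < j"
    proof (cases q)
      case (Suc r)
      then show ?thesis using subspace_add[OF S v(2)[of r] v'[of r]] that jk by (simp add: W2_def)
    qed (use v(1)[of 0] in \<open>auto simp: W1_def\<close>)
    then show "(q < brows (DB \<mu> j) \<longrightarrow> w q \<in> S) \<and> (q < brows (DB \<mu> k) \<longrightarrow> w' q \<in> S)" using v' by simp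
  qed
qed

lemma same_spanD: "same_span n u t ==> subspace S ==> (\<forall>q<n. u q \<in> S) \<longleftrightarrow> (\<forall>q<n. t q \<in> S)"
  by (simp add: same_span_def)

text \<open>In the twisted chain \<open>t\<close> the perturbation acts on the last vector, so
  \<open>v 0\<close> can be appended to \<open>t\<close>. The remaining Jordan vectors are corrected
  by \<open>t\<close> read backwards, and the longer singular chain is untwisted at the end.\<close>

lemma move_DB_LB:
  assumes A: "lin_map A" and B: "lin_map B" and Z: "lin_map Z" and nk: "1 \<le> n" "1 \<le> k"
    and ch: "chain {0} A B (DB \<mu> k) v w" "chain {0} A B (LB n) v' w'"
    and Zv: "\<And>q. q < k ==> Z (v q) = 0"
      "\<And>q. q < n ==> Z (v' q) = (if q = (if \<mu> = Infinity then n - 1 else 0) then w 0 else 0)"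
  shows "rechain (addA \<mu> A Z) (addB \<mu> B Z) (DB \<mu> k) v w (LB n) v' w' (LB (Suc n)) (DB \<mu> (k - 1))"
proof -
  let ?A = "addA \<mu> A Z" and ?B = "addB \<mu> B Z"
  have X: "lin_map (eigX \<mu> A B)" and Y: "lin_map (eigY \<mu> A B)"
    using A B by (auto intro: lin_map_eigX lin_map_eigY)
  obtain t s where t: "chain {0} (eigX \<mu> A B) (eigY \<mu> A B) (LB n) t s"
    "same_span n v' t" "same_span (n - 1) w' s" "\<And>q. q < n ==> Z (t q) = (if q = n - 1 then w 0 else 0)"
    by (rule LB_twist[OF A B ch(2) Z Zv(2)]) blast+
  define V1 where "V1 q = (if q < n then t q else v 0)" for q
  define W1 where "W1 q = (if Suc q < n then s q else w 0)" for q
  define V2 where "V2 q = v (Suc q) - (if q < n then t (n - 1 - q) else 0)" for q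
  define W2 where "W2 q = w (Suc q) - (if Suc q < n then s (n - 1 - Suc q) else 0)" for q
  note D = chain_DB_D[OF ch(1)] chain_LB_D[OF t(1)]
  have "chain {0} (eigX \<mu> ?A ?B) (eigY \<mu> ?A ?B) (LB (Suc n)) V1 W1"
  proof (rule chain_LB_I; unfold eig_add)
    fix q assume q: "q < Suc n"
    show "eigX \<mu> A B (V1 q) + Z (V1 q) = (if Suc q < Suc n then W1 q else 0)"
      using D(1)[of 0] D(2)[of q] t(4)[of q] Zv(1)[of 0] q nk by (auto simp: V1_def W1_def)
    show "eigY \<mu> A B (V1 q) = (if q = 0 then 0 else W1 (q - 1))"
      using D(1)[of 0] D(2)[of q] q nk by (auto simp: V1_def W1_def)
  qed
  then obtain V W where VW: "chain {0} ?A ?B (LB (Suc n)) V W" "same_span (Suc n) V1 V" "same_span n W1 W"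
    using LB_untwist[OF lin_map_addA[OF A Z] lin_map_addB[OF B Z]] by (metis diff_Suc_1)
  show ?thesis
  proof (rule rechainI[of _ _ _ V W _ V2 W2])
    show "chain {0} ?A ?B (LB (Suc n)) V W" by (rule VW(1))
    show "chain {0} ?A ?B (DB \<mu> (k - 1)) V2 W2"
    proof (rule chain_DB_I; unfold eig_add)
      fix q assume q: "q < k - 1"
      show "eigX \<mu> A B (V2 q) + Z (V2 q) = (if q = 0 then 0 else W2 (q - 1))"
      proof (cases "q < n")
        case True
        then have "n - 1 - q < n" "n - 1 - q = n - 1 \<longleftrightarrow> q = 0" "Suc (n - 1 - q) < n \<longleftrightarrow> q \<noteq> 0" using nk by auto
        then show ?thesis using D(1)[of "Suc q"] D(2)[of "n - 1 - q"] Zv(1)[of "Suc q"] t(4)[of "n - 1 - q"] q True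
          by (auto simp: V2_def W2_def lin_map_diff[OF X] lin_map_diff[OF Z])
      next
        case False
        then show ?thesis using D(1)[of "Suc q"] Zv(1)[of "Suc q"] q nk by (auto simp: V2_def W2_def)
      qed
      show "eigY \<mu> A B (V2 q) = W2 q"
      proof (cases "q < n")
        case True
        then have "n - 1 - q < n" "n - 1 - q = 0 \<longleftrightarrow> \<not> Suc q < n" by auto
        then show ?thesis using D(1)[of "Suc q"] D(2)[of "n - 1 - q"] q True
          by (auto simp: V2_def W2_def lin_map_diff[OF Y])
      next
        case False
        then show ?thesis using D(1)[of "Suc q"] q by (auto simp: V2_def W2_def)
      qed
    qed
  next
    fix S q assume S: "subspace S" and v: "\<And>q. q < bcols (DB \<mu> k) ==> v q \<in> S" "\<And>q. q < bcols (LB n) ==> v' q \<in> S"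
    have t': "t q \<in> S" if "q < n" for q using same_spanD[OF t(2) S] v(2) that by simp
    have "\<forall>q<Suc n. V1 q \<in> S" using t' v(1)[of 0] nk by (simp add: V1_def)
    then have "\<forall>q<Suc n. V q \<in> S" using same_spanD[OF VW(2) S] by simp
    moreover have "V2 q \<in> S" if "q < k - 1"
      unfolding V2_def using t' v(1) that subspace_0[OF S] by (intro subspace_diff[OF S]) auto
    ultimately show "(q < bcols (LB (Suc n)) \<longrightarrow> V q \<in> S) \<and> (q < bcols (DB \<mu> (k - 1)) \<longrightarrow> V2 q \<in> S)" by simp
  next
    fix S q assume S: "subspace S" and v: "\<And>q. q < bcols (LB (Suc n)) ==> V q \<in> S"
      "\<And>q. q < bcols (DB \<mu> (k - 1)) ==> V2 q \<in> S"
    have V1: "V1 q \<in> S" if "q < Suc n" for q using same_spanD[OF VW(2) S] v(1) that by simp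
    have t': "t q \<in> S" if "q < n" for q using V1[of q] that by (simp add: V1_def)
    then have "\<forall>q<n. v' q \<in> S" using same_spanD[OF t(2) S] by simp
    moreover have "v q \<in> S" if "q < k"
    proof (cases q)
      case (Suc r)
      have "(if r < n then t (n - 1 - r) else 0) \<in> S" using t' subspace_0[OF S] by auto
      from subspace_add[OF S v(2)[of r] this] show ?thesis using that Suc by (simp add: V2_def)
    qed (use V1[of n] in \<open>simp add: V1_def\<close>)
    ultimately show "(q < bcols (DB \<mu> k) \<longrightarrow> v q \<in> S) \<and> (q < bcols (LB n) \<longrightarrow> v' q \<in> S)" by simp
  next
    fix S q assume S: "subspace S" and v: "\<And>q. q < brows (DB \<mu> k) ==> w q \<in> S" "\<And>q. q < brows (LB n) ==> w' q \<in> S"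
    have t': "s q \<in> S" if "q < n - 1" for q using same_spanD[OF t(3) S] v(2) that by simp
    have "\<forall>q<n. W1 q \<in> S" using t' v(1)[of 0] nk by (auto simp: W1_def)
    then have "\<forall>q<n. W q \<in> S" using same_spanD[OF VW(3) S] by simp
    moreover have "W2 q \<in> S" if "q < k - 1"
      unfolding W2_def using t' v(1) that subspace_0[OF S] by (intro subspace_diff[OF S]) auto
    ultimately show "(q < brows (LB (Suc n)) \<longrightarrow> W q \<in> S) \<and> (q < brows (DB \<mu> (k - 1)) \<longrightarrow> W2 q \<in> S)" by simp
  next
    fix S q assume S: "subspace S" and v: "\<And>q. q < brows (LB (Suc n)) ==> W q \<in> S"
      "\<And>q. q < brows (DB \<mu> (k - 1)) ==> W2 q \<in> S"
    have W1: "W1 q \<in> S" if "q < n" for q using same_spanD[OF VW(3) S] v(1) that by simp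
    have t': "s q \<in> S" if "q < n - 1" for q
    proof -
      have "Suc q < n" using that by simp
      then show ?thesis using W1[of q] by (simp add: W1_def)
    qed
    then have "\<forall>q<n - 1. w' q \<in> S" using same_spanD[OF t(3) S] by simp
    moreover have "w q \<in> S" if "q < k"
    proof (cases q)
      case (Suc r)
      have "(if Suc r < n then s (n - 1 - Suc r) else 0) \<in> S" using t' subspace_0[OF S] by auto
      from subspace_add[OF S v(2)[of r] this] show ?thesis using that Suc by (simp add: W2_def)
    qed (use W1[of "n - 1"] nk in \<open>simp add: W1_def\<close>)
    ultimately show "(q < brows (DB \<mu> k) \<longrightarrow> w q \<in> S) \<and> (q < brows (LB n) \<longrightarrow> w' q \<in> S)" by simp
  qed
qed

end

hide_const (open) Module.smult

section \<open>Matrices as linear maps on coefficient sequences\<close>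

text \<open>Column vectors of any length are encoded as polynomials, the entries being the coefficients;
  this gives one type with a complex vector space structure.\<close>

interpretation cp: complex_vector_space "smult :: complex => complex poly => complex poly"
  by unfold_locales (simp_all add: smult_add_right smult_add_left)

definition vecs :: "nat => complex poly set" where
  "vecs n = {p. \<forall>k\<ge>n. coeff p k = 0}"

definition lin :: "complex mat => complex poly => complex poly" where
  "lin M p = (\<Sum>i<dim_row M. monom (\<Sum>k<dim_col M. M $$ (i, k) * coeff p k) i)"

lemma coeff_lin: "coeff (lin M p) i = (if i < dim_row M then \<Sum>k<dim_col M. M $$ (i, k) * coeff p k else 0)"
  by (simp add: lin_def coeff_sum)

lemma subspace_vecs: "cp.subspace (vecs n)"
  by (auto simp: cp.subspace_def vecs_def)

lemma lin_map_lin: "cp.lin_map (lin M)"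
  unfolding cp.lin_map_def
  by (auto intro!: poly_eqI simp: coeff_lin algebra_simps sum.distrib sum_distrib_left)

lemma lin_vecs: "lin M p \<in> vecs (dim_row M)"
  by (simp add: vecs_def coeff_lin)

lemma lin_mult:
  assumes "A \<in> carrier_mat m k" "B \<in> carrier_mat k n"
  shows "lin (A * B) p = lin A (lin B p)"
proof (rule poly_eqI)
  fix i
  have "(\<Sum>j<n. (\<Sum>l<k. A $$ (i, l) * B $$ (l, j)) * coeff p j) =
        (\<Sum>l<k. A $$ (i, l) * (\<Sum>j<n. B $$ (l, j) * coeff p j))"
    unfolding sum_distrib_left sum_distrib_right by (subst sum.swap) (simp add: mult.assoc)
  moreover have "(A * B) $$ (i, j) = (\<Sum>l<k. A $$ (i, l) * B $$ (l, j))" if "i < m" "j < n" for j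
    using assms that by (simp add: scalar_prod_def lessThan_atLeast0)
  ultimately show "coeff (lin (A * B) p) i = coeff (lin A (lin B p)) i"
    using assms by (simp add: coeff_lin)
qed

lemma lin_one: "p \<in> vecs n ==> lin (1\<^sub>m n) p = p"
  by (rule poly_eqI) (auto simp: coeff_lin vecs_def if_distribR if_distrib[where f="\<lambda>x. x * _"] cong: if_cong)

lemma poly_vecs_eq: "p \<in> vecs n ==> p = (\<Sum>k<n. smult (coeff p k) (monom 1 k))"
  by (rule poly_eqI) (auto simp: coeff_sum smult_monom vecs_def sum.delta)

lemma monom_vecs: "k < n ==> monom c k \<in> vecs n"
  by (auto simp: vecs_def)

lemma basis_monom: "cp.basis_mod {0} {..<n} (monom 1) (vecs n)"
  unfolding cp.basis_mod_def
proof (intro conjI)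
  show "vecs n \<subseteq> cp.add_span {0} {..<n} (monom 1)"
  proof
    fix p assume "p \<in> vecs n"
    from poly_vecs_eq[OF this] show "p \<in> cp.add_span {0} {..<n} (monom 1)"
      by (intro cp.add_spanI[where c="coeff p"]) simp
  qed
  show "cp.indep_mod {0} {..<n} (monom 1)"
    unfolding cp.indep_mod_def
  proof (intro allI impI ballI)
    fix c :: "nat => complex" and i assume *: "(\<Sum>i<n. smult (c i) (monom 1 i)) \<in> {0}" and "i \<in> {..<n}"
    have "c i = coeff (\<Sum>i<n. smult (c i) (monom 1 i)) i"
      using \<open>i \<in> {..<n}\<close> by (simp add: coeff_sum smult_monom sum.delta)
    also have "(\<Sum>i<n. smult (c i) (monom 1 i)) = 0" using * by (simp only: singleton_iff)
    finally show "c i = 0" by simp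
  qed
qed (auto simp: monom_vecs)

lemma poly_vecs_span:
  assumes "cp.subspace S" "\<And>k. k < n ==> monom 1 k \<in> S"
  shows "vecs n \<subseteq> S"
proof
  fix p assume "p \<in> vecs n"
  then have "p = (\<Sum>k<n. smult (coeff p k) (monom 1 k))" by (rule poly_vecs_eq)
  also have "\<dots> \<in> S" using assms by (intro cp.subspace_sum cp.subspace_scale) auto
  finally show "p \<in> S" .
qed

lemma lin_monom: "c < dim_col M ==> lin M (monom 1 c) = (\<Sum>r<dim_row M. smult (M $$ (r, c)) (monom 1 r))"
  by (rule poly_eqI) (simp add: coeff_lin coeff_sum smult_monom sum.delta if_distrib[where f="\<lambda>x. _ * x"] cong: if_cong)

section \<open>Positions in a direct sum\<close>

fun unflat :: "nat list => nat => nat \<times> nat" where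
  "unflat [] c = (0, c)"
| "unflat (s # ss) c = (if c < s then (0, c) else case unflat ss (c - s) of (i, q) => (Suc i, q))"

definition flat :: "nat list => nat \<times> nat => nat" where
  "flat ss = (\<lambda>(i, q). sum_list (take i ss) + q)"

abbreviation positions :: "nat list => (nat \<times> nat) set" where
  "positions ss \<equiv> SIGMA i:{..<length ss}. {..<ss ! i}"

lemma unflat_mem: "c < sum_list ss ==> unflat ss c \<in> positions ss"
proof (induction ss arbitrary: c)
  case (Cons s ss)
  show ?case
  proof (cases "c < s")
    case False
    then have "unflat ss (c - s) \<in> positions ss" using Cons by auto
    with False show ?thesis by (auto split: prod.splits)
  qed auto
qed simp

lemma flat_unflat: "flat ss (unflat ss c) = c"
proof (induction ss arbitrary: c)
  case (Cons s ss)
  show ?case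
  proof (cases "c < s")
    case False
    obtain i q where iq: "unflat ss (c - s) = (i, q)" by fastforce
    with Cons.IH[of "c - s"] False show ?thesis by (simp add: flat_def)
  qed (simp add: flat_def)
qed (simp add: flat_def)

lemma unflat_flat: "i < length ss ==> q < ss ! i ==> unflat ss (flat ss (i, q)) = (i, q)"
proof (induction ss arbitrary: i)
  case (Cons s ss)
  then show ?case by (cases i) (auto simp: flat_def)
qed simp

lemma flat_less: "i < length ss ==> q < ss ! i ==> flat ss (i, q) < sum_list ss"
proof (induction ss arbitrary: i)
  case (Cons s ss)
  then show ?case by (cases i) (auto simp: flat_def)
qed simp

lemma bij_unflat: "bij_betw (unflat ss) {..<sum_list ss} (positions ss)"
  by (rule bij_betw_byWitness[where f'="flat ss"])
     (auto simp: flat_unflat unflat_flat flat_less unflat_mem[simplified] dest!: unflat_mem)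

lemma bij_flat: "bij_betw (flat ss) (positions ss) {..<sum_list ss}"
  by (rule bij_betw_byWitness[where f'="unflat ss"])
     (auto simp: flat_unflat unflat_flat flat_less unflat_mem[simplified] dest!: unflat_mem)

lemma sum_positions: "(\<Sum>c<sum_list ss. f (unflat ss c)) = (\<Sum>j\<in>positions ss. f j)"
  by (rule sum.reindex_bij_betw[OF bij_unflat])

lemma dim_diag_block_mat':
  "dim_row (diag_block_mat Ms) = sum_list (map dim_row Ms)"
  "dim_col (diag_block_mat Ms) = sum_list (map dim_col Ms)"
  by (simp_all add: dim_diag_block_mat)

lemma diag_block_mat_index:
  assumes "r < sum_list (map dim_row Ms)" "c < sum_list (map dim_col Ms)"
    "unflat (map dim_row Ms) r = (i, p)" "unflat (map dim_col Ms) c = (j, q)"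
  shows "diag_block_mat Ms $$ (r, c) = (if i = j then Ms ! i $$ (p, q) else 0)"
  using assms
proof (induction Ms arbitrary: r c i j)
  case (Cons M Ms)
  have d: "dim_row (diag_block_mat Ms) = sum_list (map dim_row Ms)"
    "dim_col (diag_block_mat Ms) = sum_list (map dim_col Ms)" by (simp_all add: dim_diag_block_mat)
  show ?case
  proof (cases "r < dim_row M \<or> c < dim_col M")
    case True
    then show ?thesis using Cons.prems
      by (auto simp: Let_def d split: if_splits prod.splits)
  next
    case False
    then obtain i' j' where "unflat (map dim_row Ms) (r - dim_row M) = (i', p)" "i = Suc i'"
      "unflat (map dim_col Ms) (c - dim_col M) = (j', q)" "j = Suc j'"
      using Cons.prems by (auto split: prod.splits)
    moreover from this Cons.IH[of "r - dim_row M" "c - dim_col M" i' j'] False Cons.prems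
    have "diag_block_mat Ms $$ (r - dim_row M, c - dim_col M) = (if i' = j' then Ms ! i' $$ (p, q) else 0)"
      by auto
    ultimately show ?thesis using False Cons.prems by (simp add: Let_def d)
  qed
qed simp

section \<open>Orbits and frames\<close>

lemma invertible_matI: "(A :: complex mat) \<in> carrier_mat n n ==> B \<in> carrier_mat n n ==> A * B = 1\<^sub>m n ==> invertible_mat A"
  using mat_mult_left_right_inverse[of A n B]
  by (auto simp: invertible_mat_def inverts_mat_def square_mat.simps intro!: exI[of _ B])

lemma invertible_matE:
  fixes A :: "complex mat"
  assumes "invertible_mat A" "A \<in> carrier_mat n n"
  obtains B where "B \<in> carrier_mat n n" "A * B = 1\<^sub>m n" "B * A = 1\<^sub>m n"
proof -
  obtain B where B: "A * B = 1\<^sub>m (dim_row A)" "B * A = 1\<^sub>m (dim_row B)"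
    using assms by (auto simp: invertible_mat_def inverts_mat_def)
  have "dim_col B = dim_col (A * B)" by simp
  also have "\<dots> = n" using B(1) assms(2) by simp
  finally have "dim_col B = n" .
  moreover have "dim_col (B * A) = n" using assms(2) by simp
  then have "dim_row B = n" using B(2) by simp
  ultimately show ?thesis using that[of B] B assms(2) by auto
qed

lemma orbitI:
  assumes "P \<in> mat_pairs m n" "S \<in> carrier_mat m m" "S' \<in> carrier_mat m m" "S * S' = 1\<^sub>m m"
    "R \<in> carrier_mat n n" "R' \<in> carrier_mat n n" "R * R' = 1\<^sub>m n"
  shows "(S * fst P * R, S * snd P * R) \<in> orbit P"
proof -
  have "pair_rows P = m" "pair_cols P = n"
    using assms(1) by (auto simp: mat_pairs_def pair_rows_def pair_cols_def)
  moreover have "invertible_mat S" "invertible_mat R"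
    using assms by (auto intro: invertible_matI)
  ultimately show ?thesis using assms(2,5) unfolding orbit_def by blast
qed

lemma orbitE:
  assumes "Q \<in> orbit P" "P \<in> mat_pairs m n"
  obtains S S' R R' where "S \<in> carrier_mat m m" "S' \<in> carrier_mat m m" "S * S' = 1\<^sub>m m" "S' * S = 1\<^sub>m m"
    "R \<in> carrier_mat n n" "R' \<in> carrier_mat n n" "R * R' = 1\<^sub>m n" "R' * R = 1\<^sub>m n"
    "Q = (S * fst P * R, S * snd P * R)"
proof -
  have "pair_rows P = m" "pair_cols P = n"
    using assms(2) by (auto simp: mat_pairs_def pair_rows_def pair_cols_def)
  then obtain S R where SR: "S \<in> carrier_mat m m" "invertible_mat S" "R \<in> carrier_mat n n" "invertible_mat R"
    "Q = (S * fst P * R, S * snd P * R)" using assms(1) by (auto simp: orbit_def)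
  from invertible_matE[OF SR(2,1)] obtain S' where "S' \<in> carrier_mat m m" "S * S' = 1\<^sub>m m" "S' * S = 1\<^sub>m m" .
  moreover from invertible_matE[OF SR(4,3)] obtain R' where "R' \<in> carrier_mat n n" "R * R' = 1\<^sub>m n" "R' * R = 1\<^sub>m n" .
  ultimately show ?thesis using that SR by blast
qed

lemma orbit_mat_pairs: "Q \<in> orbit P ==> P \<in> mat_pairs m n ==> Q \<in> mat_pairs m n"
  by (erule orbitE) (auto simp: mat_pairs_def)

lemma orbit_refl: "P \<in> mat_pairs m n ==> P \<in> orbit P"
  using orbitI[of P m n "1\<^sub>m m" "1\<^sub>m m" "1\<^sub>m n" "1\<^sub>m n"] by (cases P) (auto simp: mat_pairs_def)

lemma orbit_sym:
  assumes "Q \<in> orbit P" "P \<in> mat_pairs m n"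
  shows "P \<in> orbit Q"
proof -
  have Q: "Q \<in> mat_pairs m n" using orbit_mat_pairs assms by blast
  obtain S S' R R' where *: "S \<in> carrier_mat m m" "S' \<in> carrier_mat m m" "S * S' = 1\<^sub>m m" "S' * S = 1\<^sub>m m"
    "R \<in> carrier_mat n n" "R' \<in> carrier_mat n n" "R * R' = 1\<^sub>m n" "R' * R = 1\<^sub>m n"
    "Q = (S * fst P * R, S * snd P * R)" using assms by (rule orbitE)
  have "S' * (S * X * R) * R' = X" if X: "X \<in> carrier_mat m n" for X
  proof -
    have "S' * (S * X * R) * R' = S' * (S * X * R * R')"
      using * X by (intro assoc_mult_mat[of _ m m _ n _ n]) auto
    also have "S * X * R * R' = S * X * (R * R')"
      using * X by (intro assoc_mult_mat[of _ m n _ n _ n]) auto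
    also have "\<dots> = S * X" using * X by simp
    also have "S' * (S * X) = (S' * S) * X"
      using * X by (intro assoc_mult_mat[symmetric, of _ m m _ m _ n]) auto
    finally show ?thesis using * X by simp
  qed
  from this[of "fst P"] this[of "snd P"] assms(2) have "P = (S' * fst Q * R', S' * snd Q * R')"
    unfolding *(9) fst_conv snd_conv by (auto simp: mat_pairs_def)
  then show ?thesis using orbitI[OF Q *(2,1,4,6,5,8)] by simp
qed

lemma orbit_trans:
  assumes "Q \<in> orbit P" "T \<in> orbit Q" "P \<in> mat_pairs m n"
  shows "T \<in> orbit P"
proof -
  have Q: "Q \<in> mat_pairs m n" using orbit_mat_pairs assms by blast
  obtain S S' R R' where *: "S \<in> carrier_mat m m" "S' \<in> carrier_mat m m" "S * S' = 1\<^sub>m m" "S' * S = 1\<^sub>m m"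
    "R \<in> carrier_mat n n" "R' \<in> carrier_mat n n" "R * R' = 1\<^sub>m n" "R' * R = 1\<^sub>m n"
    "Q = (S * fst P * R, S * snd P * R)" using assms(1,3) by (rule orbitE)
  obtain S2 S2' R2 R2' where **: "S2 \<in> carrier_mat m m" "S2' \<in> carrier_mat m m" "S2 * S2' = 1\<^sub>m m" "S2' * S2 = 1\<^sub>m m"
    "R2 \<in> carrier_mat n n" "R2' \<in> carrier_mat n n" "R2 * R2' = 1\<^sub>m n" "R2' * R2 = 1\<^sub>m n"
    "T = (S2 * fst Q * R2, S2 * snd Q * R2)" using assms(2) Q by (rule orbitE)
  have inv: "(X * Y) * (Y' * X') = 1\<^sub>m k" if "X \<in> carrier_mat k k" "X' \<in> carrier_mat k k" "Y \<in> carrier_mat k k"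
    "Y' \<in> carrier_mat k k" "X * X' = 1\<^sub>m k" "Y * Y' = 1\<^sub>m k" for X X' Y Y' :: "complex mat" and k
  proof -
    have "(X * Y) * (Y' * X') = X * (Y * (Y' * X'))"
      using that by (intro assoc_mult_mat[of _ k k _ k _ k]) auto
    also have "Y * (Y' * X') = (Y * Y') * X'"
      using that by (intro assoc_mult_mat[symmetric, of _ k k _ k _ k]) auto
    finally show ?thesis using that by simp
  qed
  have "S2 * (S * X * R) * R2 = (S2 * S) * X * (R * R2)" if X: "X \<in> carrier_mat m n" for X
    using * ** X by (simp add: assoc_mult_mat[of _ m m _ m _ n] assoc_mult_mat[of _ m m _ n _ n]
          assoc_mult_mat[of _ m n _ n _ n])
  from this[of "fst P"] this[of "snd P"] assms(3)
  have "T = ((S2 * S) * fst P * (R * R2), (S2 * S) * snd P * (R * R2))"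
    unfolding **(9) *(9) fst_conv snd_conv by (auto simp: mat_pairs_def)
  moreover have "\<dots> \<in> orbit P"
  proof (rule orbitI[OF assms(3)])
    show "(S2 * S) * (S' * S2') = 1\<^sub>m m" by (rule inv[OF **(1,2) *(1,2) **(3) *(3)])
    show "(R * R2) * (R2' * R') = 1\<^sub>m n" by (rule inv[OF *(5,6) **(5,6) *(7) **(7)])
  qed (use * ** in auto)
  ultimately show ?thesis by simp
qed

lemma orbit_eq: "Q \<in> orbit P ==> P \<in> mat_pairs m n ==> orbit Q = orbit P"
  using orbit_trans orbit_sym orbit_mat_pairs by (metis subsetI subset_antisym)

text \<open>The bases in which \<open>P\<close> becomes the direct sum of \<open>Ps\<close>: the
  \<open>v\<close> are the columns of \<open>R\<close> and the \<open>w\<close> those of the inverse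
  of \<open>S\<close>. Spanning is enough because the numbers of vectors equal the
  dimensions.\<close>

definition is_frame where
  "is_frame P Ps v w \<longleftrightarrow>
     sum_list (map pair_rows Ps) = pair_rows P \<and> sum_list (map pair_cols Ps) = pair_cols P \<and>
     (\<forall>i<length Ps. \<forall>q<pair_cols (Ps ! i). v i q \<in> vecs (pair_cols P)) \<and>
     (\<forall>i<length Ps. \<forall>p<pair_rows (Ps ! i). w i p \<in> vecs (pair_rows P)) \<and>
     vecs (pair_cols P) \<subseteq> cp.add_span {0} (positions (map pair_cols Ps)) (\<lambda>(i, q). v i q) \<and>
     vecs (pair_rows P) \<subseteq> cp.add_span {0} (positions (map pair_rows Ps)) (\<lambda>(i, p). w i p) \<and>
     (\<forall>i<length Ps. \<forall>q<pair_cols (Ps ! i).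
        lin (fst P) (v i q) = (\<Sum>p<pair_rows (Ps ! i). smult (fst (Ps ! i) $$ (p, q)) (w i p)) \<and>
        lin (snd P) (v i q) = (\<Sum>p<pair_rows (Ps ! i). smult (snd (Ps ! i) $$ (p, q)) (w i p)))"

lemma is_frameD:
  assumes "is_frame P Ps v w"
  shows "pair_rows P = sum_list (map pair_rows Ps)" "pair_cols P = sum_list (map pair_cols Ps)"
    "i < length Ps ==> q < pair_cols (Ps ! i) ==> v i q \<in> vecs (pair_cols P)"
    "i < length Ps ==> p < pair_rows (Ps ! i) ==> w i p \<in> vecs (pair_rows P)"
    "vecs (pair_cols P) \<subseteq> cp.add_span {0} (positions (map pair_cols Ps)) (\<lambda>(i, q). v i q)"
    "vecs (pair_rows P) \<subseteq> cp.add_span {0} (positions (map pair_rows Ps)) (\<lambda>(i, p). w i p)"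
    "i < length Ps ==> q < pair_cols (Ps ! i) ==>
       lin (fst P) (v i q) = (\<Sum>p<pair_rows (Ps ! i). smult (fst (Ps ! i) $$ (p, q)) (w i p))"
    "i < length Ps ==> q < pair_cols (Ps ! i) ==>
       lin (snd P) (v i q) = (\<Sum>p<pair_rows (Ps ! i). smult (snd (Ps ! i) $$ (p, q)) (w i p))"
  using assms by (simp_all add: is_frame_def)

lemma is_mat_pair_iff: "is_mat_pair P \<longleftrightarrow> P \<in> mat_pairs (pair_rows P) (pair_cols P)"
  by (cases P) (auto simp: is_mat_pair_def mat_pairs_def pair_rows_def pair_cols_def)

lemma mat_pairs_dims: "P \<in> mat_pairs m n ==> pair_rows P = m \<and> pair_cols P = n"
  by (auto simp: mat_pairs_def pair_rows_def pair_cols_def)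

lemma mat_pairs_is: "P \<in> mat_pairs m n ==> is_mat_pair P"
  by (auto simp: is_mat_pair_def)

lemma pair_dims_map:
  assumes "\<forall>X\<in>set Ps. is_mat_pair X"
  shows "map dim_row (map fst Ps) = map pair_rows Ps" "map dim_row (map snd Ps) = map pair_rows Ps"
    "map dim_col (map fst Ps) = map pair_cols Ps" "map dim_col (map snd Ps) = map pair_cols Ps"
  using assms by (auto simp: is_mat_pair_iff mat_pairs_def pair_rows_def pair_cols_def)

lemma direct_sum_mat_pairs:
  assumes "\<forall>X\<in>set Ps. is_mat_pair X"
  shows "direct_sum Ps \<in> mat_pairs (sum_list (map pair_rows Ps)) (sum_list (map pair_cols Ps))"
  unfolding direct_sum_def mat_pairs_def mem_Times_iff fst_conv snd_conv carrier_mat_def mem_Collect_eq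
    dim_diag_block_mat' pair_dims_map[OF assms] by simp

lemma direct_sum_index:
  assumes "\<forall>X\<in>set Ps. is_mat_pair X" "i < length Ps" "j < length Ps" "p < pair_rows (Ps ! i)" "q < pair_cols (Ps ! j)"
  shows "fst (direct_sum Ps) $$ (flat (map pair_rows Ps) (i, p), flat (map pair_cols Ps) (j, q)) =
      (if i = j then fst (Ps ! i) $$ (p, q) else 0)"
    "snd (direct_sum Ps) $$ (flat (map pair_rows Ps) (i, p), flat (map pair_cols Ps) (j, q)) =
      (if i = j then snd (Ps ! i) $$ (p, q) else 0)"
proof -
  have f: "flat (map pair_rows Ps) (i, p) < sum_list (map pair_rows Ps)"
    "flat (map pair_cols Ps) (j, q) < sum_list (map pair_cols Ps)"
    "unflat (map pair_rows Ps) (flat (map pair_rows Ps) (i, p)) = (i, p)"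
    "unflat (map pair_cols Ps) (flat (map pair_cols Ps) (j, q)) = (j, q)"
    using assms by (auto intro!: flat_less unflat_flat)
  show "fst (direct_sum Ps) $$ (flat (map pair_rows Ps) (i, p), flat (map pair_cols Ps) (j, q)) =
      (if i = j then fst (Ps ! i) $$ (p, q) else 0)"
    using diag_block_mat_index[of _ "map fst Ps", unfolded pair_dims_map[OF assms(1)], OF f(1,2,3,4)] assms(2)
    by (simp add: direct_sum_def)
  show "snd (direct_sum Ps) $$ (flat (map pair_rows Ps) (i, p), flat (map pair_cols Ps) (j, q)) =
      (if i = j then snd (Ps ! i) $$ (p, q) else 0)"
    using diag_block_mat_index[of _ "map snd Ps", unfolded pair_dims_map[OF assms(1)], OF f(1,2,3,4)] assms(2)
    by (simp add: direct_sum_def)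
qed

lemma sum_positions_block:
  assumes "i < length ss"
  shows "(\<Sum>(j, p)\<in>positions ss. smult (if j = i then f p else 0) (u j p)) = (\<Sum>p<ss ! i. smult (f p) (u i p))"
proof -
  have "(\<Sum>(j, p)\<in>positions ss. smult (if j = i then f p else 0) (u j p))
      = (\<Sum>j<length ss. \<Sum>p<ss ! j. smult (if j = i then f p else 0) (u j p))"
    by (simp add: sum.Sigma)
  also have "\<dots> = (\<Sum>j<length ss. if j = i then (\<Sum>p<ss ! i. smult (f p) (u i p)) else 0)"
    by (intro sum.cong) auto
  finally show ?thesis using assms by simp
qed

lemma frame_direct_sum:
  assumes "\<forall>X\<in>set Ps. is_mat_pair X"
  shows "is_frame (direct_sum Ps) Ps (\<lambda>i q. monom 1 (flat (map pair_cols Ps) (i, q)))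
     (\<lambda>i p. monom 1 (flat (map pair_rows Ps) (i, p)))"
proof -
  note D = mat_pairs_dims[OF direct_sum_mat_pairs[OF assms]]
  have span: "vecs (sum_list ss) \<subseteq> cp.add_span {0} (positions ss) (\<lambda>(i, q). monom 1 (flat ss (i, q)))" for ss
  proof (rule poly_vecs_span)
    show "cp.subspace (cp.add_span {0} (positions ss) (\<lambda>(i, q). monom 1 (flat ss (i, q))))"
      by (intro cp.subspace_add_span cp.subspace_single_0)
    fix k assume "k < sum_list ss"
    then have "unflat ss k \<in> positions ss" by (rule unflat_mem)
    from cp.add_span_base[OF _ this cp.subspace_single_0, of "\<lambda>(i, q). monom 1 (flat ss (i, q))"]
    show "monom 1 k \<in> cp.add_span {0} (positions ss) (\<lambda>(i, q). monom 1 (flat ss (i, q)))"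
      by (auto simp: split_def flat_unflat)
  qed
  have lin: "lin M (monom 1 (flat (map pair_cols Ps) (i, q)))
      = (\<Sum>p<pair_rows (Ps ! i). smult (f (Ps ! i) $$ (p, q)) (monom 1 (flat (map pair_rows Ps) (i, p))))"
    if iq: "i < length Ps" "q < pair_cols (Ps ! i)"
      and M: "M \<in> carrier_mat (sum_list (map pair_rows Ps)) (sum_list (map pair_cols Ps))"
      and ix: "\<And>j p. j < length Ps ==> p < pair_rows (Ps ! j) ==>
         M $$ (flat (map pair_rows Ps) (j, p), flat (map pair_cols Ps) (i, q)) = (if j = i then f (Ps ! j) $$ (p, q) else 0)"
    for M i q and f :: "mat_pair => complex mat"
  proof -
    have "flat (map pair_cols Ps) (i, q) < dim_col M" using M iq by (auto intro!: flat_less)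
    from lin_monom[OF this] have "lin M (monom 1 (flat (map pair_cols Ps) (i, q)))
      = (\<Sum>r<sum_list (map pair_rows Ps). smult (M $$ (r, flat (map pair_cols Ps) (i, q))) (monom 1 r))"
      using M by simp
    also have "\<dots> = (\<Sum>x\<in>positions (map pair_rows Ps).
        smult (M $$ (flat (map pair_rows Ps) x, flat (map pair_cols Ps) (i, q))) (monom 1 (flat (map pair_rows Ps) x)))"
      by (rule sum.reindex_bij_betw[OF bij_flat, symmetric])
    also have "\<dots> = (\<Sum>(j, p)\<in>positions (map pair_rows Ps).
        smult (if j = i then f (Ps ! i) $$ (p, q) else 0) (monom 1 (flat (map pair_rows Ps) (j, p))))"
      using ix by (intro sum.cong) auto
    also have "\<dots> = (\<Sum>p<map pair_rows Ps ! i. smult (f (Ps ! i) $$ (p, q)) (monom 1 (flat (map pair_rows Ps) (i, p))))"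
      using iq by (intro sum_positions_block) simp
    finally show ?thesis using iq by simp
  qed
  have fl: "flat (map f Ps) (i, q) < sum_list (map f Ps)" if "i < length Ps" "q < f (Ps ! i)" for f i q
    using that by (intro flat_less) auto
  have C: "fst (direct_sum Ps) \<in> carrier_mat (sum_list (map pair_rows Ps)) (sum_list (map pair_cols Ps))"
    "snd (direct_sum Ps) \<in> carrier_mat (sum_list (map pair_rows Ps)) (sum_list (map pair_cols Ps))"
    using direct_sum_mat_pairs[OF assms] by (auto simp: mat_pairs_def mem_Times_iff)
  show ?thesis
    unfolding is_frame_def D[THEN conjunct1] D[THEN conjunct2]
    by (intro conjI allI impI span lin C monom_vecs fl refl;
        (assumption | simp add: direct_sum_index[OF assms]))
qed

text \<open>Writing the unit vectors as combinations of the frame gives a right inverse of each of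
  the square matrices \<open>V\<close> and \<open>W\<close>, and the relations of the frame say
  \<open>P V = W D\<close> for both members of the pair.\<close>

lemma frame_orbit:
  assumes Ps: "\<forall>X\<in>set Ps. is_mat_pair X" and P: "P \<in> mat_pairs m n" and F: "is_frame P Ps v w"
  shows "direct_sum Ps \<in> orbit P"
proof -
  note F' = is_frameD[OF F]
  have Pd: "pair_rows P = m" "pair_cols P = n" using mat_pairs_dims[OF P] by auto
  have Pc: "fst P \<in> carrier_mat m n" "snd P \<in> carrier_mat m n" using P by (auto simp: mat_pairs_def mem_Times_iff)
  define rs cs where "rs = map pair_rows Ps" and "cs = map pair_cols Ps"
  have mn: "m = sum_list rs" "n = sum_list cs" using F'(1,2) by (auto simp: Pd rs_def cs_def)
  have inv: "\<exists>X'\<in>carrier_mat (sum_list ss) (sum_list ss).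
      mat (sum_list ss) (sum_list ss) (\<lambda>(k, c). coeff (case unflat ss c of (i, q) => u i q) k) * X' = 1\<^sub>m (sum_list ss)"
    if sp: "vecs (sum_list ss) \<subseteq> cp.add_span {0} (positions ss) (\<lambda>(i, q). u i q)" for ss and u :: "nat => nat => complex poly"
  proof -
    have "\<forall>k\<in>{..<sum_list ss}. \<exists>c. monom 1 k = (\<Sum>x\<in>positions ss. smult (c x) (case x of (i, q) => u i q))"
    proof
      fix k assume "k \<in> {..<sum_list ss}"
      then have "monom 1 k \<in> cp.add_span {0} (positions ss) (\<lambda>(i, q). u i q)"
        using sp monom_vecs by blast
      then show "\<exists>c. monom 1 k = (\<Sum>x\<in>positions ss. smult (c x) (case x of (i, q) => u i q))"
        by (auto simp: cp.add_span_def)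
    qed
    from bchoice[OF this] obtain c where
      c: "\<And>k. k < sum_list ss ==> monom 1 k = (\<Sum>x\<in>positions ss. smult (c k x) (case x of (i, q) => u i q))"
      by auto
    define X' where "X' = mat (sum_list ss) (sum_list ss) (\<lambda>(r, k). c k (unflat ss r))"
    have "mat (sum_list ss) (sum_list ss) (\<lambda>(k, c). coeff (case unflat ss c of (i, q) => u i q) k) * X' = 1\<^sub>m (sum_list ss)"
    proof (rule eq_matI)
      fix a b assume ab: "a < dim_row (1\<^sub>m (sum_list ss))" "b < dim_col (1\<^sub>m (sum_list ss))"
      then have "(mat (sum_list ss) (sum_list ss) (\<lambda>(k, c). coeff (case unflat ss c of (i, q) => u i q) k) * X') $$ (a, b)
        = (\<Sum>r<sum_list ss. coeff (case unflat ss r of (i, q) => u i q) a * c b (unflat ss r))"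
        by (simp add: X'_def scalar_prod_def lessThan_atLeast0)
      also have "\<dots> = (\<Sum>x\<in>positions ss. coeff (case x of (i, q) => u i q) a * c b x)"
        by (rule sum_positions)
      also have "\<dots> = coeff (monom 1 b) a"
        using ab by (subst c) (simp_all add: coeff_sum mult.commute)
      finally show "(mat (sum_list ss) (sum_list ss) (\<lambda>(k, c). coeff (case unflat ss c of (i, q) => u i q) k) * X') $$ (a, b)
          = 1\<^sub>m (sum_list ss) $$ (a, b)" using ab by auto
    qed (simp_all add: X'_def)
    moreover have "X' \<in> carrier_mat (sum_list ss) (sum_list ss)" by (simp add: X'_def)
    ultimately show ?thesis by blast
  qed
  define V where "V = mat n n (\<lambda>(k, c). coeff (case unflat cs c of (i, q) => v i q) k)"
  define W where "W = mat m m (\<lambda>(k, c). coeff (case unflat rs c of (i, q) => w i q) k)"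
  have Vc: "V \<in> carrier_mat n n" and Wc: "W \<in> carrier_mat m m" by (simp_all add: V_def W_def)
  obtain V' where V': "V' \<in> carrier_mat n n" "V * V' = 1\<^sub>m n"
    using inv[of cs v] F'(2,5) by (auto simp: V_def mn(2) cs_def)
  obtain W' where W': "W' \<in> carrier_mat m m" "W * W' = 1\<^sub>m m"
    using inv[of rs w] F'(1,6) by (auto simp: W_def mn(1) rs_def)
  have W'W: "W' * W = 1\<^sub>m m" using mat_mult_left_right_inverse[OF Wc W'(1,2)] .
  have eq: "X * V = W * Y"
    if X: "X \<in> carrier_mat m n" and Y: "Y \<in> carrier_mat m n"
      and lx: "\<And>j q. j < length Ps ==> q < pair_cols (Ps ! j) ==>
          lin X (v j q) = (\<Sum>p<pair_rows (Ps ! j). smult (f (Ps ! j) $$ (p, q)) (w j p))"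
      and iy: "\<And>i j p q. i < length Ps ==> j < length Ps ==> p < pair_rows (Ps ! i) ==> q < pair_cols (Ps ! j) ==>
         Y $$ (flat rs (i, p), flat cs (j, q)) = (if i = j then f (Ps ! i) $$ (p, q) else 0)"
    for X Y and f :: "mat_pair => complex mat"
  proof (rule eq_matI)
    fix a b assume ab: "a < dim_row (W * Y)" "b < dim_col (W * Y)"
    then have a: "a < m" and b: "b < n" using Y by (simp_all add: W_def)
    obtain j q where jq: "unflat cs b = (j, q)" by fastforce
    then have "(j, q) \<in> positions cs" using unflat_mem[of b cs] b mn by simp
    then have j: "j < length Ps" "q < pair_cols (Ps ! j)" by (auto simp: cs_def)
    have bf: "b = flat cs (j, q)" using flat_unflat[of cs b] jq by simp
    have "(X * V) $$ (a, b) = (\<Sum>k<n. X $$ (a, k) * coeff (v j q) k)"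
      using X a b by (simp add: V_def scalar_prod_def lessThan_atLeast0 jq)
    also have "\<dots> = coeff (lin X (v j q)) a" using X a by (simp add: coeff_lin)
    also have "\<dots> = coeff (\<Sum>(i, p)\<in>positions rs. smult (if i = j then f (Ps ! j) $$ (p, q) else 0) (w i p)) a"
      using lx[OF j] sum_positions_block[of j rs "\<lambda>p. f (Ps ! j) $$ (p, q)" w] j by (simp add: rs_def)
    also have "\<dots> = (\<Sum>(i, p)\<in>positions rs. coeff (w i p) a * Y $$ (flat rs (i, p), b))"
      unfolding coeff_sum bf
    proof (intro sum.cong refl)
      fix x assume "x \<in> positions rs"
      then obtain i p where "x = (i, p)" "i < length Ps" "p < pair_rows (Ps ! i)" by (auto simp: rs_def)
      then show "coeff (case x of (i, p) => smult (if i = j then f (Ps ! j) $$ (p, q) else 0) (w i p)) a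
          = (case x of (i, p) => coeff (w i p) a * Y $$ (flat rs (i, p), flat cs (j, q)))"
        using iy[of i j p q] j by simp
    qed
    also have "\<dots> = (\<Sum>r<m. (case unflat rs r of (i, p) => coeff (w i p) a * Y $$ (flat rs (i, p), b)))"
      unfolding mn(1) by (rule sum_positions[symmetric])
    also have "\<dots> = (\<Sum>r<m. coeff (case unflat rs r of (i, p) => w i p) a * Y $$ (r, b))"
    proof (intro sum.cong refl)
      fix r
      have "flat rs (unflat rs r) = r" by (rule flat_unflat)
      then show "(case unflat rs r of (i, p) => coeff (w i p) a * Y $$ (flat rs (i, p), b))
         = coeff (case unflat rs r of (i, p) => w i p) a * Y $$ (r, b)"
        by (cases "unflat rs r") simp
    qed
    also have "\<dots> = (W * Y) $$ (a, b)" using Y a b by (simp add: W_def scalar_prod_def lessThan_atLeast0)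
    finally show "(X * V) $$ (a, b) = (W * Y) $$ (a, b)" .
  qed (use X Y in \<open>simp_all add: V_def W_def\<close>)
  define D where "D = direct_sum Ps"
  have Dc: "fst D \<in> carrier_mat m n" "snd D \<in> carrier_mat m n"
    using direct_sum_mat_pairs[OF Ps] mn by (auto simp: D_def mat_pairs_def mem_Times_iff rs_def cs_def)
  have e1: "fst P * V = W * fst D"
    by (rule eq[OF Pc(1) Dc(1), of fst]) (use F'(7) direct_sum_index(1)[OF Ps] in \<open>auto simp: D_def rs_def cs_def\<close>)
  have e2: "snd P * V = W * snd D"
    by (rule eq[OF Pc(2) Dc(2), of snd]) (use F'(8) direct_sum_index(2)[OF Ps] in \<open>auto simp: D_def rs_def cs_def\<close>)
  have r: "Y = W' * X * V" if "X * V = W * Y" "X \<in> carrier_mat m n" "Y \<in> carrier_mat m n" for X Y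
  proof -
    have "W' * X * V = W' * (X * V)" using W' that Vc by (intro assoc_mult_mat) auto
    also have "\<dots> = (W' * W) * Y" unfolding that(1)
      using W' that Wc by (intro assoc_mult_mat[symmetric]) auto
    finally show ?thesis using W'W that by simp
  qed
  have "D = (W' * fst P * V, W' * snd P * V)"
    using r[OF e1 Pc(1) Dc(1)] r[OF e2 Pc(2) Dc(2)] by (simp add: prod_eq_iff)
  then show ?thesis using orbitI[OF P W'(1) Wc W'W Vc V'] by (simp add: D_def)
qed

section \<open>Blocks as matrix pairs and the Kronecker form of a pair\<close>

fun bpair :: "kblock => mat_pair" where
  "bpair (LB n) = L_pair n" | "bpair (LTB n) = LT_pair n" | "bpair (DB \<mu> n) = D_pair \<mu> n"

lemma D_pair_mat_pairs: "D_pair \<mu> n \<in> mat_pairs n n"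
  by (cases \<mu>) (auto simp: mat_pairs_def)

lemma bpair_mat_pairs: "bpair b \<in> mat_pairs (brows b) (bcols b)"
  using D_pair_mat_pairs
  by (cases b) (auto simp: mat_pairs_def L_pair_def LT_pair_def L_mat_def R_mat_def)

lemma bpair_dims [simp]: "pair_rows (bpair b) = brows b" "pair_cols (bpair b) = bcols b"
  using mat_pairs_dims[OF bpair_mat_pairs] by auto

lemma is_mat_pair_bpair [simp]: "is_mat_pair (bpair b)"
  using bpair_mat_pairs by (auto simp: is_mat_pair_def)

lemma sum_smult_delta:
  fixes w :: "nat => complex poly"
  shows "(\<Sum>p<n. smult (if q = p then c else 0) (w p)) = (if q < n then smult c (w q) else 0)"
    "(\<Sum>p<n. smult (if q = Suc p then c else 0) (w p)) = (if q \<noteq> 0 \<and> q - 1 < n then smult c (w (q - 1)) else 0)"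
    "(\<Sum>p<n. smult (if p = Suc q then c else 0) (w p)) = (if Suc q < n then smult c (w (Suc q)) else 0)"
proof -
  have *: "(\<Sum>p<n. smult (if r = p then c else 0) (w p)) = (if r < n then smult c (w r) else 0)" for r
  proof -
    have "(\<Sum>p<n. smult (if r = p then c else 0) (w p)) = (\<Sum>p<n. if p = r then smult c (w r) else 0)"
      by (intro sum.cong) auto
    then show ?thesis by simp
  qed
  from * show "(\<Sum>p<n. smult (if q = p then c else 0) (w p)) = (if q < n then smult c (w q) else 0)" .
  have "(\<Sum>p<n. smult (if p = Suc q then c else 0) (w p)) = (\<Sum>p<n. smult (if Suc q = p then c else 0) (w p))"
    by (intro sum.cong) auto
  with * show "(\<Sum>p<n. smult (if p = Suc q then c else 0) (w p)) = (if Suc q < n then smult c (w (Suc q)) else 0)"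
    by simp
  show "(\<Sum>p<n. smult (if q = Suc p then c else 0) (w p)) = (if q \<noteq> 0 \<and> q - 1 < n then smult c (w (q - 1)) else 0)"
    using *[of "q - 1"] by (cases q) auto
qed

lemma sum_smult_jordan:
  fixes w :: "nat => complex poly"
  assumes "q < n"
  shows "(\<Sum>p<n. smult (jordan_block n \<mu> $$ (p, q)) (w p)) = smult \<mu> (w q) + (if q = 0 then 0 else w (q - 1))"
proof -
  have "(\<Sum>p<n. smult (jordan_block n \<mu> $$ (p, q)) (w p))
      = (\<Sum>p<n. smult (if q = p then \<mu> else 0) (w p) + smult (if q = Suc p then 1 else 0) (w p))"
    using assms by (intro sum.cong) (auto simp: jordan_block_def)
  also have "\<dots> = smult \<mu> (w q) + (if q = 0 then 0 else w (q - 1))"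
    using assms by (simp add: sum.distrib sum_smult_delta)
  finally show ?thesis .
qed

lemma sum_smult_one:
  fixes w :: "nat => complex poly"
  assumes "q < n"
  shows "(\<Sum>p<n. smult (1\<^sub>m n $$ (p, q)) (w p)) = w q"
proof -
  have "(\<Sum>p<n. smult (1\<^sub>m n $$ (p, q)) (w p)) = (\<Sum>p<n. smult (if q = p then 1 else 0) (w p))"
    using assms by (intro sum.cong) auto
  then show ?thesis using assms by (simp add: sum_smult_delta)
qed

text \<open>The passage from chains to matrices: for \<open>U = {0}\<close> the chain relations are
  the columns of the two block matrices.\<close>

lemma chain_iff:
  "cp.chain {0} A B b v w \<longleftrightarrow> (\<forall>q<bcols b.
     A (v q) = (\<Sum>p<brows b. smult (fst (bpair b) $$ (p, q)) (w p)) \<and>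
     B (v q) = (\<Sum>p<brows b. smult (snd (bpair b) $$ (p, q)) (w p)))"
proof (cases b)
  case (LB n)
  have "(\<Sum>p<n - 1. smult (L_mat n $$ (p, q)) (w p)) = (if Suc q < n then w q else 0)"
    "(\<Sum>p<n - 1. smult (R_mat n $$ (p, q)) (w p)) = (if q = 0 then 0 else w (q - 1))" if q: "q < n" for q
  proof -
    have "(\<Sum>p<n - 1. smult (L_mat n $$ (p, q)) (w p)) = (\<Sum>p<n - 1. smult (if q = p then 1 else 0) (w p))"
      using q by (intro sum.cong) (auto simp: L_mat_def)
    then show "(\<Sum>p<n - 1. smult (L_mat n $$ (p, q)) (w p)) = (if Suc q < n then w q else 0)"
      by (auto simp: sum_smult_delta)
    have "(\<Sum>p<n - 1. smult (R_mat n $$ (p, q)) (w p)) = (\<Sum>p<n - 1. smult (if q = Suc p then 1 else 0) (w p))"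
      using q by (intro sum.cong) (auto simp: R_mat_def)
    then show "(\<Sum>p<n - 1. smult (R_mat n $$ (p, q)) (w p)) = (if q = 0 then 0 else w (q - 1))"
      using q by (auto simp: sum_smult_delta)
  qed
  then show ?thesis by (auto simp: LB L_pair_def)
next
  case (LTB n)
  have "(\<Sum>p<n. smult ((L_mat n)\<^sup>T $$ (p, q)) (w p)) = w q"
    "(\<Sum>p<n. smult ((R_mat n)\<^sup>T $$ (p, q)) (w p)) = w (Suc q)" if q: "q < n - 1" for q
  proof -
    have "(\<Sum>p<n. smult ((L_mat n)\<^sup>T $$ (p, q)) (w p)) = (\<Sum>p<n. smult (if q = p then 1 else 0) (w p))"
      using q by (intro sum.cong) (auto simp: L_mat_def)
    then show "(\<Sum>p<n. smult ((L_mat n)\<^sup>T $$ (p, q)) (w p)) = w q"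
      using q by (auto simp: sum_smult_delta)
    have "(\<Sum>p<n. smult ((R_mat n)\<^sup>T $$ (p, q)) (w p)) = (\<Sum>p<n. smult (if p = Suc q then 1 else 0) (w p))"
      using q by (intro sum.cong) (auto simp: R_mat_def)
    then show "(\<Sum>p<n. smult ((R_mat n)\<^sup>T $$ (p, q)) (w p)) = w (Suc q)"
      using q by (auto simp: sum_smult_delta)
  qed
  then show ?thesis by (auto simp: LTB LT_pair_def less_diff_conv)
next
  case (DB \<mu> n)
  have "(cp.eigX \<mu> A B (v q) - (if q = 0 then 0 else w (q - 1)) \<in> {0} \<and> cp.eigY \<mu> A B (v q) - w q \<in> {0})
    \<longleftrightarrow> A (v q) = (\<Sum>p<n. smult (fst (D_pair \<mu> n) $$ (p, q)) (w p)) \<and>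
        B (v q) = (\<Sum>p<n. smult (snd (D_pair \<mu> n) $$ (p, q)) (w p))" if q: "q < n" for q
  proof (cases \<mu>)
    case (Finite c)
    show ?thesis
      unfolding Finite D_pair.simps fst_conv snd_conv sum_smult_jordan[OF q] sum_smult_one[OF q]
      by (auto simp: algebra_simps)
  next
    case Infinity
    show ?thesis
      unfolding Infinity D_pair.simps fst_conv snd_conv sum_smult_jordan[OF q] sum_smult_one[OF q]
      by auto
  qed
  then show ?thesis
    unfolding DB cp.chain.simps bcols.simps brows.simps bpair.simps by blast
qed

lemma (in complex_vector_space) add_span_reindex:
  assumes "bij_betw f J I" "\<And>j. j \<in> J ==> t j = u (f j)" "U = {0}"
  shows "add_span U I u \<subseteq> add_span U J t"
proof
  fix x assume "x \<in> add_span U I u"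
  then obtain c where "x - (\<Sum>i\<in>I. c i \<star> u i) \<in> U" by (auto simp: add_span_def)
  moreover have "(\<Sum>i\<in>I. c i \<star> u i) = (\<Sum>j\<in>J. c (f j) \<star> t j)"
    using assms(2) by (simp add: sum_scale_reindex[OF assms(1)])
  ultimately have "x - (\<Sum>j\<in>J. c (f j) \<star> t j) \<in> U" by simp
  then show "x \<in> add_span U J t" by (rule add_spanI)
qed

lemma bij_positions:
  assumes "bij_betw f {..<length ss} {..<length ts}" "\<And>i. i < length ss ==> ss ! i = ts ! f i"
  shows "bij_betw (\<lambda>(i, q). (f i, q)) (positions ss) (positions ts)"
proof -
  have f: "f i < length ts" "inv_into {..<length ss} f (f i) = i" if "i < length ss" for i
    using that assms(1) by (auto simp: bij_betw_def)
  have g: "inv_into {..<length ss} f k < length ss" "f (inv_into {..<length ss} f k) = k" if "k < length ts" for k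
    using that assms(1) by (auto simp: bij_betw_def f_inv_into_f inv_into_into[of k f "{..<length ss}", simplified])
  show ?thesis
    by (rule bij_betw_byWitness[where f'="\<lambda>(k, q). (inv_into {..<length ss} f k, q)"])
       (use f g assms(2) in auto)
qed

lemma frame_reindex:
  assumes F: "is_frame P Ps v w" and f: "bij_betw f {..<length Qs} {..<length Ps}"
    and Q: "\<And>i. i < length Qs ==> Qs ! i = Ps ! f i"
    and s: "sum_list (map pair_rows Qs) = pair_rows P" "sum_list (map pair_cols Qs) = pair_cols P"
  shows "is_frame P Qs (\<lambda>i. v (f i)) (\<lambda>i. w (f i))"
proof -
  have fl: "f i < length Ps" if "i < length Qs" for i using that f by (auto simp: bij_betw_def)
  have sp: "cp.add_span {0} (positions (map g Ps)) (\<lambda>(i, q). u i q)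
      \<subseteq> cp.add_span {0} (positions (map g Qs)) (\<lambda>(i, q). u (f i) q)" for g u
    by (rule cp.add_span_reindex[OF bij_positions[where f=f]]) (use f fl Q in auto)
  show ?thesis
    unfolding is_frame_def using is_frameD(3,4,7,8)[OF F] fl Q s
      order_trans[OF is_frameD(5)[OF F] sp] order_trans[OF is_frameD(6)[OF F] sp] by simp
qed

text \<open>The unit vectors, regrouped by the permutation of the summands, are a frame for the
  permuted sum.\<close>

lemma direct_sum_perm:
  assumes Ps: "\<forall>X\<in>set Ps. is_mat_pair X" and "mset Ps = mset Qs"
  shows "direct_sum Qs \<in> orbit (direct_sum Ps)"
proof -
  from mset_eq_permutation[OF assms(2)[symmetric]] obtain p where
    p: "p permutes {..<length Ps}" "permute_list p Ps = Qs" by blast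
  have l: "length Qs = length Ps" using p by auto
  have Qs: "\<forall>X\<in>set Qs. is_mat_pair X" using Ps mset_eq_setD[OF assms(2)] by simp
  have ml: "sum_list (map g Qs) = sum_list (map g Ps)" for g :: "mat_pair => nat"
    using assms(2) by (metis mset_map sum_mset_sum_list)
  note D = direct_sum_mat_pairs[OF Ps]
  have "is_frame (direct_sum Ps) Qs (\<lambda>i q. monom 1 (flat (map pair_cols Ps) (p i, q)))
     (\<lambda>i q. monom 1 (flat (map pair_rows Ps) (p i, q)))"
    by (rule frame_reindex[OF frame_direct_sum[OF Ps]])
       (use p l permute_list_nth[OF p(1)] ml mat_pairs_dims[OF D] in \<open>auto simp: permutes_imp_bij\<close>)
  from frame_orbit[OF Qs D this] show ?thesis .
qed

theorem kronecker_form: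
  assumes P: "P \<in> mat_pairs m n"
  shows "\<exists>bs. (\<forall>b\<in>set bs. bvalid b) \<and> direct_sum (map bpair bs) \<in> orbit P"
proof -
  have Pd: "pair_rows P = m" "pair_cols P = n" using mat_pairs_dims[OF P] by auto
  have Pc: "fst P \<in> carrier_mat m n" "snd P \<in> carrier_mat m n" using P by (auto simp: mat_pairs_def mem_Times_iff)
  have "cp.pencil_on {0} (vecs n) {0} (vecs m) (lin (fst P)) (lin (snd P))"
    unfolding cp.pencil_on_def
    using Pc lin_vecs[of "fst P"] lin_vecs[of "snd P"]
    by (auto simp: lin_map_lin subspace_vecs cp.subspace_single_0 cp.lin_map_0[OF lin_map_lin]
        cp.subspace_0[OF subspace_vecs])
  from cp.kronecker_basis_exists[OF this basis_monom basis_monom] obtain I ty v w where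
    K: "cp.kronecker_basis {0} (vecs n) {0} (vecs m) (lin (fst P)) (lin (snd P)) I ty v w" by blast
  note K' = K[unfolded cp.kronecker_basis_def]
  have fI: "finite I" and val: "\<And>i. i \<in> I ==> bvalid (ty i)"
    and bv: "cp.basis_mod {0} (col_index I ty) (\<lambda>(i, q). v i q) (vecs n)"
    and bw: "cp.basis_mod {0} (row_index I ty) (\<lambda>(i, q). w i q) (vecs m)"
    and ch: "\<And>i. i \<in> I ==> cp.chain {0} (lin (fst P)) (lin (snd P)) (ty i) (v i) (w i)"
    using K' by auto
  define xs where "xs = sorted_list_of_set I"
  have xs: "set xs = I" "distinct xs" using fI by (auto simp: xs_def)
  define bs where "bs = map ty xs"
  define Ps where "Ps = map bpair bs"
  have len: "length Ps = length xs" by (simp add: Ps_def bs_def)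
  have nth: "Ps ! i = bpair (ty (xs ! i))" "xs ! i \<in> I" if "i < length xs" for i
    using that xs(1) by (auto simp: Ps_def bs_def)
  have crd: "sum_list (map g Ps) = card (Sigma I (\<lambda>i. {..<g (bpair (ty i))}))" for g :: "mat_pair => nat"
  proof -
    have "sum_list (map g Ps) = sum_list (map (\<lambda>i. g (bpair (ty i))) xs)"
      by (simp add: Ps_def bs_def comp_def)
    also have "\<dots> = (\<Sum>i\<in>I. g (bpair (ty i)))" using xs by (simp add: sum_list_distinct_conv_sum_set)
    finally show ?thesis using fI by (simp add: card_SigmaI)
  qed
  \<comment> \<open>Two bases of one space have equal size, so the block sizes add up to
    \<open>m\<close> and \<open>n\<close>, as a frame demands.\<close>
  have cards: "sum_list (map pair_cols Ps) = n" "sum_list (map pair_rows Ps) = m"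
    using cp.basis_mod_card[OF cp.subspace_single_0 bv basis_monom]
      cp.basis_mod_card[OF cp.subspace_single_0 bw basis_monom] by (simp_all add: crd)
  have bij: "bij_betw (\<lambda>(i, q). (xs ! i, q)) (positions (map g Ps)) (Sigma I (\<lambda>i. {..<g (bpair (ty i))}))"
    for g :: "mat_pair => nat"
  proof -
    have "bij_betw ((!) xs) {..<length xs} I" using bij_betw_nth[OF xs(2)] xs(1) by simp
    then have inj: "inj_on ((!) xs) {..<length xs}" and img: "(!) xs ` {..<length xs} = I"
      by (auto simp: bij_betw_def)
    have "inj_on (\<lambda>(i, q). (xs ! i, q)) (positions (map g Ps))"
      using inj by (auto simp: inj_on_def len)
    moreover have "(\<lambda>(i, q). (xs ! i, q)) ` positions (map g Ps) = Sigma I (\<lambda>i. {..<g (bpair (ty i))})"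
    proof (intro Set.set_eqI iffI)
      fix x assume "x \<in> (\<lambda>(i, q). (xs ! i, q)) ` positions (map g Ps)"
      then show "x \<in> Sigma I (\<lambda>i. {..<g (bpair (ty i))})" using nth by (auto simp: len)
    next
      fix x assume x: "x \<in> Sigma I (\<lambda>i. {..<g (bpair (ty i))})"
      then obtain i q where iq: "x = (i, q)" "i \<in> I" "q < g (bpair (ty i))" by auto
      then obtain k where k: "k < length xs" "xs ! k = i" using img by auto
      then have "(k, q) \<in> positions (map g Ps)" using iq nth by (auto simp: len)
      then show "x \<in> (\<lambda>(i, q). (xs ! i, q)) ` positions (map g Ps)"
        using k iq by (intro image_eqI[of _ _ "(k, q)"]) auto
    qed
    ultimately show ?thesis by (simp add: bij_betw_def)
  qed
  have b1: "cp.basis_mod {0} (positions (map pair_cols Ps)) (\<lambda>(i, q). v (xs ! i) q) (vecs n)"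
    by (rule cp.basis_mod_reindex[OF bij[of pair_cols]]) (use bv in auto)
  have b2: "cp.basis_mod {0} (positions (map pair_rows Ps)) (\<lambda>(i, q). w (xs ! i) q) (vecs m)"
    by (rule cp.basis_mod_reindex[OF bij[of pair_rows]]) (use bw in auto)
  have "is_frame P Ps (\<lambda>i. v (xs ! i)) (\<lambda>i. w (xs ! i))"
    unfolding is_frame_def Pd len
  proof (intro conjI allI impI)
    show "sum_list (map pair_rows Ps) = m" "sum_list (map pair_cols Ps) = n" by (simp_all add: cards)
    show "vecs n \<subseteq> cp.add_span {0} (positions (map pair_cols Ps)) (\<lambda>(i, q). v (xs ! i) q)"
      using b1 by (simp add: cp.basis_mod_def)
    show "vecs m \<subseteq> cp.add_span {0} (positions (map pair_rows Ps)) (\<lambda>(i, q). w (xs ! i) q)"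
      using b2 by (simp add: cp.basis_mod_def)
  next
    fix i q assume "i < length xs" "q < pair_cols (Ps ! i)"
    then show "v (xs ! i) q \<in> vecs n" using bv nth[of i] by (auto simp: cp.basis_mod_def)
  next
    fix i q assume "i < length xs" "q < pair_rows (Ps ! i)"
    then show "w (xs ! i) q \<in> vecs m" using bw nth[of i] by (auto simp: cp.basis_mod_def)
  next
    fix i q assume i: "i < length xs" and q: "q < pair_cols (Ps ! i)"
    show "lin (fst P) (v (xs ! i) q) = (\<Sum>p<pair_rows (Ps ! i). smult (fst (Ps ! i) $$ (p, q)) (w (xs ! i) p))"
      "lin (snd P) (v (xs ! i) q) = (\<Sum>p<pair_rows (Ps ! i). smult (snd (Ps ! i) $$ (p, q)) (w (xs ! i) p))"
      using ch[OF nth(2)[OF i]] q unfolding chain_iff nth(1)[OF i] by auto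
  qed
  moreover have "\<forall>X\<in>set Ps. is_mat_pair X" by (auto simp: Ps_def)
  ultimately have "direct_sum Ps \<in> orbit P" using frame_orbit P by blast
  then show ?thesis using val xs(1) by (intro exI[of _ bs]) (auto simp: Ps_def bs_def)
qed

section \<open>Perturbation of one off-diagonal block\<close>

definition triangular :: "mat_pair => mat_pair => mat_pair => mat_pair" where
  "triangular P X P' =
    (four_block_mat (fst P) (fst X) (0\<^sub>m (pair_rows P') (pair_cols P)) (fst P'),
     four_block_mat (snd P) (snd X) (0\<^sub>m (pair_rows P') (pair_cols P)) (snd P'))"

lemma triangular_mat_pairs:
  assumes "P \<in> mat_pairs m1 n1" "P' \<in> mat_pairs m2 n2" "X \<in> mat_pairs m1 n2"
  shows "triangular P X P' \<in> mat_pairs (m1 + m2) (n1 + n2)"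
  using assms by (auto simp: triangular_def mat_pairs_def pair_rows_def pair_cols_def)

lemma sum_lessThan_add:
  fixes f :: "nat => 'a::comm_monoid_add"
  shows "(\<Sum>k<a + b. f k) = (\<Sum>k<a. f k) + (\<Sum>k<b. f (a + k))"
proof -
  have "(\<Sum>k<a + b. f k) = sum f {0..<a} + sum f {a..<a + b}"
    unfolding lessThan_atLeast0 by (simp add: sum.atLeastLessThan_concat)
  also have "sum f {a..<a + b} = (\<Sum>k<b. f (a + k))"
    using sum.shift_bounds_nat_ivl[of f 0 a b] by (simp add: lessThan_atLeast0 add.commute)
  finally show ?thesis by (simp add: lessThan_atLeast0)
qed

lemma lin_triangular:
  assumes "P \<in> mat_pairs m1 n1" "P' \<in> mat_pairs m2 n2" "X \<in> mat_pairs m1 n2"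
    and f: "f = fst \<or> f = snd"
  shows "q < n1 ==> lin (f (triangular P X P')) (monom 1 q) = (\<Sum>p<m1. smult (f P $$ (p, q)) (monom 1 p))"
    "q < n2 ==> lin (f (triangular P X P')) (monom 1 (n1 + q)) =
       (\<Sum>p<m1. smult (f X $$ (p, q)) (monom 1 p)) + (\<Sum>p<m2. smult (f P' $$ (p, q)) (monom 1 (m1 + p)))"
proof -
  have d: "f (triangular P X P') \<in> carrier_mat (m1 + m2) (n1 + n2)" "f P \<in> carrier_mat m1 n1"
    "f P' \<in> carrier_mat m2 n2" "f X \<in> carrier_mat m1 n2"
    using triangular_mat_pairs[OF assms(1-3)] assms by (auto simp: mat_pairs_def mem_Times_iff)
  have e: "f (triangular P X P') = four_block_mat (f P) (f X) (0\<^sub>m m2 n1) (f P')"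
    using f mat_pairs_dims[OF assms(1)] mat_pairs_dims[OF assms(2)] by (auto simp: triangular_def)
  show "lin (f (triangular P X P')) (monom 1 q) = (\<Sum>p<m1. smult (f P $$ (p, q)) (monom 1 p))" if "q < n1"
  proof -
    have "lin (f (triangular P X P')) (monom 1 q) = (\<Sum>r<m1 + m2. smult (f (triangular P X P') $$ (r, q)) (monom 1 r))"
      using d that by (subst lin_monom) auto
    also have "\<dots> = (\<Sum>p<m1. smult (f P $$ (p, q)) (monom 1 p))"
      unfolding sum_lessThan_add using d that by (simp add: e)
    finally show ?thesis .
  qed
  show "lin (f (triangular P X P')) (monom 1 (n1 + q)) =
       (\<Sum>p<m1. smult (f X $$ (p, q)) (monom 1 p)) + (\<Sum>p<m2. smult (f P' $$ (p, q)) (monom 1 (m1 + p)))"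
    if "q < n2"
  proof -
    have "lin (f (triangular P X P')) (monom 1 (n1 + q))
        = (\<Sum>r<m1 + m2. smult (f (triangular P X P') $$ (r, n1 + q)) (monom 1 r))"
      using d that by (subst lin_monom) auto
    also have "\<dots> = (\<Sum>p<m1. smult (f X $$ (p, q)) (monom 1 p)) + (\<Sum>p<m2. smult (f P' $$ (p, q)) (monom 1 (m1 + p)))"
      unfolding sum_lessThan_add using d that by (simp add: e)
    finally show ?thesis .
  qed
qed

definition others :: "nat => nat => 'a list => nat list" where
  "others i j Ps = filter (\<lambda>k. k \<noteq> i \<and> k \<noteq> j) [0..<length Ps]"

lemma others_sum:
  assumes "i < length Ps" "j < length Ps" "i \<noteq> j"
  shows "g (Ps ! i) + g (Ps ! j) + sum_list (map (\<lambda>k. g (Ps ! k)) (others i j Ps)) = (sum_list (map g Ps) :: nat)"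
proof -
  have "sum_list (map g Ps) = (\<Sum>k<length Ps. g (Ps ! k))"
    by (simp add: sum_list_sum_nth lessThan_atLeast0)
  also have "\<dots> = (\<Sum>k\<in>{i, j}. g (Ps ! k)) + (\<Sum>k\<in>{..<length Ps} - {i, j}. g (Ps ! k))"
    using assms by (subst sum.subset_diff[of "{i, j}"]) auto
  also have "{..<length Ps} - {i, j} = set (others i j Ps)" by (auto simp: others_def)
  also have "(\<Sum>k\<in>set (others i j Ps). g (Ps ! k)) = sum_list (map (\<lambda>k. g (Ps ! k)) (others i j Ps))"
    by (simp add: sum_list_distinct_conv_sum_set others_def)
  finally show ?thesis using assms(3) by simp
qed

text \<open>The factor \<epsilon> is kept separate from the direction \<open>X\<close> because the
  orbit is the same for every \<open>\<epsilon> \<noteq> 0\<close>, while the distance from the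
  direct sum is proportional to its modulus.\<close>

definition perturb :: "mat_pair list => nat => nat => complex => mat_pair => mat_pair" where
  "perturb Ps i j \<epsilon> X = (let rs = map pair_rows Ps; cs = map pair_cols Ps;
      f = (\<lambda>Y Z. mat (sum_list rs) (sum_list cs) (\<lambda>(a, b). Y $$ (a, b) +
         (if fst (unflat rs a) = i \<and> fst (unflat cs b) = j
          then \<epsilon> * Z $$ (snd (unflat rs a), snd (unflat cs b)) else 0)))
    in (f (fst (direct_sum Ps)) (fst X), f (snd (direct_sum Ps)) (snd X)))"

lemma perturb_mat_pairs:
  "perturb Ps i j \<epsilon> X \<in> mat_pairs (sum_list (map pair_rows Ps)) (sum_list (map pair_cols Ps))"
  by (simp add: perturb_def Let_def mat_pairs_def)

lemma perturb_lin:
  assumes Ps: "\<forall>X\<in>set Ps. is_mat_pair X" and f: "f = fst \<or> f = snd"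
    and l: "l < length Ps" "q < pair_cols (Ps ! l)" and i: "i < length Ps"
  defines "W \<equiv> \<lambda>l p. monom 1 (flat (map pair_rows Ps) (l, p))"
  shows "lin (f (perturb Ps i j \<epsilon> X)) (monom 1 (flat (map pair_cols Ps) (l, q))) =
    (\<Sum>p<pair_rows (Ps ! l). smult (f (Ps ! l) $$ (p, q)) (W l p)) +
    (if l = j then \<Sum>p<pair_rows (Ps ! i). smult (\<epsilon> * f X $$ (p, q)) (W i p) else 0)"
proof -
  define rs cs where "rs = map pair_rows Ps" and "cs = map pair_cols Ps"
  have Q: "f (perturb Ps i j \<epsilon> X) \<in> carrier_mat (sum_list rs) (sum_list cs)"
    using f perturb_mat_pairs[of Ps i j \<epsilon> X] by (auto simp: mat_pairs_def mem_Times_iff rs_def cs_def)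
  have c: "flat cs (l, q) < sum_list cs" "unflat cs (flat cs (l, q)) = (l, q)"
    using l by (auto simp: cs_def intro!: flat_less unflat_flat)
  have ent: "f (perturb Ps i j \<epsilon> X) $$ (flat rs (k, p), flat cs (l, q)) =
     (if k = l then f (Ps ! l) $$ (p, q) else 0) + (if k = i then (if l = j then \<epsilon> * f X $$ (p, q) else 0) else 0)"
    if k: "k < length Ps" "p < pair_rows (Ps ! k)" for k p
  proof -
    have r: "flat rs (k, p) < sum_list rs" "unflat rs (flat rs (k, p)) = (k, p)"
      using k by (auto simp: rs_def intro!: flat_less unflat_flat)
    show ?thesis
      using f direct_sum_index[OF Ps k(1) l(1) k(2) l(2)] r c
      unfolding rs_def cs_def by (auto simp: perturb_def Let_def)
  qed
  have W: "monom 1 (flat rs x) = (case x of (k, p) => W k p)" for x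
    by (cases x) (simp add: W_def rs_def)
  have "lin (f (perturb Ps i j \<epsilon> X)) (monom 1 (flat cs (l, q)))
    = (\<Sum>r<sum_list rs. smult (f (perturb Ps i j \<epsilon> X) $$ (r, flat cs (l, q))) (monom 1 r))"
    using Q c by (subst lin_monom) auto
  also have "\<dots> = (\<Sum>x\<in>positions rs. smult (f (perturb Ps i j \<epsilon> X) $$ (flat rs x, flat cs (l, q))) (monom 1 (flat rs x)))"
    by (rule sum.reindex_bij_betw[OF bij_flat, symmetric])
  also have "\<dots> = (\<Sum>(k, p)\<in>positions rs. smult (if k = l then f (Ps ! l) $$ (p, q) else 0) (W k p)
      + smult (if k = i then (if l = j then \<epsilon> * f X $$ (p, q) else 0) else 0) (W k p))"
  proof (intro sum.cong refl)
    fix x assume "x \<in> positions rs"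
    then obtain k p where x: "x = (k, p)" "k < length Ps" "p < pair_rows (Ps ! k)" by (auto simp: rs_def)
    show "smult (f (perturb Ps i j \<epsilon> X) $$ (flat rs x, flat cs (l, q))) (monom 1 (flat rs x)) =
      (case x of (k, p) => smult (if k = l then f (Ps ! l) $$ (p, q) else 0) (W k p)
      + smult (if k = i then (if l = j then \<epsilon> * f X $$ (p, q) else 0) else 0) (W k p))"
      unfolding W unfolding x(1) prod.case ent[OF x(2,3)] by (rule smult_add_left)
  qed
  also have "\<dots> = (\<Sum>(k, p)\<in>positions rs. smult (if k = l then f (Ps ! l) $$ (p, q) else 0) (W k p))
      + (\<Sum>(k, p)\<in>positions rs. smult (if k = i then (if l = j then \<epsilon> * f X $$ (p, q) else 0) else 0) (W k p))"
    by (simp add: sum.distrib split_def)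
  also have "(\<Sum>(k, p)\<in>positions rs. smult (if k = l then f (Ps ! l) $$ (p, q) else 0) (W k p))
      = (\<Sum>p<rs ! l. smult (f (Ps ! l) $$ (p, q)) (W l p))"
    using l by (intro sum_positions_block) (simp add: rs_def)
  also have "(\<Sum>(k, p)\<in>positions rs. smult (if k = i then (if l = j then \<epsilon> * f X $$ (p, q) else 0) else 0) (W k p))
      = (\<Sum>p<rs ! i. smult (if l = j then \<epsilon> * f X $$ (p, q) else 0) (W i p))"
    using i by (intro sum_positions_block) (simp add: rs_def)
  finally show ?thesis using l i by (simp add: rs_def cs_def)
qed

lemma orbitE_conj:
  assumes "Q \<in> orbit P" "P \<in> mat_pairs m n"
  obtains S S' R R' where "S \<in> carrier_mat m m" "S' \<in> carrier_mat m m" "S * S' = 1\<^sub>m m"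
    "R \<in> carrier_mat n n" "R' \<in> carrier_mat n n" "R * R' = 1\<^sub>m n" "Q = (S * fst P * R, S * snd P * R)"
  using orbitE[OF assms] by metis

lemma triangular_conj:
  assumes P: "P \<in> mat_pairs m1 n1" "P' \<in> mat_pairs m2 n2" "X \<in> mat_pairs m1 n2"
    and S: "S1 \<in> carrier_mat m1 m1" "S1' \<in> carrier_mat m1 m1" "S1 * S1' = 1\<^sub>m m1"
    and R: "R1 \<in> carrier_mat n1 n1" "R1' \<in> carrier_mat n1 n1" "R1 * R1' = 1\<^sub>m n1"
    and S2: "S2 \<in> carrier_mat m2 m2" "S2' \<in> carrier_mat m2 m2" "S2 * S2' = 1\<^sub>m m2"
    and R2: "R2 \<in> carrier_mat n2 n2" "R2' \<in> carrier_mat n2 n2" "R2 * R2' = 1\<^sub>m n2"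
  shows "triangular (S1 * fst P * R1, S1 * snd P * R1) (S1 * fst X * R2, S1 * snd X * R2)
     (S2 * fst P' * R2, S2 * snd P' * R2) \<in> orbit (triangular P X P')"
proof -
  let ?D = "\<lambda>A B. four_block_mat A (0\<^sub>m (dim_row A) (dim_col B)) (0\<^sub>m (dim_row B) (dim_col A)) B"
  have prod: "four_block_mat A (0\<^sub>m a b) (0\<^sub>m b a) B * four_block_mat A' (0\<^sub>m a b) (0\<^sub>m b a) B' = 1\<^sub>m (a + b)"
    if "A \<in> carrier_mat a a" "B \<in> carrier_mat b b" "A' \<in> carrier_mat a a" "B' \<in> carrier_mat b b"
      "A * A' = 1\<^sub>m a" "B * B' = 1\<^sub>m b" for A A' B B' :: "complex mat" and a b
    using that by (subst mult_four_block_mat[of _ a a _ b _ b _ _ a _ b]) auto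
  have conj: "?D S1 S2 * four_block_mat M Y (0\<^sub>m m2 n1) M' * ?D R1 R2
     = four_block_mat (S1 * M * R1) (S1 * Y * R2) (0\<^sub>m m2 n1) (S2 * M' * R2)"
    if "M \<in> carrier_mat m1 n1" "M' \<in> carrier_mat m2 n2" "Y \<in> carrier_mat m1 n2" for M M' Y
    using that S(1) R(1) S2(1) R2(1)
    by (subst mult_four_block_mat[of _ m1 m1 _ m2 _ m2 _ _ n1 _ n2], simp_all,
        subst mult_four_block_mat[of _ m1 n1 _ n2 _ m2 _ _ n1 _ n2], simp_all)
  have c: "fst P \<in> carrier_mat m1 n1" "snd P \<in> carrier_mat m1 n1" "fst P' \<in> carrier_mat m2 n2" "snd P' \<in> carrier_mat m2 n2"
    "fst X \<in> carrier_mat m1 n2" "snd X \<in> carrier_mat m1 n2"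
    using P by (auto simp: mat_pairs_def mem_Times_iff)
  have d: "pair_rows P' = m2" "pair_cols P = n1" "pair_rows (S2 * fst P' * R2, S2 * snd P' * R2) = m2"
    "pair_cols (S1 * fst P * R1, S1 * snd P * R1) = n1"
    using c S2 R by (simp_all add: pair_rows_def pair_cols_def)
  have "(?D S1 S2 * fst (triangular P X P') * ?D R1 R2, ?D S1 S2 * snd (triangular P X P') * ?D R1 R2) \<in> orbit (triangular P X P')"
    by (rule orbitI[OF triangular_mat_pairs[OF P], of _ "?D S1' S2'" _ "?D R1' R2'"])
       (use S R S2 R2 prod[of S1 m1 S2 m2 S1' S2'] prod[of R1 n1 R2 n2 R1' R2'] in auto)
  then show ?thesis unfolding triangular_def d using c by (simp add: conj)
qed

definition zero_pair :: "nat => nat => mat_pair" where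
  "zero_pair m n = (0\<^sub>m m n, 0\<^sub>m m n)"

lemma zero_pair_mat_pairs: "zero_pair m n \<in> mat_pairs m n"
  by (simp add: zero_pair_def mat_pairs_def)

lemma triangular_orbit:
  assumes P: "P \<in> mat_pairs m1 n1" "P' \<in> mat_pairs m2 n2" and Q: "Q \<in> orbit P" "Q' \<in> orbit P'"
  shows "X \<in> mat_pairs m1 n2 ==> \<exists>Y\<in>mat_pairs m1 n2. triangular Q Y Q' \<in> orbit (triangular P X P')"
    "triangular Q (zero_pair m1 n2) Q' \<in> orbit (triangular P (zero_pair m1 n2) P')"
proof -
  obtain S1 S1' R1 R1' where 1: "S1 \<in> carrier_mat m1 m1" "S1' \<in> carrier_mat m1 m1" "S1 * S1' = 1\<^sub>m m1"
    "R1 \<in> carrier_mat n1 n1" "R1' \<in> carrier_mat n1 n1" "R1 * R1' = 1\<^sub>m n1" "Q = (S1 * fst P * R1, S1 * snd P * R1)"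
    using Q(1) P(1) by (rule orbitE_conj)
  obtain S2 S2' R2 R2' where 2: "S2 \<in> carrier_mat m2 m2" "S2' \<in> carrier_mat m2 m2" "S2 * S2' = 1\<^sub>m m2"
    "R2 \<in> carrier_mat n2 n2" "R2' \<in> carrier_mat n2 n2" "R2 * R2' = 1\<^sub>m n2" "Q' = (S2 * fst P' * R2, S2 * snd P' * R2)"
    using Q(2) P(2) by (rule orbitE_conj)
  note conj = triangular_conj[OF P _ 1(1-6) 2(1-6), folded 1(7) 2(7)]
  show "\<exists>Y\<in>mat_pairs m1 n2. triangular Q Y Q' \<in> orbit (triangular P X P')" if X: "X \<in> mat_pairs m1 n2"
    by (intro bexI[of _ "(S1 * fst X * R2, S1 * snd X * R2)"] conj[OF X]) (use X 1 2 in \<open>auto simp: mat_pairs_def\<close>)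
  show "triangular Q (zero_pair m1 n2) Q' \<in> orbit (triangular P (zero_pair m1 n2) P')"
    using conj[OF zero_pair_mat_pairs] 1 2 by (simp add: zero_pair_def)
qed

text \<open>Multiplying the first row strip by \<epsilon> and the first column strip by
  \<open>1 / \<epsilon>\<close> fixes the diagonal blocks and scales the corner by \<epsilon>; this
  is why an extension can be an arbitrarily small perturbation.\<close>

lemma triangular_scale:
  assumes P: "P \<in> mat_pairs m1 n1" "P' \<in> mat_pairs m2 n2" "X \<in> mat_pairs m1 n2" and \<epsilon>: "\<epsilon> \<noteq> 0"
  shows "triangular P (\<epsilon> \<cdot>\<^sub>m fst X, \<epsilon> \<cdot>\<^sub>m snd X) P' \<in> orbit (triangular P X P')"
proof -
  have c: "fst P \<in> carrier_mat m1 n1" "snd P \<in> carrier_mat m1 n1" "fst P' \<in> carrier_mat m2 n2" "snd P' \<in> carrier_mat m2 n2"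
    "fst X \<in> carrier_mat m1 n2" "snd X \<in> carrier_mat m1 n2"
    using P by (auto simp: mat_pairs_def mem_Times_iff)
  have s: "(a \<cdot>\<^sub>m 1\<^sub>m k) * M * (b \<cdot>\<^sub>m 1\<^sub>m l) = (a * b) \<cdot>\<^sub>m M" if "M \<in> carrier_mat k l" for a b :: complex and k l M
    using that by (simp add: mult_smult_assoc_mat[of _ k k _ l] mult_smult_distrib[of _ k l _ l]) (intro eq_matI, auto)
  have one: "1 \<cdot>\<^sub>m M = M" for M :: "complex mat" by (intro eq_matI) auto
  have i: "(a \<cdot>\<^sub>m 1\<^sub>m k) * (b \<cdot>\<^sub>m 1\<^sub>m k) = 1\<^sub>m k" if "a * b = 1" for a b :: complex and k
    using s[of "1\<^sub>m k" k k a b] that one by simp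
  have "triangular ((\<epsilon> \<cdot>\<^sub>m 1\<^sub>m m1) * fst P * (1 / \<epsilon> \<cdot>\<^sub>m 1\<^sub>m n1), (\<epsilon> \<cdot>\<^sub>m 1\<^sub>m m1) * snd P * (1 / \<epsilon> \<cdot>\<^sub>m 1\<^sub>m n1))
     ((\<epsilon> \<cdot>\<^sub>m 1\<^sub>m m1) * fst X * (1 \<cdot>\<^sub>m 1\<^sub>m n2), (\<epsilon> \<cdot>\<^sub>m 1\<^sub>m m1) * snd X * (1 \<cdot>\<^sub>m 1\<^sub>m n2))
     ((1 \<cdot>\<^sub>m 1\<^sub>m m2) * fst P' * (1 \<cdot>\<^sub>m 1\<^sub>m n2), (1 \<cdot>\<^sub>m 1\<^sub>m m2) * snd P' * (1 \<cdot>\<^sub>m 1\<^sub>m n2)) \<in> orbit (triangular P X P')"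
    by (rule triangular_conj[OF P, where S1'="1 / \<epsilon> \<cdot>\<^sub>m 1\<^sub>m m1" and R1'="\<epsilon> \<cdot>\<^sub>m 1\<^sub>m n1" and
          S2'="1 \<cdot>\<^sub>m 1\<^sub>m m2" and R2'="1 \<cdot>\<^sub>m 1\<^sub>m n2"]) (use \<epsilon> in \<open>auto intro!: i\<close>)
  then show ?thesis unfolding c[THEN s] using \<epsilon> by (simp add: one)
qed

lemma direct_sum_single: "direct_sum [P] = P"
  unfolding direct_sum_def list.map diag_block_mat_singleton by simp

lemma direct_sum_triangular:
  assumes "\<forall>X\<in>set Ps. is_mat_pair X" "\<forall>X\<in>set Qs. is_mat_pair X"
  shows "direct_sum (Ps @ Qs) = triangular (direct_sum Ps) (zero_pair (sum_list (map pair_rows Ps)) (sum_list (map pair_cols Qs))) (direct_sum Qs)"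
proof -
  have d: "map dim_row (map f Ps) = map pair_rows Ps" "map dim_col (map f Ps) = map pair_cols Ps"
    "map dim_row (map f Qs) = map pair_rows Qs" "map dim_col (map f Qs) = map pair_cols Qs" if "f = fst \<or> f = snd" for f
    using pair_dims_map[OF assms(1)] pair_dims_map[OF assms(2)] that by auto
  show ?thesis
    using d[of fst] d[of snd] mat_pairs_dims[OF direct_sum_mat_pairs[OF assms(1)]] mat_pairs_dims[OF direct_sum_mat_pairs[OF assms(2)]]
    by (simp add: triangular_def direct_sum_def zero_pair_def diag_block_mat_append Let_def dim_diag_block_mat' del: map_map)
qed

text \<open>A frame brings the blocks \<open>i\<close> and \<open>j\<close> to the front, where they
  form the triangular pair \<open>T\<close>; scaling removes \<epsilon>, and \<open>T\<close> is
  then replaced by the equivalent sum of \<open>Cs\<close>. The positions may stand in either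
  order.\<close>

lemma perturb_orbit:
  assumes Ps: "\<forall>X\<in>set Ps. is_mat_pair X" and ij: "i < length Ps" "j < length Ps" "i \<noteq> j"
    and X: "X \<in> mat_pairs (pair_rows (Ps ! i)) (pair_cols (Ps ! j))"
    and Cs: "\<forall>X\<in>set Cs. is_mat_pair X" and orb: "direct_sum Cs \<in> orbit (triangular (Ps ! i) X (Ps ! j))"
    and \<epsilon>: "\<epsilon> \<noteq> 0"
  shows "direct_sum (Cs @ map ((!) Ps) (others i j Ps)) \<in> orbit (perturb Ps i j \<epsilon> X)"
proof -
  define Q where "Q = perturb Ps i j \<epsilon> X"
  define ks where "ks = others i j Ps"
  have ks: "k < length Ps" "k \<noteq> i" "k \<noteq> j" if "k \<in> set ks" for k using that by (auto simp: ks_def others_def)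
  define mi ni mj nj where "mi = pair_rows (Ps ! i)" and "ni = pair_cols (Ps ! i)"
    and "mj = pair_rows (Ps ! j)" and "nj = pair_cols (Ps ! j)"
  have Pi: "Ps ! i \<in> mat_pairs mi ni" and Pj: "Ps ! j \<in> mat_pairs mj nj"
    using Ps ij by (auto simp: mi_def ni_def mj_def nj_def is_mat_pair_iff)
  have X': "X \<in> mat_pairs mi nj" using X by (simp add: mi_def nj_def)
  define T where "T = triangular (Ps ! i) (\<epsilon> \<cdot>\<^sub>m fst X, \<epsilon> \<cdot>\<^sub>m snd X) (Ps ! j)"
  have eX: "(\<epsilon> \<cdot>\<^sub>m fst X, \<epsilon> \<cdot>\<^sub>m snd X) \<in> mat_pairs mi nj" using X' by (auto simp: mat_pairs_def)
  have T: "T \<in> mat_pairs (mi + mj) (ni + nj)" unfolding T_def by (rule triangular_mat_pairs[OF Pi Pj eX])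
  have Td: "pair_rows T = mi + mj" "pair_cols T = ni + nj" using mat_pairs_dims[OF T] by auto
  define Ds where "Ds = T # map ((!) Ps) ks"
  define m n where "m = sum_list (map pair_rows Ps)" and "n = sum_list (map pair_cols Ps)"
  have Qm: "Q \<in> mat_pairs m n" unfolding Q_def m_def n_def by (rule perturb_mat_pairs)
  have Qd: "pair_rows Q = m" "pair_cols Q = n" using mat_pairs_dims[OF Qm] by auto
  define U where "U g l q = monom (1::complex) (flat (map g Ps) (l, q))" for g :: "mat_pair => nat" and l q
  \<comment> \<open>In summand 0, which is \<open>T\<close>, the positions of block \<open>i\<close>
    come first, followed by those of block \<open>j\<close> offset by the size of block
    \<open>i\<close>.\<close>
  define V where "V g k q = (case k of 0 => if q < g (Ps ! i) then U g i q else U g j (q - g (Ps ! i)) | Suc k => U g (ks ! k) q)"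
    for g k q
  have Uv: "U g l q \<in> vecs (sum_list (map g Ps))" if "l < length Ps" "q < g (Ps ! l)" for g l q
    unfolding U_def by (rule monom_vecs, rule flat_less) (use that in auto)
  have rel: "lin (f Q) (U pair_cols l q) = (\<Sum>p<pair_rows (Ps ! l). smult (f (Ps ! l) $$ (p, q)) (U pair_rows l p)) +
    (if l = j then \<Sum>p<mi. smult (\<epsilon> * f X $$ (p, q)) (U pair_rows i p) else 0)"
    if "f = fst \<or> f = snd" "l < length Ps" "q < pair_cols (Ps ! l)" for f :: "mat_pair => complex mat" and l q
    using perturb_lin[OF Ps that ij(1), of j \<epsilon> X] by (simp add: Q_def U_def mi_def)
  have nth: "Ds ! Suc k = Ps ! (ks ! k)" "ks ! k \<in> set ks" if "k < length ks" for k using that by (simp_all add: Ds_def)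
  have Vv: "V g k q \<in> vecs (sum_list (map g Ps))" if "k < length Ds" "q < g (Ds ! k)" "g T = g (Ps ! i) + g (Ps ! j)" for g k q
    using that ij Uv[of i q g] Uv[of j "q - g (Ps ! i)" g] Uv[of "ks ! (k - 1)" q g] ks[OF nth(2), of "k - 1"]
    by (auto simp: V_def Ds_def split: nat.split)
  have span: "vecs (sum_list (map g Ps)) \<subseteq> cp.add_span {0} (positions (map g Ds)) (\<lambda>(k, q). V g k q)"
    if gT: "g T = g (Ps ! i) + g (Ps ! j)" for g
  proof (rule poly_vecs_span)
    let ?S = "cp.add_span {0} (positions (map g Ds)) (\<lambda>(k, q). V g k q)"
    show "cp.subspace ?S" by (intro cp.subspace_add_span cp.subspace_single_0)
    have base: "V g k q \<in> ?S" if "k < length Ds" "q < g (Ds ! k)" for k q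
    proof -
      have "(k, q) \<in> positions (map g Ds)" using that by auto
      from cp.add_span_base[OF _ this cp.subspace_single_0, of "\<lambda>(k, q). V g k q"] show ?thesis by simp
    qed
    fix c assume "c < sum_list (map g Ps)"
    then have u: "unflat (map g Ps) c \<in> positions (map g Ps)" by (rule unflat_mem)
    obtain l q where lq: "unflat (map g Ps) c = (l, q)" by fastforce
    then have l: "l < length Ps" "q < g (Ps ! l)" using u by auto
    have "U g l q \<in> ?S"
    proof -
      consider "l = i" | "l = j" | "l \<in> set ks" using l by (auto simp: ks_def others_def)
      then show ?thesis
      proof cases
        case 1
        then show ?thesis using base[of 0 q] l gT by (simp add: V_def Ds_def)
      next
        case 2
        then show ?thesis using base[of 0 "g (Ps ! i) + q"] l gT by (simp add: V_def Ds_def)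
      next
        case 3
        then obtain k where "k < length ks" "ks ! k = l" by (auto simp: in_set_conv_nth)
        then show ?thesis using base[of "Suc k" q] l nth(1)[of k] by (simp add: V_def Ds_def)
      qed
    qed
    then show "monom 1 c \<in> ?S" using flat_unflat[of "map g Ps" c] lq by (simp add: U_def)
  qed
  have rT: "pair_rows T = pair_rows (Ps ! i) + pair_rows (Ps ! j)" and cT: "pair_cols T = pair_cols (Ps ! i) + pair_cols (Ps ! j)"
    by (simp_all add: Td mi_def mj_def ni_def nj_def)
  have sum: "sum_list (map g Ds) = sum_list (map g Ps)" if "g T = g (Ps ! i) + g (Ps ! j)" for g :: "mat_pair => nat"
    using others_sum[OF ij, of g] that by (simp add: Ds_def ks_def comp_def)
  have main: "lin (f Q) (V pair_cols k q) = (\<Sum>p<pair_rows (Ds ! k). smult (f (Ds ! k) $$ (p, q)) (V pair_rows k p))"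
    if f: "f = fst \<or> f = snd" and k: "k < length Ds" and q: "q < pair_cols (Ds ! k)" for f k q
  proof (cases k)
    case 0
    have cm: "f (Ps ! i) \<in> carrier_mat mi ni" "f (Ps ! j) \<in> carrier_mat mj nj" "f X \<in> carrier_mat mi nj"
      using Pi Pj X' f by (auto simp: mat_pairs_def mem_Times_iff)
    have fT: "f T = four_block_mat (f (Ps ! i)) (\<epsilon> \<cdot>\<^sub>m f X) (0\<^sub>m mj ni) (f (Ps ! j))"
      using f by (auto simp: T_def triangular_def mj_def ni_def)
    have q': "q < ni + nj" using q 0 by (simp add: Ds_def Td)
    have R: "(\<Sum>p<pair_rows (Ds ! k). smult (f (Ds ! k) $$ (p, q)) (V pair_rows k p))
      = (\<Sum>p<mi. smult (f T $$ (p, q)) (U pair_rows i p)) + (\<Sum>p<mj. smult (f T $$ (mi + p, q)) (U pair_rows j p))"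
      by (simp add: 0 Ds_def Td sum_lessThan_add V_def mi_def)
    show ?thesis
    proof (cases "q < ni")
      case True
      then have "f T $$ (p, q) = f (Ps ! i) $$ (p, q)" "p' < mj ==> f T $$ (mi + p', q) = 0" if "p < mi" for p p'
        using cm that by (auto simp: fT)
      moreover have "p' < mj ==> f T $$ (mi + p', q) = 0" for p' using cm True by (auto simp: fT)
      ultimately show ?thesis unfolding R using rel[OF f ij(1), of q] True ij(3)
        by (simp add: 0 V_def ni_def[symmetric] mi_def[symmetric])
    next
      case False
      then have "p < mi ==> f T $$ (p, q) = \<epsilon> * f X $$ (p, q - ni)" "p < mj ==> f T $$ (mi + p, q) = f (Ps ! j) $$ (p, q - ni)" for p
        using cm q' by (auto simp: fT)
      then show ?thesis unfolding R using rel[OF f ij(2), of "q - ni"] False q'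
        by (simp add: 0 V_def ni_def[symmetric] mj_def[symmetric] nj_def[symmetric] add.commute)
    qed
  next
    case (Suc k')
    then show ?thesis using rel[OF f, of "ks ! k'" q] nth[of k'] ks[of "ks ! k'"] k q by (simp add: V_def Ds_def)
  qed
  have "is_frame Q Ds (V pair_cols) (V pair_rows)"
    unfolding is_frame_def Qd m_def n_def
    by (intro conjI allI impI sum span Vv main rT cT) auto
  moreover have rest: "\<forall>X\<in>set (map ((!) Ps) ks). is_mat_pair X" using Ps ks by auto
  ultimately have whole: "direct_sum ([T] @ map ((!) Ps) ks) \<in> orbit Q"
    using frame_orbit[OF _ Qm, of Ds] mat_pairs_is[OF T] by (simp add: Ds_def)
  have "direct_sum Cs \<in> orbit T"
  proof -
    have "triangular (Ps ! i) X (Ps ! j) \<in> orbit T"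
      unfolding T_def by (rule orbit_sym[OF triangular_scale[OF Pi Pj X' \<epsilon>] triangular_mat_pairs[OF Pi Pj X']])
    from orbit_trans[OF this orb T] show ?thesis .
  qed
  then have sub: "direct_sum (Cs @ map ((!) Ps) ks) \<in> orbit (direct_sum ([T] @ map ((!) Ps) ks))"
  proof -
    assume C: "direct_sum Cs \<in> orbit T"
    have "sum_list (map pair_rows Cs) = mi + mj"
      using mat_pairs_dims[OF orbit_mat_pairs[OF C T]] mat_pairs_dims[OF direct_sum_mat_pairs[OF Cs]] by simp
    moreover have "direct_sum (map ((!) Ps) ks) \<in> mat_pairs (pair_rows (direct_sum (map ((!) Ps) ks))) (pair_cols (direct_sum (map ((!) Ps) ks)))"
      unfolding is_mat_pair_iff[symmetric] by (rule mat_pairs_is[OF direct_sum_mat_pairs[OF rest]])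
    moreover have "pair_cols (direct_sum (map ((!) Ps) ks)) = sum_list (map pair_cols (map ((!) Ps) ks))"
      using mat_pairs_dims[OF direct_sum_mat_pairs[OF rest]] by simp
    ultimately show ?thesis
      using triangular_orbit(2)[OF T _ C orbit_refl] direct_sum_triangular[OF Cs rest]
        direct_sum_triangular[of "[T]", OF _ rest] mat_pairs_is[OF T] Td by (simp add: direct_sum_single)
  qed
  show ?thesis using orbit_trans[OF whole sub Qm] by (simp add: Q_def ks_def)
qed

lemma unflat_block:
  assumes "a < sum_list ss" "fst (unflat ss a) = i"
  shows "sum_list (take i ss) \<le> a" "a < sum_list (take (Suc i) ss)"
proof -
  obtain q where q: "unflat ss a = (i, q)" using assms(2) by (cases "unflat ss a") auto
  then have "i < length ss" "q < ss ! i" using unflat_mem[OF assms(1)] by auto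
  moreover have "a = sum_list (take i ss) + q" using flat_unflat[of ss a] q by (simp add: flat_def)
  ultimately show "sum_list (take i ss) \<le> a" "a < sum_list (take (Suc i) ss)"
    by (simp_all add: take_Suc_conv_app_nth)
qed

lemma perturb_differs:
  assumes Ps: "\<forall>X\<in>set Ps. is_mat_pair X"
  shows "differs_only_in_block Ps i j (perturb Ps i j \<epsilon> X)"
proof -
  have d: "pair_rows (direct_sum Ps) = sum_list (map pair_rows Ps)"
    "pair_cols (direct_sum Ps) = sum_list (map pair_cols Ps)"
    using mat_pairs_dims[OF direct_sum_mat_pairs[OF Ps]] by auto
  have "fst (unflat (map pair_rows Ps) a) \<noteq> i \<or> fst (unflat (map pair_cols Ps) b) \<noteq> j"
    if "a < sum_list (map pair_rows Ps)" "b < sum_list (map pair_cols Ps)"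
      "\<not> (a \<in> block_rows Ps i \<and> b \<in> block_cols Ps j)" for a b
    using that unflat_block[OF that(1), of i] unflat_block[OF that(2), of j]
    by (auto simp: block_rows_def block_cols_def take_map)
  then show ?thesis
    unfolding differs_only_in_block_def Let_def d using perturb_mat_pairs
    by (auto simp: perturb_def Let_def)
qed

lemma perturb_dist:
  fixes Ps defines "m \<equiv> sum_list (map pair_rows Ps)" and "n \<equiv> sum_list (map pair_cols Ps)"
  shows "mat_pair_dist m n (direct_sum Ps) (perturb Ps i j \<epsilon> X)
    = cmod \<epsilon> * mat_pair_dist m n (direct_sum Ps) (perturb Ps i j 1 X)"
proof -
  define P where "P = direct_sum Ps"
  have *: "(cmod (f P $$ (a, b) - f (perturb Ps i j \<epsilon> X) $$ (a, b)))\<^sup>2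
      = (cmod \<epsilon>)\<^sup>2 * (cmod (f P $$ (a, b) - f (perturb Ps i j 1 X) $$ (a, b)))\<^sup>2"
    if "a < m" "b < n" "f = fst \<or> f = snd" for a b and f :: "mat_pair => complex mat"
    using that by (auto simp: perturb_def Let_def m_def n_def P_def norm_mult power_mult_distrib)
  have "(\<Sum>a<m. \<Sum>b<n. (cmod (fst P $$ (a, b) - fst (perturb Ps i j \<epsilon> X) $$ (a, b)))\<^sup>2
        + (cmod (snd P $$ (a, b) - snd (perturb Ps i j \<epsilon> X) $$ (a, b)))\<^sup>2)
    = (cmod \<epsilon>)\<^sup>2 * (\<Sum>a<m. \<Sum>b<n. (cmod (fst P $$ (a, b) - fst (perturb Ps i j 1 X) $$ (a, b)))\<^sup>2
        + (cmod (snd P $$ (a, b) - snd (perturb Ps i j 1 X) $$ (a, b)))\<^sup>2)"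
    unfolding sum_distrib_left by (intro sum.cong refl) (simp add: * distrib_left)
  then show ?thesis unfolding mat_pair_dist_def P_def[symmetric] by (simp add: real_sqrt_mult)
qed

theorem small_block_perturbationI:
  assumes Ps: "\<forall>X\<in>set Ps. is_mat_pair X" and ij: "i < length Ps" "j < length Ps" "i \<noteq> j"
    and X: "X \<in> mat_pairs (pair_rows (Ps ! i)) (pair_cols (Ps ! j))"
    and Cs: "\<forall>X\<in>set Cs. is_mat_pair X" and orb: "direct_sum Cs \<in> orbit (triangular (Ps ! i) X (Ps ! j))"
  shows "small_block_perturbation Ps i j (orbit (direct_sum (Cs @ map ((!) Ps) (others i j Ps))))"
  unfolding small_block_perturbation_def Let_def
proof (intro allI impI)
  fix \<delta> :: real assume \<delta>: "\<delta> > 0"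
  define P where "P = direct_sum Ps"
  define m n where "m = sum_list (map pair_rows Ps)" and "n = sum_list (map pair_cols Ps)"
  have d: "pair_rows P = m" "pair_cols P = n"
    using mat_pairs_dims[OF direct_sum_mat_pairs[OF Ps]] by (auto simp: P_def m_def n_def)
  define C where "C = mat_pair_dist m n P (perturb Ps i j 1 X)"
  have C: "C \<ge> 0" by (simp add: C_def mat_pair_dist_def sum_nonneg)
  \<comment> \<open>\<open>C\<close> is the distance for \<epsilon> = 1; the added 1 avoids a
    division by zero, and the factor 2 makes the inequality strict.\<close>
  define e where "e = \<delta> / (2 * (C + 1))"
  have e: "e > 0" using \<delta> C by (simp add: e_def)
  define Q where "Q = perturb Ps i j (complex_of_real e) X"
  have "mat_pair_dist m n P Q = e * C"
    using perturb_dist[of Ps i j "complex_of_real e" X] e by (simp add: Q_def m_def n_def P_def C_def)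
  also have "\<dots> < \<delta>"
  proof -
    have "e * C \<le> e * (C + 1)" using e by simp
    also have "\<dots> = \<delta> / 2" using C by (simp add: e_def field_simps)
    finally show ?thesis using \<delta> by linarith
  qed
  finally have dist: "mat_pair_dist (pair_rows P) (pair_cols P) P Q < \<delta>" by (simp add: d)
  have Qm: "Q \<in> mat_pairs m n" unfolding Q_def m_def n_def by (rule perturb_mat_pairs)
  have "direct_sum (Cs @ map ((!) Ps) (others i j Ps)) \<in> orbit Q"
    unfolding Q_def by (rule perturb_orbit[OF Ps ij X Cs orb]) (use e in simp)
  then have "Q \<in> orbit (direct_sum (Cs @ map ((!) Ps) (others i j Ps)))"
    using Qm by (rule orbit_sym)
  moreover have "differs_only_in_block Ps i j Q" unfolding Q_def by (rule perturb_differs[OF Ps])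
  ultimately show "\<exists>Q\<in>orbit (direct_sum (Cs @ map ((!) Ps) (others i j Ps))).
      differs_only_in_block Ps i j Q \<and>
      mat_pair_dist (pair_rows (direct_sum Ps)) (pair_cols (direct_sum Ps)) (direct_sum Ps) Q < \<delta>"
    using dist unfolding P_def by blast
qed

section \<open>Transposition and the elementary moves on pairs of blocks\<close>

definition transpose_pair :: "mat_pair => mat_pair" where
  "transpose_pair P = (transpose_mat (fst P), transpose_mat (snd P))"

lemma transpose_mat_pairs: "P \<in> mat_pairs m n ==> transpose_pair P \<in> mat_pairs n m"
  by (auto simp: transpose_pair_def mat_pairs_def)

lemma direct_sum_transpose:
  "transpose_pair (direct_sum Ps) = direct_sum (map transpose_pair Ps)"
proof -
  have "transpose_mat (diag_block_mat Ms) = diag_block_mat (map transpose_mat Ms)" for Ms :: "complex mat list"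
  proof (induction Ms)
    case (Cons M Ms)
    let ?N = "diag_block_mat Ms"
    have "transpose_mat (four_block_mat M (0\<^sub>m (dim_row M) (dim_col ?N)) (0\<^sub>m (dim_row ?N) (dim_col M)) ?N)
      = four_block_mat (transpose_mat M) (0\<^sub>m (dim_col M) (dim_row ?N)) (0\<^sub>m (dim_col ?N) (dim_row M)) (transpose_mat ?N)"
      by (subst transpose_four_block_mat[of _ "dim_row M" "dim_col M" _ "dim_col ?N" _ "dim_row ?N"]) auto
    then show ?case using Cons by (simp add: Let_def) (metis index_transpose_mat(2) index_transpose_mat(3))
  qed simp
  then show ?thesis by (simp add: transpose_pair_def direct_sum_def o_def)
qed

lemma orbit_transpose:
  assumes "Q \<in> orbit P" "P \<in> mat_pairs m n"
  shows "transpose_pair Q \<in> orbit (transpose_pair P)"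
proof -
  obtain S S' R R' where SR: "S \<in> carrier_mat m m" "S' \<in> carrier_mat m m" "S * S' = 1\<^sub>m m" "S' * S = 1\<^sub>m m"
    "R \<in> carrier_mat n n" "R' \<in> carrier_mat n n" "R * R' = 1\<^sub>m n" "R' * R = 1\<^sub>m n"
    "Q = (S * fst P * R, S * snd P * R)" using assms by (rule orbitE)
  have t: "transpose_mat (S * M * R) = transpose_mat R * transpose_mat M * transpose_mat S" if "M \<in> carrier_mat m n" for M
    using SR that assoc_mult_mat[of "transpose_mat R" n n "transpose_mat M" m "transpose_mat S" m]
    by (subst transpose_mult[of "S * M" m n R n]; (subst transpose_mult[of S m m M n])?) auto
  have i: "transpose_mat R * transpose_mat R' = 1\<^sub>m n" "transpose_mat S * transpose_mat S' = 1\<^sub>m m"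
    using SR(4,8) transpose_mult[of R' n n R n] transpose_mult[of S' m m S m] SR by simp_all
  have "(transpose_mat R * fst (transpose_pair P) * transpose_mat S, transpose_mat R * snd (transpose_pair P) * transpose_mat S)
     \<in> orbit (transpose_pair P)"
    by (rule orbitI[OF transpose_mat_pairs[OF assms(2)], where S'="transpose_mat R'" and R'="transpose_mat S'"])
       (use SR i in auto)
  moreover have "fst P \<in> carrier_mat m n" "snd P \<in> carrier_mat m n" using assms(2) by (auto simp: mat_pairs_def)
  ultimately show ?thesis by (simp add: transpose_pair_def SR(9) t)
qed

text \<open>The summands \<open>cs\<close> come from an extension of \<open>b2\<close> by
  \<open>b1\<close>, with the perturbation in the rows of \<open>b1\<close> and the columns of
  \<open>b2\<close>. The order of the arguments matters: the perturbation is above the diagonal when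
  \<open>b1\<close> precedes \<open>b2\<close>.\<close>

definition ext_move :: "kblock => kblock => kblock list => bool" where
  "ext_move b1 b2 cs \<longleftrightarrow> (\<exists>X\<in>mat_pairs (brows b1) (bcols b2).
     direct_sum (map bpair cs) \<in> orbit (triangular (bpair b1) X (bpair b2)))"

lemma chain_triangular:
  assumes "X \<in> mat_pairs (brows b1) (bcols b2)"
  defines "T \<equiv> triangular (bpair b1) X (bpair b2)"
  shows "cp.chain {0} (lin (fst T)) (lin (snd T)) b1 (monom 1) (monom 1)"
    "X = (0\<^sub>m (brows b1) (bcols b2), 0\<^sub>m (brows b1) (bcols b2)) ==>
     cp.chain {0} (lin (fst T)) (lin (snd T)) b2 (\<lambda>q. monom 1 (bcols b1 + q)) (\<lambda>p. monom 1 (brows b1 + p))"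
proof -
  note L = lin_triangular[OF bpair_mat_pairs bpair_mat_pairs assms(1)]
  show "cp.chain {0} (lin (fst T)) (lin (snd T)) b1 (monom 1) (monom 1)"
    unfolding chain_iff using L(1)[of fst] L(1)[of snd] by (simp add: T_def)
  show "cp.chain {0} (lin (fst T)) (lin (snd T)) b2 (\<lambda>q. monom 1 (bcols b1 + q)) (\<lambda>p. monom 1 (brows b1 + p))"
    if X: "X = (0\<^sub>m (brows b1) (bcols b2), 0\<^sub>m (brows b1) (bcols b2))"
    unfolding chain_iff using L(2)[of fst] L(2)[of snd] by (simp add: T_def X)
qed

text \<open>Equal spans and equal total sizes turn the new chains into a frame of
  \<open>T\<close>.\<close>

lemma rechain_frame:
  assumes T: "T \<in> mat_pairs (brows b1 + brows b2) (bcols b1 + bcols b2)"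
    and R: "cp.rechain (lin (fst T)) (lin (snd T)) b1 (monom 1) (monom 1) b2
       (\<lambda>q. monom 1 (bcols b1 + q)) (\<lambda>p. monom 1 (brows b1 + p)) c1 c2"
    and d: "brows c1 + brows c2 = brows b1 + brows b2" "bcols c1 + bcols c2 = bcols b1 + bcols b2"
  shows "direct_sum (map bpair [c1, c2]) \<in> orbit T"
proof -
  obtain V1 W1 V2 W2 where
    ch: "cp.chain {0} (lin (fst T)) (lin (snd T)) c1 V1 W1" "cp.chain {0} (lin (fst T)) (lin (snd T)) c2 V2 W2"
    and c: "\<And>S. cp.subspace S ==> ((\<forall>q<bcols b1. monom 1 q \<in> S) \<and> (\<forall>q<bcols b2. monom 1 (bcols b1 + q) \<in> S)) =
         ((\<forall>q<bcols c1. V1 q \<in> S) \<and> (\<forall>q<bcols c2. V2 q \<in> S))"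
    and r: "\<And>S. cp.subspace S ==> ((\<forall>q<brows b1. monom 1 q \<in> S) \<and> (\<forall>q<brows b2. monom 1 (brows b1 + q) \<in> S)) =
         ((\<forall>q<brows c1. W1 q \<in> S) \<and> (\<forall>q<brows c2. W2 q \<in> S))"
    using R unfolding cp.rechain_def by blast
  define V where "V i = (if i = 0 then V1 else V2)" for i :: nat
  define W where "W i = (if i = 0 then W1 else W2)" for i :: nat
  have Td: "pair_rows T = brows b1 + brows b2" "pair_cols T = bcols b1 + bcols b2"
    using mat_pairs_dims[OF T] by auto
  have two: "i < length (map bpair [c1, c2]) \<longleftrightarrow> i = 0 \<or> i = 1" for i by auto
  \<comment> \<open>The span condition applied to the subspace \<open>vecs\<close> itself: the new
    vectors have the right length.\<close>
  have mem: "(\<forall>q<g c1. Y1 q \<in> vecs (n1 + n2)) \<and> (\<forall>q<g c2. Y2 q \<in> vecs (n1 + n2))"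
    if "\<And>S. cp.subspace S ==> ((\<forall>q<n1. monom 1 q \<in> S) \<and> (\<forall>q<n2. monom 1 (n1 + q) \<in> S)) =
         ((\<forall>q<g c1. Y1 q \<in> S) \<and> (\<forall>q<g c2. Y2 q \<in> S))" for g :: "kblock => nat" and n1 n2 Y1 Y2
    using that[OF subspace_vecs[of "n1 + n2"]] by (auto simp: monom_vecs)
  have span: "vecs (n1 + n2) \<subseteq> cp.add_span {0} (positions [g c1, g c2]) (\<lambda>(i, q). (if i = 0 then Y1 else Y2) q)"
    if eq: "\<And>S. cp.subspace S ==> ((\<forall>q<n1. monom 1 q \<in> S) \<and> (\<forall>q<n2. monom 1 (n1 + q) \<in> S)) =
         ((\<forall>q<g c1. Y1 q \<in> S) \<and> (\<forall>q<g c2. Y2 q \<in> S))" for g :: "kblock => nat" and n1 n2 Y1 Y2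
  proof -
    define S where "S = cp.add_span {0} (positions [g c1, g c2]) (\<lambda>(i, q). (if i = 0 then Y1 else Y2) q)"
    have sS: "cp.subspace S" unfolding S_def by (intro cp.subspace_add_span cp.subspace_single_0)
    have "(if i = 0 then Y1 else Y2) q \<in> S" if "(i, q) \<in> positions [g c1, g c2]" for i q
      using cp.add_span_base[OF _ that cp.subspace_single_0, of "\<lambda>(i, q). (if i = 0 then Y1 else Y2) q"]
      unfolding S_def by simp
    from this[of 0] this[of 1] have "(\<forall>q<g c1. Y1 q \<in> S) \<and> (\<forall>q<g c2. Y2 q \<in> S)" by auto
    then have mon: "(\<forall>q<n1. monom 1 q \<in> S) \<and> (\<forall>q<n2. monom 1 (n1 + q) \<in> S)" using eq[OF sS] by simp
    have "monom 1 k \<in> S" if "k < n1 + n2" for k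
    proof (cases "k < n1")
      case False
      then have "k - n1 < n2" using that by simp
      with mon have "monom 1 (n1 + (k - n1)) \<in> S" by simp
      then show ?thesis using False by simp
    qed (use mon in simp)
    from poly_vecs_span[OF sS this] show ?thesis by (simp add: S_def)
  qed
  have "is_frame T (map bpair [c1, c2]) V W"
    unfolding is_frame_def Td two
  proof (intro conjI allI impI)
    show "sum_list (map pair_rows (map bpair [c1, c2])) = brows b1 + brows b2"
      "sum_list (map pair_cols (map bpair [c1, c2])) = bcols b1 + bcols b2" using d by simp_all
    show "V i q \<in> vecs (bcols b1 + bcols b2)"
      if "i = 0 \<or> i = 1" "q < pair_cols (map bpair [c1, c2] ! i)" for i q
      using mem[of "bcols b1" "bcols b2" bcols V1 V2, OF c] that by (auto simp: V_def)
    show "W i q \<in> vecs (brows b1 + brows b2)"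
      if "i = 0 \<or> i = 1" "q < pair_rows (map bpair [c1, c2] ! i)" for i q
      using mem[of "brows b1" "brows b2" brows W1 W2, OF r] that by (auto simp: W_def)
    show "vecs (bcols b1 + bcols b2) \<subseteq> cp.add_span {0} (positions (map pair_cols (map bpair [c1, c2]))) (\<lambda>(i, q). V i q)"
      using span[of "bcols b1" "bcols b2" bcols V1 V2, OF c] by (simp add: V_def)
    show "vecs (brows b1 + brows b2) \<subseteq> cp.add_span {0} (positions (map pair_rows (map bpair [c1, c2]))) (\<lambda>(i, q). W i q)"
      using span[of "brows b1" "brows b2" brows W1 W2, OF r] by (simp add: W_def)
    fix i q assume iq: "i = 0 \<or> i = 1" "q < pair_cols (map bpair [c1, c2] ! i)"
    show "lin (fst T) (V i q) = (\<Sum>p<pair_rows (map bpair [c1, c2] ! i).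
              smult (fst (map bpair [c1, c2] ! i) $$ (p, q)) (W i p))"
      "lin (snd T) (V i q) = (\<Sum>p<pair_rows (map bpair [c1, c2] ! i).
              smult (snd (map bpair [c1, c2] ! i) $$ (p, q)) (W i p))"
      using iq ch unfolding chain_iff by (auto simp: V_def W_def)
  qed
  then show ?thesis by (rule frame_orbit[OF _ T, rotated]) auto
qed

definition unit_perturbation :: "ext_complex => nat => nat => nat => nat => mat_pair" where
  "unit_perturbation \<mu> m n p q = (let E = mat m n (\<lambda>(i, j). if i = p \<and> j = q then 1 else 0)
     in if \<mu> = Infinity then (E, 0\<^sub>m m n) else (0\<^sub>m m n, E))"

text \<open>A single 1 in the corner adds a map of rank one to the matrix selected by \<mu>; this
  matches \<open>addA\<close> and \<open>addB\<close> on the side of chains.\<close>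

lemma lin_perturbed:
  fixes \<mu> :: ext_complex
  assumes "p < brows b1" "q < bcols b2"
  defines "X \<equiv> unit_perturbation \<mu> (brows b1) (bcols b2) p q"
    and "Oz \<equiv> (0\<^sub>m (brows b1) (bcols b2), 0\<^sub>m (brows b1) (bcols b2))"
    and "Z \<equiv> \<lambda>x. smult (coeff x (bcols b1 + q)) (monom 1 p)"
  shows "lin (fst (triangular (bpair b1) X (bpair b2))) = cp.addA \<mu> (lin (fst (triangular (bpair b1) Oz (bpair b2)))) Z"
    "lin (snd (triangular (bpair b1) X (bpair b2))) = cp.addB \<mu> (lin (snd (triangular (bpair b1) Oz (bpair b2)))) Z"
proof -
  have bp: "bpair b1 \<in> mat_pairs (brows b1) (bcols b1)" "bpair b2 \<in> mat_pairs (brows b2) (bcols b2)"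
    by (rule bpair_mat_pairs)+
  have c: "fst (bpair b1) \<in> carrier_mat (brows b1) (bcols b1)" "snd (bpair b1) \<in> carrier_mat (brows b1) (bcols b1)"
    "fst (bpair b2) \<in> carrier_mat (brows b2) (bcols b2)" "snd (bpair b2) \<in> carrier_mat (brows b2) (bcols b2)"
    using bp by (auto simp: mat_pairs_def mem_Times_iff)
  define E where "E = mat (brows b1) (bcols b2) (\<lambda>(i, j). if i = p \<and> j = q then 1 else 0 :: complex)"
  have key: "lin (four_block_mat P E (0\<^sub>m (brows b2) (bcols b1)) Q) x
      = lin (four_block_mat P (0\<^sub>m (brows b1) (bcols b2)) (0\<^sub>m (brows b2) (bcols b1)) Q) x + Z x"
    if "P \<in> carrier_mat (brows b1) (bcols b1)" "Q \<in> carrier_mat (brows b2) (bcols b2)" for P Q x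
  proof (rule poly_eqI)
    fix r
    have e: "four_block_mat P E (0\<^sub>m (brows b2) (bcols b1)) Q $$ (r, k)
        = four_block_mat P (0\<^sub>m (brows b1) (bcols b2)) (0\<^sub>m (brows b2) (bcols b1)) Q $$ (r, k)
          + (if k = bcols b1 + q then (if r = p then 1 else 0) else 0)"
      if "r < brows b1 + brows b2" "k < bcols b1 + bcols b2" for k
      using that \<open>P \<in> _\<close> \<open>Q \<in> _\<close> assms(1,2) by (auto simp: E_def)
    have "(\<Sum>k<bcols b1 + bcols b2. (if k = bcols b1 + q then (if r = p then 1 else 0) else 0) * coeff x k)
        = (\<Sum>k<bcols b1 + bcols b2. if k = bcols b1 + q then (if r = p then coeff x k else 0) else 0)"
      by (intro sum.cong refl) auto
    also have "\<dots> = (if r = p then coeff x (bcols b1 + q) else 0)" using assms(2) by simp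
    finally have s: "(\<Sum>k<bcols b1 + bcols b2. (if k = bcols b1 + q then (if r = p then 1 else 0) else 0) * coeff x k)
        = (if r = p then coeff x (bcols b1 + q) else 0)" .
    have "(\<Sum>k<bcols b1 + bcols b2. four_block_mat P E (0\<^sub>m (brows b2) (bcols b1)) Q $$ (r, k) * coeff x k)
        = (\<Sum>k<bcols b1 + bcols b2. four_block_mat P (0\<^sub>m (brows b1) (bcols b2)) (0\<^sub>m (brows b2) (bcols b1)) Q $$ (r, k) * coeff x k)
          + (if r = p then coeff x (bcols b1 + q) else 0)" if "r < brows b1 + brows b2"
      unfolding s[symmetric] sum.distrib[symmetric] distrib_right[symmetric]
      using e[OF that] by (intro sum.cong refl) simp
    then show "coeff (lin (four_block_mat P E (0\<^sub>m (brows b2) (bcols b1)) Q) x) r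
      = coeff (lin (four_block_mat P (0\<^sub>m (brows b1) (bcols b2)) (0\<^sub>m (brows b2) (bcols b1)) Q) x + Z x) r"
      using that assms(1) by (simp add: coeff_lin Z_def)
  qed
  show "lin (fst (triangular (bpair b1) X (bpair b2))) = cp.addA \<mu> (lin (fst (triangular (bpair b1) Oz (bpair b2)))) Z"
    by (cases \<mu>) (auto simp: fun_eq_iff triangular_def X_def Oz_def unit_perturbation_def Let_def
        key[OF c(1,3)] E_def[symmetric])
  show "lin (snd (triangular (bpair b1) X (bpair b2))) = cp.addB \<mu> (lin (snd (triangular (bpair b1) Oz (bpair b2)))) Z"
    by (cases \<mu>) (auto simp: fun_eq_iff triangular_def X_def Oz_def unit_perturbation_def Let_def
        key[OF c(2,4)] E_def[symmetric])
qed

text \<open>Reduces an extension to the chain constructions above: \<open>Z\<close> sends the column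
  \<open>q\<close> of \<open>b2\<close> to the row \<open>p\<close> of \<open>b1\<close> and kills
  every other basis column.\<close>

lemma ext_moveI:
  assumes pq: "p < brows b1" "q < bcols b2"
    and d: "brows c1 + brows c2 = brows b1 + brows b2" "bcols c1 + bcols c2 = bcols b1 + bcols b2"
    and R: "\<And>A B Z v w v' w'. cp.lin_map A ==> cp.lin_map B ==> cp.lin_map Z ==>
      cp.chain {0} A B b1 v w ==> cp.chain {0} A B b2 v' w' ==> (\<And>j. j < bcols b1 ==> Z (v j) = 0) ==>
      (\<And>j. j < bcols b2 ==> Z (v' j) = (if j = q then w p else 0)) ==>
      cp.rechain (cp.addA \<mu> A Z) (cp.addB \<mu> B Z) b1 v w b2 v' w' c1 c2"
  shows "ext_move b1 b2 [c1, c2]"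
proof -
  define X where "X = unit_perturbation \<mu> (brows b1) (bcols b2) p q"
  define O' where "O' = (0\<^sub>m (brows b1) (bcols b2) :: complex mat, 0\<^sub>m (brows b1) (bcols b2) :: complex mat)"
  define Z where "Z x = smult (coeff x (bcols b1 + q)) (monom 1 p)" for x :: "complex poly"
  have X: "X \<in> mat_pairs (brows b1) (bcols b2)"
    by (simp add: X_def unit_perturbation_def Let_def mat_pairs_def)
  have O': "O' \<in> mat_pairs (brows b1) (bcols b2)" by (simp add: O'_def mat_pairs_def)
  define T where "T = triangular (bpair b1) X (bpair b2)"
  have T: "T \<in> mat_pairs (brows b1 + brows b2) (bcols b1 + bcols b2)"
    unfolding T_def by (rule triangular_mat_pairs[OF bpair_mat_pairs bpair_mat_pairs X])
  have lZ: "cp.lin_map Z" by (simp add: cp.lin_map_def Z_def smult_add_left)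
  have "cp.rechain (lin (fst T)) (lin (snd T)) b1 (monom 1) (monom 1) b2
       (\<lambda>q. monom 1 (bcols b1 + q)) (\<lambda>p. monom 1 (brows b1 + p)) c1 c2"
    unfolding T_def X_def lin_perturbed[OF pq] O'_def[symmetric] Z_def[abs_def, symmetric]
    by (rule R[OF lin_map_lin lin_map_lin lZ chain_triangular(1)[OF O'] chain_triangular(2)[OF O' O'_def]])
       (auto simp: Z_def)
  from rechain_frame[OF T this d] X show ?thesis unfolding ext_move_def T_def by blast
qed

lemma add_Finite: "cp.addA (Finite c) A Z = A" "cp.addB (Finite c) B Z = (\<lambda>x. B x + Z x)"
  by (auto simp: fun_eq_iff)

lemma ext_move_LB:
  assumes "1 \<le> j" "j < k"
  shows "ext_move (LB k) (LB j) [LB (Suc j), LB (k - 1)]"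
  \<comment> \<open>The value \<open>Finite 0\<close> selects \<open>B\<close> as the matrix that
    carries the perturbation.\<close>
  by (rule ext_moveI[where \<mu>="Finite 0" and p=0 and q=0])
     (use assms cp.move_LB[OF _ _ _ assms] in \<open>auto simp: add_Finite simp del: cp.chain.simps\<close>)

lemma ext_move_DB:
  assumes "1 \<le> j" "j \<le> k"
  shows "ext_move (DB \<mu> j) (DB \<mu> k) [DB \<mu> (Suc k), DB \<mu> (j - 1)]"
  by (rule ext_moveI[where \<mu>=\<mu> and p=0 and q=0])
     (use assms cp.move_DB[OF _ _ _ assms] in \<open>auto simp del: cp.chain.simps\<close>)

lemma ext_move_DB_LB:
  assumes "1 \<le> n" "1 \<le> k"
  shows "ext_move (DB \<mu> k) (LB n) [LB (Suc n), DB \<mu> (k - 1)]"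
proof (rule ext_moveI[where \<mu>=\<mu> and p=0 and q="if \<mu> = Infinity then n - 1 else 0"])
  fix A B Z v w v' w'
  assume *: "cp.lin_map A" "cp.lin_map B" "cp.lin_map Z" "cp.chain {0} A B (DB \<mu> k) v w"
    "cp.chain {0} A B (LB n) v' w'" "\<And>j. j < bcols (DB \<mu> k) ==> Z (v j) = 0"
    "\<And>j. j < bcols (LB n) ==> Z (v' j) = (if j = (if \<mu> = Infinity then n - 1 else 0) then w 0 else 0)"
  show "cp.rechain (cp.addA \<mu> A Z) (cp.addB \<mu> B Z) (DB \<mu> k) v w (LB n) v' w' (LB (Suc n)) (DB \<mu> (k - 1))"
    by (rule cp.move_DB_LB[OF *(1-3) assms *(4,5)]) (use *(6,7) in auto)
qed (use assms in auto)

fun dual :: "kblock => kblock" where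
  "dual (LB n) = LTB n" | "dual (LTB n) = LB n" | "dual (DB \<mu> n) = DB \<mu> n"

lemma dual_dims [simp]: "brows (dual b) = bcols b" "bcols (dual b) = brows b"
  by (cases b; simp)+

text \<open>\<open>J\<close> reverses the basis, and the hypothesis is symmetry about the
  antidiagonal, which identity matrices and Jordan blocks possess.\<close>

lemma anti_transpose:
  fixes M :: "complex mat"
  assumes M: "M \<in> carrier_mat n n" "\<And>i j. i < n ==> j < n ==> M $$ (n - 1 - j, n - 1 - i) = M $$ (i, j)"
  defines "J \<equiv> mat n n (\<lambda>(i, j). if j = n - 1 - i then 1 else 0)"
  shows "J * transpose_mat M * J = M"
proof (rule eq_matI)
  fix i j assume "i < dim_row M" "j < dim_col M"
  then have ij: "i < n" "j < n" using M by auto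
  have Jc: "J \<in> carrier_mat n n" by (simp add: J_def)
  have left: "(J * N) $$ (i, j) = N $$ (n - 1 - i, j)" if "N \<in> carrier_mat n n" "i < n" "j < n" for N i j
  proof -
    have "(J * N) $$ (i, j) = (\<Sum>k<n. J $$ (i, k) * N $$ (k, j))"
      using that Jc by (simp add: scalar_prod_def atLeast0LessThan)
    also have "\<dots> = (\<Sum>k<n. if k = n - 1 - i then N $$ (k, j) else 0)"
      using that by (intro sum.cong) (auto simp: J_def)
    finally show ?thesis using that by simp
  qed
  have right: "(N * J) $$ (i, j) = N $$ (i, n - 1 - j)" if "N \<in> carrier_mat n n" "i < n" "j < n" for N i j
  proof -
    have "(N * J) $$ (i, j) = (\<Sum>k<n. N $$ (i, k) * J $$ (k, j))"
      using that Jc by (simp add: scalar_prod_def atLeast0LessThan)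
    also have "\<dots> = (\<Sum>k<n. if k = n - 1 - j then N $$ (i, k) else 0)"
      using that by (intro sum.cong) (auto simp: J_def)
    finally show ?thesis using that by simp
  qed
  have c: "J \<in> carrier_mat n n" "transpose_mat M \<in> carrier_mat n n" "n - 1 - i < n" "n - 1 - j < n" using M(1) ij by (auto simp: J_def)
  have "(J * transpose_mat M * J) $$ (i, j) = transpose_mat M $$ (n - 1 - i, n - 1 - j)"
    using right[OF mult_carrier_mat[OF c(1,2)] ij] left[OF c(2) ij(1) c(4)] by simp
  also have "\<dots> = M $$ (i, j)" using M ij c by simp
  finally show "(J * transpose_mat M * J) $$ (i, j) = M $$ (i, j)" .
qed (use M in \<open>auto simp: J_def\<close>)

text \<open>Transposition exchanges the two singular kinds literally; a Jordan pair is only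
  equivalent to its transpose, by reversing the basis.\<close>

lemma dual_transpose: "bpair (dual b) \<in> orbit (transpose_pair (bpair b))"
proof -
  have P: "transpose_pair (bpair b) \<in> mat_pairs (bcols b) (brows b)"
    by (rule transpose_mat_pairs[OF bpair_mat_pairs])
  show ?thesis
  proof (cases b)
    case (DB \<mu> n)
    define J :: "complex mat" where "J = mat n n (\<lambda>(i, j). if j = n - 1 - i then 1 else 0)"
    have at: "J * transpose_mat (fst (bpair b)) * J = fst (bpair b)" "J * transpose_mat (snd (bpair b)) * J = snd (bpair b)"
      unfolding J_def by (rule anti_transpose; cases \<mu>; auto simp: DB jordan_block_def)+
    have "J * transpose_mat (1\<^sub>m n) * J = 1\<^sub>m n"
      unfolding J_def by (rule anti_transpose) auto
    then have "J * J = 1\<^sub>m n" by (simp add: J_def)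
    then have "(J * fst (transpose_pair (bpair b)) * J, J * snd (transpose_pair (bpair b)) * J) \<in> orbit (transpose_pair (bpair b))"
      using P by (intro orbitI[where S'=J and R'=J and m=n and n=n]) (auto simp: J_def DB)
    then show ?thesis by (simp add: transpose_pair_def at[unfolded DB bpair.simps] DB)
  qed (use orbit_refl[OF P] in \<open>simp_all add: transpose_pair_def L_pair_def LT_pair_def\<close>)
qed

text \<open>Transposition turns an extension of \<open>b\<^sub>2\<close> by \<open>b\<^sub>1\<close> into an extension of the dual of \<open>b\<^sub>1\<close> by the dual
  of \<open>b\<^sub>2\<close>; the Jordan blocks have to be reversed.\<close>

lemma ext_move_dual:
  assumes "ext_move b1 b2 [c1, c2]"
  shows "ext_move (dual b2) (dual b1) [dual c1, dual c2]"
proof -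
  obtain X where X: "X \<in> mat_pairs (brows b1) (bcols b2)"
    and orb: "direct_sum (map bpair [c1, c2]) \<in> orbit (triangular (bpair b1) X (bpair b2))"
    using assms by (auto simp: ext_move_def)
  define T where "T = triangular (bpair b1) X (bpair b2)"
  define m1 n1 m2 n2 where "m1 = brows b1" and "n1 = bcols b1" and "m2 = brows b2" and "n2 = bcols b2"
  have P: "bpair b1 \<in> mat_pairs m1 n1" "bpair b2 \<in> mat_pairs m2 n2" "X \<in> mat_pairs m1 n2"
    using bpair_mat_pairs X by (simp_all add: m1_def n1_def m2_def n2_def)
  have T: "T \<in> mat_pairs (m1 + m2) (n1 + n2)" unfolding T_def by (rule triangular_mat_pairs[OF P])
  define T' where "T' = triangular (transpose_pair (bpair b2)) (transpose_pair X) (transpose_pair (bpair b1))"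
  have Pt: "transpose_pair (bpair b1) \<in> mat_pairs n1 m1" "transpose_pair (bpair b2) \<in> mat_pairs n2 m2" "transpose_pair X \<in> mat_pairs n2 m1"
    using P by (auto intro: transpose_mat_pairs)
  have T': "T' \<in> mat_pairs (n2 + n1) (m2 + m1)" unfolding T'_def by (rule triangular_mat_pairs[OF Pt(2,1,3)])
  \<comment> \<open>\<open>W\<close> interchanges the two strips: transposition makes the pair lower
    triangular, and the interchange makes it upper triangular again.\<close>
  define W where "W a b = four_block_mat (0\<^sub>m a b) (1\<^sub>m a) (1\<^sub>m b) (0\<^sub>m b a :: complex mat)" for a b
  have W: "W a b \<in> carrier_mat (a + b) (b + a)" "W a b * W b a = 1\<^sub>m (a + b)" for a b
    unfolding W_def by (simp, subst mult_four_block_mat[of _ a b _ a _ b _ _ a _ b]) auto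
  have c: "fst (bpair b1) \<in> carrier_mat m1 n1" "snd (bpair b1) \<in> carrier_mat m1 n1" "fst (bpair b2) \<in> carrier_mat m2 n2"
    "snd (bpair b2) \<in> carrier_mat m2 n2" "fst X \<in> carrier_mat m1 n2" "snd X \<in> carrier_mat m1 n2"
    using P by (auto simp: mat_pairs_def mem_Times_iff)
  have swap: "W n2 n1 * transpose_mat (four_block_mat M Y (0\<^sub>m m2 n1) M') * W m1 m2
     = four_block_mat (transpose_mat M') (transpose_mat Y) (0\<^sub>m n1 m2) (transpose_mat M)"
    if "M \<in> carrier_mat m1 n1" "M' \<in> carrier_mat m2 n2" "Y \<in> carrier_mat m1 n2" for M M' Y :: "complex mat"
    using that unfolding W_def
    by (subst transpose_four_block_mat[of _ m1 n1 _ n2 _ m2], simp_all,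
        subst mult_four_block_mat[of _ n2 n1 _ n2 _ n1 _ _ m1 _ m2], simp_all,
        subst mult_four_block_mat[of _ n2 m1 _ m2 _ n1 _ _ m2 _ m1], simp_all)
  have "(W n2 n1 * fst (transpose_pair T) * W m1 m2, W n2 n1 * snd (transpose_pair T) * W m1 m2) \<in> orbit (transpose_pair T)"
    by (rule orbitI[OF transpose_mat_pairs[OF T], of _ "W n1 n2" _ "W m2 m1"]) 
      (use W(1)[of n2 n1] W(1)[of n1 n2] W(1)[of m1 m2] W(1)[of m2 m1] W(2)[of n2 n1] W(2)[of m1 m2] in \<open>simp_all add: add.commute\<close>)
  also have "(W n2 n1 * fst (transpose_pair T) * W m1 m2, W n2 n1 * snd (transpose_pair T) * W m1 m2) = T'"
    using mat_pairs_dims[OF P(1)] mat_pairs_dims[OF P(2)] mat_pairs_dims[OF Pt(1)] mat_pairs_dims[OF Pt(2)]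
    by (simp add: T_def T'_def triangular_def transpose_pair_def swap c)
  finally have 1: "T' \<in> orbit (transpose_pair T)" .
  have two: "direct_sum [Q, Q'] = triangular Q (zero_pair (pair_rows Q) (pair_cols Q')) Q'" if "is_mat_pair Q" "is_mat_pair Q'" for Q Q'
    using direct_sum_triangular[of "[Q]" "[Q']"] that by (simp add: direct_sum_single)
  have m: "transpose_pair (bpair c) \<in> mat_pairs (bcols c) (brows c)" for c by (rule transpose_mat_pairs[OF bpair_mat_pairs])
  have "transpose_pair (direct_sum (map bpair [c1, c2])) \<in> orbit (transpose_pair T)"
    using orbit_transpose[OF orb[folded T_def] T] .
  then have 2: "direct_sum [transpose_pair (bpair c1), transpose_pair (bpair c2)] \<in> orbit (transpose_pair T)"
    by (simp add: direct_sum_transpose)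
  have "direct_sum [bpair (dual c1), bpair (dual c2)] \<in> orbit (direct_sum [transpose_pair (bpair c1), transpose_pair (bpair c2)])"
    using triangular_orbit(2)[OF m m dual_transpose dual_transpose, of c1 c2] mat_pairs_dims[OF m] mat_pairs_is[OF m]
    by (simp add: two)
  from orbit_trans[OF 2 this transpose_mat_pairs[OF T]] orbit_sym[OF 1 transpose_mat_pairs[OF T]]
  have 3: "direct_sum [bpair (dual c1), bpair (dual c2)] \<in> orbit T'"
    using T' by (metis orbit_trans)
  have "\<exists>Y\<in>mat_pairs n2 m1. triangular (bpair (dual b2)) Y (bpair (dual b1)) \<in> orbit T'"
    unfolding T'_def by (rule triangular_orbit(1)[OF Pt(2,1) dual_transpose dual_transpose Pt(3)])
  then obtain Y where Y: "Y \<in> mat_pairs n2 m1" "triangular (bpair (dual b2)) Y (bpair (dual b1)) \<in> orbit T'" by blast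
  have "T' \<in> orbit (triangular (bpair (dual b2)) Y (bpair (dual b1)))" by (rule orbit_sym[OF Y(2) T'])
  moreover have "triangular (bpair (dual b2)) Y (bpair (dual b1)) \<in> mat_pairs (n2 + n1) (m2 + m1)"
    by (rule orbit_mat_pairs[OF Y(2) T'])
  ultimately have "direct_sum [bpair (dual c1), bpair (dual c2)] \<in> orbit (triangular (bpair (dual b2)) Y (bpair (dual b1)))"
    using 3 orbit_trans by blast
  then show ?thesis using Y(1) unfolding ext_move_def by (auto simp: n2_def m1_def)
qed

lemma ext_move_LTB:
  assumes "1 \<le> j" "j < k"
  shows "ext_move (LTB j) (LTB k) [LTB (Suc j), LTB (k - 1)]"
  using ext_move_dual[OF ext_move_LB[OF assms]] by simp

lemma ext_move_LTB_DB:
  assumes "1 \<le> m" "1 \<le> k"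
  shows "ext_move (LTB m) (DB \<mu> k) [LTB (Suc m), DB \<mu> (k - 1)]"
  using ext_move_dual[OF ext_move_DB_LB[OF assms]] by simp

section \<open>Semicontinuity of solution spaces\<close>

definition mat_tendsto :: "nat => nat => (nat => mat_pair) => mat_pair => bool" where
  "mat_tendsto m n Q P \<longleftrightarrow> (\<forall>i<m. \<forall>j<n. (\<lambda>t. fst (Q t) $$ (i, j)) \<longlonglongrightarrow> fst P $$ (i, j) \<and>
     (\<lambda>t. snd (Q t) $$ (i, j)) \<longlonglongrightarrow> snd P $$ (i, j))"

lemma entry_le_dist:
  assumes "i < m" "j < n"
  shows "cmod (fst P $$ (i, j) - fst Q $$ (i, j)) \<le> mat_pair_dist m n P Q"
    "cmod (snd P $$ (i, j) - snd Q $$ (i, j)) \<le> mat_pair_dist m n P Q"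
proof -
  define d where "d = (\<lambda>(i, j). (cmod (fst P $$ (i,j) - fst Q $$ (i,j)))\<^sup>2 + (cmod (snd P $$ (i,j) - snd Q $$ (i,j)))\<^sup>2)"
  have "d (i, j) \<le> sum d ({..<m} \<times> {..<n})"
    by (rule member_le_sum) (use assms in \<open>auto simp: d_def\<close>)
  also have "\<dots> = (\<Sum>i<m. \<Sum>j<n. d (i, j))" by (simp add: sum.cartesian_product)
  finally have *: "d (i, j) \<le> (\<Sum>i<m. \<Sum>j<n. d (i, j))" .
  have "cmod (fst P $$ (i, j) - fst Q $$ (i, j)) \<le> sqrt (d (i, j))"
    "cmod (snd P $$ (i, j) - snd Q $$ (i, j)) \<le> sqrt (d (i, j))"
    by (auto intro!: real_le_rsqrt simp: d_def)
  moreover have "sqrt (d (i, j)) \<le> mat_pair_dist m n P Q"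
    using real_sqrt_le_mono[OF *] by (simp add: mat_pair_dist_def d_def)
  ultimately show "cmod (fst P $$ (i, j) - fst Q $$ (i, j)) \<le> mat_pair_dist m n P Q"
    "cmod (snd P $$ (i, j) - snd Q $$ (i, j)) \<le> mat_pair_dist m n P Q"
    by linarith+
qed

lemma closure_metric:
  "P \<in> mat_pair_topology m n closure_of Y \<longleftrightarrow> P \<in> mat_pairs m n \<and>
      (\<forall>r>0. \<exists>Q\<in>Y. Q \<in> mat_pairs m n \<and> mat_pair_dist m n P Q < r)"
proof -
  interpret Metric_space "mat_pairs m n" "mat_pair_dist m n" by (rule Metric_space_mat_pairs)
  show ?thesis unfolding mat_pair_topology_def metric_closure_of by (auto simp: mball_def)
qed

lemma closure_iff:
  "P \<in> mat_pair_topology m n closure_of Y \<longleftrightarrow>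
     P \<in> mat_pairs m n \<and> (\<exists>Q. (\<forall>t. Q t \<in> Y \<inter> mat_pairs m n) \<and> mat_tendsto m n Q P)"
  unfolding closure_metric
proof (intro conj_cong refl iffI)
  assume P: "P \<in> mat_pairs m n" and *: "\<forall>r>0. \<exists>Q\<in>Y. Q \<in> mat_pairs m n \<and> mat_pair_dist m n P Q < r"
  have "\<exists>Q. Q \<in> Y \<inter> mat_pairs m n \<and> mat_pair_dist m n P Q < inverse (real (Suc t))" for t
    using *[rule_format, of "inverse (real (Suc t))"] by auto
  then obtain Q where Q: "\<And>t. Q t \<in> Y \<inter> mat_pairs m n" "\<And>t. mat_pair_dist m n P (Q t) < inverse (real (Suc t))"
    by metis
  have lim: "X \<longlonglongrightarrow> (l::complex)" if "\<And>t. cmod (l - X t) \<le> mat_pair_dist m n P (Q t)" for X l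
  proof -
    have "(\<lambda>t. cmod (X t - l)) \<longlonglongrightarrow> 0"
    proof (rule real_tendsto_sandwich[OF _ _ tendsto_const LIMSEQ_inverse_real_of_nat])
      have "cmod (X t - l) \<le> inverse (real (Suc t))" for t
        using that[of t] Q(2)[of t] by (simp add: norm_minus_commute)
      then show "\<forall>\<^sub>F t in sequentially. cmod (X t - l) \<le> inverse (real (Suc t))" by simp
    qed simp
    then show ?thesis by (simp add: tendsto_norm_zero_iff LIM_zero_iff)
  qed
  have "mat_tendsto m n Q P" unfolding mat_tendsto_def
    by (intro allI impI conjI lim entry_le_dist)
  with Q(1) show "\<exists>Q. (\<forall>t. Q t \<in> Y \<inter> mat_pairs m n) \<and> mat_tendsto m n Q P" by blast
next
  assume P: "P \<in> mat_pairs m n" and "\<exists>Q. (\<forall>t. Q t \<in> Y \<inter> mat_pairs m n) \<and> mat_tendsto m n Q P"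
  then obtain Q where Q: "\<And>t. Q t \<in> Y \<inter> mat_pairs m n" "mat_tendsto m n Q P" by blast
  have "(\<lambda>t. mat_pair_dist m n P (Q t)) \<longlonglongrightarrow> sqrt (\<Sum>i<m. \<Sum>j<n.
     (cmod (fst P $$ (i,j) - fst P $$ (i,j)))\<^sup>2 + (cmod (snd P $$ (i,j) - snd P $$ (i,j)))\<^sup>2)"
    unfolding mat_pair_dist_def
    using Q(2) by (intro tendsto_intros) (auto simp: mat_tendsto_def)
  then have "(\<lambda>t. mat_pair_dist m n P (Q t)) \<longlonglongrightarrow> 0" by simp
  show "\<forall>r>0. \<exists>Q\<in>Y. Q \<in> mat_pairs m n \<and> mat_pair_dist m n P Q < r"
  proof (intro allI impI)
    fix r :: real assume "r > 0"
    from order_tendstoD(2)[OF \<open>_ \<longlonglongrightarrow> 0\<close> this] obtain t where "mat_pair_dist m n P (Q t) < r"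
      by (auto simp: eventually_sequentially)
    then show "\<exists>Q\<in>Y. Q \<in> mat_pairs m n \<and> mat_pair_dist m n P Q < r" using Q(1)[of t] by blast
  qed
qed

text \<open>Bolzano-Weierstrass one coordinate at a time, each time inside the subsequence found
  before.\<close>

lemma bounded_family_subsequence:
  fixes X :: "'i => nat => complex"
  assumes "finite I" "\<And>i. i \<in> I ==> bounded (range (X i))"
  shows "\<exists>r l. strict_mono (r :: nat => nat) \<and> (\<forall>i\<in>I. (\<lambda>t. X i (r t)) \<longlonglongrightarrow> l i)"
  using assms
proof (induction I rule: finite_induct)
  case empty
  show ?case using strict_mono_id by blast
next
  case (insert j I)
  then obtain r l where r: "strict_mono (r :: nat => nat)" "\<And>i. i \<in> I ==> (\<lambda>t. X i (r t)) \<longlonglongrightarrow> l i" by auto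
  have "bounded (range (\<lambda>t. X j (r t)))" using insert.prems[of j] by (auto intro: bounded_subset)
  then obtain l' s where s: "strict_mono s" "((\<lambda>t. X j (r t)) \<circ> s) \<longlonglongrightarrow> l'"
    using bounded_imp_convergent_subsequence by blast
  have "(\<lambda>t. X i ((r \<circ> s) t)) \<longlonglongrightarrow> (l(j := l')) i" if "i \<in> insert j I" for i
  proof (cases "i = j")
    case True
    then show ?thesis using s(2) by (simp add: o_def)
  next
    case False
    with that show ?thesis using LIMSEQ_subseq_LIMSEQ[OF r(2)[of i] s(1)] by (simp add: o_def)
  qed
  moreover have "strict_mono (r \<circ> s)" using r(1) s(1) by (rule strict_mono_o)
  ultimately show ?case by blast
qed

definition act :: "complex \<times> complex => mat_pair => complex poly => complex poly" where
  "act c P x = smult (fst c) (lin (fst P) x) + smult (snd c) (lin (snd P) x)"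

text \<open>With \<open>N = k\<close> these are chains of length \<open>k\<close>. With
  \<open>N = Suc k\<close> there is one more equation, in which \<open>x k = 0\<close>, so that
  \<open>act d\<close> must kill \<open>x (k - 1)\<close>: the \<open>x i\<close> are then the
  coefficients, in descending order, of a polynomial solution of degree below
  \<open>k\<close>.\<close>

definition sols :: "complex \<times> complex => complex \<times> complex => nat => nat => mat_pair => (nat => complex poly) set" where
  "sols c d k N P = {x. (\<forall>i. x i \<in> vecs (pair_cols P)) \<and> (\<forall>i\<ge>k. x i = 0) \<and>
     (\<forall>i<N. act c P (x i) = (if i = 0 then 0 else act d P (x (i - 1))))}"

text \<open>Coordinates \<open>J\<close> that can be prescribed freely and determine the solution,
  so \<open>card J\<close> is the dimension of the solution space. A description by coordinates is
  chosen because their vanishing passes to limits.\<close>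

definition solution_coords ::
    "complex \<times> complex => complex \<times> complex => nat => nat => mat_pair => (nat \<times> nat) set => bool" where
  "solution_coords c d k N P J \<longleftrightarrow> J \<subseteq> {..<k} \<times> {..<pair_cols P} \<and>
     (\<forall>x\<in>sols c d k N P. (\<forall>(i, q)\<in>J. coeff (x i) q = 0) \<longrightarrow> (\<forall>i. x i = 0)) \<and>
     (\<forall>j\<in>J. \<exists>x\<in>sols c d k N P. \<forall>(i, q)\<in>J. coeff (x i) q = (if (i, q) = j then 1 else 0))"

lemma lin_map_act: "cp.lin_map (act c P)"
  using lin_map_lin[of "fst P"] lin_map_lin[of "snd P"]
  unfolding cp.lin_map_def act_def by (simp add: smult_add_right mult.commute)

lemma sols_combine:
  assumes "\<And>j. j \<in> J ==> x j \<in> sols c d k N P"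
  shows "(\<lambda>i. \<Sum>j\<in>J. smult (a j) (x j i)) \<in> sols c d k N P"
proof -
  have s: "act c P (\<Sum>j\<in>J. smult (a j) (f j)) = (\<Sum>j\<in>J. smult (a j) (act c P (f j)))" for c f
    by (simp add: cp.lin_map_sum[OF lin_map_act] cp.lin_map_scale[OF lin_map_act])
  have "act c P (\<Sum>j\<in>J. smult (a j) (x j i)) = (if i = 0 then 0 else act d P (\<Sum>j\<in>J. smult (a j) (x j (i - 1))))"
    if "i < N" for i
    unfolding s using assms that by (auto simp: sols_def intro!: sum.neutral sum.cong)
  moreover have "(\<Sum>j\<in>J. smult (a j) (x j i)) \<in> vecs (pair_cols P)" for i
    using assms by (intro cp.subspace_sum subspace_vecs cp.subspace_scale) (auto simp: sols_def)
  moreover have "(\<Sum>j\<in>J. smult (a j) (x j i)) = 0" if "i \<ge> k" for i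
    using assms that by (intro sum.neutral) (auto simp: sols_def)
  ultimately show ?thesis by (simp add: sols_def)
qed

lemma sols_orbit:
  assumes Q: "Q \<in> mat_pairs m n" and T: "T = (S * fst Q * R, S * snd Q * R)"
    and S: "S \<in> carrier_mat m m" and R: "R \<in> carrier_mat n n" "R' \<in> carrier_mat n n" "R * R' = 1\<^sub>m n"
    and x: "x \<in> sols c d k N Q"
  shows "(\<lambda>i. lin R' (x i)) \<in> sols c d k N T"
proof -
  have cQ: "fst Q \<in> carrier_mat m n" "snd Q \<in> carrier_mat m n" using Q by (auto simp: mat_pairs_def)
  have pc: "pair_cols T = n" "pair_cols Q = n" using cQ R T by (auto simp: pair_cols_def)
  have "lin (S * M * R) (lin R' p) = lin S (lin M p)" if "M \<in> carrier_mat m n" "p \<in> vecs n" for M p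
  proof -
    have "lin (S * M * R) (lin R' p) = lin (S * M) (lin R (lin R' p))"
      using lin_mult[of "S * M" m n R n] S R that(1) by simp
    also have "lin R (lin R' p) = p" using lin_mult[of R n n R' n p] R lin_one[OF that(2)] by simp
    also have "lin (S * M) p = lin S (lin M p)" using lin_mult[of S m m M n] S that(1) by simp
    finally show ?thesis .
  qed
  with cQ have act: "act c T (lin R' p) = lin S (act c Q p)" if "p \<in> vecs n" for p c
    using that by (simp add: act_def T cp.lin_map_add[OF lin_map_lin] cp.lin_map_scale[OF lin_map_lin])
  show ?thesis unfolding sols_def pc mem_Collect_eq
  proof (intro conjI allI impI)
    show "lin R' (x i) \<in> vecs n" for i using lin_vecs[of R' "x i"] R(2) by simp
    show "lin R' (x i) = 0" if "k \<le> i" for i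
      using x that cp.lin_map_0[OF lin_map_lin] by (simp add: sols_def)
    show "act c T (lin R' (x i)) = (if i = 0 then 0 else act d T (lin R' (x (i - 1))))" if "i < N" for i
      using x that by (simp add: act sols_def pc cp.lin_map_0[OF lin_map_lin])
  qed
qed

lemma sum_direct_sum_row:
  assumes Ps: "\<forall>X\<in>set Ps. is_mat_pair X" and a: "a < length Ps" "r < pair_rows (Ps ! a)" and f: "f = fst \<or> f = snd"
  shows "(\<Sum>c<sum_list (map pair_cols Ps). f (direct_sum Ps) $$ (flat (map pair_rows Ps) (a, r), c) * g c)
    = (\<Sum>q<pair_cols (Ps ! a). f (Ps ! a) $$ (r, q) * g (flat (map pair_cols Ps) (a, q)))"
proof -
  let ?cs = "map pair_cols Ps"
  have "(\<Sum>c<sum_list ?cs. f (direct_sum Ps) $$ (flat (map pair_rows Ps) (a, r), c) * g c)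
    = (\<Sum>j\<in>positions ?cs. f (direct_sum Ps) $$ (flat (map pair_rows Ps) (a, r), flat ?cs j) * g (flat ?cs j))"
    by (rule sum.reindex_bij_betw[OF bij_flat, symmetric])
  also have "\<dots> = (\<Sum>(b, q)\<in>positions ?cs. if b = a then f (Ps ! a) $$ (r, q) * g (flat ?cs (a, q)) else 0)"
    using direct_sum_index[OF Ps a(1) _ a(2)] f by (intro sum.cong refl) auto
  also have "\<dots> = (\<Sum>b<length Ps. \<Sum>q<pair_cols (Ps ! b). if b = a then f (Ps ! a) $$ (r, q) * g (flat ?cs (a, q)) else 0)"
    by (subst sum.Sigma[symmetric]) (auto intro!: sum.cong)
  also have "\<dots> = (\<Sum>b<length Ps. if b = a then (\<Sum>q<pair_cols (Ps ! a). f (Ps ! a) $$ (r, q) * g (flat ?cs (a, q))) else 0)"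
    by (intro sum.cong refl) auto
  finally show ?thesis using a(1) by simp
qed

text \<open>Projection to the summand \<open>a\<close>, as \<open>place\<close> below is the
  inclusion of it. Both commute with the action of the pair, so solutions can be restricted to
  summands and extended from them.\<close>

definition part :: "nat list => nat => complex poly => complex poly" where
  "part cs a x = (\<Sum>q<cs ! a. monom (coeff x (flat cs (a, q))) q)"

lemma coeff_part: "coeff (part cs a x) q = (if q < cs ! a then coeff x (flat cs (a, q)) else 0)"
  by (simp add: part_def coeff_sum coeff_monom)

lemma lin_part:
  assumes Ps: "\<forall>X\<in>set Ps. is_mat_pair X" and a: "a < length Ps" and f: "f = fst \<or> f = snd"
  shows "lin (f (Ps ! a)) (part (map pair_cols Ps) a x) = part (map pair_rows Ps) a (lin (f (direct_sum Ps)) x)"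
proof (rule poly_eqI)
  fix r
  have pa: "Ps ! a \<in> mat_pairs (pair_rows (Ps ! a)) (pair_cols (Ps ! a))" using Ps a by (simp add: is_mat_pair_iff[symmetric])
  then have d: "dim_row (f (Ps ! a)) = pair_rows (Ps ! a)" "dim_col (f (Ps ! a)) = pair_cols (Ps ! a)"
    using f by (auto simp: mat_pairs_def)
  have D: "dim_row (f (direct_sum Ps)) = sum_list (map pair_rows Ps)" "dim_col (f (direct_sum Ps)) = sum_list (map pair_cols Ps)"
    using direct_sum_mat_pairs[OF Ps] f by (auto simp: mat_pairs_def)
  show "coeff (lin (f (Ps ! a)) (part (map pair_cols Ps) a x)) r = coeff (part (map pair_rows Ps) a (lin (f (direct_sum Ps)) x)) r"
    unfolding coeff_lin coeff_part d D using a sum_direct_sum_row[OF Ps a _ f, of r "coeff x"] flat_less[of a "map pair_rows Ps" r]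
    by (auto intro!: sum.cong)
qed

lemma part_add: "part cs a (x + y) = part cs a x + part cs a y"
  and part_smult: "part cs a (smult t x) = smult t (part cs a x)"
  and part_0: "part cs a 0 = 0"
  by (rule poly_eqI, simp add: coeff_part)+

lemma sols_part:
  assumes Ps: "\<forall>X\<in>set Ps. is_mat_pair X" and a: "a < length Ps" and x: "x \<in> sols c d k N (direct_sum Ps)"
  shows "(\<lambda>i. part (map pair_cols Ps) a (x i)) \<in> sols c d k N (Ps ! a)"
proof -
  have act: "act c (Ps ! a) (part (map pair_cols Ps) a p) = part (map pair_rows Ps) a (act c (direct_sum Ps) p)" for p c
    using lin_part[OF Ps a, of fst] lin_part[OF Ps a, of snd] by (simp add: act_def part_add part_smult)
  show ?thesis using x unfolding sols_def by (auto simp: act part_0 vecs_def coeff_part a)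
qed

definition place :: "nat list => nat => complex poly => complex poly" where
  "place cs a y = (\<Sum>q<cs ! a. monom (coeff y q) (flat cs (a, q)))"

lemma coeff_place:
  assumes "a < length cs" "b < length cs" "q < cs ! b"
  shows "coeff (place cs a y) (flat cs (b, q)) = (if a = b then coeff y q else 0)"
proof -
  have inj: "flat cs (a, p) = flat cs (b, q) \<longleftrightarrow> a = b \<and> p = q" if "p < cs ! a" for p
  proof
    assume "flat cs (a, p) = flat cs (b, q)"
    then have "unflat cs (flat cs (a, p)) = unflat cs (flat cs (b, q))" by simp
    then show "a = b \<and> p = q" unfolding unflat_flat[OF assms(1) that] unflat_flat[OF assms(2,3)] by simp
  qed simp
  have "coeff (place cs a y) (flat cs (b, q)) = (\<Sum>p<cs ! a. if p = q then (if a = b then coeff y q else 0) else 0)"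
    unfolding place_def coeff_sum coeff_monom
  proof (rule sum.cong[OF refl])
    fix p assume "p \<in> {..<cs ! a}"
    then have "flat cs (a, p) = flat cs (b, q) \<longleftrightarrow> a = b \<and> p = q" using inj[of p] by simp
    then show "(if flat cs (a, p) = flat cs (b, q) then coeff y p else 0) =
        (if p = q then if a = b then coeff y q else 0 else 0)" by simp
  qed
  also have "\<dots> = (if a = b then coeff y q else 0)" using assms(3) by (simp del: if_weak_cong)
  finally show ?thesis .
qed

lemma place_vecs: "a < length cs ==> place cs a y \<in> vecs (sum_list cs)"
  unfolding place_def by (intro cp.subspace_sum subspace_vecs monom_vecs) (auto intro: flat_less)

lemma poly_eq_flat:
  assumes "x \<in> vecs (sum_list cs)" "y \<in> vecs (sum_list cs)"
    "\<And>b q. b < length cs ==> q < cs ! b ==> coeff x (flat cs (b, q)) = coeff y (flat cs (b, q))"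
  shows "x = y"
proof (rule poly_eqI)
  fix c
  show "coeff x c = coeff y c"
  proof (cases "c < sum_list cs")
    case True
    obtain b q where bq: "unflat cs c = (b, q)" by fastforce
    then show ?thesis using unflat_mem[OF True] flat_unflat[of cs c] assms(3)[of b q] by auto
  qed (use assms(1,2) in \<open>auto simp: vecs_def\<close>)
qed

lemma lin_place:
  assumes Ps: "\<forall>X\<in>set Ps. is_mat_pair X" and a: "a < length Ps" and f: "f = fst \<or> f = snd"
  shows "lin (f (direct_sum Ps)) (place (map pair_cols Ps) a y) = place (map pair_rows Ps) a (lin (f (Ps ! a)) y)"
proof (rule poly_eq_flat[of _ "map pair_rows Ps"])
  have D: "dim_row (f (direct_sum Ps)) = sum_list (map pair_rows Ps)" "dim_col (f (direct_sum Ps)) = sum_list (map pair_cols Ps)"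
    using direct_sum_mat_pairs[OF Ps] f by (auto simp: mat_pairs_def)
  have pa: "Ps ! a \<in> mat_pairs (pair_rows (Ps ! a)) (pair_cols (Ps ! a))" using Ps a by (simp add: is_mat_pair_iff[symmetric])
  then have d: "dim_row (f (Ps ! a)) = pair_rows (Ps ! a)" "dim_col (f (Ps ! a)) = pair_cols (Ps ! a)"
    using f by (auto simp: mat_pairs_def)
  show "lin (f (direct_sum Ps)) (place (map pair_cols Ps) a y) \<in> vecs (sum_list (map pair_rows Ps))"
    using lin_vecs[of "f (direct_sum Ps)"] by (simp add: D)
  show "place (map pair_rows Ps) a (lin (f (Ps ! a)) y) \<in> vecs (sum_list (map pair_rows Ps))"
    using a by (simp add: place_vecs)
  fix b r assume b: "b < length (map pair_rows Ps)" "r < map pair_rows Ps ! b"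
  have "(\<Sum>c<sum_list (map pair_cols Ps). f (direct_sum Ps) $$ (flat (map pair_rows Ps) (b, r), c) * coeff (place (map pair_cols Ps) a y) c)
     = (\<Sum>q<pair_cols (Ps ! b). f (Ps ! b) $$ (r, q) * (if a = b then coeff y q else 0))"
    using b a by (subst sum_direct_sum_row[OF Ps _ _ f]) (auto simp: coeff_place intro!: sum.cong)
  moreover have "coeff (place (map pair_rows Ps) a (lin (f (Ps ! a)) y)) (flat (map pair_rows Ps) (b, r))
     = (if a = b then \<Sum>q<pair_cols (Ps ! b). f (Ps ! b) $$ (r, q) * coeff y q else 0)"
    using b a d by (cases "a = b") (simp_all add: coeff_place coeff_lin)
  ultimately show "coeff (lin (f (direct_sum Ps)) (place (map pair_cols Ps) a y)) (flat (map pair_rows Ps) (b, r))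
     = coeff (place (map pair_rows Ps) a (lin (f (Ps ! a)) y)) (flat (map pair_rows Ps) (b, r))"
    using b flat_less[of b "map pair_rows Ps" r] by (auto simp: coeff_lin D)
qed

lemma place_add: "place cs a (x + y) = place cs a x + place cs a y"
  and place_smult: "place cs a (smult t x) = smult t (place cs a x)"
  and place_0: "place cs a 0 = 0"
  by (simp_all add: place_def add_monom[symmetric] smult_monom sum.distrib smult_sum2)

lemma sols_place:
  assumes Ps: "\<forall>X\<in>set Ps. is_mat_pair X" and a: "a < length Ps" and x: "x \<in> sols c d k N (Ps ! a)"
  shows "(\<lambda>i. place (map pair_cols Ps) a (x i)) \<in> sols c d k N (direct_sum Ps)"
proof -
  have act: "act c (direct_sum Ps) (place (map pair_cols Ps) a p) = place (map pair_rows Ps) a (act c (Ps ! a) p)" for p c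
    using lin_place[OF Ps a, of fst] lin_place[OF Ps a, of snd] by (simp add: act_def place_add place_smult)
  have pc: "pair_cols (direct_sum Ps) = sum_list (map pair_cols Ps)"
    using mat_pairs_dims[OF direct_sum_mat_pairs[OF Ps]] by simp
  show ?thesis using x a unfolding sols_def pc by (auto simp: act place_0 place_vecs)
qed

text \<open>The dual solutions \<open>y b j\<close> of all summands outnumber the linear conditions
  \<phi>, so a nontrivial combination meets every condition. It is not zero, since its coordinate at
  the position \<open>(b, j)\<close> is the coefficient of \<open>y b j\<close>.\<close>

lemma direct_sum_solution:
  fixes \<phi> :: "'t => (nat => complex poly) => complex"
  assumes Qs: "\<forall>X\<in>set Qs. is_mat_pair X"
    and J: "\<And>b. b < length Qs ==> solution_coords c d k N (Qs ! b) (J b)"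
    and T: "finite T" "card T < (\<Sum>b<length Qs. card (J b))"
    and \<phi>: "\<And>t x y. \<phi> t (\<lambda>i. x i + y i) = \<phi> t x + \<phi> t y" "\<And>t s x. \<phi> t (\<lambda>i. smult s (x i)) = s * \<phi> t x"
  shows "\<exists>x\<in>sols c d k N (direct_sum Qs). (\<forall>t\<in>T. \<phi> t x = 0) \<and> (\<exists>i. x i \<noteq> 0)"
proof -
  have Jsub: "J b \<subseteq> {..<k} \<times> {..<pair_cols (Qs ! b)}" if "b < length Qs" for b
    using J[OF that] by (simp add: solution_coords_def)
  have Jfin: "finite (J b)" if "b < length Qs" for b
    using finite_subset[OF Jsub[OF that]] by simp
  define good where "good b j x \<longleftrightarrow> x \<in> sols c d k N (Qs ! b) \<and>
      (\<forall>(i, q)\<in>J b. coeff (x i) q = (if (i, q) = j then 1 else 0))" for b j x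
  define y where "y b j = (SOME x. good b j x)" for b j
  have good: "good b j (y b j)" if "b < length Qs" "j \<in> J b" for b j
    unfolding y_def by (rule someI_ex[of "good b j"])
      (use J[OF that(1), unfolded solution_coords_def, THEN conjunct2, THEN conjunct2, rule_format, OF that(2)]
        in \<open>unfold good_def Bex_def\<close>)
  have y: "y b j \<in> sols c d k N (Qs ! b)" if "b < length Qs" "j \<in> J b" for b j
    using good[OF that] by (simp add: good_def)
  have y2: "coeff (y b j i) q = (if (i, q) = j then 1 else 0)" if "b < length Qs" "j \<in> J b" "(i, q) \<in> J b" for b j i q
    using good[OF that(1,2)] that(3) unfolding good_def by (auto dest: bspec)
  define U where "U = (SIGMA b:{..<length Qs}. J b)"
  define z where "z = (\<lambda>(b, j) i. place (map pair_cols Qs) b (y b j i))"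
  have z: "z u \<in> sols c d k N (direct_sum Qs)" if "u \<in> U" for u
  proof -
    have u: "fst u < length Qs" "snd u \<in> J (fst u)" using that by (auto simp: U_def)
    from sols_place[OF Qs u(1) y[OF u]] show ?thesis by (simp add: z_def case_prod_beta)
  qed
  have fU: "finite U" using Jfin by (auto simp: U_def)
  have "card T < card U" using T(2) Jfin by (simp add: U_def card_SigmaI)
  from underdetermined_system[OF T(1) fU this, of "\<lambda>u t. \<phi> t (z u)"]
  obtain a where a: "\<And>t. t \<in> T ==> (\<Sum>u\<in>U. a u * \<phi> t (z u)) = 0" "\<exists>u\<in>U. a u \<noteq> 0"
    by (auto simp: mult.commute)
  define x where "x i = (\<Sum>u\<in>U. smult (a u) (z u i))" for i
  have "x \<in> sols c d k N (direct_sum Qs)"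
    unfolding x_def[abs_def] by (rule sols_combine) (rule z)
  moreover have "\<phi> t x = 0" if "t \<in> T" for t
  proof -
    have "\<phi> t (\<lambda>i. \<Sum>u\<in>F. smult (a u) (z u i)) = (\<Sum>u\<in>F. a u * \<phi> t (z u))" if "finite F" for F
      using that
    proof induction
      case empty
      show ?case using \<phi>(2)[of t 0 "\<lambda>i. 0"] by simp
    qed (simp add: \<phi>)
    from this[OF fU] a(1)[OF that] show ?thesis by (simp add: x_def[abs_def])
  qed
  moreover have "\<exists>i. x i \<noteq> 0"
  proof -
    from a(2) obtain b i q where u: "b < length Qs" "(i, q) \<in> J b" "a (b, (i, q)) \<noteq> 0" by (auto simp: U_def)
    have q: "q < map pair_cols Qs ! b" "b < length (map pair_cols Qs)" using Jsub[OF u(1)] u by auto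
    have "coeff (x i) (flat (map pair_cols Qs) (b, q)) = (\<Sum>u\<in>U. if u = (b, (i, q)) then a u else 0)"
      unfolding x_def coeff_sum coeff_smult
    proof (rule sum.cong[OF refl])
      fix u assume "u \<in> U"
      moreover obtain b' j where "u = (b', j)" by (cases u)
      ultimately have u': "u = (b', j)" "b' < length Qs" "j \<in> J b'" by (auto simp: U_def)
      show "a u * coeff (z u i) (flat (map pair_cols Qs) (b, q)) = (if u = (b, (i, q)) then a u else 0)"
        using u u' q y2[of b j i q] by (auto simp: z_def coeff_place)
    qed
    also have "\<dots> = a (b, (i, q))" using fU u by (simp add: U_def)
    finally show ?thesis using u(3) by (intro exI[of _ i]) auto
  qed
  ultimately show ?thesis by blast
qed

text \<open>Otherwise each \<open>Q t\<close> has a solution of norm 1 that vanishes at all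
  coordinates which determine a solution of the limit pair. By compactness a subsequence converges
  to a solution of the limit pair with norm 1 and the same vanishing coordinates, but such a
  solution is zero.\<close>

theorem solutions_semicontinuous:
  fixes as bs :: "'b list"
  assumes g: "\<And>b. b \<in> set as \<union> set bs ==> is_mat_pair (g b)"
    and J: "\<And>b. b \<in> set as \<union> set bs ==> solution_coords c d k N (g b) (J b)"
    and P: "direct_sum (map g as) \<in> mat_pairs m n"
    and Q: "direct_sum (map g bs) \<in> mat_pairs m n" "\<And>t. Q t \<in> orbit (direct_sum (map g bs))"
    and lim: "mat_tendsto m n Q (direct_sum (map g as))"
  shows "sum_list (map (\<lambda>b. card (J b)) bs) \<le> sum_list (map (\<lambda>b. card (J b)) as)"
proof (rule ccontr)
  assume "\<not> ?thesis"
  then have less: "(\<Sum>a<length as. card (J (as ! a))) < (\<Sum>b<length bs. card (J (bs ! b)))"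
    by (simp add: sum_list_sum_nth atLeast0LessThan)
  have Ps: "\<forall>X\<in>set (map g as). is_mat_pair X" and Qs: "\<forall>X\<in>set (map g bs). is_mat_pair X" using g by auto
  define cs where "cs = map pair_cols (map g as)"
  have n: "n = sum_list cs" and pcP: "pair_cols (direct_sum (map g as)) = n"
    using mat_pairs_dims[OF P] mat_pairs_dims[OF direct_sum_mat_pairs[OF Ps]] by (auto simp: cs_def)
  have Jfin: "finite (J b)" if "b \<in> set as" for b
    using J[of b] that finite_subset[of "J b" "{..<k} \<times> {..<pair_cols (g b)}"] by (auto simp: solution_coords_def)
  define T where "T = (SIGMA a:{..<length as}. J (as ! a))"
  have fT: "finite T" and cT: "card T = (\<Sum>a<length as. card (J (as ! a)))"
    unfolding T_def using Jfin by (auto intro!: finite_SigmaI simp: card_SigmaI)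
  define I where "I = {..<k} \<times> {..<n}"
  have "\<exists>x\<in>sols c d k N (Q t). (\<forall>(a, i, q)\<in>T. coeff (x i) (flat cs (a, q)) = 0) \<and> (\<Sum>(i, q)\<in>I. cmod (coeff (x i) q)) = 1" for t
  proof -
    obtain S S' R R' where SR: "S \<in> carrier_mat m m" "S' \<in> carrier_mat m m" "S * S' = 1\<^sub>m m" "S' * S = 1\<^sub>m m"
      "R \<in> carrier_mat n n" "R' \<in> carrier_mat n n" "R * R' = 1\<^sub>m n" "R' * R = 1\<^sub>m n"
      "Q t = (S * fst (direct_sum (map g bs)) * R, S * snd (direct_sum (map g bs)) * R)"
      using Q(2)[of t] Q(1) by (rule orbitE)
    \<comment> \<open>The conditions are imposed on \<open>lin R' (x i)\<close>, which is the
      solution transported to \<open>Q t\<close>; so they concern the same coordinates for every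
      \<open>t\<close>.\<close>
    have "\<exists>x\<in>sols c d k N (direct_sum (map g bs)).
      (\<forall>t\<in>T. (\<lambda>(a, i, q). coeff (lin R' (x i)) (flat cs (a, q))) t = 0) \<and> (\<exists>i. x i \<noteq> 0)"
      by (rule direct_sum_solution[OF Qs, of _ _ _ _ "\<lambda>b. J (bs ! b)"])
        (use J less in \<open>auto simp: fT cT cp.lin_map_add[OF lin_map_lin] cp.lin_map_scale[OF lin_map_lin]\<close>)
    then obtain x where x1: "x \<in> sols c d k N (direct_sum (map g bs))"
      and x2: "\<forall>t\<in>T. (case t of (a, i, q) => coeff (lin R' (x i)) (flat cs (a, q))) = 0" and "\<exists>i. x i \<noteq> 0" by blast
    then obtain i0 where "x i0 \<noteq> 0" by blast
    note x = x1 x2[THEN bspec, of "(_, _, _)", unfolded prod.case] this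
    define x' where "x' i = lin R' (x i)" for i
    have x': "x' \<in> sols c d k N (Q t)"
      unfolding x'_def[abs_def] by (rule sols_orbit[OF Q(1) SR(9,1,5,6,7) x(1)])
    have pcQ: "pair_cols (Q t) = n" using mat_pairs_dims[OF orbit_mat_pairs[OF Q(2) Q(1)]] by simp
    have "x i0 \<in> vecs n" using x(1) mat_pairs_dims[OF Q(1)] by (auto simp: sols_def)
    then have "lin R (x' i0) = x i0"
      unfolding x'_def using lin_mult[of R n n R' n] SR lin_one by metis
    then have "x' i0 \<noteq> 0" using x(3) cp.lin_map_0[OF lin_map_lin, of R] by auto
    moreover have "\<forall>i\<ge>k. x' i = 0" using x' by (simp add: sols_def)
    ultimately have i0: "i0 < k" by (meson not_le)
    from \<open>x' i0 \<noteq> 0\<close> obtain q0 where q0: "coeff (x' i0) q0 \<noteq> 0" by (auto simp: poly_eq_iff)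
    have "x' i0 \<in> vecs n" using x' by (simp add: sols_def pcQ)
    with q0 have "q0 < n" by (simp add: vecs_def not_le[symmetric]) blast
    define s where "s = (\<Sum>(i, q)\<in>I. cmod (coeff (x' i) q))"
    have "cmod (coeff (x' i0) q0) \<le> s" unfolding s_def
      using member_le_sum[of "(i0, q0)" I "\<lambda>(i, q). cmod (coeff (x' i) q)"] i0 \<open>q0 < n\<close> by (auto simp: I_def)
    moreover have "0 < cmod (coeff (x' i0) q0)" using q0 by simp
    ultimately have s: "s > 0" by (rule less_le_trans[rotated])
    define y where "y i = smult (complex_of_real (1 / s)) (x' i)" for i
    have "y \<in> sols c d k N (Q t)"
      using sols_combine[of "{()}" "\<lambda>_. x'" c d k N "Q t" "\<lambda>_. complex_of_real (1 / s)"] x' by (simp add: y_def[abs_def])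
    moreover have "\<forall>(a, i, q)\<in>T. coeff (y i) (flat cs (a, q)) = 0" using x(2) by (auto simp: y_def x'_def)
    moreover have "(\<Sum>(i, q)\<in>I. cmod (coeff (y i) q)) = (1 / s) * s"
      unfolding s_def sum_distrib_left using s
      by (intro sum.cong refl) (auto simp: y_def norm_mult norm_divide s_def[symmetric])
    ultimately show ?thesis using s by (intro bexI[of _ y]) auto
  qed
  then obtain x where x': "\<And>t. x t \<in> sols c d k N (Q t) \<and>
      (\<forall>(a, i, q)\<in>T. coeff (x t i) (flat cs (a, q)) = 0) \<and> (\<Sum>(i, q)\<in>I. cmod (coeff (x t i) q)) = 1"
    unfolding Bex_def by metis
  have x: "x t \<in> sols c d k N (Q t)" "(a, i, q) \<in> T ==> coeff (x t i) (flat cs (a, q)) = 0"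
    "(\<Sum>(i, q)\<in>I. cmod (coeff (x t i) q)) = 1" for t a i q
    using x'[of t] by (auto dest: bspec)
  have fI: "finite I" by (simp add: I_def)
  have "bounded (range (\<lambda>t. coeff (x t (fst u)) (snd u)))" if "u \<in> I" for u
  proof (rule boundedI[where B=1], clarify)
    fix t
    show "cmod (coeff (x t (fst u)) (snd u)) \<le> 1"
      using member_le_sum[of u I "\<lambda>(i, q). cmod (coeff (x t i) q)"] that fI x(3)[of t] by (auto simp: case_prod_beta)
  qed
  from bounded_family_subsequence[OF fI this, of "\<lambda>u. u"]
  obtain r l where r: "strict_mono (r :: nat => nat)"
    and l: "\<And>u. u \<in> I ==> (\<lambda>t. coeff (x (r t) (fst u)) (snd u)) \<longlonglongrightarrow> l u" by blast
  define X where "X i = (if i < k then \<Sum>q<n. monom (l (i, q)) q else 0)" for i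
  have cX: "coeff (X i) q = (if i < k \<and> q < n then l (i, q) else 0)" for i q
    by (simp add: X_def coeff_sum coeff_monom)
  have limX: "(\<lambda>t. coeff (x (r t) i) q) \<longlonglongrightarrow> coeff (X i) q" for i q
  proof (cases "i < k \<and> q < n")
    case True
    then show ?thesis using l[of "(i, q)"] by (simp add: cX I_def)
  next
    case False
    have "pair_cols (Q t) = n" for t using mat_pairs_dims[OF orbit_mat_pairs[OF Q(2) Q(1)]] by simp
    then have "coeff (x t i) q = 0" for t using False x(1)[of t] by (cases "i < k") (auto simp: sols_def vecs_def)
    with False show ?thesis by (auto simp: cX)
  qed
  have limQ: "mat_tendsto m n (\<lambda>t. Q (r t)) (direct_sum (map g as))"
    using lim r LIMSEQ_subseq_LIMSEQ unfolding mat_tendsto_def by (fastforce simp: o_def)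
  have act: "(\<lambda>t. coeff (act e (Q (r t)) (x (r t) i)) j) \<longlonglongrightarrow> coeff (act e (direct_sum (map g as)) (X i)) j" for e i j
  proof -
    have "Q t \<in> mat_pairs m n" for t by (rule orbit_mat_pairs[OF Q(2) Q(1)])
    then have d: "dim_row (fst (Q t)) = m" "dim_row (snd (Q t)) = m" "dim_col (fst (Q t)) = n" "dim_col (snd (Q t)) = n" for t
      by (auto simp: mat_pairs_def mem_Times_iff)
    have d': "dim_row (fst (direct_sum (map g as))) = m" "dim_row (snd (direct_sum (map g as))) = m"
      "dim_col (fst (direct_sum (map g as))) = n" "dim_col (snd (direct_sum (map g as))) = n"
      using P by (auto simp: mat_pairs_def mem_Times_iff)
    show ?thesis
    proof (cases "j < m")
      case True
      then show ?thesis unfolding act_def coeff_add coeff_smult coeff_lin d d'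
        using limQ limX by (auto intro!: tendsto_intros simp: mat_tendsto_def)
    qed (simp add: act_def coeff_lin d d')
  qed
  have "X \<in> sols c d k N (direct_sum (map g as))"
    unfolding sols_def mem_Collect_eq pcP
  proof (intro conjI allI impI)
    show "X i \<in> vecs n" for i by (simp add: vecs_def cX)
    show "X i = 0" if "k \<le> i" for i using that by (simp add: X_def)
    show "act c (direct_sum (map g as)) (X i) = (if i = 0 then 0 else act d (direct_sum (map g as)) (X (i - 1)))"
      if "i < N" for i
    proof (rule poly_eqI)
      fix j
      have "coeff (act c (Q (r t)) (x (r t) i)) j = coeff (if i = 0 then 0 else act d (Q (r t)) (x (r t) (i - 1))) j" for t
        using x(1)[of "r t"] that by (simp add: sols_def)
      then show "coeff (act c (direct_sum (map g as)) (X i)) j =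
         coeff (if i = 0 then 0 else act d (direct_sum (map g as)) (X (i - 1))) j"
        using act[of c i j] act[of d "i - 1" j] by (auto intro: LIMSEQ_unique)
    qed
  qed
  from sols_part[OF Ps _ this] have part: "(\<lambda>i. part cs a (X i)) \<in> sols c d k N (g (as ! a))" if "a < length as" for a
    using that by (simp add: cs_def)
  have "part cs a (X i) = 0" if a: "a < length as" for a i
  proof -
    have "coeff (part cs a (X i)) q = 0" if "(i, q) \<in> J (as ! a)" for i q
    proof -
      have "coeff (x t i) (flat cs (a, q)) = 0" for t using x(2) that a by (auto simp: T_def)
      then have "coeff (X i) (flat cs (a, q)) = 0" using limX[of i "flat cs (a, q)"] by (auto intro: LIMSEQ_unique)
      then show ?thesis by (simp add: coeff_part)
    qed
    then show ?thesis using J[of "as ! a"] part[OF a] a unfolding solution_coords_def by force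
  qed
  then have "coeff (X i) (flat cs (a, q)) = 0" if "a < length cs" "q < cs ! a" for i a q
    using coeff_part[of cs a "X i" q] that by (simp add: cs_def)
  then have "X i = 0" for i
    by (intro poly_eq_flat[of _ cs]) (auto simp: n[symmetric] vecs_def cX)
  then have "l u = 0" if "u \<in> I" for u using that cX[of "fst u" "snd u"] by (auto simp: I_def)
  have "(\<lambda>t. \<Sum>u\<in>I. cmod (coeff (x (r t) (fst u)) (snd u))) \<longlonglongrightarrow> (\<Sum>u\<in>I. cmod (l u))"
    using l by (intro tendsto_intros)
  moreover have "(\<Sum>u\<in>I. cmod (coeff (x (r t) (fst u)) (snd u))) = 1" for t
    using x(3)[of "r t"] by (simp add: case_prod_beta)
  ultimately show False using \<open>\<And>u. u \<in> I ==> l u = 0\<close> LIMSEQ_unique[OF tendsto_const] by fastforce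
qed

section \<open>Dimensions of the solution spaces of single blocks\<close>

definition szL :: "kblock => nat option" where
  "szL b = (case b of LB n => Some n | _ => None)"

definition szT :: "kblock => nat option" where
  "szT b = (case b of LTB n => Some n | _ => None)"

text \<open>For \<open>j > 0\<close>, the dimension of the space of polynomial solutions of degree
  below \<open>j - 1\<close>, for the block if \<open>s\<close> is \<open>szL\<close> and for its
  transpose if \<open>s\<close> is \<open>szT\<close>. The size selector \<open>s\<close> lets both
  singular kinds share the counting lemmas.\<close>

definition sdim :: "(kblock => nat option) => nat => kblock => nat" where
  "sdim s j b = (case s b of Some n => j - n | None => 0)"

abbreviation "fdim \<equiv> sdim szL"
abbreviation "gdim \<equiv> sdim szT"

lemmas fdim_def = sdim_def szL_def and gdim_def = sdim_def szT_def

text \<open>The dimension of the space of chains of length \<open>k\<close> at the eigenvalue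
  \<mu>.\<close>

definition hdim :: "ext_complex => nat => kblock => nat" where
  "hdim \<mu> k b = (case b of LB n => k | LTB n => 0 | DB \<nu> n => if \<nu> = \<mu> then min k n else 0)"

text \<open>As \<open>y\<close> vanishes beyond the block, the shifted entry
  \<open>y (Suc r)\<close> is correct in the last row too.\<close>

lemma bpair_row_sums:
  assumes "r < brows b" "\<And>c. c \<ge> bcols b ==> y c = (0::complex)"
  shows "(\<Sum>c<bcols b. fst (bpair b) $$ (r, c) * y c) =
      (case b of LB n => y r | LTB n => y r | DB \<mu> n => (case \<mu> of Finite l => y r | Infinity => y (Suc r)))"
    "(\<Sum>c<bcols b. snd (bpair b) $$ (r, c) * y c) =
      (case b of LB n => y (Suc r) | LTB n => (if r = 0 then 0 else y (r - 1))
       | DB \<mu> n => (case \<mu> of Finite l => l * y r + y (Suc r) | Infinity => y r))"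
proof -
  have delta: "(\<Sum>c<n. (if c = k then 1 else 0) * y c) = (if k < n then y k else 0)" for n k
    by (simp add: if_distrib[of "\<lambda>z. z * _"] cong: if_cong)
  have s: "(\<Sum>c<n. M $$ (r, c) * y c) = z" if "\<And>c. c < n ==> M $$ (r, c) = e c" "(\<Sum>c<n. e c * y c) = z" for M e n z
    using that by simp
  have jord: "(\<Sum>c<n. jordan_block n l $$ (r, c) * y c) = l * y r + y (Suc r)" if "r < n" "\<And>c. c \<ge> n ==> y c = 0" for n l
  proof (rule s[where e="\<lambda>c. l * (if c = r then 1 else 0) + (if c = Suc r then 1 else 0)"])
    show "(\<Sum>c<n. (l * (if c = r then 1 else 0) + (if c = Suc r then 1 else 0)) * y c) = l * y r + y (Suc r)"
      using that delta[of r n] delta[of "Suc r" n]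
      by (simp add: distrib_right sum.distrib mult.assoc sum_distrib_left[symmetric])
  qed (use that in \<open>auto simp: jordan_block_def\<close>)
  have one: "(\<Sum>c<n. 1\<^sub>m n $$ (r, c) * y c) = y r" if "r < n" for n
    by (rule s[where e="\<lambda>c. if c = r then 1 else 0"]) (use that delta[of r n] in auto)
  have L: "(\<Sum>c<n. L_mat n $$ (r, c) * y c) = y r" "(\<Sum>c<n. R_mat n $$ (r, c) * y c) = y (Suc r)" if "r < n - 1" for n
    by (rule s[where e="\<lambda>c. if c = r then 1 else 0"], use that delta[of r n] in \<open>auto simp: L_mat_def\<close>)
       (rule s[where e="\<lambda>c. if c = Suc r then 1 else 0"], use that delta[of "Suc r" n] in \<open>auto simp: R_mat_def\<close>)
  have LT: "(\<Sum>c<n - 1. transpose_mat (L_mat n) $$ (r, c) * y c) = y r"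
    "(\<Sum>c<n - 1. transpose_mat (R_mat n) $$ (r, c) * y c) = (if r = 0 then 0 else y (r - 1))" if "r < n" "\<And>c. c \<ge> n - 1 ==> y c = 0" for n
  proof -
    show "(\<Sum>c<n - 1. transpose_mat (L_mat n) $$ (r, c) * y c) = y r"
      by (rule s[where e="\<lambda>c. if c = r then 1 else 0"]) (use that delta[of r "n - 1"] in \<open>auto simp: L_mat_def\<close>)
    show "(\<Sum>c<n - 1. transpose_mat (R_mat n) $$ (r, c) * y c) = (if r = 0 then 0 else y (r - 1))"
    proof (cases r)
      case 0
      then show ?thesis using that by (auto simp: R_mat_def intro!: sum.neutral)
    next
      case (Suc r')
      show ?thesis
        by (rule s[where e="\<lambda>c. if c = r' then 1 else 0"]) (use that Suc delta[of r' "n - 1"] in \<open>auto simp: R_mat_def\<close>)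
    qed
  qed
  show "(\<Sum>c<bcols b. fst (bpair b) $$ (r, c) * y c) =
      (case b of LB n => y r | LTB n => y r | DB \<mu> n => (case \<mu> of Finite l => y r | Infinity => y (Suc r)))"
    using assms L LT(1) one jord[of _ 0]
    by (cases b) (auto simp: L_pair_def LT_pair_def split: ext_complex.split)
  show "(\<Sum>c<bcols b. snd (bpair b) $$ (r, c) * y c) =
      (case b of LB n => y (Suc r) | LTB n => (if r = 0 then 0 else y (r - 1))
       | DB \<mu> n => (case \<mu> of Finite l => l * y r + y (Suc r) | Infinity => y r))"
    using assms L LT(2) one jord
    by (cases b) (auto simp: L_pair_def LT_pair_def split: ext_complex.split)
qed

lemma coeff_act_bpair:
  assumes "r < brows b" "y \<in> vecs (bcols b)"
  shows "coeff (act c (bpair b) y) r = (case b of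
      LB n => fst c * coeff y r + snd c * coeff y (Suc r)
    | LTB n => fst c * coeff y r + snd c * (if r = 0 then 0 else coeff y (r - 1))
    | DB (Finite l) n => fst c * coeff y r + snd c * (l * coeff y r + coeff y (Suc r))
    | DB Infinity n => fst c * coeff y (Suc r) + snd c * coeff y r)"
proof -
  have d: "dim_row (fst (bpair b)) = brows b" "dim_row (snd (bpair b)) = brows b"
    "dim_col (fst (bpair b)) = bcols b" "dim_col (snd (bpair b)) = bcols b"
    using bpair_mat_pairs[of b] by (auto simp: mat_pairs_def mem_Times_iff)
  have z: "\<And>c. c \<ge> bcols b ==> coeff y c = 0" using assms(2) by (simp add: vecs_def)
  show ?thesis
    using assms(1) by (simp add: act_def coeff_lin d bpair_row_sums[OF assms(1) z] split: kblock.split ext_complex.split)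
qed

lemma act_bpair_eq_0:
  assumes "act c (bpair b) y = 0" "r < brows b" "y \<in> vecs (bcols b)"
  shows "(case b of
      LB n => fst c * coeff y r + snd c * coeff y (Suc r)
    | LTB n => fst c * coeff y r + snd c * (if r = 0 then 0 else coeff y (r - 1))
    | DB (Finite l) n => fst c * coeff y r + snd c * (l * coeff y r + coeff y (Suc r))
    | DB Infinity n => fst c * coeff y (Suc r) + snd c * coeff y r) = 0"
  using coeff_act_bpair[OF assms(2,3), of c] assms(1) by simp

lemma solution_coordsI:
  assumes "I \<subseteq> {..<k}" "q < pair_cols P"
    and det: "\<And>x i. x \<in> sols c d k N P ==> (\<And>i. i \<in> I ==> coeff (x i) q = 0) ==> x i = 0"
    and ex: "\<And>i0. i0 \<in> I ==> \<exists>x\<in>sols c d k N P. \<forall>i\<in>I. coeff (x i) q = (if i = i0 then 1 else 0)"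
  shows "solution_coords c d k N P ((\<lambda>i. (i, q)) ` I)"
  unfolding solution_coords_def
proof (intro conjI ballI impI allI)
  show "(\<lambda>i. (i, q)) ` I \<subseteq> {..<k} \<times> {..<pair_cols P}" using assms(1,2) by auto
  show "x i = 0" if "x \<in> sols c d k N P" "\<forall>(i, q)\<in>(\<lambda>i. (i, q)) ` I. coeff (x i) q = 0" for x i
    using that by (intro det) auto
  fix j assume "j \<in> (\<lambda>i. (i, q)) ` I"
  then obtain i0 where i0: "i0 \<in> I" "j = (i0, q)" by blast
  from ex[OF i0(1)] obtain x where x: "x \<in> sols c d k N P" "\<forall>i\<in>I. coeff (x i) q = (if i = i0 then 1 else 0)" by blast
  from x(2) i0(2) have "\<forall>(i, q)\<in>(\<lambda>i. (i, q)) ` I. coeff (x i) q = (if (i, q) = j then 1 else 0)" by auto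
  with x(1) show "\<exists>x\<in>sols c d k N P. \<forall>(i, q)\<in>(\<lambda>i. (i, q)) ` I. coeff (x i) q = (if (i, q) = j then 1 else 0)" by blast
qed

text \<open>If \<open>act c\<close> is injective, then \<open>x 0 = 0\<close>, hence
  \<open>x 1 = 0\<close>, and so on.\<close>

lemma solution_coords_inj:
  assumes "\<And>x. x \<in> vecs (pair_cols P) ==> act c P x = 0 ==> x = 0" "k \<le> N"
  shows "solution_coords c d k N P {}"
proof -
  have "x i = 0" if x: "x \<in> sols c d k N P" for x i
  proof (induction i)
    case 0
    then show ?case using x assms by (cases "k = 0") (auto simp: sols_def)
  next
    case (Suc i)
    then show ?case using x assms cp.lin_map_0[OF lin_map_act, of d P]
      by (cases "Suc i < N") (auto simp: sols_def)
  qed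
  then show ?thesis by (simp add: solution_coords_def)
qed

text \<open>With \<open>N = Suc k\<close> the last equation starts the argument at the other end,
  where \<open>act d\<close> is injective.\<close>

lemma solution_coords_inj':
  assumes "\<And>x. x \<in> vecs (pair_cols P) ==> act d P x = 0 ==> x = 0"
  shows "solution_coords c d k (Suc k) P {}"
proof -
  have "x i = 0" if x: "x \<in> sols c d k (Suc k) P" for x i
  proof (cases "i \<le> k")
    case True
    then show ?thesis
    proof (induction i rule: inc_induct)
      case base
      then show ?case using x by (simp add: sols_def)
    next
      case (step i)
      then have "act c P (x (Suc i)) = act d P (x i)" using x by (auto simp: sols_def)
      then show ?case using step x assms cp.lin_map_0[OF lin_map_act, of c P] by (auto simp: sols_def)
    qed
  qed (use x in \<open>auto simp: sols_def\<close>)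
  then show ?thesis by (simp add: solution_coords_def)
qed

lemma solsD:
  assumes "x \<in> sols c d k N P"
  shows "x i \<in> vecs (pair_cols P)" "i \<ge> k ==> x i = 0"
    "i < N ==> act c P (x i) = (if i = 0 then 0 else act d P (x (i - 1)))"
  using assms by (auto simp: sols_def)

lemma act_vecs: "P \<in> mat_pairs m n ==> act c P x \<in> vecs m"
  using lin_vecs[of "fst P" x] lin_vecs[of "snd P" x] by (auto simp: act_def vecs_def mat_pairs_def)

lemma act_eqI:
  assumes P: "P \<in> mat_pairs m n"
    and "\<And>r. r < m ==> coeff (act c P x) r = (if i = 0 then 0 else coeff (act d P y) r)"
  shows "act c P x = (if i = 0 then 0 else act d P y)"
proof (rule poly_eqI)
  fix r
  show "coeff (act c P x) r = coeff (if i = 0 then 0 else act d P y) r"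
    using assms(2)[of r] act_vecs[OF P, of c x] act_vecs[OF P, of d y] by (cases "r < m") (auto simp: vecs_def)
qed

text \<open>A singular block of size \<open>(n - 1) \<times> n\<close>: the equations are \<open>x\<^sub>i(r) = x\<^sub>i\<^sub>-\<^sub>1(r + 1)\<close>, and \<open>N = k + 1\<close>
  adds the requirement \<open>x\<^sub>k\<^sub>-\<^sub>1(r + 1) = 0\<close>.\<close>

lemma solution_coords_shift:
  assumes P: "P \<in> mat_pairs (n - 1) n" "1 \<le> n"
    and c: "\<And>x r. x \<in> vecs n ==> r < n - 1 ==> coeff (act c P x) r = coeff x r"
    and d: "\<And>x r. x \<in> vecs n ==> r < n - 1 ==> coeff (act d P x) r = coeff x (Suc r)"
    and N: "N = k \<and> K = k \<or> N = Suc k \<and> K = Suc k - n"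
  shows "solution_coords c d k N P ((\<lambda>i. (i, n - 1)) ` {..<K})"
proof -
  have pc: "pair_cols P = n" using mat_pairs_dims[OF P(1)] by simp
  have det: "x i = 0" if x: "x \<in> sols c d k N P" and z: "\<And>i. i < K ==> coeff (x i) (n - 1) = 0" for x i
  proof -
    have xv: "x i \<in> vecs n" for i using solsD(1)[OF x] pc by simp
    have e: "coeff (x i) r = (if i = 0 then 0 else coeff (x (i - 1)) (Suc r))" if "i < N" "r < n - 1" for i r
      using solsD(3)[OF x that(1)] c[OF xv that(2), of i] d[OF xv that(2), of "i - 1"] by (auto split: if_splits)
    have sh: "coeff (x (i + j)) q = coeff (x i) (q + j)" if "i + j < N" "q + j < n" for i j q
      using that
    proof (induction j arbitrary: q)
      case (Suc j)
      then show ?case using e[of "i + Suc j" q] Suc.IH[of "Suc q"] by simp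
    qed simp
    \<comment> \<open>For \<open>K \<le> i < k\<close> the last coordinate of \<open>x i\<close>
      reappears, shifted down, as a coordinate of \<open>x k = 0\<close>.\<close>
    have top: "coeff (x i) (n - 1) = 0" for i
    proof (cases "i < K \<or> i \<ge> k")
      case True
      then show ?thesis using z solsD(2)[OF x] by auto
    next
      case False
      then have "N = Suc k" "k - i \<le> n - 1" "i \<le> k" using N by auto
      then show ?thesis using sh[of i "k - i" "n - 1 - (k - i)"] solsD(2)[OF x, of k] P(2) by simp
    qed
    have "\<forall>q. coeff (x i) q = 0"
    proof (induction i)
      case 0
      show ?case
      proof
        fix q
        consider "q < n - 1" | "q = n - 1" | "q \<ge> n" by linarith
        then show "coeff (x 0) q = 0"
        proof cases
          case 1
          show ?thesis
          proof (cases "0 < N")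
            case False
            then show ?thesis using N solsD(2)[OF x, of 0] by simp
          qed (use e[of 0 q] 1 in simp)
        qed (use top xv[of 0] in \<open>auto simp: vecs_def\<close>)
      qed
    next
      case (Suc i)
      show ?case
      proof
        fix q
        consider "q < n - 1" | "q = n - 1" | "q \<ge> n" by linarith
        then show "coeff (x (Suc i)) q = 0"
        proof cases
          case 1
          show ?thesis
          proof (cases "Suc i < N")
            case False
            then have "k \<le> Suc i" using N by linarith
            then show ?thesis using solsD(2)[OF x] by simp
          qed (use e[of "Suc i" q] 1 Suc in simp)
        qed (use top xv[of "Suc i"] in \<open>auto simp: vecs_def\<close>)
      qed
    qed
    then show ?thesis by (simp add: poly_eq_iff)
  qed
  have ex: "\<exists>x\<in>sols c d k N P. \<forall>i<K. coeff (x i) (n - 1) = (if i = i0 then 1 else 0)" if i0: "i0 < K" for i0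
  proof (intro bexI)
    \<comment> \<open>A single 1 that enters at the last position at index \<open>i0\<close> and
      moves down one place per step.\<close>
    define x :: "nat => complex poly" where
      "x i = (if i0 \<le> i \<and> i \<le> i0 + (n - 1) \<and> i < k then monom 1 (i0 + (n - 1) - i) else 0)" for i
    have "K \<le> k" using N P(2) by auto
    have co: "coeff (x i) q = (if i0 \<le> i \<and> i < k \<and> i + q = i0 + (n - 1) then 1 else 0)" for i q
      by (auto simp: x_def coeff_monom)
    show "\<forall>i<K. coeff (x i) (n - 1) = (if i = i0 then 1 else 0)" using \<open>K \<le> k\<close> by (auto simp: co)
    have xv: "x i \<in> vecs n" for i using P(2) by (auto simp: vecs_def co)
    show "x \<in> sols c d k N P" unfolding sols_def mem_Collect_eq pc
    proof (intro conjI allI impI xv)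
      show "x i = 0" if "k \<le> i" for i using that by (simp add: x_def)
      show "act c P (x i) = (if i = 0 then 0 else act d P (x (i - 1)))" if i: "i < N" for i
      proof (rule act_eqI[OF P(1)])
        fix r assume r: "r < n - 1"
        show "coeff (act c P (x i)) r = (if i = 0 then 0 else coeff (act d P (x (i - 1))) r)"
          unfolding c[OF xv r] d[OF xv r] co using r i i0 N by auto
      qed
    qed
  qed
  have "{..<K} \<subseteq> {..<k}" "n - 1 < pair_cols P" using N P(2) pc by auto
  then show ?thesis by (rule solution_coordsI) (use det ex in \<open>simp_all add: Ball_def\<close>)
qed

text \<open>The equations read \<open>x_i(r + 1) = l x_i(r) + x_(i-1)(r)\<close>, with the last term
  absent for \<open>i = 0\<close>: the values at position 0 are free and determine the rest.\<close>

lemma solution_coords_LB_Finite: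
  assumes n: "1 \<le> n"
  shows "solution_coords (- l, 1) (1, 0) k k (bpair (LB n)) ((\<lambda>i. (i, 0)) ` {..<k})"
proof -
  let ?P = "bpair (LB n)"
  have pc: "pair_cols ?P = n" by (simp del: bpair.simps)
  have P: "?P \<in> mat_pairs (n - 1) n" using bpair_mat_pairs[of "LB n"] by simp
  have c: "coeff (act (- l, 1) ?P x) r = coeff x (Suc r) - l * coeff x r" and d: "coeff (act (1, 0) ?P x) r = coeff x r"
    if "x \<in> vecs n" "r < n - 1" for x r
    using coeff_act_bpair[of r "LB n" x] that by (simp_all del: bpair.simps)
  have det: "x i = 0" if x: "x \<in> sols (- l, 1) (1, 0) k k ?P" and z: "\<And>i. i < k ==> coeff (x i) 0 = 0" for x i
  proof -
    have xv: "x i \<in> vecs n" for i using solsD(1)[OF x] pc by simp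
    have "\<forall>i. coeff (x i) q = 0" for q
    proof (induction q)
      case 0
      show ?case using z solsD(2)[OF x] by (metis coeff_0 not_le)
    next
      case (Suc r)
      show ?case
      proof
        fix i
        consider "r < n - 1" "i < k" | "i \<ge> k" | "Suc r \<ge> n" by linarith
        then show "coeff (x i) (Suc r) = 0"
        proof cases
          case 1
          then show ?thesis using solsD(3)[OF x, of i] c[OF xv 1(1), of i] d[OF xv 1(1), of "i - 1"] Suc
            by (auto split: if_splits)
        next
          case 2
          then show ?thesis using solsD(2)[OF x] by simp
        next
          case 3
          then show ?thesis using xv[of i] by (simp add: vecs_def)
        qed
      qed
    qed
    then show ?thesis by (simp add: poly_eq_iff)
  qed
  have ex: "\<exists>x\<in>sols (- l, 1) (1, 0) k k ?P. \<forall>i<k. coeff (x i) 0 = (if i = i0 then 1 else 0)" if "i0 < k" for i0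
  proof (intro bexI)
    define y :: "nat => nat => complex" where
      "y = rec_nat (\<lambda>i. if i = i0 then 1 else 0) (\<lambda>q f i. l * f i + (if i = 0 then 0 else f (i - 1)))"
    have y: "y 0 i = (if i = i0 then 1 else 0)" "y (Suc q) i = l * y q i + (if i = 0 then 0 else y q (i - 1))" for q i
      by (simp_all add: y_def)
    define x where "x i = (if i < k then \<Sum>q<n. monom (y q i) q else 0)" for i
    have co: "coeff (x i) q = (if i < k \<and> q < n then y q i else 0)" for i q
      by (simp add: x_def coeff_sum coeff_monom)
    show "\<forall>i<k. coeff (x i) 0 = (if i = i0 then 1 else 0)" using n by (simp add: co y)
    have xv: "x i \<in> vecs n" for i by (simp add: vecs_def co)
    show "x \<in> sols (- l, 1) (1, 0) k k ?P" unfolding sols_def mem_Collect_eq pc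
    proof (intro conjI allI impI xv)
      show "x i = 0" if "k \<le> i" for i using that by (simp add: x_def)
      show "act (- l, 1) ?P (x i) = (if i = 0 then 0 else act (1, 0) ?P (x (i - 1)))" if i: "i < k" for i
      proof (rule act_eqI[OF P])
        fix r assume r: "r < n - 1"
        then have "Suc r < n" "r < n" "i - 1 < k" using i by linarith+
        then show "coeff (act (- l, 1) ?P (x i)) r = (if i = 0 then 0 else coeff (act (1, 0) ?P (x (i - 1))) r)"
          unfolding c[OF xv r] d[OF xv r] co using i by (simp add: y)
      qed
    qed
  qed
  have "{..<k} \<subseteq> {..<k}" "0 < pair_cols ?P" using n pc by auto
  then show ?thesis by (rule solution_coordsI) (use det ex in \<open>simp_all add: Ball_def del: bpair.simps\<close>)
qed

text \<open>The equations read \<open>x_i(r + 1) = x_(i-1)(r)\<close>, and for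
  \<open>r = n - 1\<close> the left side is 0. The value \<open>x_i(0)\<close> arrives at position
  \<open>n\<close> after \<open>n\<close> steps, so it has to vanish if \<open>i + n < k\<close>;
  the last \<open>min k n\<close> values are free.\<close>

lemma solution_coords_jordan:
  assumes P: "P \<in> mat_pairs n n"
    and c: "\<And>x r. x \<in> vecs n ==> r < n ==> coeff (act c P x) r = coeff x (Suc r)"
    and d: "\<And>x r. x \<in> vecs n ==> r < n ==> coeff (act d P x) r = coeff x r"
  shows "solution_coords c d k k P ((\<lambda>i. (i, 0)) ` {k - n..<k})"
proof -
  have pc: "pair_cols P = n" using mat_pairs_dims[OF P(1)] by simp
  have det: "x i = 0" if x: "x \<in> sols c d k k P" and z: "\<And>i. k - n \<le> i ==> i < k ==> coeff (x i) 0 = 0" for x i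
  proof -
    have xv: "x i \<in> vecs n" for i using solsD(1)[OF x] pc by simp
    have e: "coeff (x i) (Suc r) = (if i = 0 then 0 else coeff (x (i - 1)) r)" if "i < k" "r < n" for i r
      using solsD(3)[OF x that(1)] c[OF xv that(2), of i] d[OF xv that(2), of "i - 1"] by (auto split: if_splits)
    have sh: "coeff (x (i + j)) j = coeff (x i) 0" if "i + j < k" "j \<le> n" for i j
      using that
    proof (induction j)
      case (Suc j)
      then show ?case using e[of "i + Suc j" j] by simp
    qed simp
    have bot: "coeff (x i) 0 = 0" for i
    proof (cases "k - n \<le> i \<or> i \<ge> k")
      case True
      then show ?thesis using z solsD(2)[OF x] by (metis coeff_0 not_le)
    next
      case False
      then have "i + n < k" by linarith
      then show ?thesis using sh[of i n] xv[of "i + n"] by (simp add: vecs_def)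
    qed
    have "\<forall>i. coeff (x i) q = 0" for q
    proof (induction q)
      case (Suc r)
      show ?case
      proof
        fix i
        consider "r < n" "i < k" | "i \<ge> k" | "Suc r \<ge> n" by linarith
        then show "coeff (x i) (Suc r) = 0"
          using e[of i r] Suc solsD(2)[OF x, of i] xv[of i] by cases (auto simp: vecs_def)
      qed
    qed (use bot in simp)
    then show ?thesis by (simp add: poly_eq_iff)
  qed
  have ex: "\<exists>x\<in>sols c d k k P. \<forall>i\<in>{k - n..<k}. coeff (x i) 0 = (if i = i0 then 1 else 0)" if i0: "k - n \<le> i0" "i0 < k" for i0
  proof (intro bexI)
    define x :: "nat => complex poly" where "x i = (if i0 \<le> i \<and> i < k then monom 1 (i - i0) else 0)" for i
    have co: "coeff (x i) q = (if i < k \<and> i = i0 + q then 1 else 0)" for i q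
      by (auto simp: x_def coeff_monom)
    show "\<forall>i\<in>{k - n..<k}. coeff (x i) 0 = (if i = i0 then 1 else 0)" by (auto simp: co)
    have xv: "x i \<in> vecs n" for i using i0 by (auto simp: vecs_def co)
    show "x \<in> sols c d k k P" unfolding sols_def mem_Collect_eq pc
    proof (intro conjI allI impI xv)
      show "x i = 0" if "k \<le> i" for i using that by (simp add: x_def)
      show "act c P (x i) = (if i = 0 then 0 else act d P (x (i - 1)))" if i: "i < k" for i
      proof (rule act_eqI[OF P(1)])
        fix r assume r: "r < n"
        show "coeff (act c P (x i)) r = (if i = 0 then 0 else coeff (act d P (x (i - 1))) r)"
          unfolding c[OF xv r] d[OF xv r] co using i by auto
      qed
    qed
  qed
  show ?thesis
  proof (cases "n = 0")
    case True
    then show ?thesis using det by (auto simp: solution_coords_def)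
  next
    case False
    then have "{k - n..<k} \<subseteq> {..<k}" "0 < pair_cols P" using pc by auto
    then show ?thesis by (rule solution_coordsI) (use det ex in \<open>simp_all add: Ball_def\<close>)
  qed
qed

lemma vecs_zeroI: "x \<in> vecs n ==> (\<And>r. r < n ==> coeff x r = 0) ==> x = 0"
  by (auto simp: poly_eq_iff vecs_def) (metis not_le)

lemma vecs_zero_descending:
  assumes "x \<in> vecs n" "\<And>r. r < n ==> coeff x r = a * coeff x (Suc r)"
  shows "x = 0"
proof -
  have "coeff x r = 0" if "r \<le> n" for r
    using that by (induction r rule: inc_induct) (use assms in \<open>auto simp: vecs_def\<close>)
  with assms(1) show ?thesis by (auto intro: vecs_zeroI)
qed

definition coords_L :: "nat => nat => (nat \<times> nat) set" where
  "coords_L K n = (\<lambda>i. (i, n - 1)) ` {..<K}"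

lemma card_coords_L [simp]: "card (coords_L K n) = K"
  by (simp add: coords_L_def card_image inj_on_def)

lemma solution_coords_LB:
  assumes "1 \<le> n" "N = k \<and> K = k \<or> N = Suc k \<and> K = Suc k - n"
  shows "solution_coords (1, 0) (0, 1) k N (bpair (LB n)) (coords_L K n)"
  unfolding coords_L_def
  by (rule solution_coords_shift)
     (use assms bpair_mat_pairs[of "LB n"] coeff_act_bpair[of _ "LB n"] in \<open>auto simp del: bpair.simps\<close>)

lemma solution_coords_LTB:
  "k \<le> N ==> solution_coords (1, 0) (0, 1) k N (bpair (LTB n)) {}"
  by (rule solution_coords_inj, rule vecs_zeroI[where n="n - 1"])
     (use act_bpair_eq_0[of _ "LTB n"] in \<open>force simp del: bpair.simps\<close>)+

lemma solution_coords_fdim: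
  assumes "bvalid b"
  shows "\<exists>J. solution_coords (1, 0) (0, 1) k (Suc k) (bpair b) J \<and> card J = fdim (Suc k) b"
proof (cases b)
  case (LB n)
  then show ?thesis using solution_coords_LB[of n "Suc k" k] assms by (auto simp: fdim_def simp del: bpair.simps)
next
  case (LTB n)
  then show ?thesis using solution_coords_LTB[of k "Suc k" n] by (auto simp: fdim_def simp del: bpair.simps)
next
  case (DB \<mu> n)
  show ?thesis
  proof (cases \<mu>)
    case (Finite l)
    have "solution_coords (1, 0) (0, 1) k (Suc k) (bpair b) {}"
      by (rule solution_coords_inj, rule vecs_zeroI[where n=n])
         (use DB Finite act_bpair_eq_0[of _ b] in \<open>force simp del: bpair.simps\<close>)+
    then show ?thesis by (auto simp: fdim_def DB)
  next
    case Infinity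
    have "solution_coords (1, 0) (0, 1) k (Suc k) (bpair b) {}"
      by (rule solution_coords_inj', rule vecs_zeroI[where n=n])
         (use DB Infinity act_bpair_eq_0[of _ b] in \<open>force simp del: bpair.simps\<close>)+
    then show ?thesis by (auto simp: fdim_def DB)
  qed
qed

lemma solution_coords_gdim:
  assumes "bvalid b"
  shows "\<exists>J. solution_coords (1, 0) (0, 1) k (Suc k) (transpose_pair (bpair b)) J \<and> card J = gdim (Suc k) b"
proof (cases b)
  case (LB n)
  then show ?thesis using solution_coords_LTB[of k "Suc k" n] by (auto simp: gdim_def transpose_pair_def L_pair_def LT_pair_def)
next
  case (LTB n)
  then show ?thesis using solution_coords_LB[of n "Suc k" k] assms by (auto simp: gdim_def transpose_pair_def L_pair_def LT_pair_def)
next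
  case (DB \<mu> n)
  have pc: "pair_cols (transpose_pair (bpair b)) = n"
    by (cases \<mu>) (simp_all add: DB transpose_pair_def pair_cols_def)
  show ?thesis
  proof (cases \<mu>)
    case (Finite l)
    have "solution_coords (1, 0) (0, 1) k (Suc k) (transpose_pair (bpair b)) {}"
      by (rule solution_coords_inj) (auto simp: act_def pc, auto simp: DB Finite transpose_pair_def lin_one)
    then show ?thesis by (auto simp: gdim_def DB)
  next
    case Infinity
    have "solution_coords (1, 0) (0, 1) k (Suc k) (transpose_pair (bpair b)) {}"
      by (rule solution_coords_inj') (auto simp: act_def pc, auto simp: DB Infinity transpose_pair_def lin_one)
    then show ?thesis by (auto simp: gdim_def DB)
  qed
qed

lemma solution_coords_hdim_Finite:
  assumes "bvalid b"
  shows "\<exists>J. solution_coords (- l, 1) (1, 0) k k (bpair b) J \<and> card J = hdim (Finite l) k b"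
proof (cases b)
  case (LB n)
  then show ?thesis using solution_coords_LB_Finite[of n l k] assms
    by (intro exI[of _ "(\<lambda>i. (i, 0)) ` {..<k}"]) (auto simp: hdim_def card_image inj_on_def simp del: bpair.simps)
next
  case (LTB n)
  have "solution_coords (- l, 1) (1, 0) k k (bpair b) {}"
  proof (rule solution_coords_inj[OF _ order_refl], rule vecs_zero_descending[where n="n - 1" and a=l])
    fix x assume x: "x \<in> vecs (pair_cols (bpair b))" and z: "act (- l, 1) (bpair b) x = 0"
    then show v: "x \<in> vecs (n - 1)" by (simp add: LTB del: bpair.simps)
    fix r assume "r < n - 1"
    with z x coeff_act_bpair[of "Suc r" b x "(- l, 1)"] show "coeff x r = l * coeff x (Suc r)"
      by (simp add: LTB del: bpair.simps)
  qed
  then show ?thesis by (auto simp: hdim_def LTB)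
next
  case (DB \<mu> n)
  note act = coeff_act_bpair[of _ b _, unfolded DB kblock.case brows.simps bcols.simps]
  have P: "bpair b \<in> mat_pairs n n" "pair_cols (bpair b) = n" using bpair_mat_pairs[of b] by (simp_all add: DB del: bpair.simps)
  show ?thesis
  proof (cases "\<mu> = Finite l")
    case True
    have "solution_coords (- l, 1) (1, 0) k k (bpair b) ((\<lambda>i. (i, 0)) ` {k - n..<k})"
      by (rule solution_coords_jordan) (use P act True in \<open>auto simp: DB algebra_simps simp del: bpair.simps\<close>)
    then show ?thesis using True
      by (intro exI[of _ "(\<lambda>i. (i, 0)) ` {k - n..<k}"]) (auto simp: hdim_def DB card_image inj_on_def min_def)
  next
    case False
    \<comment> \<open>Away from the eigenvalue a kernel vector obeys a first order recursion in
      descending position, and it starts from 0 beyond the block.\<close>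
    have "\<exists>a. \<forall>x\<in>vecs n. act (- l, 1) (bpair b) x = 0 \<longrightarrow> (\<forall>r<n. coeff x r = a * coeff x (Suc r))"
    proof (cases \<mu>)
      case (Finite m)
      have "coeff x r = 1 / (l - m) * coeff x (Suc r)" if "x \<in> vecs n" "act (- l, 1) (bpair b) x = 0" "r < n" for x r
        using act[of r x "(- l, 1)"] that False Finite by (simp add: DB field_simps del: bpair.simps)
      then show ?thesis by blast
    next
      case Infinity
      have "coeff x r = l * coeff x (Suc r)" if "x \<in> vecs n" "act (- l, 1) (bpair b) x = 0" "r < n" for x r
        using act[of r x "(- l, 1)"] that Infinity by (simp add: DB del: bpair.simps)
      then show ?thesis by blast
    qed
    then obtain a where "\<And>x r. x \<in> vecs n ==> act (- l, 1) (bpair b) x = 0 ==> r < n ==> coeff x r = a * coeff x (Suc r)" by blast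
    then have "solution_coords (- l, 1) (1, 0) k k (bpair b) {}"
      by (intro solution_coords_inj order_refl vecs_zero_descending[where n=n and a=a]) (simp_all only: P(2))
    then show ?thesis using False by (auto simp: hdim_def DB)
  qed
qed

lemma solution_coords_hdim_Infinity:
  assumes "bvalid b"
  shows "\<exists>J. solution_coords (1, 0) (0, 1) k k (bpair b) J \<and> card J = hdim Infinity k b"
proof (cases b)
  case (LB n)
  then show ?thesis using solution_coords_LB[of n k k k] assms by (auto simp: hdim_def simp del: bpair.simps)
next
  case (LTB n)
  then show ?thesis using solution_coords_LTB[of k k n] by (auto simp: hdim_def simp del: bpair.simps)
next
  case (DB \<mu> n)
  have P: "bpair b \<in> mat_pairs n n" "pair_cols (bpair b) = n" using bpair_mat_pairs[of b] by (simp_all add: DB del: bpair.simps)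
  show ?thesis
  proof (cases \<mu>)
    case Infinity
    have "solution_coords (1, 0) (0, 1) k k (bpair b) ((\<lambda>i. (i, 0)) ` {k - n..<k})"
      by (rule solution_coords_jordan) (use P coeff_act_bpair[of _ b] Infinity in \<open>auto simp: DB simp del: bpair.simps\<close>)
    then show ?thesis using Infinity
      by (intro exI[of _ "(\<lambda>i. (i, 0)) ` {k - n..<k}"]) (auto simp: hdim_def DB card_image inj_on_def min_def)
  next
    case (Finite l)
    have "solution_coords (1, 0) (0, 1) k k (bpair b) {}"
      by (rule solution_coords_inj, rule vecs_zeroI[where n=n])
         (use DB Finite act_bpair_eq_0[of _ b] in \<open>force simp del: bpair.simps\<close>)+
    then show ?thesis by (auto simp: hdim_def DB Finite)
  qed
qed

definition dims_ge :: "kblock list => kblock list => bool" where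
  "dims_ge as bs \<longleftrightarrow> (\<forall>j. sum_list (map (fdim j) bs) \<le> sum_list (map (fdim j) as)) \<and>
     (\<forall>j. sum_list (map (gdim j) bs) \<le> sum_list (map (gdim j) as)) \<and>
     (\<forall>\<mu> k. sum_list (map (hdim \<mu> k) bs) \<le> sum_list (map (hdim \<mu> k) as))"

text \<open>All inequalities are instances of \<open>solutions_semicontinuous\<close>; for
  \<open>gdim\<close> it is applied to the transposed pairs, which converge as well. The bound
  \<open>j = 0\<close>, not covered by \<open>Suc k\<close>, is trivial.\<close>

theorem closure_dims_ge:
  assumes valid: "\<And>b. b \<in> set as \<union> set bs ==> bvalid b"
    and cl: "direct_sum (map bpair as) \<in> mat_pair_topology m n closure_of (orbit (direct_sum (map bpair bs)))"
  shows "dims_ge as bs"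
proof -
  let ?P = "direct_sum (map bpair as)" and ?B = "direct_sum (map bpair bs)"
  from cl obtain Q where P: "?P \<in> mat_pairs m n" and Q: "\<And>t. Q t \<in> orbit ?B" "\<And>t. Q t \<in> mat_pairs m n"
    and lim: "mat_tendsto m n Q ?P" unfolding closure_iff by blast
  have B0: "?B \<in> mat_pairs (pair_rows ?B) (pair_cols ?B)"
    unfolding is_mat_pair_iff[symmetric] by (rule mat_pairs_is[OF direct_sum_mat_pairs]) simp
  have "Q 0 \<in> mat_pairs (pair_rows ?B) (pair_cols ?B)" by (rule orbit_mat_pairs[OF Q(1) B0])
  then have "pair_rows ?B = m \<and> pair_cols ?B = n" using mat_pairs_dims[OF Q(2)[of 0]] mat_pairs_dims by metis
  with B0 have B: "?B \<in> mat_pairs m n" by simp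
  have main: "sum_list (map \<phi> bs) \<le> sum_list (map \<phi> as)"
    if ex: "\<And>b. bvalid b ==> \<exists>J. solution_coords c d k N (bpair b) J \<and> card J = \<phi> b" for c d k N \<phi>
  proof -
    define J where "J b = (SOME J. solution_coords c d k N (bpair b) J \<and> card J = \<phi> b)" for b
    have J: "solution_coords c d k N (bpair b) (J b)" "card (J b) = \<phi> b" if "bvalid b" for b
      using someI_ex[OF ex[OF that]] unfolding J_def by auto
    have "sum_list (map (\<lambda>b. card (J b)) bs) \<le> sum_list (map (\<lambda>b. card (J b)) as)"
      by (rule solutions_semicontinuous[OF _ _ P B Q(1) lim]) (use J(1) valid in auto)
    moreover have "map (\<lambda>b. card (J b)) xs = map \<phi> xs" if "set xs \<subseteq> set as \<union> set bs" for xs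
      using J(2) valid that by (auto simp: subset_eq)
    ultimately show ?thesis by simp
  qed
  have mainT: "sum_list (map (gdim (Suc k)) bs) \<le> sum_list (map (gdim (Suc k)) as)" for k
  proof -
    define J where "J b = (SOME J. solution_coords (1, 0) (0, 1) k (Suc k) (transpose_pair (bpair b)) J \<and> card J = gdim (Suc k) b)" for b
    have J: "solution_coords (1, 0) (0, 1) k (Suc k) (transpose_pair (bpair b)) (J b)" "card (J b) = gdim (Suc k) b" if "bvalid b" for b
      using someI_ex[OF solution_coords_gdim[OF that, of k]] unfolding J_def by auto
    have tr: "direct_sum (map (\<lambda>b. transpose_pair (bpair b)) xs) = transpose_pair (direct_sum (map bpair xs))" for xs
      by (simp add: direct_sum_transpose o_def)
    have "sum_list (map (\<lambda>b. card (J b)) bs) \<le> sum_list (map (\<lambda>b. card (J b)) as)"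
    proof (rule solutions_semicontinuous[where g="\<lambda>b. transpose_pair (bpair b)" and Q="\<lambda>t. transpose_pair (Q t)" and m=n and n=m])
      show "is_mat_pair (transpose_pair (bpair b))" for b
        using transpose_mat_pairs[OF bpair_mat_pairs, of b] mat_pairs_is by blast
      show "mat_tendsto n m (\<lambda>t. transpose_pair (Q t)) (direct_sum (map (\<lambda>b. transpose_pair (bpair b)) as))"
        unfolding tr mat_tendsto_def
      proof (intro allI impI)
        fix i j assume ij: "i < n" "j < m"
        have "dim_row (fst (Q t)) = m" "dim_row (snd (Q t)) = m" "dim_col (fst (Q t)) = n" "dim_col (snd (Q t)) = n" for t
          using Q(2)[of t] by (auto simp: mat_pairs_def mem_Times_iff)
        moreover have "dim_row (fst ?P) = m" "dim_row (snd ?P) = m" "dim_col (fst ?P) = n" "dim_col (snd ?P) = n"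
          using P by (auto simp: mat_pairs_def mem_Times_iff)
        ultimately show "(\<lambda>t. fst (transpose_pair (Q t)) $$ (i, j)) \<longlonglongrightarrow> fst (transpose_pair ?P) $$ (i, j) \<and>
           (\<lambda>t. snd (transpose_pair (Q t)) $$ (i, j)) \<longlonglongrightarrow> snd (transpose_pair ?P) $$ (i, j)"
          using lim ij by (simp add: transpose_pair_def mat_tendsto_def)
      qed
    qed (use J(1) valid in \<open>auto simp: tr intro: transpose_mat_pairs P B orbit_transpose[OF Q(1) B]\<close>)
    moreover have "map (\<lambda>b. card (J b)) xs = map (gdim (Suc k)) xs" if "set xs \<subseteq> set as \<union> set bs" for xs
      using J(2) valid that by (auto simp: subset_eq)
    ultimately show ?thesis by simp
  qed
  have zero: "sum_list (map (fdim 0) xs) = 0" "sum_list (map (gdim 0) xs) = 0" for xs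
    by (induction xs) (auto simp: fdim_def gdim_def split: kblock.split)
  show ?thesis unfolding dims_ge_def
  proof (intro conjI allI)
    show "sum_list (map (fdim j) bs) \<le> sum_list (map (fdim j) as)" for j
      by (cases j) (simp_all add: zero main[OF solution_coords_fdim])
    show "sum_list (map (gdim j) bs) \<le> sum_list (map (gdim j) as)" for j
      by (cases j) (simp_all add: zero mainT)
    show "sum_list (map (hdim \<mu> k) bs) \<le> sum_list (map (hdim \<mu> k) as)" for \<mu> k
      by (cases \<mu>) (simp_all add: main[OF solution_coords_hdim_Finite] main[OF solution_coords_hdim_Infinity])
  qed
qed

section \<open>Extensions of a row-singular block by a column-singular block\<close>

lemma coeff_lin_triangular:
  assumes "P \<in> mat_pairs m1 n1" "P' \<in> mat_pairs m2 n2" "X \<in> mat_pairs m1 n2" and f: "f = fst \<or> f = snd"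
  shows "r < m1 ==> coeff (lin (f (triangular P X P')) x) r =
      (\<Sum>c<n1. f P $$ (r, c) * coeff x c) + (\<Sum>q<n2. f X $$ (r, q) * coeff x (n1 + q))"
    "r < m2 ==> coeff (lin (f (triangular P X P')) x) (m1 + r) = (\<Sum>q<n2. f P' $$ (r, q) * coeff x (n1 + q))"
proof -
  have d: "dim_row (f (triangular P X P')) = m1 + m2" "dim_col (f (triangular P X P')) = n1 + n2"
    using triangular_mat_pairs[OF assms(1-3)] f by (auto simp: mat_pairs_def mem_Times_iff)
  have dd: "f P \<in> carrier_mat m1 n1" "f P' \<in> carrier_mat m2 n2" "f X \<in> carrier_mat m1 n2"
    "pair_rows P' = m2" "pair_cols P = n1"
    using assms mat_pairs_dims by (auto simp: mat_pairs_def mem_Times_iff)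
  have T: "f (triangular P X P') = four_block_mat (f P) (f X) (0\<^sub>m m2 n1) (f P')"
    using f dd(4,5) by (auto simp: triangular_def)
  show "coeff (lin (f (triangular P X P')) x) r =
      (\<Sum>c<n1. f P $$ (r, c) * coeff x c) + (\<Sum>q<n2. f X $$ (r, q) * coeff x (n1 + q))" if "r < m1"
    using that dd by (auto simp: coeff_lin d sum_lessThan_add T intro!: arg_cong2[of _ _ _ _ "(+)"] sum.cong)
  show "coeff (lin (f (triangular P X P')) x) (m1 + r) = (\<Sum>q<n2. f P' $$ (r, q) * coeff x (n1 + q))" if "r < m2"
    using that dd by (auto simp: coeff_lin d sum_lessThan_add T intro!: sum.cong)
qed

text \<open>The corner of a pencil of companion type: the zeros of \<open>p\<close> become
  eigenvalues of the extension, and \<open>Infinity\<close> does where the degree of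
  \<open>p\<close> falls short of \<open>m + n - 1\<close>. In the second matrix, the coefficients
  below \<open>n - 1\<close> fill the first row and the following ones the last column; the top
  coefficient goes, negated, into the first matrix.\<close>

definition companion_block :: "nat => nat => (nat => complex) => mat_pair" where
  "companion_block m n p = (mat m n (\<lambda>(r, q). if r = m - 1 \<and> q = n - 1 then - p (m + n - 1) else 0),
     mat m n (\<lambda>(r, q). if q = n - 1 then p (n - 1 + r) else if r = 0 then p q else 0))"

locale companion =
  fixes m n :: nat and p :: "complex poly"
  assumes m: "1 \<le> m" and n: "1 \<le> n"
begin

definition "NN = m + n - 1"

definition "T = triangular (bpair (LTB m)) (companion_block m n (coeff p)) (bpair (LB n))"

lemma companion_block_mat_pairs: "companion_block m n (coeff p) \<in> mat_pairs m n"
  by (simp add: companion_block_def mat_pairs_def)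

lemma T_mat_pairs: "T \<in> mat_pairs NN NN"
  using triangular_mat_pairs[OF bpair_mat_pairs bpair_mat_pairs, of _ "LTB m" "LB n"] companion_block_mat_pairs m n
  by (simp add: T_def NN_def del: bpair.simps)

lemma
  assumes "r < NN"
  shows lin_T_fst: "coeff (lin (fst T) x) r =
      (if r < m - 1 then coeff x r else if r = m - 1 then - coeff p NN * coeff x (NN - 1) else coeff x (r - 1))"
    and lin_T_snd: "x \<in> vecs NN ==> coeff (lin (snd T) x) r =
      (if r = 0 then \<Sum>q<n. coeff p q * coeff x (m - 1 + q)
       else if r < m then coeff x (r - 1) + coeff p (n - 1 + r) * coeff x (NN - 1) else coeff x r)"
proof -
  let ?X = "companion_block m n (coeff p)"
  define y where "y c = (if c < m - 1 then coeff x c else 0)" for c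
  have X: "?X \<in> mat_pairs (brows (LTB m)) (bcols (LB n))" using companion_block_mat_pairs by simp
  note low = coeff_lin_triangular(1)[OF bpair_mat_pairs bpair_mat_pairs X, folded T_def, of _ r x]
  note high = coeff_lin_triangular(2)[OF bpair_mat_pairs bpair_mat_pairs X, folded T_def, of _ "r - m" x]
  have y: "(\<Sum>c<bcols (LTB m). M $$ (r, c) * coeff x c) = (\<Sum>c<bcols (LTB m). M $$ (r, c) * y c)" for M
    by (intro sum.cong) (auto simp: y_def)
  note rs = bpair_row_sums[of r "LTB m" y]
  have delta: "(\<Sum>q<n. (if q = k then a else 0) * g q) = (if k < n then a * g k else (0::complex))" for k g a
    by (simp add: if_distrib[of "\<lambda>z. z * _"] cong: if_cong)
  have z: "m - 1 + (n - 1) = NN - 1" "m + n - 1 = NN" using m n by (auto simp: NN_def)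
  show "coeff (lin (fst T) x) r =
      (if r < m - 1 then coeff x r else if r = m - 1 then - coeff p NN * coeff x (NN - 1) else coeff x (r - 1))"
  proof (cases "r < m")
    case True
    have "(\<Sum>q<n. fst ?X $$ (r, q) * coeff x (m - 1 + q)) = (if r = m - 1 then - coeff p NN * coeff x (NN - 1) else 0)"
    proof -
      have "(\<Sum>q<n. fst ?X $$ (r, q) * coeff x (m - 1 + q))
         = (\<Sum>q<n. (if q = n - 1 then (if r = m - 1 then - coeff p NN else 0) else 0) * coeff x (m - 1 + q))"
        using True z by (intro sum.cong) (auto simp: companion_block_def)
      then show ?thesis using n z unfolding delta by simp
    qed
    then show ?thesis using low[of fst] y[of "fst (bpair (LTB m))"] rs(1) True m by (auto simp: y_def simp del: bpair.simps)
  next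
    case False
    then have "coeff (lin (fst T) x) (m + (r - m)) = (\<Sum>q<bcols (LB n). fst (bpair (LB n)) $$ (r - m, q) * (coeff x (m - 1 + q)))"
      using high[of fst] assms by (simp add: NN_def del: bpair.simps)
    also have "\<dots> = (\<Sum>q<bcols (LB n). fst (bpair (LB n)) $$ (r - m, q) * (if q < n then coeff x (m - 1 + q) else 0))"
      by (intro sum.cong) auto
    also have "\<dots> = coeff x (m - 1 + (r - m))"
      using bpair_row_sums(1)[of "r - m" "LB n" "\<lambda>q. if q < n then coeff x (m - 1 + q) else 0"] assms False
      by (simp add: NN_def del: bpair.simps)
    finally show ?thesis using False m by (auto simp: Suc_diff_le)
  qed
  assume xv: "x \<in> vecs NN"
  show "coeff (lin (snd T) x) r =
      (if r = 0 then \<Sum>q<n. coeff p q * coeff x (m - 1 + q)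
       else if r < m then coeff x (r - 1) + coeff p (n - 1 + r) * coeff x (NN - 1) else coeff x r)"
  proof (cases "r < m")
    case True
    have "(\<Sum>q<n. snd ?X $$ (r, q) * coeff x (m - 1 + q)) =
        (if r = 0 then \<Sum>q<n. coeff p q * coeff x (m - 1 + q) else coeff p (n - 1 + r) * coeff x (NN - 1))"
    proof (cases "r = 0")
      case True
      then show ?thesis using m by (auto simp: companion_block_def intro!: sum.cong)
    next
      case False
      have "(\<Sum>q<n. snd ?X $$ (r, q) * coeff x (m - 1 + q))
         = (\<Sum>q<n. (if q = n - 1 then coeff p (n - 1 + r) else 0) * coeff x (m - 1 + q))"
        using True False by (intro sum.cong) (auto simp: companion_block_def)
      then show ?thesis using n False z unfolding delta by simp
    qed
    then show ?thesis using low[of snd] y[of "snd (bpair (LTB m))"] rs(2) True m by (auto simp: y_def simp del: bpair.simps)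
  next
    case False
    then have "coeff (lin (snd T) x) (m + (r - m)) = (\<Sum>q<bcols (LB n). snd (bpair (LB n)) $$ (r - m, q) * (coeff x (m - 1 + q)))"
      using high[of snd] assms by (simp add: NN_def del: bpair.simps)
    also have "\<dots> = (\<Sum>q<bcols (LB n). snd (bpair (LB n)) $$ (r - m, q) * (if q < n then coeff x (m - 1 + q) else 0))"
      by (intro sum.cong) auto
    also have "\<dots> = coeff x (m - 1 + Suc (r - m))"
      using bpair_row_sums(2)[of "r - m" "LB n" "\<lambda>q. if q < n then coeff x (m - 1 + q) else 0"] assms False
      by (auto simp: NN_def simp del: bpair.simps)
    finally show ?thesis using False m by (auto simp: Suc_diff_le)
  qed
qed

text \<open>\<open>R(x) = \<Sum> x\<^sup>q v'\<^sub>q + \<Sum> \<sigma>\<^sub>c(x) v\<^sub>c\<close> satisfies \<open>(B - x A) R(x) = p(x) w\<^sub>0\<close>; its Taylor coefficients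
  at a root of \<open>p\<close> of multiplicity \<open>e\<close> form a Jordan chain of length \<open>e\<close>.\<close>

definition "\<sigma> c = (\<Sum>j\<in>{n + c..NN}. monom (- coeff p j) (j - 1 - c))"

lemma sigma_step:
  assumes "1 \<le> r" "r < m"
  shows "\<sigma> (r - 1) + monom (coeff p (n - 1 + r)) (n - 1) = monom 1 1 * \<sigma> r"
proof -
  have "{n + (r - 1)..NN} = insert (n - 1 + r) {n + r..NN}" using assms n by (auto simp: NN_def)
  then have "\<sigma> (r - 1) = monom (- coeff p (n - 1 + r)) (n - 1) + (\<Sum>j\<in>{n + r..NN}. monom (- coeff p j) (j - 1 - (r - 1)))"
    using assms n by (simp add: \<sigma>_def)
  also have "(\<Sum>j\<in>{n + r..NN}. monom (- coeff p j) (j - 1 - (r - 1))) = monom 1 1 * \<sigma> r"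
    unfolding \<sigma>_def sum_distrib_left using assms n by (intro sum.cong) (auto simp: mult_monom intro!: arg_cong2[of _ _ _ _ monom])
  finally show ?thesis by (simp add: minus_monom[symmetric])
qed

lemma sigma_0:
  assumes "degree p \<le> NN"
  shows "(\<Sum>q<n. monom (coeff p q) q) = monom 1 1 * \<sigma> 0 + p"
proof -
  have "p = (\<Sum>j\<le>NN. monom (coeff p j) j)" by (rule poly_as_sum_of_monoms'[OF assms, symmetric])
  also have "{..NN} = {..<n} \<union> {n..NN}" using m by (auto simp: NN_def)
  also have "(\<Sum>j\<in>{..<n} \<union> {n..NN}. monom (coeff p j) j) = (\<Sum>q<n. monom (coeff p q) q) + (\<Sum>j\<in>{n..NN}. monom (coeff p j) j)"
    by (rule sum.union_disjoint) auto
  also have "(\<Sum>j\<in>{n..NN}. monom (coeff p j) j) = - (monom 1 1 * \<sigma> 0)"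
    unfolding \<sigma>_def sum_distrib_left sum_negf[symmetric] using n
    by (intro sum.cong) (auto simp: mult_monom minus_monom intro!: arg_cong2[of _ _ _ _ monom])
  finally have "p + monom 1 1 * \<sigma> 0 = (\<Sum>q<n. monom (coeff p q) q)"
    by (simp only: add_uminus_conv_diff eq_diff_eq)
  then show ?thesis by (simp only: add.commute)
qed

lemma sigma_last: "\<sigma> (m - 1) = monom (- coeff p NN) (n - 1)"
proof -
  have "{n + (m - 1)..NN} = {NN}" using m by (auto simp: NN_def)
  then show ?thesis using m n by (simp add: \<sigma>_def NN_def)
qed

text \<open>The rows below the first force a kernel vector of \<open>B - x0 A\<close> to be a
  multiple \<open>t R(x0)\<close>, with \<open>R\<close> as above. The first row then reads
  \<open>t p(x0) = 0\<close>.\<close>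

lemma T_injective:
  assumes deg: "degree p \<le> NN" and x0: "poly p x0 \<noteq> 0"
    and x: "x \<in> vecs NN" "act (- x0, 1) T x = 0"
  shows "x = 0"
proof -
  have eq: "coeff (lin (snd T) x) r = x0 * coeff (lin (fst T) x) r" for r
    using arg_cong[OF x(2), of "\<lambda>y. coeff y r"] by (simp add: act_def)
  define t where "t = coeff x (m - 1)"
  have hi: "coeff x (m - 1 + q) = x0 ^ q * t" if "q < n" for q
    using that
  proof (induction q)
    case (Suc q)
    then have "m - 1 + Suc q < NN" "m \<le> m - 1 + Suc q" using m by (auto simp: NN_def)
    then have "coeff (lin (fst T) x) (m - 1 + Suc q) = coeff x (m - 1 + q)"
      "coeff (lin (snd T) x) (m - 1 + Suc q) = coeff x (m - 1 + Suc q)"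
      by (subst lin_T_fst lin_T_snd[OF _ x(1)]; force)+
    then show ?case using eq[of "m - 1 + Suc q"] Suc by simp
  qed (simp add: t_def)
  have NN: "NN - 1 = m - 1 + (n - 1)" "m \<le> NN" using m n by (auto simp: NN_def)
  have lo: "coeff (lin (fst T) x) c = t * poly (\<sigma> c) x0" if "c \<le> m - 1" for c
    using that
  proof (induction c rule: inc_induct)
    case base
    show ?case using lin_T_fst[of "m - 1" x] hi[of "n - 1"] m n NN unfolding sigma_last poly_monom by simp
  next
    case (step c)
    then have c: "c < m - 1" "Suc c < NN" "Suc c < m" using NN m by auto
    have "coeff x c + coeff p (n - 1 + Suc c) * coeff x (NN - 1) = x0 * (t * poly (\<sigma> (Suc c)) x0)"
      using eq[of "Suc c"] lin_T_snd[OF c(2) x(1)] step.IH c by simp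
    moreover have "poly (\<sigma> c) x0 + coeff p (n - 1 + Suc c) * x0 ^ (n - 1) = x0 * poly (\<sigma> (Suc c)) x0"
      using arg_cong[OF sigma_step[of "Suc c"], of "\<lambda>p. poly p x0"] c by (simp add: poly_monom)
    moreover have "coeff x (NN - 1) = x0 ^ (n - 1) * t" using hi[of "n - 1"] n NN(1) by simp
    ultimately have "coeff x c = x0 * (t * poly (\<sigma> (Suc c)) x0) - coeff p (n - 1 + Suc c) * (x0 ^ (n - 1) * t)"
      "poly (\<sigma> c) x0 = x0 * poly (\<sigma> (Suc c)) x0 - coeff p (n - 1 + Suc c) * x0 ^ (n - 1)"
      by (simp_all only: eq_diff_eq)
    then have "coeff x c = t * poly (\<sigma> c) x0" by (simp only:) (simp only: algebra_simps)
    then show ?case using lin_T_fst[of c x] c by simp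
  qed
  have "0 < NN" using NN m by auto
  have "(\<Sum>q<n. coeff p q * coeff x (m - 1 + q)) = x0 * (t * poly (\<sigma> 0) x0)"
    using eq[of 0] lin_T_snd[OF \<open>0 < NN\<close> x(1)] lo[of 0] by simp
  moreover have "(\<Sum>q<n. coeff p q * coeff x (m - 1 + q)) = t * (\<Sum>q<n. coeff p q * x0 ^ q)"
    unfolding sum_distrib_left using hi by (intro sum.cong refl) (simp only: lessThan_iff mult.left_commute mult.commute)
  moreover have "(\<Sum>q<n. coeff p q * x0 ^ q) = x0 * poly (\<sigma> 0) x0 + poly p x0"
    using arg_cong[OF sigma_0[OF deg], of "\<lambda>p. poly p x0"] by (simp add: poly_sum poly_monom)
  ultimately have "t * poly p x0 = 0" by (simp add: algebra_simps)
  with x0 have "t = 0" by simp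
  show ?thesis
  proof (rule vecs_zeroI[OF x(1)])
    fix r assume r: "r < NN"
    show "coeff x r = 0"
    proof (cases "r < m - 1")
      case True
      then show ?thesis using lo[of r] lin_T_fst[OF r, of x] \<open>t = 0\<close> by simp
    next
      case False
      then show ?thesis using hi[of "r - (m - 1)"] r \<open>t = 0\<close> by (simp add: NN_def)
    qed
  qed
qed

lemma T_chain_Finite:
  assumes deg: "degree p \<le> NN" and e: "[:- l, 1:] ^ e dvd p" "0 < e"
  shows "\<exists>x\<in>sols (- l, 1) (1, 0) e e T. x 0 \<noteq> 0"
proof -
  \<comment> \<open>Substitution of \<open>x + l\<close>: the coefficient of index \<open>i\<close>
    of \<open>\<tau> g\<close> is the Taylor coefficient of \<open>g\<close> at \<open>l\<close>.
    The polynomials \<open>\<rho> c\<close> are the coordinates of \<open>R\<close>.\<close>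
  define \<tau> where "\<tau> g = pcompose g [:l, 1:]" for g :: "complex poly"
  define \<rho> where "\<rho> c = (if c < m - 1 then \<sigma> c else monom 1 (c - (m - 1)))" for c
  define x where "x i = (if i < e then \<Sum>c<NN. monom (coeff (\<tau> (\<rho> c)) i) c else 0)" for i
  have cx: "coeff (x i) c = (if i < e \<and> c < NN then coeff (\<tau> (\<rho> c)) i else 0)" for i c
    by (simp add: x_def coeff_sum coeff_monom)
  have xv: "x i \<in> vecs NN" for i by (simp add: vecs_def cx)
  have NN: "NN - 1 = m - 1 + (n - 1)" "m \<le> NN" using m n by (auto simp: NN_def)
  have \<tau>: "\<tau> (g + h) = \<tau> g + \<tau> h" "\<tau> (smult a g) = smult a (\<tau> g)" "\<tau> (\<Sum>q\<in>Q. f q) = (\<Sum>q\<in>Q. \<tau> (f q))"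
    "\<tau> (monom 1 1 * g) = [:l, 1:] * \<tau> g" for g h a f and Q :: "nat set"
  proof -
    have "monom 1 1 = ([:0, 1:] :: complex poly)" by (simp add: monom_altdef)
    then show "\<tau> (monom 1 1 * g) = [:l, 1:] * \<tau> g" by (simp add: \<tau>_def pcompose_mult pcompose_pCons)
  qed (simp_all add: \<tau>_def pcompose_add pcompose_smult pcompose_sum)
  have X: "coeff ([:l, 1:] * g) i = l * coeff g i + (if i = 0 then 0 else coeff g (i - 1))" for g :: "complex poly" and i
    by (cases i) simp_all
  \<comment> \<open>The root \<open>l\<close> has multiplicity at least \<open>e\<close>, so the
    right side \<open>p(x) w_0\<close> drops out of the first \<open>e\<close> chain
    equations.\<close>
  have pz: "coeff (\<tau> p) i = 0" if "i < e" for i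
  proof -
    from e(1) obtain g where "p = [:- l, 1:] ^ e * g" by (rule dvdE)
    moreover have "\<tau> ([:- l, 1:] ^ k) = monom 1 k" for k
    proof (induction k)
      case (Suc k)
      have "\<tau> ([:- l, 1:] ^ Suc k) = \<tau> [:- l, 1:] * \<tau> ([:- l, 1:] ^ k)" by (simp only: \<tau>_def power_Suc pcompose_mult)
      also have "\<tau> [:- l, 1:] = monom 1 1" by (simp add: \<tau>_def pcompose_pCons monom_altdef)
      finally show ?case using Suc by (simp add: mult_monom)
    qed (simp add: \<tau>_def pcompose_1)
    ultimately have "\<tau> p = monom 1 e * \<tau> g" by (simp add: \<tau>_def pcompose_mult)
    then show ?thesis using that by (simp add: coeff_monom_mult)
  qed
  have top: "\<rho> (NN - 1) = monom 1 (n - 1)" "NN - 1 < NN" using NN m n by (simp_all add: \<rho>_def NN_def)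
  have Ax: "coeff (lin (fst T) (x i)) r = (if i < e then coeff (\<tau> (if r < m then \<sigma> r else monom 1 (r - m))) i else 0)"
    if "r < NN" for r i
  proof -
    have "smult (- coeff p NN) (monom 1 (n - 1)) = \<sigma> (m - 1)" unfolding sigma_last by (simp add: smult_monom)
    then have "coeff (\<tau> (\<sigma> (m - 1))) i = - coeff p NN * coeff (\<tau> (monom 1 (n - 1))) i" by (metis \<tau>(2) coeff_smult)
    then have last: "- coeff p NN * coeff (x i) (NN - 1) = (if i < e then coeff (\<tau> (\<sigma> (m - 1))) i else 0)"
      using top by (simp add: cx)
    consider "r < m - 1" | "r = m - 1" | "m \<le> r" by linarith
    then show ?thesis
    proof cases
      case 1
      then have "r < m" by linarith
      with 1 show ?thesis unfolding lin_T_fst[OF that] using that by (simp add: cx \<rho>_def)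
    next
      case 2
      then show ?thesis unfolding lin_T_fst[OF that] using m last by simp
    next
      case 3
      then have "r - 1 - (m - 1) = r - m" "r - 1 < NN" "\<not> r - 1 < m - 1" "\<not> r < m - 1" "r \<noteq> m - 1" using that m by linarith+
      then show ?thesis unfolding lin_T_fst[OF that] cx \<rho>_def using 3 by simp
    qed
  qed
  have Bx: "coeff (lin (snd T) (x i)) r = (if i < e then coeff (\<tau> (monom 1 1 * (if r < m then \<sigma> r else monom 1 (r - m)))) i else 0)"
    if r: "r < NN" for r i
  proof (cases "i < e")
    case i: True
    consider "r = 0" | "1 \<le> r" "r < m" | "m \<le> r" by linarith
    then show ?thesis
    proof cases
      case 1
      have "(\<Sum>q<n. coeff p q * coeff (x i) (m - 1 + q)) = (\<Sum>q<n. coeff (\<tau> (smult (coeff p q) (monom 1 q))) i)"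
        using i m n by (intro sum.cong refl) (auto simp: cx \<rho>_def \<tau>(2) NN_def)
      also have "\<dots> = coeff (\<tau> (\<Sum>q<n. monom (coeff p q) q)) i" by (simp add: \<tau>(3) coeff_sum smult_monom)
      also have "\<dots> = coeff (\<tau> (monom 1 1 * \<sigma> 0)) i" unfolding sigma_0[OF deg] \<tau>(1) using pz[OF i] by simp
      finally show ?thesis using lin_T_snd[OF r xv] 1 m i by simp
    next
      case 2
      have "monom 1 1 * \<sigma> r = \<sigma> (r - 1) + smult (coeff p (n - 1 + r)) (monom 1 (n - 1))"
        using sigma_step[OF 2] by (simp add: smult_monom)
      then have "coeff (\<tau> (monom 1 1 * \<sigma> r)) i = coeff (\<tau> (\<sigma> (r - 1))) i + coeff p (n - 1 + r) * coeff (\<tau> (monom 1 (n - 1))) i"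
        by (simp only: \<tau>(1,2) coeff_add coeff_smult)
      moreover have "\<rho> (r - 1) = \<sigma> (r - 1)" "r - 1 < NN" using 2 r by (auto simp: \<rho>_def)
      ultimately show ?thesis unfolding lin_T_snd[OF r xv] cx using 2 i top by simp
    next
      case 3
      then have "\<rho> r = monom 1 1 * monom 1 (r - m)" "\<not> r < m" "r \<noteq> 0"
        using m by (auto simp: \<rho>_def mult_monom Suc_diff_le)
      then show ?thesis unfolding lin_T_snd[OF r xv] cx using i r by simp
    qed
  qed (use lin_T_snd[OF r xv, of i] m in \<open>simp add: cx\<close>)
  have "x \<in> sols (- l, 1) (1, 0) e e T"
    unfolding sols_def mem_Collect_eq mat_pairs_dims[OF T_mat_pairs, THEN conjunct2]
  proof (intro conjI allI impI xv)
    show "x i = 0" if "e \<le> i" for i using that by (simp add: x_def)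
    show "act (- l, 1) T (x i) = (if i = 0 then 0 else act (1, 0) T (x (i - 1)))" if "i < e" for i
    proof (rule act_eqI[OF T_mat_pairs])
      fix r assume r: "r < NN"
      show "coeff (act (- l, 1) T (x i)) r = (if i = 0 then 0 else coeff (act (1, 0) T (x (i - 1))) r)"
        using that unfolding act_def coeff_add coeff_smult fst_conv snd_conv Ax[OF r] Bx[OF r] \<tau>(4) X by auto
    qed
  qed
  moreover have "coeff (x 0) (m - 1) = 1" using e(2) NN m by (simp add: cx \<rho>_def \<tau>_def pcompose_1)
  then have "x 0 \<noteq> 0" by auto
  ultimately show ?thesis by blast
qed

lemma T_chain_Infinity:
  assumes deg: "degree p + e \<le> NN" and e: "0 < e"
  shows "\<exists>x\<in>sols (1, 0) (0, 1) e e T. x 0 \<noteq> 0"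
proof -
  \<comment> \<open>\<open>y i c\<close> is the coefficient of \<open>x^(n-1-i)\<close> after
    \<open>p(x) / x^(c+1)\<close> has been added to the coordinate of \<open>R\<close> at each
    \<open>c < m - 1\<close>. This cancels the high powers and changes the right side from
    \<open>p(x) w_0\<close> to \<open>p(x) / x^(m-1) w_(m-1)\<close>, whose coefficients at
    exponents above \<open>n - e\<close> vanish by the degree bound.\<close>
  define y where "y i c = (if c < m - 1 then if 1 \<le> i \<and> i \<le> n + c then coeff p (n + c - i) else 0
     else if c - (m - 1) + i = n - 1 then 1 else 0)" for i c
  define x where "x i = (if i < e then \<Sum>c<NN. monom (y i c) c else 0)" for i
  have cx: "coeff (x i) c = (if i < e \<and> c < NN then y i c else 0)" for i c
    by (simp add: x_def coeff_sum coeff_monom)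
  have xv: "x i \<in> vecs NN" for i by (simp add: vecs_def cx)
  have NN: "NN - 1 = m - 1 + (n - 1)" "m \<le> NN" "NN = n + (m - 1)" using m n by (auto simp: NN_def)
  have pz: "coeff p (NN - i) = 0" if "i < e" for i using deg that by (intro coeff_eq_0) linarith
  have A: "coeff (lin (fst T) (x i)) r = (if r < m then if 1 \<le> i \<and> i \<le> n + r then coeff p (n + r - i) else 0
      else if r - m + i = n - 1 then 1 else 0)" if "r < NN" "i < e" for r i
  proof -
    consider "r < m - 1" | "r = m - 1" | "m \<le> r" by linarith
    then show ?thesis
    proof cases
      case 2
      then have "n + r - i = NN - i" using NN m by simp
      then show ?thesis using 2 pz[of 0] pz[OF that(2)] e lin_T_fst[OF that(1), of "x i"] m by simp
    next
      case 3
      then have "r - 1 - (m - 1) = r - m" "r - 1 < NN" "\<not> r - 1 < m - 1" "r \<noteq> m - 1" "\<not> r < m - 1" using that m by auto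
      then show ?thesis using 3 lin_T_fst[OF that(1), of "x i"] that m by (simp add: cx y_def)
    qed (use lin_T_fst[OF that(1), of "x i"] that in \<open>simp add: cx y_def\<close>)
  qed
  have B: "coeff (lin (snd T) (x (i - 1))) r = (if r < m then if 1 \<le> i \<and> i \<le> n + r then coeff p (n + r - i) else 0
      else if r - m + i = n - 1 then 1 else 0)" if "r < NN" "i < e" "1 \<le> i" for r i
  proof -
    consider "r = 0" | "1 \<le> r" "r < m" | "m \<le> r" by linarith
    then show ?thesis
    proof cases
      case 1
      have "(\<Sum>q<n. coeff p q * coeff (x (i - 1)) (m - 1 + q)) = (\<Sum>q<n. if q = n - i then (if i \<le> n then coeff p (n - i) else 0) else 0)"
      proof (intro sum.cong refl)
        fix q assume "q \<in> {..<n}"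
        then have "q < n" by simp
        then have "q + (i - 1) = n - 1 \<longleftrightarrow> q = n - i \<and> i \<le> n" using \<open>1 \<le> i\<close> by arith
        moreover have "m - 1 + q - (m - 1) = q" by simp
        ultimately have "m - 1 + q - (m - 1) + (i - 1) = n - 1 \<longleftrightarrow> q = n - i \<and> i \<le> n" by (simp only:)
        moreover have "m - 1 + q < NN" "i - 1 < e" using that NN \<open>q < n\<close> by linarith+
        moreover have "\<not> m - 1 + q < m - 1" by simp
        ultimately show "coeff p q * coeff (x (i - 1)) (m - 1 + q) = (if q = n - i then (if i \<le> n then coeff p (n - i) else 0) else 0)"
          unfolding cx y_def by auto
      qed
      also have "\<dots> = (if i \<le> n then coeff p (n - i) else 0)" using that n by simp
      finally show ?thesis using lin_T_snd[OF that(1) xv, of "i - 1"] 1 m that by simp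
    next
      case 2
      have "n + (r - 1) - (i - 1) = n + r - i" "i - 1 \<le> n + (r - 1) \<longleftrightarrow> i \<le> n + r" "r - 1 < m - 1" "1 \<le> i - 1 \<longleftrightarrow> 2 \<le> i"
        using 2 that n by linarith+
      then have "y (i - 1) (r - 1) = (if 2 \<le> i \<and> i \<le> n + r then coeff p (n + r - i) else 0)" unfolding y_def by simp
      moreover have "NN - 1 - (m - 1) + (i - 1) = n - 1 \<longleftrightarrow> i = 1" "\<not> NN - 1 < m - 1" using NN n that by linarith+
      then have "y (i - 1) (NN - 1) = (if i = 1 then 1 else 0)" unfolding y_def by simp
      moreover have "n - 1 + r = n + r - 1" "r - 1 < NN" "NN - 1 < NN" "i - 1 < e" "1 \<le> n + r" using 2 that n by linarith+
      moreover have "i = 1 \<or> 2 \<le> i" using that by linarith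
      ultimately show ?thesis unfolding lin_T_snd[OF that(1) xv] cx using 2 that by auto
    next
      case 3
      then have "r - (m - 1) + (i - 1) = n - 1 \<longleftrightarrow> r - m + i = n - 1" "\<not> r < m - 1" using that m by auto
      then show ?thesis using lin_T_snd[OF that(1) xv, of "i - 1"] 3 that m by (simp add: cx y_def)
    qed
  qed
  have "x \<in> sols (1, 0) (0, 1) e e T"
    unfolding sols_def mem_Collect_eq mat_pairs_dims[OF T_mat_pairs, THEN conjunct2]
  proof (intro conjI allI impI xv)
    show "x i = 0" if "e \<le> i" for i using that by (simp add: x_def)
    show "act (1, 0) T (x i) = (if i = 0 then 0 else act (0, 1) T (x (i - 1)))" if i: "i < e" for i
    proof (rule act_eqI[OF T_mat_pairs])
      fix r assume r: "r < NN"
      show "coeff (act (1, 0) T (x i)) r = (if i = 0 then 0 else coeff (act (0, 1) T (x (i - 1))) r)"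
      proof (cases "i = 0")
        case True
        have "\<not> r < m ==> r - m \<noteq> n - 1" using r NN m n by linarith
        then show ?thesis using A[OF r i] True by (auto simp: act_def)
      next
        case False
        then show ?thesis using A[OF r i] B[OF r i] by (simp add: act_def)
      qed
    qed
  qed
  moreover have "coeff (x 0) (NN - 1) = 1" using e NN m n by (auto simp: cx y_def)
  then have "x 0 \<noteq> 0" by auto
  ultimately show ?thesis by blast
qed

end

lemma sols_orbit_nonzero:
  assumes "Q' \<in> orbit Q" "Q \<in> mat_pairs m n" "x \<in> sols c d k N Q" "x 0 \<noteq> 0"
  shows "\<exists>y\<in>sols c d k N Q'. y 0 \<noteq> 0"
proof -
  obtain S S' R R' where SR: "S \<in> carrier_mat m m" "S' \<in> carrier_mat m m" "S * S' = 1\<^sub>m m" "S' * S = 1\<^sub>m m"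
    "R \<in> carrier_mat n n" "R' \<in> carrier_mat n n" "R * R' = 1\<^sub>m n" "R' * R = 1\<^sub>m n"
    "Q' = (S * fst Q * R, S * snd Q * R)" using assms(1,2) by (rule orbitE)
  have "x 0 \<in> vecs n" using assms(3) mat_pairs_dims[OF assms(2)] by (simp add: sols_def)
  then have "lin R (lin R' (x 0)) = x 0" using lin_mult[of R n n R' n] SR lin_one by metis
  then have "lin R' (x 0) \<noteq> 0" using assms(4) cp.lin_map_0[OF lin_map_lin, of R] by auto
  with sols_orbit[OF assms(2) SR(9,1,5,6,7) assms(3)] show ?thesis by (intro bexI)
qed

text \<open>The equations give \<open>x_j(j) = x_0(0)\<close>; if \<open>k > n\<close>, this reaches
  position \<open>n\<close>, where everything is 0, and the first vector vanishes.\<close>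

lemma jordan_chain_length:
  assumes x: "x \<in> sols c d k k P" "x 0 \<noteq> 0" "0 < k"
    and P: "P \<in> mat_pairs n n"
    and c: "\<And>x r. x \<in> vecs n ==> r < n ==> coeff (act c P x) r = coeff x (Suc r)"
    and d: "\<And>x r. x \<in> vecs n ==> r < n ==> coeff (act d P x) r = coeff x r"
  shows "k \<le> n"
proof (rule ccontr)
  assume "\<not> k \<le> n"
  have xv: "x i \<in> vecs n" for i using solsD(1)[OF x(1)] mat_pairs_dims[OF P] by simp
  have e: "coeff (x i) (Suc r) = (if i = 0 then 0 else coeff (x (i - 1)) r)" if "i < k" "r < n" for i r
    using solsD(3)[OF x(1) that(1)] c[OF xv that(2), of i] d[OF xv that(2), of "i - 1"] by (auto split: if_splits)
  have sh: "coeff (x j) j = coeff (x 0) 0" if "j \<le> n" for j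
    using that
  proof (induction j)
    case (Suc j)
    then show ?case using e[of "Suc j" j] \<open>\<not> k \<le> n\<close> by simp
  qed simp
  have "coeff (x 0) 0 = 0" using sh[of n] xv[of n] by (simp add: vecs_def)
  have "coeff (x 0) r = 0" for r
  proof (cases r)
    case (Suc r')
    then show ?thesis using e[of 0 r'] x(3) xv[of 0] by (cases "r' < n") (auto simp: vecs_def)
  qed (use \<open>coeff (x 0) 0 = 0\<close> in simp)
  then show False using x(2) by (simp add: poly_eq_iff)
qed

definition eig_coeffs :: "ext_complex => (complex \<times> complex) \<times> (complex \<times> complex)" where
  "eig_coeffs \<mu> = (case \<mu> of Finite l => ((- l, 1), (1, 0)) | Infinity => ((1, 0), (0, 1)))"

lemma solution_coords_hdim:
  "bvalid b ==> \<exists>J. solution_coords (fst (eig_coeffs \<mu>)) (snd (eig_coeffs \<mu>)) k k (bpair b) J \<and> card J = hdim \<mu> k b"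
  using solution_coords_hdim_Finite solution_coords_hdim_Infinity
  by (cases \<mu>) (auto simp: eig_coeffs_def)

text \<open>A nonzero chain excludes \<open>hdim \<mu> k b = 0\<close>; with \<open>LB\<close> ruled
  out, a Jordan block at \<mu> remains.\<close>

lemma block_of_long_chain:
  assumes b: "bvalid b" "\<And>n. b \<noteq> LB n" and k: "0 < k"
    and x: "x \<in> sols (fst (eig_coeffs \<mu>)) (snd (eig_coeffs \<mu>)) k k (bpair b)" "x 0 \<noteq> 0"
  shows "\<exists>j\<ge>k. b = DB \<mu> j"
proof -
  have "hdim \<mu> k b \<noteq> 0"
  proof
    assume "hdim \<mu> k b = 0"
    then obtain J where J: "solution_coords (fst (eig_coeffs \<mu>)) (snd (eig_coeffs \<mu>)) k k (bpair b) J" "card J = 0"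
      using solution_coords_hdim[OF b(1), of \<mu> k] by auto
    then have "finite J" by (intro finite_subset[of J "{..<k} \<times> {..<pair_cols (bpair b)}"]) (auto simp: solution_coords_def)
    with J have "J = {}" by simp
    then show False using J(1) x by (auto simp: solution_coords_def)
  qed
  then obtain j where j: "b = DB \<mu> j" using b(2) by (cases b) (auto simp: hdim_def split: if_splits)
  note act = coeff_act_bpair[of _ b _, unfolded j kblock.case brows.simps bcols.simps]
  have P: "bpair b \<in> mat_pairs j j" using bpair_mat_pairs[of b] by (simp add: j del: bpair.simps)
  have "k \<le> j"
    by (rule jordan_chain_length[OF x k P])
       (use act in \<open>auto simp: j eig_coeffs_def algebra_simps split: ext_complex.split simp del: bpair.simps\<close>)
  with j show ?thesis by blast
qed

text \<open>The multiplicities at finite points become roots of \<open>p\<close>, and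
  \<open>e Infinity\<close> is the deficit of its degree. The summands of the extension are not
  computed but recognised in its Kronecker form: injectivity at a point that is not a root excludes
  \<open>LB\<close>, squareness then excludes \<open>LTB\<close>, and a chain of length
  \<open>e \<mu>\<close> with nonzero first vector needs a Jordan block at least that large.\<close>

theorem ext_move_LTB_LB:
  assumes mn: "1 \<le> m" "1 \<le> n" and S: "finite S" "(\<Sum>\<mu>\<in>S. e \<mu>) = m + n - 1"
  shows "\<exists>cs. ext_move (LTB m) (LB n) cs \<and> (\<forall>b\<in>set cs. \<exists>\<mu> k. b = DB \<mu> k \<and> 1 \<le> k) \<and>
     (\<forall>\<mu>\<in>S. \<forall>k. min k (e \<mu>) \<le> sum_list (map (hdim \<mu> k) cs))"
proof -
  define F where "F = {l. Finite l \<in> S}"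
  define p where "p = (\<Prod>l\<in>F. [:- l, 1:] ^ e (Finite l))"
  interpret companion m n p using mn by unfold_locales
  have fF: "finite F" unfolding F_def using finite_vimageI[OF S(1), of Finite] by (simp add: inj_on_def vimage_def)
  have S': "S = (if Infinity \<in> S then {Infinity} else {}) \<union> Finite ` F"
  proof (rule Set.set_eqI)
    fix \<mu> show "\<mu> \<in> S \<longleftrightarrow> \<mu> \<in> (if Infinity \<in> S then {Infinity} else {}) \<union> Finite ` F"
      by (cases \<mu>) (auto simp: F_def)
  qed
  have "(\<Sum>\<mu>\<in>S. e \<mu>) = (if Infinity \<in> S then e Infinity else 0) + (\<Sum>l\<in>F. e (Finite l))"
    by (subst S', subst sum.union_disjoint) (use fF in \<open>auto simp: sum.reindex inj_on_def\<close>)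
  moreover have "degree p = (\<Sum>l\<in>F. e (Finite l))"
    unfolding p_def by (subst degree_prod_eq_sum_degree) (auto simp: degree_power_eq)
  ultimately have deg: "degree p + (if Infinity \<in> S then e Infinity else 0) = NN" using S(2) by (simp add: NN_def)
  then have deg': "degree p \<le> NN" by (simp split: if_splits)
  have "p \<noteq> 0" unfolding p_def using fF by simp
  from poly_roots_finite[OF this] obtain x0 where x0: "poly p x0 \<noteq> 0"
    using infinite_UNIV_char_0[where 'a=complex] by (metis (mono_tags, lifting) UNIV_eq_I mem_Collect_eq)
  obtain cs where cs: "\<And>b. b \<in> set cs ==> bvalid b" and orb: "direct_sum (map bpair cs) \<in> orbit T"
    using kronecker_form[OF T_mat_pairs] by blast
  let ?D = "direct_sum (map bpair cs)"
  have pairs: "\<forall>X\<in>set (map bpair cs). is_mat_pair X" by auto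
  have orb': "T \<in> orbit ?D" by (rule orbit_sym[OF orb T_mat_pairs])
  have D: "?D \<in> mat_pairs NN NN" by (rule orbit_mat_pairs[OF orb T_mat_pairs])
  have noLB: "LB k \<notin> set cs" for k
  proof
    assume "LB k \<in> set cs"
    then obtain a where a: "a < length cs" "cs ! a = LB k" by (auto simp: in_set_conv_nth)
    have k: "1 \<le> k" using cs[of "LB k"] \<open>LB k \<in> set cs\<close> by simp
    have "solution_coords (- x0, 1) (1, 0) 1 1 (bpair (LB k)) ((\<lambda>i. (i, 0)) ` {..<1})"
      by (rule solution_coords_LB_Finite[OF k])
    from this[unfolded solution_coords_def, THEN conjunct2, THEN conjunct2, THEN bspec, of "(0, 0)"]
    obtain y where y: "y \<in> sols (- x0, 1) (1, 0) 1 1 (bpair (LB k))"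
      and y0: "\<forall>(i, q)\<in>(\<lambda>i. (i, 0)) ` {..<1}. coeff (y i) q = (if (i, q) = (0, 0) then 1 else 0)"
      by (auto simp del: bpair.simps)
    note y = y y0[THEN bspec, of "(0, 0)", simplified]
    have "(\<lambda>i. place (map pair_cols (map bpair cs)) a (y i)) \<in> sols (- x0, 1) (1, 0) 1 1 ?D"
      by (rule sols_place[OF pairs]) (use a y in simp_all)
    moreover have "place (map pair_cols (map bpair cs)) a (y 0) \<noteq> 0"
    proof
      assume "place (map pair_cols (map bpair cs)) a (y 0) = 0"
      then show False using coeff_place[of a "map pair_cols (map bpair cs)" a 0 "y 0"] a k y(2) by (simp del: bpair.simps)
    qed
    ultimately obtain z where z: "z \<in> sols (- x0, 1) (1, 0) 1 1 T" "z 0 \<noteq> 0"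
      using sols_orbit_nonzero[OF orb' D] by blast
    have "z 0 \<in> vecs NN" using solsD(1)[OF z(1), of 0] mat_pairs_dims[OF T_mat_pairs] by simp
    moreover have "act (- x0, 1) T (z 0) = 0" using solsD(3)[OF z(1), of 0] by simp
    ultimately show False using T_injective[OF deg' x0] z(2) by blast
  qed
  have noLTB: "LTB k \<notin> set cs" for k
  proof
    assume "LTB k \<in> set cs"
    \<comment> \<open>Without \<open>LB\<close> no block has more columns than rows, and
      \<open>LTB\<close> has strictly fewer; a square sum leaves no place for it.\<close>
    have "sum_list (map bcols cs) \<le> sum_list (map brows cs)" if "\<And>k. LB k \<notin> set cs" for cs
      using that
    proof (induction cs)
      case (Cons b cs)
      then have "sum_list (map bcols cs) \<le> sum_list (map brows cs)" by simp
      moreover have "bcols b \<le> brows b" using Cons.prems by (cases b) auto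
      ultimately show ?case by simp
    qed simp
    moreover have "\<exists>xs ys. cs = xs @ LTB k # ys" using \<open>LTB k \<in> set cs\<close> by (rule split_list)
    then obtain xs ys where xy: "cs = xs @ LTB k # ys" by blast
    ultimately have "sum_list (map bcols xs) \<le> sum_list (map brows xs)" "sum_list (map bcols ys) \<le> sum_list (map brows ys)"
      using noLB by auto
    moreover have "1 \<le> k" using cs[OF \<open>LTB k \<in> set cs\<close>] by simp
    moreover have "sum_list (map brows cs) = sum_list (map bcols cs)"
      using mat_pairs_dims[OF D] mat_pairs_dims[OF direct_sum_mat_pairs[OF pairs]] by (simp add: o_def)
    ultimately show False by (simp add: xy)
  qed
  have cs_DB: "\<exists>\<mu> k. b = DB \<mu> k \<and> 1 \<le> k" if "b \<in> set cs" for b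
  proof (cases b)
    case (DB \<mu> k)
    then show ?thesis using cs[OF that] by simp
  qed (use that noLB noLTB in blast)+
  have "min k (e \<mu>) \<le> sum_list (map (hdim \<mu> k) cs)" if \<mu>: "\<mu> \<in> S" for \<mu> k
  proof (cases "e \<mu> = 0")
    case False
    have "\<exists>x\<in>sols (fst (eig_coeffs \<mu>)) (snd (eig_coeffs \<mu>)) (e \<mu>) (e \<mu>) T. x 0 \<noteq> 0"
    proof (cases \<mu>)
      case (Finite l)
      have "[:- l, 1:] ^ e (Finite l) dvd p" unfolding p_def using fF \<mu> Finite by (intro dvd_prodI) (auto simp: F_def)
      then show ?thesis using T_chain_Finite[OF deg'] False Finite by (simp add: eig_coeffs_def)
    next
      case Infinity
      then show ?thesis using T_chain_Infinity deg False \<mu> by (simp add: eig_coeffs_def)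
    qed
    then obtain x where x: "x \<in> sols (fst (eig_coeffs \<mu>)) (snd (eig_coeffs \<mu>)) (e \<mu>) (e \<mu>) ?D" "x 0 \<noteq> 0"
      using sols_orbit_nonzero[OF orb T_mat_pairs] by blast
    have "\<exists>a<length cs. part (map pair_cols (map bpair cs)) a (x 0) \<noteq> 0"
    proof (rule ccontr)
      assume none: "\<not> ?thesis"
      have "x 0 = 0"
      proof (rule poly_eq_flat[where cs="map pair_cols (map bpair cs)"])
        show "x 0 \<in> vecs (sum_list (map pair_cols (map bpair cs)))"
          using solsD(1)[OF x(1)] mat_pairs_dims[OF direct_sum_mat_pairs[OF pairs]] by simp
        fix b q assume "b < length (map pair_cols (map bpair cs))" "q < map pair_cols (map bpair cs) ! b"
        then show "coeff (x 0) (flat (map pair_cols (map bpair cs)) (b, q)) = coeff 0 (flat (map pair_cols (map bpair cs)) (b, q))"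
          using none coeff_part[of "map pair_cols (map bpair cs)" b "x 0" q] by simp
      qed (simp add: vecs_def)
      with x(2) show False by simp
    qed
    then obtain a where a: "a < length cs" "part (map pair_cols (map bpair cs)) a (x 0) \<noteq> 0" by blast
    have "(\<lambda>i. part (map pair_cols (map bpair cs)) a (x i)) \<in> sols (fst (eig_coeffs \<mu>)) (snd (eig_coeffs \<mu>)) (e \<mu>) (e \<mu>) (bpair (cs ! a))"
      using sols_part[OF pairs _ x(1), of a] a(1) by simp
    moreover have in_cs: "cs ! a \<in> set cs" using a(1) by simp
    have "cs ! a \<noteq> LB k" for k using in_cs noLB[of k] by auto
    moreover have "0 < e \<mu>" using False by simp
    ultimately have "\<exists>j\<ge>e \<mu>. cs ! a = DB \<mu> j" 
      using block_of_long_chain[OF cs[OF in_cs], where x="\<lambda>i. part (map pair_cols (map bpair cs)) a (x i)"] a(2) by blast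
    then obtain j where j: "e \<mu> \<le> j" "cs ! a = DB \<mu> j" by blast
    have "min k (e \<mu>) \<le> hdim \<mu> k (cs ! a)" using j by (simp add: hdim_def)
    also have "\<dots> \<le> sum_list (map (hdim \<mu> k) cs)" using a(1) by (intro member_le_sum_list) auto
    finally show ?thesis .
  qed simp
  moreover have "ext_move (LTB m) (LB n) cs"
    unfolding ext_move_def using companion_block_mat_pairs orb by (auto simp: T_def simp del: bpair.simps)
  ultimately show ?thesis using cs_DB by blast
qed

section \<open>Comparing block multisets\<close>

abbreviation tot :: "(kblock => nat) => kblock multiset => nat" where
  "tot \<phi> A \<equiv> \<Sum>b\<in>#A. \<phi> b"

text \<open>The multiset counterpart of \<open>dims_ge\<close>.\<close>

definition ge :: "kblock multiset => kblock multiset => bool" where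
  "ge A B \<longleftrightarrow> (\<forall>j. tot (fdim j) B \<le> tot (fdim j) A) \<and> (\<forall>j. tot (gdim j) B \<le> tot (gdim j) A) \<and>
     (\<forall>\<mu> k. tot (hdim \<mu> k) B \<le> tot (hdim \<mu> k) A)"

text \<open>The piecewise linear shape of \<open>sdim\<close>: for large \<open>j\<close> the total
  is \<open>j * num - len\<close>, and \<open>cnt s j\<close> is its increment from \<open>j\<close>
  to \<open>Suc j\<close>.\<close>

definition num :: "(kblock => nat option) => kblock => nat" where
  "num s b = (case s b of Some n => 1 | None => 0)"
definition len :: "(kblock => nat option) => kblock => nat" where
  "len s b = (case s b of Some n => n | None => 0)"
definition cnt :: "(kblock => nat option) => nat => kblock => nat" where
  "cnt s j b = (case s b of Some n => if n \<le> j then 1 else 0 | None => 0)"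

abbreviation "nL \<equiv> num szL"
abbreviation "nT \<equiv> num szT"
abbreviation "sL \<equiv> len szL"
abbreviation "sT \<equiv> len szT"

text \<open>The same data for \<open>hdim\<close>: for large \<open>k\<close> the total is
  \<open>k * nL + sD\<close>, and \<open>cD \<mu> k\<close> is the part of its increment that comes
  from Jordan blocks.\<close>

definition sD :: "ext_complex => kblock => nat" where
  "sD \<mu> b = (case b of DB \<nu> k => if \<nu> = \<mu> then k else 0 | _ => 0)"
definition sDall :: "kblock => nat" where "sDall b = (case b of DB \<nu> k => k | _ => 0)"
definition cD :: "ext_complex => nat => kblock => nat" where
  "cD \<mu> k b = (case b of DB \<nu> j => if \<nu> = \<mu> \<and> k < j then 1 else 0 | _ => 0)"
definition sqLT :: "kblock => nat" where "sqLT b = (case b of LB n => n * n | LTB n => n * n | _ => 0)"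
definition sqD :: "kblock => nat" where "sqD b = (case b of DB \<nu> k => k * k | _ => 0)"

lemmas block_fun_defs = sdim_def hdim_def num_def len_def cnt_def szL_def szT_def sD_def sDall_def cD_def sqLT_def sqD_def

lemma tot_cong_add: "(\<And>b. b \<in># A ==> \<phi> b + \<psi> b = \<omega> b) ==> tot \<phi> A + tot \<psi> A = tot \<omega> A"
  by (induction A) (auto simp: algebra_simps)

lemma tot_add_le: "(\<And>b. b \<in># A ==> \<phi> b \<le> \<omega> b) ==> tot \<phi> A \<le> tot \<omega> A"
  by (induction A) (auto intro: add_mono)

lemma tot_mult: "tot (\<lambda>b. c * \<phi> b) A = c * tot \<phi> A"
  by (induction A) (auto simp: algebra_simps)

lemma tot_eq_0_D: "tot \<phi> A = 0 ==> b \<in># A ==> \<phi> b = 0"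
  by (auto simp: sum_mset_0_iff)

text \<open>Couples a size selector with its constructor, so that both singular kinds are treated in
  one argument.\<close>

definition sing :: "(kblock => nat option) => (nat => kblock) => bool" where
  "sing s K \<longleftrightarrow> s = szL \<and> K = LB \<or> s = szT \<and> K = LTB"

lemma sing_iff: "sing s K ==> s b = Some n \<longleftrightarrow> b = K n"
  by (auto simp: sing_def szL_def szT_def split: kblock.splits)

lemma singD: "sing s K ==> s b = Some n ==> b = K n"
  by (simp add: sing_iff)

lemma sing_LB: "sing szL LB" and sing_LTB: "sing szT LTB"
  by (simp_all add: sing_def)

lemma sing_cases: "sing s K ==> (s = szL ==> K = LB ==> P) ==> (s = szT ==> K = LTB ==> P) ==> P"
  by (auto simp: sing_def)

lemma szL_neq_szT: "szL \<noteq> szT"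
proof
  assume "szL = szT"
  then have "szL (LB 0) = szT (LB 0)" by simp
  then show False by (simp add: szL_def szT_def)
qed

lemma sdim_Suc: "tot (sdim s (Suc j)) A = tot (sdim s j) A + tot (cnt s j) A"
  by (rule tot_cong_add[symmetric]) (auto simp: block_fun_defs split: option.split)

lemma hdim_Suc: "tot (hdim \<mu> (Suc k)) A = tot (hdim \<mu> k) A + tot nL A + tot (cD \<mu> k) A"
proof -
  have "tot (hdim \<mu> k) A + tot nL A = tot (\<lambda>b. hdim \<mu> k b + nL b) A" by (rule tot_cong_add) simp
  moreover have "tot (\<lambda>b. hdim \<mu> k b + nL b) A + tot (cD \<mu> k) A = tot (hdim \<mu> (Suc k)) A"
    by (rule tot_cong_add) (auto simp: block_fun_defs split: kblock.split)
  ultimately show ?thesis by simp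
qed

lemma count_tot: "count A b = tot (\<lambda>x. if x = b then 1 else 0) A"
  by (induction A) auto

text \<open>Second differences of the dimensions are multiplicities.\<close>

lemma cnt_Suc: "sing s K ==> tot (cnt s (Suc j)) A = tot (cnt s j) A + count A (K (Suc j))"
  unfolding count_tot
  by (rule tot_cong_add[symmetric]) (auto simp: cnt_def sing_iff[symmetric] split: option.split)

lemma cD_Suc: "tot (cD \<mu> k) A = tot (cD \<mu> (Suc k)) A + count A (DB \<mu> (Suc k))"
  unfolding count_tot by (rule tot_cong_add[symmetric]) (auto simp: block_fun_defs split: kblock.split)

lemma cnt_le: "tot (cnt s j) A \<le> tot (num s) A"
  by (rule tot_add_le) (auto simp: cnt_def num_def split: option.split)

lemma cnt_eq: "sing s K ==> (\<And>n. K n \<in># A ==> n \<le> j) ==> tot (cnt s j) A = tot (num s) A"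
  by (intro arg_cong[of _ _ sum_mset] image_mset_cong) (auto simp: cnt_def num_def split: option.split dest: singD)

lemma cnt_eqD:
  assumes "sing s K" "tot (cnt s j) A = tot (num s) A" "K n \<in># A"
  shows "n \<le> j"
proof -
  have "tot (cnt s j) A + tot (\<lambda>b. num s b - cnt s j b) A = tot (num s) A"
    by (rule tot_cong_add) (auto simp: cnt_def num_def split: option.split)
  then have "tot (\<lambda>b. num s b - cnt s j b) A = 0" using assms(2) by simp
  from tot_eq_0_D[OF this assms(3)] have "num s (K n) - cnt s j (K n) = 0" .
  moreover have "s (K n) = Some n" using sing_iff[OF assms(1)] by simp
  ultimately show ?thesis by (simp add: cnt_def num_def split: if_splits)
qed

lemma sdim_large: "sing s K ==> (\<And>n. K n \<in># A ==> n \<le> j) ==> tot (sdim s j) A + tot (len s) A = j * tot (num s) A"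
  unfolding tot_mult[symmetric]
  by (rule tot_cong_add) (auto simp: sdim_def len_def num_def split: option.split dest: singD)

lemma sdim_ge: "j * tot (num s) A \<le> tot (sdim s j) A + tot (len s) A"
  unfolding tot_mult[symmetric] sum_mset.distrib[symmetric]
  by (rule tot_add_le) (auto simp: sdim_def len_def num_def split: option.split)

lemma hdim_le: "tot (hdim \<mu> k) A \<le> k * tot nL A + tot (sD \<mu>) A"
  unfolding tot_mult[symmetric] sum_mset.distrib[symmetric]
  by (rule tot_add_le) (auto simp: block_fun_defs split: kblock.split)

lemma hdim_nL: "k * tot nL A \<le> tot (hdim \<mu> k) A"
  unfolding tot_mult[symmetric]
  by (rule tot_add_le) (auto simp: block_fun_defs split: kblock.split)

lemma hdim_large: "(\<And>j. DB \<mu> j \<in># A ==> j \<le> k) ==> tot (hdim \<mu> k) A = k * tot nL A + tot (sD \<mu>) A"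
  unfolding tot_mult[symmetric]
  by (rule tot_cong_add[symmetric]) (auto simp: block_fun_defs split: kblock.split)

lemma cD_mono: "k \<le> k' ==> tot (cD \<mu> k') A \<le> tot (cD \<mu> k) A"
  by (rule tot_add_le) (auto simp: block_fun_defs split: kblock.split)

text \<open>An \<open>LB\<close> has one row less than its size and an \<open>LTB\<close> one column
  less; \<open>bvalid\<close> keeps the subtraction from being truncated.\<close>

lemma rows_cols:
  assumes "\<And>b. b \<in># A ==> bvalid b"
  shows "tot brows A + tot nL A = tot sL A + tot sT A + tot sDall A"
    "tot bcols A + tot nT A = tot sL A + tot sT A + tot sDall A"
proof -
  have "tot (\<lambda>b. brows b + nL b) A = tot (\<lambda>b. sL b + sT b + sDall b) A"
    "tot (\<lambda>b. bcols b + nT b) A = tot (\<lambda>b. sL b + sT b + sDall b) A"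
    using assms by (intro arg_cong[of _ _ sum_mset] image_mset_cong; force simp: block_fun_defs split: kblock.split)+
  then show "tot brows A + tot nL A = tot sL A + tot sT A + tot sDall A"
    "tot bcols A + tot nT A = tot sL A + tot sT A + tot sDall A"
    by (simp_all add: sum_mset.distrib)
qed

lemma sDall_sum:
  assumes "finite S" "\<And>\<mu> k. DB \<mu> k \<in># A ==> \<mu> \<in> S"
  shows "tot sDall A = (\<Sum>\<mu>\<in>S. tot (sD \<mu>) A)"
  using assms(2)
proof (induction A)
  case (add b A)
  have "sDall b = (\<Sum>\<mu>\<in>S. sD \<mu> b)"
    using assms(1) add.prems[of _ _] by (cases b) (auto simp: block_fun_defs)
  moreover have "tot sDall A = (\<Sum>\<mu>\<in>S. tot (sD \<mu>) A)" using add.prems by (intro add.IH) auto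
  ultimately show ?case by (simp add: sum.distrib)
qed simp

lemma bounded_blocks:
  obtains N where "\<And>n. LB n \<in># A ==> n \<le> N" "\<And>n. LTB n \<in># A ==> n \<le> N" "\<And>\<mu> n. DB \<mu> n \<in># A ==> n \<le> N"
proof -
  have le: "\<phi> b \<le> tot \<phi> A" if "b \<in># A" for \<phi> and b :: kblock
    using that by (metis image_mset_add_mset insert_DiffM le_add1 sum_mset.insert)
  show thesis
  proof (rule that[of "tot sL A + tot sT A + tot sDall A"])
    show "n \<le> tot sL A + tot sT A + tot sDall A" if "LB n \<in># A" for n
      using le[OF that, of sL] by (simp add: block_fun_defs)
    show "n \<le> tot sL A + tot sT A + tot sDall A" if "LTB n \<in># A" for n
      using le[OF that, of sT] by (simp add: block_fun_defs)
    show "n \<le> tot sL A + tot sT A + tot sDall A" if "DB \<mu> n \<in># A" for \<mu> n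
      using le[OF that, of sDall] by (simp add: block_fun_defs)
  qed
qed

lemma finite_eigenvalues: "finite {\<mu>. \<exists>k. DB \<mu> k \<in># A}"
proof -
  have "{\<mu>. \<exists>k. DB \<mu> k \<in># A} \<subseteq> (\<lambda>b. case b of DB \<mu> k => \<mu> | _ => Infinity) ` set_mset A"
    by (force simp: image_iff)
  then show ?thesis by (rule finite_subset) simp
qed

text \<open>Multiplicities are second differences. The number of \<open>LB\<close> summands has to
  be recovered first, because it enters the increments of \<open>hdim\<close>.\<close>

lemma blocks_eqI:
  assumes valid: "\<And>b. b \<in># A + B ==> bvalid b"
    and f: "\<And>j. tot (fdim j) A = tot (fdim j) B" and g: "\<And>j. tot (gdim j) A = tot (gdim j) B"
    and h: "\<And>\<mu> k. tot (hdim \<mu> k) A = tot (hdim \<mu> k) B"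
  shows "A = B"
proof (rule multiset_eqI)
  fix b
  have c: "tot (cnt szL j) A = tot (cnt szL j) B" "tot (cnt szT j) A = tot (cnt szT j) B" for j
    using f[of j] f[of "Suc j"] g[of j] g[of "Suc j"] by (simp_all add: sdim_Suc)
  obtain N1 N2 where "\<And>n. LB n \<in># A ==> n \<le> N1" "\<And>n. LB n \<in># B ==> n \<le> N2"
    using bounded_blocks[of A] bounded_blocks[of B] by metis
  then have "tot nL A = tot nL B"
    using c(1)[of "max N1 N2"] cnt_eq[OF sing_LB, of A "max N1 N2"] cnt_eq[OF sing_LB, of B "max N1 N2"] by (simp add: le_max_iff_disj)
  then have cD: "tot (cD \<mu> k) A = tot (cD \<mu> k) B" for \<mu> k
    using h[of \<mu> k] h[of \<mu> "Suc k"] by (simp add: hdim_Suc)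
  show "count A b = count B b"
  proof (cases "bvalid b")
    case True
    show ?thesis
    proof (cases b)
      case (LB n)
      with True obtain k where "b = LB (Suc k)" by (cases n) auto
      then show ?thesis using c(1)[of k] c(1)[of "Suc k"] by (simp add: cnt_Suc[OF sing_LB])
    next
      case (LTB n)
      with True obtain k where "b = LTB (Suc k)" by (cases n) auto
      then show ?thesis using c(2)[of k] c(2)[of "Suc k"] by (simp add: cnt_Suc[OF sing_LTB])
    next
      case (DB \<mu> n)
      with True obtain k where "b = DB \<mu> (Suc k)" by (cases n) auto
      then show ?thesis using cD[of \<mu> k] cD[of \<mu> "Suc k"] cD_Suc[of \<mu> k A] cD_Suc[of \<mu> k B] by simp
    qed
  next
    case False
    then have "b \<notin># A" "b \<notin># B" using valid by auto
    then show ?thesis by (simp add: not_in_iff)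
  qed
qed

text \<open>The ends are the zeros of \<open>d\<close> nearest to \<open>i0\<close>. For a
  difference of dimension functions its slope changes there, which will reveal summands.\<close>

lemma positive_interval:
  fixes d :: "nat => int"
  assumes "d 0 = 0" "d i0 > 0" "\<And>j. j \<ge> J ==> d j = 0" "\<And>j. d j \<ge> 0"
  obtains a b where "a < i0" "i0 < b" "d a = 0" "d b = 0" "\<And>i. a < i ==> i < b ==> d i > 0"
proof -
  define a where "a = Max {i. i \<le> i0 \<and> d i = 0}"
  have fin: "finite {i. i \<le> i0 \<and> d i = 0}" by simp
  have "0 \<in> {i. i \<le> i0 \<and> d i = 0}" using assms(1) by simp
  then have "a \<in> {i. i \<le> i0 \<and> d i = 0}" unfolding a_def by (intro Max_in[OF fin]) blast
  then have a: "a \<le> i0" "d a = 0" by simp_all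
  define b where "b = (LEAST i. i0 \<le> i \<and> d i = 0)"
  have "i0 \<le> max i0 J \<and> d (max i0 J) = 0" using assms(3) by simp
  then have b: "i0 \<le> b" "d b = 0" unfolding b_def using LeastI[of "\<lambda>i. i0 \<le> i \<and> d i = 0"] by blast+
  show thesis
  proof (rule that[of a b])
    show "a < i0" "i0 < b" using a b assms(2) by (auto simp: order_less_le)
    show "d a = 0" "d b = 0" by fact+
    fix i assume i: "a < i" "i < b"
    have "d i \<noteq> 0"
    proof
      assume "d i = 0"
      show False
      proof (cases "i \<le> i0")
        case True
        then have "i \<le> a" unfolding a_def using fin \<open>d i = 0\<close> by (intro Max_ge) auto
        with i show False by simp
      next
        case False
        then have "b \<le> i" unfolding b_def using \<open>d i = 0\<close> by (intro Least_le) auto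
        with i show False by simp
      qed
    qed
    with assms(4)[of i] show "d i > 0" by simp
  qed
qed

text \<open>The strict order of the summands in the theorem: if \<open>b1\<close> is before
  \<open>b2\<close>, the block in the rows of \<open>b1\<close> and the columns of \<open>b2\<close>
  is above the diagonal. Jordan blocks with different eigenvalues are incomparable.\<close>

fun before :: "kblock => kblock => bool" where
  "before (LTB j) (LTB k) = (j < k)"
| "before (LB k) (LB j) = (j < k)"
| "before (DB \<mu> j) (DB \<nu> k) = (\<mu> = \<nu> \<and> j < k)"
| "before (LTB _) (DB _ _) = True"
| "before (LTB _) (LB _) = True"
| "before (DB _ _) (LB _) = True"
| "before _ _ = False"

text \<open>One component for each kind of move: merging \<open>LTB\<close> with \<open>LB\<close>
  lowers \<open>nL\<close>; growth of a singular block at the expense of a Jordan block lowers the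
  Jordan total; singular sizes that approach each other lower their sum of squares; Jordan sizes
  that move apart raise \<open>sqD\<close>, which the square of the total bounds.\<close>

definition shrinks :: "(kblock multiset \<times> kblock multiset) set" where
  "shrinks = measures [tot nL, tot sDall, tot sqLT, \<lambda>A. (tot sDall A)\<^sup>2 - tot sqD A]"

text \<open>One admissible step from \<open>A\<close> towards \<open>B\<close>. The case
  \<open>b1 = b2\<close> occurs for equal Jordan blocks, and \<open>DB \<mu> 0\<close> for a Jordan
  block of size 1 that has been used up.\<close>

definition improves :: "kblock multiset => kblock multiset => kblock => kblock => kblock list => kblock multiset => bool" where
  "improves A B b1 b2 cs R \<longleftrightarrow> A = add_mset b1 (add_mset b2 R) \<and> (before b1 b2 \<or> b1 = b2) \<and> ext_move b1 b2 cs \<and>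
     (\<forall>b\<in>set cs. bvalid b \<or> (\<exists>\<mu>. b = DB \<mu> 0)) \<and> ge (mset cs + R) B \<and> (mset cs + R, A) \<in> shrinks"

lemma sqD_le: "tot sqD A \<le> (tot sDall A)\<^sup>2"
proof (induction A)
  case (add b A)
  have "sqD b \<le> (sDall b)\<^sup>2" by (auto simp: block_fun_defs power2_eq_square split: kblock.split)
  then show ?case using add by (simp add: power2_sum)
qed simp

lemma nat_max:
  assumes "P n0" "\<And>n. P n ==> n \<le> (N :: nat)"
  obtains n where "P n" "\<And>k. P k ==> k \<le> n"
  using that[of "Greatest P"] GreatestI_nat[of P n0 N] Greatest_le_nat[of P _ N] assms by simp

lemma pick_max:
  assumes "b n0 \<in># A" "(\<exists>s. sing s b) \<or> b = DB \<mu>"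
  obtains n where "b n \<in># A" "\<And>k. b k \<in># A ==> k \<le> n"
proof -
  obtain N where "\<And>n. LB n \<in># A ==> n \<le> N" "\<And>n. LTB n \<in># A ==> n \<le> N" "\<And>\<mu> n. DB \<mu> n \<in># A ==> n \<le> N"
    by (rule bounded_blocks[of A]) blast
  then have "\<And>n. b n \<in># A ==> n \<le> N" using assms(2) by (auto simp: sing_def)
  from nat_max[of "\<lambda>n. b n \<in># A", OF assms(1) this] that show thesis by blast
qed

lemma two_elements:
  assumes "x \<in># A" "y \<in># A" "x \<noteq> y"
  obtains R where "A = add_mset x (add_mset y R)"
proof -
  obtain A' where A': "A = add_mset x A'" using assms(1) by (metis insert_DiffM)
  with assms obtain R where "A' = add_mset y R" by (metis insert_DiffM insert_noteq_member)
  with A' that show thesis by blast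
qed

lemma geD:
  assumes "ge A B"
  shows "tot (fdim j) B \<le> tot (fdim j) A" "tot (gdim j) B \<le> tot (gdim j) A" "tot (hdim \<mu> k) B \<le> tot (hdim \<mu> k) A"
  using assms by (auto simp: ge_def)

lemma geD_sing: "ge A B ==> sing s K ==> tot (sdim s j) B \<le> tot (sdim s j) A"
  by (auto simp: sing_def ge_def)

lemma geI_sing:
  assumes "\<And>s K j. sing s K ==> tot (sdim s j) B \<le> tot (sdim s j) A" "\<And>\<mu> k. tot (hdim \<mu> k) B \<le> tot (hdim \<mu> k) A"
  shows "ge A B"
  using assms(1)[OF sing_LB] assms(1)[OF sing_LTB] assms(2) by (simp add: ge_def)

text \<open>Moving the sizes \<open>j\<close> and \<open>k\<close> one step towards each other
  lowers \<open>sdim\<close> by 1 exactly for \<open>j < i < k\<close>, where \<open>pos\<close>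
  gives slack.\<close>

lemma improve_sing_sing:
  assumes valid: "\<And>b. b \<in># A ==> bvalid b" and ge: "ge A B" and sing: "sing s K"
    and x: "K j \<in># A" "K k \<in># A" "Suc j < k"
    and pos: "\<And>i. j < i ==> i < k ==> tot (sdim s i) B < tot (sdim s i) A"
  shows "\<exists>b1 b2 cs R. improves A B b1 b2 cs R"
proof -
  have "K j \<noteq> K k" using sing x(3) by (auto simp: sing_def)
  then obtain R where A: "A = add_mset (K j) (add_mset (K k) R)" using two_elements[OF x(1,2)] by blast
  have j: "1 \<le> j" using valid[OF x(1)] sing by (auto simp: sing_def)
  let ?cs = "[K (Suc j), K (k - 1)]"
  have f: "tot (sdim s' i) (mset ?cs + R) + (if s' = s \<and> j < i \<and> i < k then 1 else 0) = tot (sdim s' i) A"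
    if "sing s' K'" for s' K' i
    using sing that x(3)
    by (elim sing_cases) (auto simp: A sdim_def szL_def szT_def szL_neq_szT szL_neq_szT[symmetric])
  have h: "tot (hdim \<mu> i) (mset ?cs + R) = tot (hdim \<mu> i) A" for \<mu> i
    using sing by (auto simp: A hdim_def sing_def)
  have "ge (mset ?cs + R) B"
  proof (rule geI_sing)
    show "tot (sdim s' i) B \<le> tot (sdim s' i) (mset ?cs + R)" if "sing s' K'" for s' K' i
      using f[OF that, of i] pos[of i] geD_sing[OF ge that, of i] by (auto split: if_splits)
    show "tot (hdim \<mu> i) B \<le> tot (hdim \<mu> i) (mset ?cs + R)" for \<mu> i
      unfolding h by (rule geD[OF ge])
  qed
  \<comment> \<open>With \<open>k = k' + 2\<close> the sums of squares are compared without
    subtraction.\<close>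
  moreover define k' where "k' = k - 2"
  have k': "k = Suc (Suc k')" "j \<le> k'" using x(3) by (simp_all add: k'_def)
  have "(mset ?cs + R, A) \<in> shrinks"
    using k'(2) sing by (auto simp: A shrinks_def k'(1) sing_def num_def szL_def szT_def sDall_def sqLT_def)
  ultimately have imp: "improves A B b1 b2 ?cs R" if "A = add_mset b1 (add_mset b2 R)" "before b1 b2" "ext_move b1 b2 ?cs" for b1 b2
    unfolding improves_def using that x(3) j sing by (auto simp: sing_def)
  from sing show ?thesis unfolding sing_def
  proof (elim disjE conjE)
    assume "K = LB"
    then show ?thesis using ext_move_LB[OF j, of k] x(3) A
      by (intro exI[of _ "LB k"] exI[of _ "LB j"] exI[of _ ?cs] exI[of _ R] imp) (auto simp: add_mset_commute)
  next
    assume "K = LTB"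
    then show ?thesis using ext_move_LTB[OF j, of k] x(3) A
      by (intro exI[of _ "LTB j"] exI[of _ "LTB k"] exI[of _ ?cs] exI[of _ R] imp) auto
  qed
qed

text \<open>Moving the sizes apart to \<open>j - 1\<close> and \<open>k + 1\<close> lowers
  \<open>hdim\<close> at \<mu> by 1 exactly for \<open>j \<le> i \<le> k\<close>.\<close>

lemma improve_DB_DB:
  assumes A: "A = add_mset (DB \<mu> j) (add_mset (DB \<mu> k) R)" and ge: "ge A B" and jk: "1 \<le> j" "j \<le> k"
    and pos: "\<And>i. j \<le> i ==> i \<le> k ==> tot (hdim \<mu> i) B < tot (hdim \<mu> i) A"
  shows "\<exists>b1 b2 cs R. improves A B b1 b2 cs R"
proof -
  let ?C = "mset [DB \<mu> (Suc k), DB \<mu> (j - 1)] + R"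
  have f: "tot (fdim i) ?C = tot (fdim i) A" and g: "tot (gdim i) ?C = tot (gdim i) A" for i
    by (simp_all add: A fdim_def gdim_def)
  have h: "tot (hdim \<nu> i) ?C + (if \<nu> = \<mu> \<and> j \<le> i \<and> i \<le> k then 1 else 0) = tot (hdim \<nu> i) A" for \<nu> i
    using jk by (auto simp: A hdim_def)
  have "ge ?C B"
    unfolding ge_def
  proof (intro conjI allI)
    show "tot (fdim i) B \<le> tot (fdim i) ?C" "tot (gdim i) B \<le> tot (gdim i) ?C" for i
      unfolding f g by (rule geD[OF ge])+
    show "tot (hdim \<nu> i) B \<le> tot (hdim \<nu> i) ?C" for \<nu> i
      using h[of \<nu> i] pos[of i] geD(3)[OF ge, of \<nu> i] by (cases "\<nu> = \<mu> \<and> j \<le> i \<and> i \<le> k") auto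
  qed
  moreover obtain j' where j': "j = Suc j'" using jk(1) by (cases j) auto
  have "tot sqD A < tot sqD ?C" using jk(2) by (simp add: A j' sqD_def)
  moreover have "tot sDall ?C = tot sDall A" by (simp add: A j' sDall_def)
  moreover have "tot nL ?C = tot nL A" "tot sqLT ?C = tot sqLT A" by (simp_all add: A num_def szL_def sqLT_def)
  ultimately have "ge ?C B" "(?C, A) \<in> shrinks"
    using sqD_le[of ?C] unfolding shrinks_def by (simp_all del: image_mset_union sum_mset.union)
  then show ?thesis unfolding improves_def
    using ext_move_DB[OF jk, of \<mu>] jk A
    by (intro exI[of _ "DB \<mu> j"] exI[of _ "DB \<mu> k"] exI[of _ "[DB \<mu> (Suc k), DB \<mu> (j - 1)]"] exI[of _ R]) (auto simp: order_le_less)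
qed

text \<open>The growth of the singular block costs 1 for all \<open>i > n\<close>, and the loss in
  the Jordan block costs 1 at \<mu> for all \<open>i \<ge> k\<close>; so slack is required on
  unbounded ranges.\<close>

lemma improve_sing_DB:
  assumes valid: "\<And>b. b \<in># A ==> bvalid b" and ge: "ge A B" and sing: "sing s K"
    and x: "DB \<mu> k \<in># A" "K n \<in># A"
    and posf: "\<And>i. n < i ==> tot (sdim s i) B < tot (sdim s i) A"
    and posh: "\<And>i. k \<le> i ==> tot (hdim \<mu> i) B < tot (hdim \<mu> i) A"
  shows "\<exists>b1 b2 cs R. improves A B b1 b2 cs R"
proof -
  have "DB \<mu> k \<noteq> K n" using sing by (auto simp: sing_def)
  then obtain R where A: "A = add_mset (DB \<mu> k) (add_mset (K n) R)" using two_elements[OF x] by blast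
  have v: "1 \<le> k" "1 \<le> n" using valid[OF x(1)] valid[OF x(2)] sing by (auto simp: sing_def)
  let ?cs = "[K (Suc n), DB \<mu> (k - 1)]"
  have f: "tot (sdim s' i) (mset ?cs + R) + (if s' = s \<and> n < i then 1 else 0) = tot (sdim s' i) A"
    if "sing s' K'" for s' K' i
    using sing that
    by (elim sing_cases) (auto simp: A sdim_def szL_def szT_def szL_neq_szT szL_neq_szT[symmetric])
  have h: "tot (hdim \<nu> i) (mset ?cs + R) + (if \<nu> = \<mu> \<and> k \<le> i then 1 else 0) = tot (hdim \<nu> i) A" for \<nu> i
    using v sing by (auto simp: A hdim_def sing_def)
  have "ge (mset ?cs + R) B"
  proof (rule geI_sing)
    show "tot (sdim s' i) B \<le> tot (sdim s' i) (mset ?cs + R)" if "sing s' K'" for s' K' i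
      using f[OF that, of i] posf[of i] geD_sing[OF ge that, of i] by (auto split: if_splits)
    show "tot (hdim \<nu> i) B \<le> tot (hdim \<nu> i) (mset ?cs + R)" for \<nu> i
      using h[of \<nu> i] posh[of i] geD(3)[OF ge, of \<nu> i] by (cases "\<nu> = \<mu> \<and> k \<le> i") auto
  qed
  moreover have "(mset ?cs + R, A) \<in> shrinks"
    using v sing by (auto simp: A shrinks_def sing_def num_def szL_def szT_def sDall_def)
  ultimately have imp: "improves A B b1 b2 ?cs R" if "A = add_mset b1 (add_mset b2 R)" "before b1 b2" "ext_move b1 b2 ?cs" for b1 b2
    unfolding improves_def using that v sing by (auto simp: sing_def)
  from sing show ?thesis unfolding sing_def
  proof (elim disjE conjE)
    assume "K = LB"
    then show ?thesis using ext_move_DB_LB[OF v(2,1), of \<mu>] A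
      by (intro exI[of _ "DB \<mu> k"] exI[of _ "LB n"] exI[of _ ?cs] exI[of _ R] imp) auto
  next
    assume "K = LTB"
    then show ?thesis using ext_move_LTB_DB[OF v(2,1), of \<mu>] A
      by (intro exI[of _ "LTB n"] exI[of _ "DB \<mu> k"] exI[of _ ?cs] exI[of _ R] imp) (auto simp: add_mset_commute)
  qed
qed

text \<open>The merge takes \<open>i - n\<close>, \<open>i - m\<close> and \<open>i\<close> away
  from the three kinds of dimension and returns at least \<open>min i (e \<mu>)\<close> for \<mu> in
  \<open>S\<close>. Nothing is lost at \<mu> as long as \<open>i \<le> e \<mu>\<close>; beyond that
  \<open>posh\<close> applies.\<close>

lemma improve_LTB_LB:
  assumes valid: "\<And>b. b \<in># A ==> bvalid b" and ge: "ge A B"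
    and x: "LTB m \<in># A" "LB n \<in># A"
    and posf: "\<And>i. tot (fdim i) B + (i - n) \<le> tot (fdim i) A"
    and posg: "\<And>i. tot (gdim i) B + (i - m) \<le> tot (gdim i) A"
    and S: "finite S" "(\<Sum>\<mu>\<in>S. e \<mu>) = m + n - 1"
    and posh: "\<And>\<mu> i. tot (hdim \<mu> i) B + i \<le> tot (hdim \<mu> i) A + (if \<mu> \<in> S then e \<mu> else 0)"
  shows "\<exists>b1 b2 cs R. improves A B b1 b2 cs R"
proof -
  obtain R where A: "A = add_mset (LTB m) (add_mset (LB n) R)" using two_elements[OF x] by auto
  have v: "1 \<le> m" "1 \<le> n" using valid[OF x(1)] valid[OF x(2)] by simp_all
  obtain cs where cs: "ext_move (LTB m) (LB n) cs" "\<And>b. b \<in> set cs ==> \<exists>\<mu> k. b = DB \<mu> k \<and> 1 \<le> k"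
    "\<And>\<mu> k. \<mu> \<in> S ==> min k (e \<mu>) \<le> sum_list (map (hdim \<mu> k) cs)"
    using ext_move_LTB_LB[OF v S] by blast
  have z: "tot \<phi> (mset cs) = 0" if "\<And>\<mu> k. \<phi> (DB \<mu> k) = 0" for \<phi>
    using cs(2) that by (fastforce simp: sum_mset_0_iff)
  have "ge (mset cs + R) B"
    unfolding ge_def
  proof (intro conjI allI)
    show "tot (fdim i) B \<le> tot (fdim i) (mset cs + R)" for i
      using posf[of i] z[of "fdim i"] by (simp add: A fdim_def)
    show "tot (gdim i) B \<le> tot (gdim i) (mset cs + R)" for i
      using posg[of i] z[of "gdim i"] by (simp add: A gdim_def)
    fix \<mu> i
    have A': "tot (hdim \<mu> i) A = i + tot (hdim \<mu> i) R" by (simp add: A hdim_def)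
    have "tot (hdim \<mu> i) (mset cs) = sum_list (map (hdim \<mu> i) cs)" by (simp add: sum_mset_sum_list[symmetric])
    then have "(if \<mu> \<in> S then min i (e \<mu>) else 0) \<le> tot (hdim \<mu> i) (mset cs)" using cs(3)[of \<mu> i] by simp
    then show "tot (hdim \<mu> i) B \<le> tot (hdim \<mu> i) (mset cs + R)"
      using posh[of \<mu> i] geD(3)[OF ge, of \<mu> i] A' by (auto split: if_splits simp: min_def)
  qed
  moreover have "(mset cs + R, A) \<in> shrinks" using z[of nL] by (simp add: A shrinks_def num_def szL_def)
  moreover have "\<forall>b\<in>set cs. bvalid b \<or> (\<exists>\<mu>. b = DB \<mu> 0)" using cs(2) by fastforce
  ultimately show ?thesis unfolding improves_def
    using cs(1) A by (intro exI[of _ "LTB m"] exI[of _ "LB n"] exI[of _ cs] exI[of _ R]) auto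
qed

declare of_nat_sum_mset [simp del]

lemma sdim_0: "tot (sdim s 0) X = 0" and hdim_0: "tot (hdim \<mu> 0) X = 0"
  by (auto simp: sum_mset_0_iff block_fun_defs split: kblock.split option.split)

lemma tot_pos: "tot \<phi> A \<noteq> 0 ==> \<exists>b. b \<in># A \<and> \<phi> b > 0"
  by (metis gr0I less_irrefl sum_mset_0_iff image_iff set_image_mset)

lemma exists_sing: "sing s K ==> tot (num s) A \<noteq> 0 ==> \<exists>n. K n \<in># A"
  by (drule tot_pos) (auto simp: num_def split: option.splits dest: singD)

lemma exists_DB: "tot (sD \<mu>) A \<noteq> 0 ==> \<exists>k. DB \<mu> k \<in># A"
  by (drule tot_pos, elim exE conjE, rename_tac b, case_tac b) (auto simp: sD_def split: if_splits)

text \<open>Past its largest size \<open>n\<close>, the dimension of \<open>A\<close> grows with the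
  full slope, so the gap to \<open>B\<close> cannot shrink. It is positive at \<open>Suc n\<close>:
  either all sizes in \<open>B\<close> are at most \<open>n\<close> and the totals of sizes decide,
  or \<open>B\<close> has a smaller increment at \<open>n\<close>.\<close>

lemma sing_gap:
  assumes ge: "ge A B" and sing: "sing s K" and n: "\<And>k. K k \<in># A ==> k \<le> n"
    and l: "tot (num s) B = tot (num s) A" "tot (len s) A < tot (len s) B" and j: "n < j"
  shows "tot (sdim s j) B < tot (sdim s j) A"
proof -
  have "tot (sdim s (Suc n)) B < tot (sdim s (Suc n)) A"
  proof (cases "tot (cnt s n) B = tot (num s) B")
    case True
    then have "\<And>k. K k \<in># B ==> k \<le> n" by (rule cnt_eqD[OF sing])
    then show ?thesis using sdim_large[OF sing, of B "Suc n"] sdim_large[OF sing, of A "Suc n"] n l by fastforce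
  next
    case False
    then have "tot (cnt s n) B < tot (num s) B" using cnt_le[of s n B] by simp
    then show ?thesis using geD_sing[OF ge sing, of n] cnt_eq[OF sing n] l(1) by (simp add: sdim_Suc)
  qed
  then have "tot (sdim s (Suc n + i)) B < tot (sdim s (Suc n + i)) A" for i
  proof (induction i)
    case (Suc i)
    have "tot (cnt s (Suc n + i)) A = tot (num s) A" using n by (intro cnt_eq[OF sing]) fastforce
    then show ?case using Suc cnt_le[of s "Suc n + i" B] l(1) by (simp add: sdim_Suc)
  qed simp
  from this[of "j - Suc n"] j show ?thesis by simp
qed

text \<open>Past \<open>n\<close> the increment of \<open>A\<close> is its number of summands, which
  exceeds every increment of \<open>B\<close> by at least 1.\<close>

lemma sing_gap_linear:
  assumes ge: "ge A B" and sing: "sing s K" and n: "\<And>k. K k \<in># A ==> k \<le> n" and l: "tot (num s) B < tot (num s) A"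
  shows "tot (sdim s j) B + (j - n) \<le> tot (sdim s j) A"
proof (cases "n \<le> j")
  case True
  then show ?thesis
  proof (induction j rule: dec_induct)
    case base
    show ?case using geD_sing[OF ge sing] by simp
  next
    case (step j)
    have "tot (cnt s j) A = tot (num s) A" using n step by (intro cnt_eq[OF sing]) fastforce
    then show ?case using step cnt_le[of s j B] l by (simp add: sdim_Suc)
  qed
qed (use geD_sing[OF ge sing] in simp)

lemma DB_gap:
  assumes k: "\<And>j. DB \<mu> j \<in># A ==> j \<le> k" and l: "tot nL B = tot nL A" "tot (sD \<mu>) B < tot (sD \<mu>) A" and i: "k \<le> i"
  shows "tot (hdim \<mu> i) B < tot (hdim \<mu> i) A"
  using hdim_large[of \<mu> A i] k i hdim_le[of \<mu> i B] l by fastforce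

text \<open>\<open>tot nL\<close> is the asymptotic slope of \<open>hdim\<close>. The argument
  \<open>?k\<close> exceeds the bounded part of \<open>A\<close> by 1, so a larger slope of
  \<open>B\<close> would show there.\<close>

lemma nL_mono:
  assumes "ge A B"
  shows "tot nL B \<le> tot nL A"
proof (rule ccontr)
  assume "\<not> ?thesis"
  then have "Suc (tot nL A) \<le> tot nL B" by simp
  let ?k = "Suc (tot (sD Infinity) A)"
  have "?k * Suc (tot nL A) \<le> ?k * tot nL B" using \<open>Suc _ \<le> _\<close> by (rule mult_le_mono2)
  also have "\<dots> \<le> tot (hdim Infinity ?k) A" using hdim_nL[of ?k B Infinity] geD(3)[OF assms, of Infinity ?k] by linarith
  also have "\<dots> \<le> ?k * tot nL A + tot (sD Infinity) A" by (rule hdim_le)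
  finally show False by simp
qed

lemma sub_interval:
  fixes fA fB :: "nat => nat"
  assumes "\<And>j. fB j \<le> fA j" "fA i \<noteq> fB i" "fA 0 = fB 0" "\<And>j. N \<le> j ==> fA j = fB j"
  obtains a b where "a < i" "i < b" "fA a = fB a" "fA b = fB b" "\<And>j. a < j ==> j < b ==> fB j < fA j"
proof (rule positive_interval[of "\<lambda>j. int (fA j) - int (fB j)" i N])
  show "0 < int (fA i) - int (fB i)" using assms(1)[of i] assms(2) by simp
  show "0 \<le> int (fA j) - int (fB j)" for j using assms(1)[of j] by simp
  fix a b
  assume "a < i" "i < b" "int (fA a) - int (fB a) = 0" "int (fA b) - int (fB b) = 0"
    "\<And>j. a < j ==> j < b ==> 0 < int (fA j) - int (fB j)"
  then show thesis using that[of a b] by simp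
qed (use assms(3,4) in auto)

text \<open>Equal numbers of \<open>L\<close> summands and equal row counts give equal sums of all
  sizes, and large arguments show that the singular totals are at most, the Jordan totals at least
  those of \<open>B\<close>. If a singular total differs, so does a Jordan total, and a Jordan block
  feeds a singular one. Otherwise the dimension differences vanish at 0 and at large arguments, and
  a bump in one of them yields two blocks of \<open>A\<close> of the same kind.\<close>

lemma improve_equal:
  assumes vA: "\<And>b. b \<in># A ==> bvalid b" and vB: "\<And>b. b \<in># B ==> bvalid b"
    and dims: "tot brows A = tot brows B" "tot bcols A = tot bcols B"
    and ge: "ge A B" and ne: "A \<noteq> B" and eqL: "tot nL B = tot nL A"
  shows "\<exists>b1 b2 cs R. improves A B b1 b2 cs R"
proof -
  obtain N where N: "\<And>n. LB n \<in># A + B ==> n \<le> N" "\<And>n. LTB n \<in># A + B ==> n \<le> N" "\<And>\<mu> n. DB \<mu> n \<in># A + B ==> n \<le> N"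
    by (rule bounded_blocks[of "A + B"]) blast
  have eqX: "tot sL A + tot sT A + tot sDall A = tot sL B + tot sT B + tot sDall B"
    using rows_cols(1)[of A, OF vA] rows_cols(1)[of B, OF vB] dims eqL by simp
  then have eqT: "tot nT B = tot nT A" using rows_cols(2)[of A, OF vA] rows_cols(2)[of B, OF vB] dims by simp
  have eqN: "tot (num s) B = tot (num s) A" if "sing s K" for s K
    using that eqL eqT by (elim sing_cases) simp_all
  have N': "n \<le> j" if "N \<le> j" "LB n \<in># A + B \<or> LTB n \<in># A + B \<or> DB \<mu> n \<in># A + B" for n \<mu> j
    using N that le_trans by blast
  have large: "tot (sdim s j) A + tot (len s) A = j * tot (num s) A" "tot (sdim s j) B + tot (len s) B = j * tot (num s) A"
    if s: "sing s K" "N \<le> j" for s K j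
  proof -
    have "n \<le> j" if "K n \<in># A + B" for n using s(1) that N'[OF s(2)] by (elim sing_cases) auto
    note n = this[unfolded union_iff]
    show "tot (sdim s j) A + tot (len s) A = j * tot (num s) A" by (rule sdim_large[OF s(1) n]) simp
    show "tot (sdim s j) B + tot (len s) B = j * tot (num s) A"
      unfolding eqN[OF s(1), symmetric] by (rule sdim_large[OF s(1) n]) simp
  qed
  have largeD: "tot (hdim \<mu> j) A = j * tot nL A + tot (sD \<mu>) A" "tot (hdim \<mu> j) B = j * tot nL A + tot (sD \<mu>) B"
    if "N \<le> j" for j \<mu>
  proof -
    show "tot (hdim \<mu> j) A = j * tot nL A + tot (sD \<mu>) A" by (rule hdim_large) (use N'[OF that] in auto)
    show "tot (hdim \<mu> j) B = j * tot nL A + tot (sD \<mu>) B" unfolding eqL[symmetric] by (rule hdim_large) (use N'[OF that] in auto)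
  qed
  have leS: "tot (len s) A \<le> tot (len s) B" if "sing s K" for s K
    using large[OF that, of N] geD_sing[OF ge that, of N] by simp
  have leD: "tot (sD \<mu>) B \<le> tot (sD \<mu>) A" for \<mu> using largeD[of N \<mu>] geD(3)[OF ge, of \<mu> N] by simp
  define S where "S = {\<mu>. \<exists>k. DB \<mu> k \<in># A + B}"
  have S: "finite S" unfolding S_def by (rule finite_eigenvalues)
  have sumS: "tot sDall A = (\<Sum>\<mu>\<in>S. tot (sD \<mu>) A)" "tot sDall B = (\<Sum>\<mu>\<in>S. tot (sD \<mu>) B)"
    using sDall_sum[OF S, of A] sDall_sum[OF S, of B] by (auto simp: S_def)
  have D: "\<exists>\<mu>. tot (sD \<mu>) B < tot (sD \<mu>) A" if "tot sDall B < tot sDall A"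
  proof (rule ccontr)
    assume "\<not> ?thesis"
    then have "tot sDall A \<le> tot sDall B" unfolding sumS by (intro sum_mono) (simp add: not_less)
    with that show False by simp
  qed
  consider s K where "sing s K" "tot (len s) A < tot (len s) B" | "tot sL A = tot sL B" "tot sT A = tot sT B"
    using leS sing_LB sing_LTB by (metis le_neq_implies_less)
  then show ?thesis
  proof cases
    case (1 s K)
    then have "tot sL A + tot sT A < tot sL B + tot sT B"
      using leS[OF sing_LB] leS[OF sing_LTB] by (elim sing_cases) auto
    with eqX D obtain \<mu> where \<mu>: "tot (sD \<mu>) B < tot (sD \<mu>) A" by fastforce
    then obtain k0 where "DB \<mu> k0 \<in># A" using exists_DB[of \<mu> A] by (metis less_nat_zero_code)
    then obtain k where k: "DB \<mu> k \<in># A" "\<And>j. DB \<mu> j \<in># A ==> j \<le> k" using pick_max[of "DB \<mu>" k0 A \<mu>] by blast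
    have "tot (num s) A \<noteq> 0"
    proof
      assume "tot (num s) A = 0"
      then have "tot (len s) B = 0" using large(2)[OF 1(1) order_refl] by (simp only: mult_0_right add_is_0)
      with 1 show False by simp
    qed
    then obtain n0 where "K n0 \<in># A" using exists_sing[OF 1(1)] by blast
    then obtain n where n: "K n \<in># A" "\<And>j. K j \<in># A ==> j \<le> n" using pick_max[of K n0 A] 1(1) by blast
    show ?thesis
      by (rule improve_sing_DB[OF vA ge 1(1) k(1) n(1)])
         (use sing_gap[OF ge 1(1) n(2) eqN[OF 1(1)] 1(2)] DB_gap[OF k(2) eqL \<mu>] in auto)
  next
    case 2
    then have eqD0: "tot sDall A = tot sDall B" using eqX by linarith
    have eqD: "tot (sD \<mu>) A = tot (sD \<mu>) B" for \<mu>
    proof (rule ccontr)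
      assume "tot (sD \<mu>) A \<noteq> tot (sD \<mu>) B"
      then have less: "tot (sD \<mu>) B < tot (sD \<mu>) A" using leD[of \<mu>] by simp
      then obtain k0 where "DB \<mu> k0 \<in># A" using exists_DB[of \<mu> A] by (metis less_nat_zero_code)
      then have "\<mu> \<in> S" by (auto simp: S_def)
      with less leD have "(\<Sum>\<mu>\<in>S. tot (sD \<mu>) B) < (\<Sum>\<mu>\<in>S. tot (sD \<mu>) A)" by (intro sum_strict_mono_ex1[OF S]) auto
      with sumS eqD0 show False by simp
    qed
    have "\<not> ((\<forall>i. tot (fdim i) A = tot (fdim i) B) \<and> (\<forall>i. tot (gdim i) A = tot (gdim i) B) \<and>
        (\<forall>\<mu> i. tot (hdim \<mu> i) A = tot (hdim \<mu> i) B))"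
    proof
      assume "(\<forall>i. tot (fdim i) A = tot (fdim i) B) \<and> (\<forall>i. tot (gdim i) A = tot (gdim i) B) \<and>
        (\<forall>\<mu> i. tot (hdim \<mu> i) A = tot (hdim \<mu> i) B)"
      then have "A = B" by (intro blocks_eqI) (use vA vB in auto)
      with ne show False ..
    qed
    then have "\<exists>s K i. sing s K \<and> tot (sdim s i) A \<noteq> tot (sdim s i) B \<or> (\<exists>\<mu>. tot (hdim \<mu> i) A \<noteq> tot (hdim \<mu> i) B)"
      using sing_LB sing_LTB by blast
    then consider s K i where "sing s K" "tot (sdim s i) A \<noteq> tot (sdim s i) B"
      | \<mu> i where "tot (hdim \<mu> i) A \<noteq> tot (hdim \<mu> i) B"
      by blast
    then show ?thesis
    proof cases
      case (1 s K i)
      note sing = 1(1)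
      have eqS: "tot (len s) A = tot (len s) B" using sing 2 by (elim sing_cases) simp_all
      obtain a b where ab: "a < i" "i < b" "tot (sdim s a) A = tot (sdim s a) B" "tot (sdim s b) A = tot (sdim s b) B"
        "\<And>j. a < j ==> j < b ==> tot (sdim s j) B < tot (sdim s j) A"
      proof (rule sub_interval[of "\<lambda>j. tot (sdim s j) B" "\<lambda>j. tot (sdim s j) A" i N])
        show "tot (sdim s j) A = tot (sdim s j) B" if "N \<le> j" for j
          using large[OF sing that] unfolding eqS by (metis add_right_cancel)
      qed (use geD_sing[OF ge sing] 1 in \<open>simp_all add: sdim_0\<close>)
      \<comment> \<open>The difference of the totals for \<open>A\<close> and \<open>B\<close> is 0
        at \<open>a\<close> and \<open>b\<close> and positive in between. Its slope therefore rises
        at both ends, so \<open>A\<close> has more summands than \<open>B\<close> of size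
        \<open>a\<close> and of size \<open>b\<close>.\<close>
      have up: "tot (cnt s a) B < tot (cnt s a) A" using ab(5)[of "Suc a"] ab(1-3) by (simp add: sdim_Suc)
      \<comment> \<open>No summand has size 0, so \<open>a\<close> is positive and the increment
        just before it exists.\<close>
      have "tot (cnt s 0) A = 0" unfolding sum_mset_0_iff
        using vA sing by (elim sing_cases) (fastforce simp: cnt_def szL_def szT_def split: kblock.split)+
      then have "a \<noteq> 0" using up by (metis less_nat_zero_code)
      then obtain a' where a': "a = Suc a'" by (cases a) auto
      have "tot (cnt s a') A \<le> tot (cnt s a') B" using ab(3) geD_sing[OF ge sing, of a'] by (simp add: a' sdim_Suc)
      with up have "count B (K a) < count A (K a)" by (simp add: a' cnt_Suc[OF sing])
      then have aA: "K a \<in># A" by (simp add: count_greater_zero_iff[symmetric] del: count_greater_zero_iff)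
      obtain b' where b': "b = Suc b'" using ab(2) by (cases b) auto
      have "tot (cnt s b') A < tot (cnt s b') B" using ab(5)[of b'] ab(1,2,4) by (simp add: b' sdim_Suc)
      moreover have "tot (cnt s b) B \<le> tot (cnt s b) A" using ab(4) geD_sing[OF ge sing, of "Suc b"] by (simp add: sdim_Suc)
      ultimately have "count B (K b) < count A (K b)" by (simp add: b' cnt_Suc[OF sing])
      then have bA: "K b \<in># A" by (simp add: count_greater_zero_iff[symmetric] del: count_greater_zero_iff)
      show ?thesis by (rule improve_sing_sing[OF vA ge sing aA bA]) (use ab in auto)
    next
      case (2 \<mu> i)
      obtain a b where ab: "a < i" "i < b" "tot (hdim \<mu> a) A = tot (hdim \<mu> a) B" "tot (hdim \<mu> b) A = tot (hdim \<mu> b) B"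
        "\<And>j. a < j ==> j < b ==> tot (hdim \<mu> j) B < tot (hdim \<mu> j) A"
        by (rule sub_interval[of "\<lambda>j. tot (hdim \<mu> j) B" "\<lambda>j. tot (hdim \<mu> j) A" i N])
           (use geD(3)[OF ge] 2 largeD eqD in \<open>simp_all add: hdim_0\<close>)
      \<comment> \<open>The Jordan part of the slope counts blocks larger than the argument. For
        \<open>A\<close> it exceeds that of \<open>B\<close> at \<open>a\<close> and is below it at
        \<open>b'\<close>, and for \<open>B\<close> it does not increase; so it drops by at least 2
        for \<open>A\<close>, and two blocks of \<open>A\<close> have sizes above \<open>a\<close>
        and at most \<open>b'\<close>.\<close>
      have up: "tot (cD \<mu> a) B < tot (cD \<mu> a) A" using ab(5)[of "Suc a"] ab(1-3) eqL by (simp add: hdim_Suc)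
      obtain b' where b': "b = Suc b'" using ab(2) by (cases b) auto
      have "tot (cD \<mu> b') A < tot (cD \<mu> b') B" using ab(5)[of b'] ab(1,2,4) eqL by (simp add: b' hdim_Suc)
      moreover have "tot (cD \<mu> b') B \<le> tot (cD \<mu> a) B" using ab(1,2) b' by (intro cD_mono) simp
      ultimately have two: "tot (cD \<mu> b') A + 2 \<le> tot (cD \<mu> a) A" using up by simp
      define F where "F = filter_mset (\<lambda>x. \<exists>j. x = DB \<mu> j \<and> a < j \<and> j \<le> b') A"
      have "tot (cD \<mu> b') A + tot (\<lambda>x. if \<exists>j. x = DB \<mu> j \<and> a < j \<and> j \<le> b' then 1 else 0) A = tot (cD \<mu> a) A"
        using ab(1,2) b' by (intro tot_cong_add) (auto simp: cD_def split: kblock.split)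
      moreover have "tot (\<lambda>x. if \<exists>j. x = DB \<mu> j \<and> a < j \<and> j \<le> b' then 1 else 0) X
          = size (filter_mset (\<lambda>x. \<exists>j. x = DB \<mu> j \<and> a < j \<and> j \<le> b') X)" for X
        by (induction X) auto
      ultimately have "2 \<le> size F" using two by (simp add: F_def)
      then obtain x F' where F': "F = add_mset x F'" by (metis not_numeral_le_zero size_empty multiset_cases)
      then obtain y F'' where F'': "F' = add_mset y F''" using \<open>2 \<le> size F\<close>
        by (metis One_nat_def Suc_1 Suc_n_not_le_n multiset_cases size_add_mset size_empty)
      have "x \<in># F" "y \<in># F" by (simp_all add: F' F'')
      then obtain j k where jk: "x = DB \<mu> j" "y = DB \<mu> k" "a < j" "j \<le> b'" "a < k" "k \<le> b'" by (auto simp: F_def)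
      have "A = F + filter_mset (\<lambda>x. \<not> (\<exists>j. x = DB \<mu> j \<and> a < j \<and> j \<le> b')) A" unfolding F_def by (rule multiset_partition)
      then obtain R where R: "A = add_mset (DB \<mu> j) (add_mset (DB \<mu> k) R)" by (simp add: F' F'' jk)
      show ?thesis
      proof (cases "j \<le> k")
        case True
        show ?thesis by (rule improve_DB_DB[OF R ge]) (use True jk ab b' in auto)
      next
        case False
        have R': "A = add_mset (DB \<mu> k) (add_mset (DB \<mu> j) R)" by (simp add: R add_mset_commute)
        show ?thesis by (rule improve_DB_DB[OF R' ge]) (use False jk ab b' in auto)
      qed
    qed
  qed
qed

text \<open>By the row and column counts \<open>A\<close> has \<open>D\<close> more summands than
  \<open>B\<close> of either singular kind. Unless some Jordan block can feed the largest
  \<open>LB n\<close>, that block is merged with the largest \<open>LTB m\<close>; what has to be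
  shown is that the required multiplicities \<open>e0\<close> add up to at most
  \<open>m + n - 1\<close>.\<close>

lemma improve_greater:
  assumes vA: "\<And>b. b \<in># A ==> bvalid b" and vB: "\<And>b. b \<in># B ==> bvalid b"
    and dims: "tot brows A = tot brows B" "tot bcols A = tot bcols B"
    and ge: "ge A B" and l: "tot nL B < tot nL A"
  shows "\<exists>b1 b2 cs R. improves A B b1 b2 cs R"
proof -
  note RC = rows_cols[of A, OF vA] rows_cols[of B, OF vB]
  have lT: "tot nT B < tot nT A" using RC dims l by linarith
  obtain n where n: "LB n \<in># A" "\<And>j. LB j \<in># A ==> j \<le> n"
    using exists_sing[OF sing_LB] l pick_max[of LB _ A] sing_LB by (metis less_nat_zero_code)
  obtain m where m: "LTB m \<in># A" "\<And>j. LTB j \<in># A ==> j \<le> m"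
    using exists_sing[OF sing_LTB] lT pick_max[of LTB _ A] sing_LTB by (metis less_nat_zero_code)
  show ?thesis
  proof (cases "\<exists>\<mu> k. DB \<mu> k \<in># A \<and> (\<forall>j. DB \<mu> j \<in># A \<longrightarrow> j \<le> k) \<and> (\<forall>i\<ge>k. tot (hdim \<mu> i) B < tot (hdim \<mu> i) A)")
    case True
    then obtain \<mu> k where k: "DB \<mu> k \<in># A" "\<And>i. k \<le> i ==> tot (hdim \<mu> i) B < tot (hdim \<mu> i) A" by blast
    have "tot (fdim i) B < tot (fdim i) A" if "n < i" for i
      using sing_gap_linear[OF ge sing_LB n(2) l, of i] that by linarith
    then show ?thesis by (intro improve_sing_DB[OF vA ge sing_LB k(1) n(1)] k(2))
  next
    case no_gap: False
    define D where "D = int (tot nL A) - int (tot nL B)"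
    have D: "D \<ge> 1" "int (tot nT A) - int (tot nT B) = D" using l RC dims by (auto simp: D_def)
    \<comment> \<open>As no gap persists, the dimensions agree at some \<open>k0\<close> past all
      Jordan sizes of \<open>A\<close> at \<mu> (\<open>k0 = 0\<close> if there are none). From
      there on \<open>hdim\<close> of \<open>A\<close> is linear, and comparison with the linear
      upper bound for \<open>B\<close> produces the factor \<open>D\<close>.\<close>
    have key: "D * (int i + int (tot (hdim \<mu> i) B) - int (tot (hdim \<mu> i) A)) + int (tot (sD \<mu>) A) \<le> int (tot (sD \<mu>) B)" for \<mu> i
    proof -
      have "\<exists>k0. (\<forall>j. DB \<mu> j \<in># A \<longrightarrow> j \<le> k0) \<and> tot (hdim \<mu> k0) A = tot (hdim \<mu> k0) B"
      proof (cases "\<exists>k. DB \<mu> k \<in># A")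
        case True
        then obtain k where k: "DB \<mu> k \<in># A" "\<And>j. DB \<mu> j \<in># A ==> j \<le> k" using pick_max[of "DB \<mu>" _ A \<mu>] by blast
        with no_gap obtain k0 where "k \<le> k0" "\<not> tot (hdim \<mu> k0) B < tot (hdim \<mu> k0) A" by blast
        with k(2) geD(3)[OF ge, of \<mu> k0] show ?thesis by (meson le_antisym le_trans not_le)
      next
        case False
        then show ?thesis using hdim_0 by metis
      qed
      then obtain k0 where k0: "\<And>j. DB \<mu> j \<in># A ==> j \<le> k0" "tot (hdim \<mu> k0) A = tot (hdim \<mu> k0) B" by blast
      have hA: "int (tot (hdim \<mu> k) A) = int k * int (tot nL A) + int (tot (sD \<mu>) A)" if "k0 \<le> k" for k
      proof -
        have "tot (hdim \<mu> k) A = k * tot nL A + tot (sD \<mu>) A"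
          by (rule hdim_large) (use k0(1) that le_trans in blast)
        then show ?thesis by (simp only: of_nat_mult of_nat_add)
      qed
      have hB: "int (tot (hdim \<mu> k) B) \<le> int k * int (tot nL B) + int (tot (sD \<mu>) B)" for k
        using hdim_le[of \<mu> k B] by (simp flip: of_nat_mult of_nat_add)
      have eq: "int k * int (tot nL A) = int k * D + int k * int (tot nL B)" for k by (simp add: D_def algebra_simps)
      define u where "u = int (tot (hdim \<mu> i) A) - int (tot (hdim \<mu> i) B)"
      have u: "u \<ge> 0" using geD(3)[OF ge, of \<mu> i] by (simp add: u_def)
      have "D * (int i - u) + int (tot (sD \<mu>) A) \<le> int (tot (sD \<mu>) B)"
      proof (cases "i \<le> k0")
        case True
        have "D * (int i - u) \<le> D * int k0" using True u D(1) by (intro mult_left_mono) auto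
        moreover have "int k0 * D + int (tot (sD \<mu>) A) \<le> int (tot (sD \<mu>) B)"
          using hA[of k0] hB[of k0] k0(2) eq[of k0] by simp
        ultimately show ?thesis by (simp add: mult.commute)
      next
        case False
        have "1 * u \<le> D * u" using D(1) u by (rule mult_right_mono)
        moreover have "int i * D + int (tot (sD \<mu>) A) \<le> u + int (tot (sD \<mu>) B)"
          using hA[of i] False hB[of i] eq[of i] by (simp add: u_def)
        ultimately show ?thesis by (simp add: algebra_simps)
      qed
      then show ?thesis by (simp add: u_def algebra_simps)
    qed
    \<comment> \<open>The least multiplicity at \<mu> that makes up for the chains lost with the
      \<open>LB\<close> summand.\<close>
    define e0 where "e0 \<mu> = (LEAST e. \<forall>i. tot (hdim \<mu> i) B + i \<le> tot (hdim \<mu> i) A + e)" for \<mu>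
    have ex: "\<forall>i. tot (hdim \<mu> i) B + i \<le> tot (hdim \<mu> i) A + tot (sD \<mu>) B" for \<mu>
    proof
      fix i
      define v where "v = int i + int (tot (hdim \<mu> i) B) - int (tot (hdim \<mu> i) A)"
      have "v \<le> int (tot (sD \<mu>) B)"
      proof (cases "v \<ge> 0")
        case True
        then have "1 * v \<le> D * v" using D(1) by (intro mult_right_mono)
        then show ?thesis using key[of i \<mu>] by (simp add: v_def)
      qed simp
      then show "tot (hdim \<mu> i) B + i \<le> tot (hdim \<mu> i) A + tot (sD \<mu>) B" by (simp add: v_def)
    qed
    have e0: "tot (hdim \<mu> i) B + i \<le> tot (hdim \<mu> i) A + e0 \<mu>" for \<mu> i
      using LeastI[of "\<lambda>e. \<forall>i. tot (hdim \<mu> i) B + i \<le> tot (hdim \<mu> i) A + e", OF ex] unfolding e0_def by blast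
    have e0_le: "D * int (e0 \<mu>) + int (tot (sD \<mu>) A) \<le> int (tot (sD \<mu>) B)" for \<mu>
    proof (cases "e0 \<mu>")
      case 0
      then show ?thesis using key[of 0 \<mu>] unfolding hdim_0 by simp
    next
      case (Suc e)
      then have "\<not> (\<forall>i. tot (hdim \<mu> i) B + i \<le> tot (hdim \<mu> i) A + e)"
        using not_less_Least[of e "\<lambda>e. \<forall>i. tot (hdim \<mu> i) B + i \<le> tot (hdim \<mu> i) A + e"] by (simp add: e0_def)
      then obtain i where "tot (hdim \<mu> i) A + e < tot (hdim \<mu> i) B + i" by (auto simp: not_le)
      then have "int (e0 \<mu>) \<le> int i + int (tot (hdim \<mu> i) B) - int (tot (hdim \<mu> i) A)" using Suc by simp
      then have "D * int (e0 \<mu>) \<le> D * (int i + int (tot (hdim \<mu> i) B) - int (tot (hdim \<mu> i) A))"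
        using D(1) by (intro mult_left_mono) auto
      then show ?thesis using key[of i \<mu>] by linarith
    qed
    \<comment> \<open>\<open>Infinity\<close> is included so that some eigenvalue can take up the
      surplus of \<open>m + n - 1\<close> over the sum of the \<open>e0\<close>.\<close>
    define S where "S = insert Infinity {\<mu>. \<exists>k. DB \<mu> k \<in># A + B}"
    have S: "finite S" using finite_eigenvalues[of "A + B"] by (simp add: S_def)
    have sumS: "tot sDall A = (\<Sum>\<mu>\<in>S. tot (sD \<mu>) A)" "tot sDall B = (\<Sum>\<mu>\<in>S. tot (sD \<mu>) B)"
      using sDall_sum[OF S, of A] sDall_sum[OF S, of B] by (auto simp: S_def)
    have "D * int (\<Sum>\<mu>\<in>S. e0 \<mu>) + int (tot sDall A) \<le> int (tot sDall B)"
      unfolding sumS of_nat_sum sum_distrib_left sum.distrib[symmetric] by (intro sum_mono e0_le)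
    moreover have "int (tot sDall B) - int (tot sDall A) = int (tot sL A) - int (tot sL B) + (int (tot sT A) - int (tot sT B)) - D"
      using RC dims by (simp add: D_def)
    \<comment> \<open>Evaluation at the largest size \<open>n\<close> in \<open>A\<close>: there
      \<open>n * num - len\<close> is the exact value of \<open>sdim\<close> for \<open>A\<close>
      and a lower bound for \<open>B\<close>.\<close>
    moreover have len: "int (tot (len s) A) - int (tot (len s) B) \<le> D * int n"
      if sing: "sing s K" and n: "\<And>j. K j \<in># A ==> j \<le> n" for s K n
    proof -
      have "int (tot (sdim s n) A) + int (tot (len s) A) = int n * int (tot (num s) A)"
        using sdim_large[OF sing n] by (simp flip: of_nat_mult of_nat_add)
      moreover have "int n * int (tot (num s) B) \<le> int (tot (sdim s n) B) + int (tot (len s) B)"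
        using sdim_ge[of n s B] by (simp flip: of_nat_mult of_nat_add)
      moreover have D': "D = int (tot (num s) A) - int (tot (num s) B)"
        using sing by (elim sing_cases) (simp_all add: D_def D(2)[unfolded D_def, symmetric])
      ultimately show ?thesis using geD_sing[OF ge sing, of n] unfolding D' by (simp add: algebra_simps)
    qed
    ultimately have "D * int (\<Sum>\<mu>\<in>S. e0 \<mu>) \<le> D * (int m + int n - 1)"
      using len[OF sing_LB n(2)] len[OF sing_LTB m(2)] by (simp add: algebra_simps)
    then have "int (\<Sum>\<mu>\<in>S. e0 \<mu>) \<le> int m + int n - 1" using D(1) by simp
    then have sum_e0: "(\<Sum>\<mu>\<in>S. e0 \<mu>) \<le> m + n - 1" by linarith
    define e where "e \<mu> = e0 \<mu> + (if \<mu> = Infinity then m + n - 1 - (\<Sum>\<mu>\<in>S. e0 \<mu>) else 0)" for \<mu>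
    have "(\<Sum>\<mu>\<in>S. e \<mu>) = m + n - 1" using sum_e0 S by (simp add: e_def sum.distrib S_def)
    moreover have "tot (hdim \<mu> i) B + i \<le> tot (hdim \<mu> i) A + (if \<mu> \<in> S then e \<mu> else 0)" for \<mu> i
    proof (cases "\<mu> \<in> S")
      case True
      then show ?thesis using e0[of \<mu> i] by (simp add: e_def)
    next
      case False
      then have "\<not> (\<exists>k. DB \<mu> k \<in># B)" by (simp add: S_def)
      then have "tot (sD \<mu>) B = 0" using exists_DB[of \<mu> B] by blast
      then show ?thesis using ex[of \<mu>, rule_format, of i] False by linarith
    qed
    ultimately show ?thesis
      by (intro improve_LTB_LB[OF vA ge m(1) n(1) sing_gap_linear[OF ge sing_LB n(2) l] sing_gap_linear[OF ge sing_LTB m(2) lT] S])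
  qed
qed

theorem improvement_exists:
  assumes "\<And>b. b \<in># A ==> bvalid b" "\<And>b. b \<in># B ==> bvalid b"
    "tot brows A = tot brows B" "tot bcols A = tot bcols B" "ge A B" "A \<noteq> B"
  shows "\<exists>b1 b2 cs R. improves A B b1 b2 cs R"
proof (cases "tot nL B = tot nL A")
  case True
  with assms show ?thesis by (intro improve_equal)
next
  case False
  then have "tot nL B < tot nL A" using nL_mono[OF assms(5)] by linarith
  with assms(1-5) show ?thesis by (intro improve_greater)
qed

section \<open>Orbit closures and the main theorem\<close>

lemma closure_refl: "P \<in> mat_pairs m n ==> P \<in> Y ==> P \<in> mat_pair_topology m n closure_of Y"
  unfolding closure_metric using Metric_space.zero[OF Metric_space_mat_pairs] by fastforce

lemma closure_trans:
  assumes "P \<in> mat_pair_topology m n closure_of Y" "Y \<inter> mat_pairs m n \<subseteq> mat_pair_topology m n closure_of Z"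
  shows "P \<in> mat_pair_topology m n closure_of Z"
proof -
  have t: "topspace (mat_pair_topology m n) = mat_pairs m n"
    unfolding mat_pair_topology_def by (rule Metric_space.topspace_mtopology[OF Metric_space_mat_pairs])
  have "P \<in> mat_pair_topology m n closure_of (Y \<inter> mat_pairs m n)"
    using assms(1) unfolding closure_metric by blast
  also have "\<dots> \<subseteq> mat_pair_topology m n closure_of (mat_pair_topology m n closure_of Z)"
    by (rule closure_of_mono[OF assms(2)])
  finally show ?thesis by simp
qed

text \<open>Multiplication by fixed \<open>S\<close> and \<open>R\<close> is continuous and
  preserves the orbit of \<open>Q\<close>, so the closure is a union of orbits.\<close>

lemma closure_orbit:
  assumes P: "P \<in> mat_pair_topology m n closure_of orbit Q" and Q: "Q \<in> mat_pairs m n" and T: "T \<in> orbit P"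
  shows "T \<in> mat_pair_topology m n closure_of orbit Q"
proof -
  obtain F where Pm: "P \<in> mat_pairs m n" and F: "\<And>t. F t \<in> orbit Q" "\<And>t. F t \<in> mat_pairs m n" and lim: "mat_tendsto m n F P"
    using P unfolding closure_iff by blast
  obtain S S' R R' where SR: "S \<in> carrier_mat m m" "S' \<in> carrier_mat m m" "S * S' = 1\<^sub>m m" "S' * S = 1\<^sub>m m"
    "R \<in> carrier_mat n n" "R' \<in> carrier_mat n n" "R * R' = 1\<^sub>m n" "R' * R = 1\<^sub>m n"
    "T = (S * fst P * R, S * snd P * R)" using T Pm by (rule orbitE)
  define G where "G t = (S * fst (F t) * R, S * snd (F t) * R)" for t
  have GF: "G t \<in> orbit (F t)" for t
    unfolding G_def by (rule orbitI[OF F(2) SR(1-3,5-7)])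
  have "G t \<in> orbit Q" for t by (rule orbit_trans[OF F(1) GF Q])
  moreover have "G t \<in> mat_pairs m n" for t by (rule orbit_mat_pairs[OF GF F(2)])
  moreover have "mat_tendsto m n G T"
    unfolding mat_tendsto_def
  proof (intro allI impI)
    fix i j assume ij: "i < m" "j < n"
    have e: "(S * M * R) $$ (i, j) = (\<Sum>k<m. S $$ (i, k) * (\<Sum>l<n. M $$ (k, l) * R $$ (l, j)))" if "M \<in> carrier_mat m n" for M
      using SR(1,5) that ij by (simp add: scalar_prod_def atLeast0LessThan)
    have c: "fst (F t) \<in> carrier_mat m n" "snd (F t) \<in> carrier_mat m n" for t
      using F(2)[of t] by (auto simp: mat_pairs_def mem_Times_iff)
    have cP: "fst P \<in> carrier_mat m n" "snd P \<in> carrier_mat m n" using Pm by (auto simp: mat_pairs_def)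
    show "(\<lambda>t. fst (G t) $$ (i, j)) \<longlonglongrightarrow> fst T $$ (i, j) \<and> (\<lambda>t. snd (G t) $$ (i, j)) \<longlonglongrightarrow> snd T $$ (i, j)"
      unfolding G_def SR(9) fst_conv snd_conv e[OF c(1)] e[OF c(2)] e[OF cP(1)] e[OF cP(2)]
      using lim by (auto intro!: tendsto_intros simp: mat_tendsto_def)
  qed
  moreover have "T \<in> mat_pairs m n" by (rule orbit_mat_pairs[OF T Pm])
  ultimately show ?thesis unfolding closure_iff by blast
qed

lemma orbit_leI:
  assumes "P \<in> mat_pair_topology m n closure_of orbit Q" "Q \<in> mat_pairs m n"
  shows "orbit_le (orbit P) (orbit Q)"
  unfolding orbit_le_def using closure_orbit[OF assms] by blast

text \<open>\<open>orbit_le\<close> admits any ambient size; membership of \<open>P\<close> itself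
  identifies it.\<close>

lemma orbit_leD:
  assumes "orbit_le (orbit P) (orbit Q)" "P \<in> mat_pairs m n"
  shows "P \<in> mat_pair_topology m n closure_of orbit Q"
proof -
  obtain m' n' where s: "orbit P \<subseteq> mat_pair_topology m' n' closure_of orbit Q" using assms(1) by (auto simp: orbit_le_def)
  then have P: "P \<in> mat_pair_topology m' n' closure_of orbit Q" using orbit_refl[OF assms(2)] by blast
  then have "P \<in> mat_pairs m' n'" by (simp add: closure_metric)
  then have "m' = m" "n' = n" using mat_pairs_dims assms(2) by blast+
  with P show ?thesis by simp
qed

lemma small_block_perturbation_closure:
  assumes "small_block_perturbation Ps i j Y" "direct_sum Ps \<in> mat_pairs m n"
  shows "direct_sum Ps \<in> mat_pair_topology m n closure_of Y"
  using assms mat_pairs_dims[OF assms(2)]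
  unfolding closure_metric small_block_perturbation_def differs_only_in_block_def Let_def by blast

lemma direct_sum_drop_empty:
  assumes "\<forall>b\<in>set cs. bvalid b \<or> (\<exists>\<mu>. b = DB \<mu> 0)"
  shows "direct_sum (map bpair (filter bvalid cs)) = direct_sum (map bpair cs)"
  using assms
proof (induction cs)
  case (Cons b cs)
  then have IH: "direct_sum (map bpair (filter bvalid cs)) = direct_sum (map bpair cs)" by simp
  show ?case
  proof (cases "bvalid b")
    case True
    then show ?thesis using IH by (simp add: direct_sum_def Let_def)
  next
    case False
    then obtain \<mu> where b: "b = DB \<mu> 0" using Cons.prems by auto
    have e: "four_block_mat M (0\<^sub>m 0 (dim_col N)) (0\<^sub>m (dim_row N) 0) N = N" if "dim_row M = 0" "dim_col M = 0" for M N :: "complex mat"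
      using that by (intro eq_matI) auto
    have "dim_row (fst (bpair b)) = 0" "dim_col (fst (bpair b)) = 0" "dim_row (snd (bpair b)) = 0" "dim_col (snd (bpair b)) = 0"
      by (cases \<mu>; simp add: b)+
    then have "direct_sum (map bpair (b # cs)) = direct_sum (map bpair cs)" using e by (simp add: direct_sum_def Let_def)
    then show ?thesis using IH False by simp
  qed
qed simp

lemma sum_list_tot: "sum_list (map \<phi> xs) = tot \<phi> (mset xs)"
  by (simp add: sum_mset_sum_list[symmetric])

lemma block_sum_mat_pairs:
  "direct_sum (map bpair bs) \<in> mat_pairs (tot brows (mset bs)) (tot bcols (mset bs))"
  using direct_sum_mat_pairs[of "map bpair bs"] by (simp add: o_def sum_list_tot)

lemma ext_move_dims:
  assumes "ext_move b1 b2 cs"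
  shows "tot brows (mset cs) = brows b1 + brows b2" "tot bcols (mset cs) = bcols b1 + bcols b2"
proof -
  obtain X where X: "X \<in> mat_pairs (brows b1) (bcols b2)" "direct_sum (map bpair cs) \<in> orbit (triangular (bpair b1) X (bpair b2))"
    using assms by (auto simp: ext_move_def)
  from orbit_mat_pairs[OF X(2) triangular_mat_pairs[OF bpair_mat_pairs bpair_mat_pairs X(1)]]
  show "tot brows (mset cs) = brows b1 + brows b2" "tot bcols (mset cs) = bcols b1 + bcols b2"
    using mat_pairs_dims[OF block_sum_mat_pairs, of cs] mat_pairs_dims by metis+
qed

lemma mset_others:
  fixes as :: "'a list"
  assumes "i < length as" "j < length as" "i \<noteq> j"
  shows "mset as = add_mset (as ! i) (add_mset (as ! j) (mset (map ((!) as) (others i j as))))"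
proof (rule multiset_eqI)
  fix x :: 'a
  have c: "count (mset ys) x = sum_list (map (\<lambda>b. if b = x then 1 else 0) ys)" for ys
    by (induction ys) auto
  show "count (mset as) x = count (add_mset (as ! i) (add_mset (as ! j) (mset (map ((!) as) (others i j as))))) x"
    using others_sum[OF assms, of "\<lambda>b. if b = x then 1 else 0"]
    unfolding count_add_mset c map_map o_def by (auto split: if_splits)
qed

lemma two_positions:
  assumes "mset as = add_mset b1 (add_mset b2 R)"
  obtains i j where "i < length as" "j < length as" "i \<noteq> j" "as ! i = b1" "as ! j = b2"
proof -
  have "b1 \<in> set as" using assms by (metis set_mset_mset union_single_eq_member add_mset_add_single union_commute)
  then obtain xs ys where as: "as = xs @ b1 # ys" by (meson split_list)
  then have "mset (xs @ ys) = add_mset b2 R" using assms by simp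
  then have "b2 \<in> set (xs @ ys)" by (metis set_mset_mset union_single_eq_member add_mset_add_single union_commute)
  then obtain k where k: "k < length (xs @ ys)" "(xs @ ys) ! k = b2" by (meson in_set_conv_nth)
  show thesis
    by (rule that[of "length xs" "if k < length xs then k else Suc k"])
       (use k in \<open>auto simp: as nth_append\<close>)
qed

lemma perturbation_step:
  assumes ij: "i < length as" "j < length as" "i \<noteq> j" and mv: "ext_move (as ! i) (as ! j) cs"
    and cs: "\<forall>b\<in>set cs. bvalid b \<or> (\<exists>\<mu>. b = DB \<mu> 0)"
  shows "small_block_perturbation (map bpair as) i j
     (orbit (direct_sum (map bpair (filter bvalid cs @ map ((!) as) (others i j as)))))"
proof -
  obtain X where X: "X \<in> mat_pairs (brows (as ! i)) (bcols (as ! j))"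
    "direct_sum (map bpair cs) \<in> orbit (triangular (bpair (as ! i)) X (bpair (as ! j)))"
    using mv by (auto simp: ext_move_def)
  have oth: "others i j (map bpair as) = others i j as" by (simp add: others_def)
  have "map ((!) (map bpair as)) (others i j as) = map bpair (map ((!) as) (others i j as))"
    by (auto simp: others_def)
  moreover have "small_block_perturbation (map bpair as) i j
     (orbit (direct_sum (map bpair (filter bvalid cs) @ map ((!) (map bpair as)) (others i j (map bpair as)))))"
    by (rule small_block_perturbationI) (use ij X direct_sum_drop_empty[OF cs] in auto)
  ultimately show ?thesis by (simp only: oth map_append)
qed

lemma shrinks_wf: "wf shrinks"
  by (simp add: shrinks_def)

lemma tot_filter_bvalid:
  assumes "\<forall>b\<in>set cs. bvalid b \<or> (\<exists>\<mu>. b = DB \<mu> 0)" "\<And>\<mu>. \<phi> (DB \<mu> 0) = 0"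
  shows "tot \<phi> (mset (filter bvalid cs) + R) = tot \<phi> (mset cs + R)"
  using assms by (induction cs) auto

lemma improves_filter:
  assumes "improves A B b1 b2 cs R"
  shows "ge (mset (filter bvalid cs) + R) B" "(mset (filter bvalid cs) + R, A) \<in> shrinks"
    "tot brows (mset (filter bvalid cs) + R) = tot brows A" "tot bcols (mset (filter bvalid cs) + R) = tot bcols A"
proof -
  have cs: "\<forall>b\<in>set cs. bvalid b \<or> (\<exists>\<mu>. b = DB \<mu> 0)" using assms by (simp add: improves_def)
  note t = tot_filter_bvalid[OF cs]
  have e: "tot (fdim j) (mset (filter bvalid cs) + R) = tot (fdim j) (mset cs + R)"
    "tot (gdim j) (mset (filter bvalid cs) + R) = tot (gdim j) (mset cs + R)"
    "tot (hdim \<mu> j) (mset (filter bvalid cs) + R) = tot (hdim \<mu> j) (mset cs + R)"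
    "tot nL (mset (filter bvalid cs) + R) = tot nL (mset cs + R)"
    "tot sDall (mset (filter bvalid cs) + R) = tot sDall (mset cs + R)"
    "tot sqLT (mset (filter bvalid cs) + R) = tot sqLT (mset cs + R)"
    "tot sqD (mset (filter bvalid cs) + R) = tot sqD (mset cs + R)" for j \<mu>
    by (rule t, simp add: block_fun_defs)+
  show "ge (mset (filter bvalid cs) + R) B" using assms unfolding improves_def ge_def e by blast
  show "(mset (filter bvalid cs) + R, A) \<in> shrinks"
  proof -
    have "(mset cs + R, A) \<in> shrinks" using assms unfolding improves_def by blast
    then show ?thesis unfolding shrinks_def measures_def in_inv_image list.map e .
  qed
  have "A = add_mset b1 (add_mset b2 R)" "ext_move b1 b2 cs" using assms by (auto simp: improves_def)
  then show "tot brows (mset (filter bvalid cs) + R) = tot brows A" "tot bcols (mset (filter bvalid cs) + R) = tot bcols A"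
    using ext_move_dims t[of brows R] t[of bcols R] by simp_all
qed

lemma improves_perturbation:
  assumes imp: "improves (mset as) B b1 b2 cs R" and vA: "\<And>b. b \<in> set as ==> bvalid b"
    and ij: "i < length as" "j < length as" "i \<noteq> j" "as ! i = b1" "as ! j = b2"
  obtains ds where "mset ds = mset (filter bvalid cs) + R" "\<forall>b\<in>set ds. bvalid b"
    "small_block_perturbation (map bpair as) i j (orbit (direct_sum (map bpair ds)))"
proof -
  have i: "mset as = add_mset b1 (add_mset b2 R)" "ext_move b1 b2 cs" "\<forall>b\<in>set cs. bvalid b \<or> (\<exists>\<mu>. b = DB \<mu> 0)"
    using imp by (auto simp: improves_def)
  let ?ds = "filter bvalid cs @ map ((!) as) (others i j as)"
  have "mset (map ((!) as) (others i j as)) = R" using mset_others[OF ij(1-3)] i(1) ij(4,5) by simp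
  moreover have "bvalid b" if "b \<in> set ?ds" for b using that vA by (auto simp: others_def)
  moreover have "small_block_perturbation (map bpair as) i j (orbit (direct_sum (map bpair ?ds)))"
    by (rule perturbation_step) (use ij i in auto)
  ultimately show thesis by (intro that[of ?ds]) auto
qed

text \<open>Well-founded induction along improvement steps: every step exhibits the current pair as
  a limit of the next orbit, and closures compose. No order of the two perturbed blocks is needed
  here, since only closures matter.\<close>

theorem dims_ge_closure:
  assumes "\<And>b. b \<in> set as ==> bvalid b" "\<And>b. b \<in> set bs ==> bvalid b" "ge (mset as) (mset bs)"
    "direct_sum (map bpair as) \<in> mat_pairs m n" "direct_sum (map bpair bs) \<in> mat_pairs m n"
  shows "direct_sum (map bpair as) \<in> mat_pair_topology m n closure_of orbit (direct_sum (map bpair bs))"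
  using assms
proof (induction "mset as" arbitrary: as rule: wf_induct_rule[OF shrinks_wf])
  case 1
  note prems = 1(2-)
  have dims: "tot brows (mset as) = m" "tot brows (mset bs) = m" "tot bcols (mset as) = n" "tot bcols (mset bs) = n"
    using mat_pairs_dims[OF prems(4)] mat_pairs_dims[OF prems(5)] mat_pairs_dims[OF block_sum_mat_pairs] by metis+
  show ?case
  proof (cases "mset as = mset bs")
    case True
    have "direct_sum (map bpair as) \<in> orbit (direct_sum (map bpair bs))"
      by (rule direct_sum_perm) (use True in auto)
    with prems(4) show ?thesis by (rule closure_refl)
  next
    case False
    obtain b1 b2 cs R where imp: "improves (mset as) (mset bs) b1 b2 cs R"
      using improvement_exists[of "mset as" "mset bs"] prems dims False by auto
    then have "mset as = add_mset b1 (add_mset b2 R)" by (simp add: improves_def)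
    then obtain i j where ij: "i < length as" "j < length as" "i \<noteq> j" "as ! i = b1" "as ! j = b2"
      by (rule two_positions)
    obtain ds where ds: "mset ds = mset (filter bvalid cs) + R" "\<forall>b\<in>set ds. bvalid b"
      "small_block_perturbation (map bpair as) i j (orbit (direct_sum (map bpair ds)))"
      by (rule improves_perturbation[OF imp prems(1) ij])
    note f = improves_filter[OF imp, folded ds(1)]
    have dm: "direct_sum (map bpair ds) \<in> mat_pairs m n" using block_sum_mat_pairs[of ds] f(3,4) dims by simp
    have "direct_sum (map bpair ds) \<in> mat_pair_topology m n closure_of orbit (direct_sum (map bpair bs))"
      by (rule 1(1)[OF f(2) ds(2)[rule_format] prems(2) f(1) dm prems(5)])
    then have "orbit (direct_sum (map bpair ds)) \<subseteq> mat_pair_topology m n closure_of orbit (direct_sum (map bpair bs))"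
      using closure_orbit[OF _ prems(5)] by blast
    then show ?thesis
      using closure_trans[OF small_block_perturbation_closure[OF ds(3) prems(4)]] by blast
  qed
qed

text \<open>Phrased as absence of inversions because \<open>before\<close> is not total: equal
  blocks, and Jordan blocks with different eigenvalues, may stand in either order.\<close>

lemma sorted_blocks:
  assumes "sorted ms" "distinct (map fst es)" "\<forall>(\<mu>, ks)\<in>set es. sorted ks" "sorted ns"
  shows "sorted_wrt (\<lambda>x y. \<not> before y x)
     (map LTB ms @ concat (map (\<lambda>(\<mu>, ks). map (DB \<mu>) ks) es) @ map LB (rev ns))"
proof -
  have m: "sorted_wrt (\<lambda>x y. \<not> before y x) (map LTB ms)"
    using assms(1) by (simp add: sorted_wrt_map not_less)
  have n: "sorted_wrt (\<lambda>x y. \<not> before y x) (map LB (rev ns))"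
    using assms(4) by (simp add: sorted_wrt_map sorted_wrt_rev not_less)
  have e: "sorted_wrt (\<lambda>x y. \<not> before y x) (concat (map (\<lambda>(\<mu>, ks). map (DB \<mu>) ks) es))"
    using assms(2,3)
  proof (induction es)
    case (Cons e es)
    obtain \<mu> ks where e: "e = (\<mu>, ks)" by (cases e)
    have "\<nu> \<noteq> \<mu>" if "(\<nu>, l) \<in> set es" for \<nu> l
      using Cons.prems(1) that e by (force simp: image_iff)
    then show ?case using Cons e by (auto simp: sorted_wrt_append sorted_wrt_map not_less)
  qed simp
  show ?thesis using m n e by (auto simp: sorted_wrt_append)
qed

theorem mainTheorem4:
  fixes ms ns :: "nat list" and es :: "(ext_complex \<times> nat list) list"
    and \<A> \<B> :: mat_pair
  assumes "sorted ms" and "\<forall>m\<in>set ms. 1 \<le> m"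
    and "distinct (map fst es)"
    and "\<forall>(\<mu>, ks)\<in>set es. sorted ks \<and> (\<forall>k\<in>set ks. 1 \<le> k)"
    and "sorted ns" and "\<forall>n\<in>set ns. 1 \<le> n"
    and "\<A> = direct_sum (kronecker_summands ms es ns)"
    and "is_mat_pair \<B>"
    and "immediate_successor (orbit \<B>) (orbit \<A>)"
  shows "\<exists>i j. i < j \<and> j < length (kronecker_summands ms es ns) \<and>
    small_block_perturbation (kronecker_summands ms es ns) i j (orbit \<B>)"
proof -
  define as where "as = map LTB ms @ concat (map (\<lambda>(\<mu>, ks). map (DB \<mu>) ks) es) @ map LB (rev ns)"
  have "map bpair (concat (map (\<lambda>(\<mu>, ks). map (DB \<mu>) ks) es)) = concat (map (\<lambda>(\<mu>, ks). map (D_pair \<mu>) ks) es)"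
    by (induction es) auto
  then have summands: "kronecker_summands ms es ns = map bpair as" by (simp add: as_def kronecker_summands_def)
  have vA: "bvalid b" if "b \<in> set as" for b using that assms(2,4,6) by (fastforce simp: as_def)
  have sorted: "sorted_wrt (\<lambda>x y. \<not> before y x) as"
    unfolding as_def by (rule sorted_blocks) (use assms in auto)
  define m n where "m = tot brows (mset as)" and "n = tot bcols (mset as)"
  have A: "\<A> = direct_sum (map bpair as)" "\<A> \<in> mat_pairs m n"
    using block_sum_mat_pairs[of as] by (simp_all add: assms(7) summands m_def n_def)
  have less: "orbit_le (orbit \<A>) (orbit \<B>)" "orbit \<A> \<noteq> orbit \<B>"
    and immediate: "\<And>C. is_mat_pair C ==> orbit_less (orbit \<A>) (orbit C) ==> \<not> orbit_less (orbit C) (orbit \<B>)"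
    using assms(9) by (auto simp: immediate_successor_def orbit_less_def)
  have AB: "\<A> \<in> mat_pair_topology m n closure_of orbit \<B>" by (rule orbit_leD[OF less(1) A(2)])
  \<comment> \<open>A pair in the orbit of \<open>\<B>\<close> close to \<open>\<A>\<close> has the
    size of \<open>\<A>\<close>, and hence so has \<open>\<B>\<close>.\<close>
  then have "\<exists>Q\<in>orbit \<B>. Q \<in> mat_pairs m n \<and> mat_pair_dist m n \<A> Q < 1" by (simp add: closure_metric)
  then obtain Q where "Q \<in> orbit \<B>" "Q \<in> mat_pairs m n" by blast
  moreover have "\<B> \<in> mat_pairs (pair_rows \<B>) (pair_cols \<B>)" using assms(8) by (simp add: is_mat_pair_iff)
  ultimately have B: "\<B> \<in> mat_pairs m n" using orbit_mat_pairs mat_pairs_dims by metis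
  obtain bs where vB: "\<And>b. b \<in> set bs ==> bvalid b" and bs: "direct_sum (map bpair bs) \<in> orbit \<B>"
    using kronecker_form[OF B] by blast
  have orbB: "orbit (direct_sum (map bpair bs)) = orbit \<B>" by (rule orbit_eq[OF bs B])
  have Bm: "direct_sum (map bpair bs) \<in> mat_pairs m n" by (rule orbit_mat_pairs[OF bs B])
  have ge_iff: "dims_ge xs ys \<longleftrightarrow> ge (mset xs) (mset ys)" for xs ys
    by (simp add: dims_ge_def ge_def sum_list_tot)
  have "dims_ge as bs"
    by (rule closure_dims_ge[of _ _ m n]) (use vA vB AB A orbB in auto)
  moreover have "mset as \<noteq> mset bs"
  proof
    assume "mset as = mset bs"
    then have "\<A> \<in> orbit (direct_sum (map bpair bs))"
      unfolding A(1) by (intro direct_sum_perm) auto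
    then show False using orbit_eq[OF _ Bm] orbB less(2) by simp
  qed
  moreover have "tot brows (mset bs) = m" "tot bcols (mset bs) = n"
    using mat_pairs_dims[OF Bm] mat_pairs_dims[OF block_sum_mat_pairs, of bs] by metis+
  ultimately obtain b1 b2 cs R where imp: "improves (mset as) (mset bs) b1 b2 cs R"
    using improvement_exists[of "mset as" "mset bs"] vA vB unfolding ge_iff m_def n_def by auto
  then have split: "mset as = add_mset b1 (add_mset b2 R)" and order: "before b1 b2 \<or> b1 = b2" by (auto simp: improves_def)
  obtain i0 j0 where ij0: "i0 < length as" "j0 < length as" "i0 \<noteq> j0" "as ! i0 = b1" "as ! j0 = b2"
    using split by (rule two_positions)
  \<comment> \<open>Absence of inversions puts \<open>b1\<close> in front of \<open>b2\<close>; if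
    the blocks are equal, the two positions can be interchanged.\<close>
  have "\<exists>i j. i < j \<and> j < length as \<and> as ! i = b1 \<and> as ! j = b2"
  proof (cases "i0 < j0")
    case False
    then have "j0 < i0" using ij0(3) by simp
    then have "\<not> before b1 b2" using sorted ij0 by (auto simp: sorted_wrt_iff_nth_less)
    with order \<open>j0 < i0\<close> ij0 show ?thesis by blast
  qed (use ij0 in blast)
  then obtain i j where ij: "i < j" "j < length as" "as ! i = b1" "as ! j = b2" by blast
  obtain ds where ds: "mset ds = mset (filter bvalid cs) + R" "\<forall>b\<in>set ds. bvalid b"
    and pert: "small_block_perturbation (map bpair as) i j (orbit (direct_sum (map bpair ds)))"
    by (rule improves_perturbation[OF imp vA less_trans[OF ij(1,2)] ij(2) less_imp_neq[OF ij(1)] ij(3,4)])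
  note f = improves_filter[OF imp, folded ds(1)]
  let ?C = "direct_sum (map bpair ds)"
  have C: "?C \<in> mat_pairs m n" using block_sum_mat_pairs[of ds] f(3,4) by (simp add: m_def n_def)
  have AC: "\<A> \<in> mat_pair_topology m n closure_of orbit ?C"
    using small_block_perturbation_closure[OF pert] A by simp
  \<comment> \<open>Equal orbits would give the dimension inequalities in both directions, hence the
    same summands, against the strict decrease in \<open>shrinks\<close>.\<close>
  have "orbit \<A> \<noteq> orbit ?C"
  proof
    assume eq: "orbit \<A> = orbit ?C"
    then have "?C \<in> orbit \<A>" using orbit_refl[OF C] by simp
    then have "?C \<in> mat_pair_topology m n closure_of orbit \<A>" using C by (intro closure_refl)
    then have "dims_ge ds as" using ds(2) vA A by (intro closure_dims_ge[of _ _ m n]) auto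
    moreover have "dims_ge as ds" using ds(2) vA A AC by (intro closure_dims_ge[of _ _ m n]) auto
    ultimately have "mset ds = mset as"
      unfolding ge_iff using ds(2) vA by (intro blocks_eqI) (auto simp: ge_def intro: antisym)
    with f(2) show False using wf_not_refl[OF shrinks_wf] by auto
  qed
  then have "orbit_less (orbit \<A>) (orbit ?C)" using orbit_leI[OF AC C] by (simp add: orbit_less_def)
  then have "\<not> orbit_less (orbit ?C) (orbit \<B>)" by (rule immediate[OF mat_pairs_is[OF C]])
  moreover have "orbit_le (orbit ?C) (orbit \<B>)"
    unfolding orbB[symmetric] by (rule orbit_leI[OF dims_ge_closure[OF ds(2)[rule_format] vB f(1) C Bm] Bm])
  ultimately have "orbit ?C = orbit \<B>" by (simp add: orbit_less_def)
  with pert ij show ?thesis unfolding summands by auto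
qed

end
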